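(* Let $B,K,m>0$, $f\in L_2(\Omega)$, $\boldsymbol G\in H(\mathrm{dDiv},\Omega;\mathbb S)$, $g\in H^2(\Omega)$, and $\eta\in H^1(\Omega)$. Then the minimization problem $$(u,\phi)=\operatorname*{arg\,min}\{E(v,\psi):\ v\in V_g,\ \psi\in W_\eta\}$$ with $$E(v,\psi)=\frac B2\int_\Omega|\nabla^2v+q^2\boldsymbol T(\psi)v|^2+\frac m2\int_\Omega v^2+\frac K2\int_\Omega|\nabla\psi|^2-\int_\Omega fv+B\,\langle\mathrm{tr}^{\mathrm{dDiv}}(\boldsymbol G),v\rangle$$ has a solution $(u,\phi)$. Moreover, the following nonlinear variational system has a solution $(\boldsymbol M,u,\phi)\in H(\mathrm{dDiv},\Omega;\mathbb S)\times L_2(\Omega)\times H^1(\Omega)$: $$\langle\!\langle\boldsymbol M,\boldsymbol N\rangle\!\rangle_{\mathrm{dDiv},\phi}=\frac Bm\bigl(f,\ \mathrm{div\,Div}\,\boldsymbol N+q^2\boldsymbol T(\phi):\boldsymbol N\bigr)-B\langle\mathrm{tr}^{\mathrm{Ggrad}}(g),\boldsymbol N\rangle,$$ $$(u,w)+\frac Bm\bigl(\mathrm{div\,Div}\,\boldsymbol M+q^2\boldsymbol T(\phi):\boldsymbol M,\ w\bigr)=\frac1m(f,w),$$ $$K(\nabla\phi,\nabla\chi)+Bq^2\bigl(\boldsymbol M:\boldsymbol T'(\phi)\,u,\ \chi\bigr)=0,$$ $$\langle\mathrm{tr}^{\mathrm{dDiv}}(\boldsymbol M),z\rangle=\langle\mathrm{tr}^{\mathrm{dDiv}}(\boldsymbol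 G),z\rangle\qquad\text{and}\qquad\phi=\eta\ \text{ on }\Gamma$$ for all $\boldsymbol N\in H_N(\mathrm{dDiv},\Omega;\mathbb S)$, $w\in L_2(\Omega)$, $\chi\in H^1_0(\Omega)$, $z\in H^2_D(\Omega)$; and this solution has $u\in H^2(\Omega)$ and $\boldsymbol M=\nabla^2u+q^2\boldsymbol T(\phi)u$, with $u$ and $\boldsymbol M$ satisfying the boundary conditions $$\langle\mathrm{tr}^{\mathrm{Ggrad}}(u),\boldsymbol N\rangle=\langle\mathrm{tr}^{\mathrm{Ggrad}}(g),\boldsymbol N\rangle\ \ \forall\boldsymbol N\in H_N(\mathrm{dDiv},\Omega;\mathbb S),\qquad \langle\mathrm{tr}^{\mathrm{dDiv}}(\boldsymbol M),z\rangle=\langle\mathrm{tr}^{\mathrm{dDiv}}(\boldsymbol G),z\rangle\ \ \forall z\in H^2_D(\Omega).$$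
   Context: Setting. $d=2$; $\Omega\subset\mathbb R^2$ is a simply-connected, bounded, polygonal Lipschitz domain with boundary $\Gamma$ and exterior unit normal $\boldsymbol n$; $q>0$ is a constant. $\mathbb S=\{\boldsymbol A\in\mathbb R^{2\times2}:\boldsymbol A=\boldsymbol A^\top\}$ with Frobenius inner product $\boldsymbol A:\boldsymbol B$ and norm $|\boldsymbol A|^2=\boldsymbol A:\boldsymbol A$. $(\cdot,\cdot)$ is the $L_2(\Omega)$ inner product for scalar, vector or tensor functions. $\nabla^2v$ is the Hessian of $v$; $\mathrm{div\,Div}$ is the (distributional) iterated divergence of tensors ($\mathrm{Div}$ row-wise). For a scalar function $\psi$, $$\boldsymbol T(\psi)=\begin{pmatrix}\cos^2\psi&\sin\psi\cos\psi\\ \sin\psi\cos\psi&\sin^2\psi\end{pmatrix},\qquad \boldsymbol T'(\psi)=\begin{pmatrix}-\sin(2\psi)&\cos(2\psi)\\ \cos(2\psi)&\sin(2\psi)\end{pmatrix}.$$ Boundary decomposition. $\Gamma$ is the closure of the union of pairwise disjoint relatively open pieces $\Gamma_{hc},\Gamma_{ss},\Gamma_{sc},\Gamma_f$ (each empty or a union of connected sets of positive relative measure) and of the elements of $J=J_D\cup J_N$, where $J_D,J_N$ are disjoint (possibly empty) sets of vertex-singletons of $\Gamma$ (a vertex may have angle $\pi$), disjoint from the other pieces; every $\gamma\in J$ has positive distance to $\Gamma_{hc}\cup\Gamma_{ss}$. Spaces. $H(\mathrm{dDiv},\Omega;\mathbb S):=\{\boldsymbol M\in L_2(\Omega;\mathbb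 S):\mathrm{div\,Div}\,\boldsymbol M\in L_2(\Omega)\}$. For $\phi\in H^1(\Omega)$, $$\langle\!\langle\boldsymbol M,\boldsymbol N\rangle\!\rangle_{\mathrm{dDiv},\phi}:=B(\boldsymbol M,\boldsymbol N)+\frac{B^2}m\bigl(\mathrm{div\,Div}\,\boldsymbol M+q^2\boldsymbol T(\phi):\boldsymbol M,\ \mathrm{div\,Div}\,\boldsymbol N+q^2\boldsymbol T(\phi):\boldsymbol N\bigr).$$ The trace operators $\mathrm{tr}^{\mathrm{Ggrad}}:H^2(\Omega)\to H(\mathrm{dDiv},\Omega;\mathbb S)^*$ and $\mathrm{tr}^{\mathrm{dDiv}}:H(\mathrm{dDiv},\Omega;\mathbb S)\to H^2(\Omega)^*$ are defined by $$\langle\mathrm{tr}^{\mathrm{Ggrad}}(v),\boldsymbol M\rangle:=\langle\mathrm{tr}^{\mathrm{dDiv}}(\boldsymbol M),v\rangle:=(\mathrm{div\,Div}\,\boldsymbol M,v)-(\boldsymbol M,\nabla^2v).$$ $H^2_D(\Omega):=\{v\in H^2(\Omega): v|_{\Gamma_{hc}\cup\Gamma_{ss}}=0,\ \boldsymbol n\cdot\nabla v|_{\Gamma_{hc}\cup\Gamma_{sc}}=0,\ v|_\gamma=0\ \forall\gamma\in J_D\}$; $H_N(\mathrm{dDiv},\Omega;\mathbb S):=\{\boldsymbol M\in H(\mathrm{dDiv},\Omega;\mathbb S):\langle\mathrm{tr}^{\mathrm{dDiv}}(\boldsymbol M),v\rangle=0\ \forall v\in H^2_D(\Omega)\}$;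 $V_g:=\{v\in H^2(\Omega):\langle\mathrm{tr}^{\mathrm{Ggrad}}(v),\boldsymbol N\rangle=\langle\mathrm{tr}^{\mathrm{Ggrad}}(g),\boldsymbol N\rangle\ \forall\boldsymbol N\in H_N(\mathrm{dDiv},\Omega;\mathbb S)\}$; $W_\eta:=\{\psi\in H^1(\Omega):\psi-\eta\in H^1_0(\Omega)\}$. *)

theory Defs
  imports "HOL-Analysis.Analysis"
begin

text \<open>
  Functions on a domain are total functions used as representatives of their classes modulo
  Lebesgue null sets; the inner product and norm of \<^typ>\<open>real^2^2\<close> are the Frobenius ones.
\<close>

definition L2_space :: "'a measure \<Rightarrow> ('a \<Rightarrow> 'b::euclidean_space) set" where
  "L2_space M = {f. f \<in> borel_measurable M \<and> integrable M (\<lambda>x. (norm (f x))\<^sup>2)}"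

abbreviation L2 :: "(real^2) set \<Rightarrow> (real^2 \<Rightarrow> 'b::euclidean_space) set" where
  "L2 \<Omega> \<equiv> L2_space (lebesgue_on \<Omega>)"

definition ip :: "(real^2) set \<Rightarrow> (real^2 \<Rightarrow> 'b::euclidean_space) \<Rightarrow> (real^2 \<Rightarrow> 'b) \<Rightarrow> real" where
  "ip \<Omega> f g = (LINT x|lebesgue_on \<Omega>. f x \<bullet> g x)"

definition partial :: "2 \<Rightarrow> (real^2 \<Rightarrow> real) \<Rightarrow> real^2 \<Rightarrow> real" where
  "partial i f x = frechet_derivative f (at x) (axis i 1)"

primrec C_k :: "nat \<Rightarrow> (real^2 \<Rightarrow> real) \<Rightarrow> bool" where
  "C_k 0 f \<longleftrightarrow> continuous_on UNIV f"
| "C_k (Suc k) f \<longleftrightarrow> f differentiable_on UNIV \<and> (\<forall>i. C_k k (partial i f))"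

definition smooth :: "(real^2 \<Rightarrow> real) \<Rightarrow> bool" where
  "smooth f \<longleftrightarrow> (\<forall>k. C_k k f)"

definition grad :: "(real^2 \<Rightarrow> real) \<Rightarrow> real^2 \<Rightarrow> real^2" where
  "grad f x = (\<chi> i. partial i f x)"

definition hess :: "(real^2 \<Rightarrow> real) \<Rightarrow> real^2 \<Rightarrow> real^2^2" where
  "hess f x = (\<chi> i j. partial j (partial i f) x)"

definition test_functions :: "(real^2) set \<Rightarrow> (real^2 \<Rightarrow> real) set" where
  "test_functions \<Omega> =
     {\<theta>. smooth \<theta> \<and> compact (closure {x. \<theta> x \<noteq> 0}) \<and> closure {x. \<theta> x \<noteq> 0} \<subseteq> \<Omega>}"

text \<open>
  The operators \<open>weak_grad\<close>, \<open>weak_hess\<close> and \<open>dDiv\<close> pick a representative by Hilbert choice.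
  They are meaningful only on \<open>H1\<close>, \<open>H2\<close> and \<open>H_dDiv\<close>, respectively, where the chosen
  distributional derivative is unique up to a null set.
\<close>

definition is_weak_grad :: "(real^2) set \<Rightarrow> (real^2 \<Rightarrow> real) \<Rightarrow> (real^2 \<Rightarrow> real^2) \<Rightarrow> bool" where
  "is_weak_grad \<Omega> v D \<longleftrightarrow>
     D \<in> L2 \<Omega> \<and>
     (\<forall>\<theta>\<in>test_functions \<Omega>. \<forall>i. ip \<Omega> v (partial i \<theta>) = - ip \<Omega> (\<lambda>x. D x $ i) \<theta>)"

definition H1 :: "(real^2) set \<Rightarrow> (real^2 \<Rightarrow> real) set" where
  "H1 \<Omega> = {v \<in> L2 \<Omega>. \<exists>D. is_weak_grad \<Omega> v D}"

definition weak_grad :: "(real^2) set \<Rightarrow> (real^2 \<Rightarrow> real) \<Rightarrow> real^2 \<Rightarrow> real^2" where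
  "weak_grad \<Omega> v = (SOME D. is_weak_grad \<Omega> v D)"

definition H2 :: "(real^2) set \<Rightarrow> (real^2 \<Rightarrow> real) set" where
  "H2 \<Omega> = {v \<in> H1 \<Omega>. \<forall>i. (\<lambda>x. weak_grad \<Omega> v x $ i) \<in> H1 \<Omega>}"

definition weak_hess :: "(real^2) set \<Rightarrow> (real^2 \<Rightarrow> real) \<Rightarrow> real^2 \<Rightarrow> real^2^2" where
  "weak_hess \<Omega> v x = (\<chi> i. weak_grad \<Omega> (\<lambda>y. weak_grad \<Omega> v y $ i) x)"

definition H1_limit :: "(real^2) set \<Rightarrow> (nat \<Rightarrow> real^2 \<Rightarrow> real) \<Rightarrow> (real^2 \<Rightarrow> real) \<Rightarrow> bool" where
  "H1_limit \<Omega> \<theta> v \<longleftrightarrow>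
     (\<lambda>k. LINT x|lebesgue_on \<Omega>. (\<theta> k x - v x)\<^sup>2) \<longlonglongrightarrow> 0 \<and>
     (\<lambda>k. LINT x|lebesgue_on \<Omega>. (norm (grad (\<theta> k) x - weak_grad \<Omega> v x))\<^sup>2) \<longlonglongrightarrow> 0"

definition H1_0 :: "(real^2) set \<Rightarrow> (real^2 \<Rightarrow> real) set" where
  "H1_0 \<Omega> = {v \<in> H1 \<Omega>. \<exists>\<theta>. (\<forall>k. \<theta> k \<in> test_functions \<Omega>) \<and> H1_limit \<Omega> \<theta> v}"

definition L2_sym :: "(real^2) set \<Rightarrow> (real^2 \<Rightarrow> real^2^2) set" where
  "L2_sym \<Omega> = {M \<in> L2 \<Omega>. AE x in lebesgue_on \<Omega>. transpose (M x) = M x}"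

definition is_dDiv :: "(real^2) set \<Rightarrow> (real^2 \<Rightarrow> real^2^2) \<Rightarrow> (real^2 \<Rightarrow> real) \<Rightarrow> bool" where
  "is_dDiv \<Omega> M w \<longleftrightarrow> w \<in> L2 \<Omega> \<and> (\<forall>\<theta>\<in>test_functions \<Omega>. ip \<Omega> M (hess \<theta>) = ip \<Omega> w \<theta>)"

definition H_dDiv :: "(real^2) set \<Rightarrow> (real^2 \<Rightarrow> real^2^2) set" where
  "H_dDiv \<Omega> = {M \<in> L2_sym \<Omega>. \<exists>w. is_dDiv \<Omega> M w}"

definition dDiv :: "(real^2) set \<Rightarrow> (real^2 \<Rightarrow> real^2^2) \<Rightarrow> real^2 \<Rightarrow> real" where
  "dDiv \<Omega> M = (SOME w. is_dDiv \<Omega> M w)"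

text \<open>
  Locally, in a rotated (or reflected) and translated coordinate system, the domain is the
  set of points below the graph of a Lipschitz function.
\<close>

definition lipschitz_domain :: "(real^2) set \<Rightarrow> bool" where
  "lipschitz_domain \<Omega> \<longleftrightarrow>
     open \<Omega> \<and> connected \<Omega> \<and> \<Omega> \<noteq> {} \<and>
     (\<forall>p\<in>frontier \<Omega>. \<exists>R \<epsilon> L h.
        orthogonal_transformation (R :: real^2 \<Rightarrow> real^2) \<and> \<epsilon> > 0 \<and> L-lipschitz_on UNIV (h :: real \<Rightarrow> real) \<and>
        (\<forall>y\<in>ball p \<epsilon>. y \<in> \<Omega> \<longleftrightarrow> R (y - p) $ 2 < h (R (y - p) $ 1)))"

text \<open>
  A set of pairs \<open>(a, b)\<close> represents a set of edges with end points \<open>a\<close>, \<open>b\<close>; consecutive edges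
  may be collinear, so that a vertex may have angle \<open>\<pi>\<close>.
\<close>

definition polygonal_boundary :: "(real^2) set \<Rightarrow> ((real^2) \<times> (real^2)) set \<Rightarrow> bool" where
  "polygonal_boundary \<Omega> E \<longleftrightarrow>
     finite E \<and> (\<forall>(a, b)\<in>E. a \<noteq> b) \<and>
     frontier \<Omega> = (\<Union>(a, b)\<in>E. closed_segment a b) \<and>
     (\<forall>(a, b)\<in>E. \<forall>(c, d)\<in>E. (a, b) \<noteq> (c, d) \<longrightarrow>
        closed_segment a b \<inter> closed_segment c d \<subseteq> {a, b} \<inter> {c, d})"

definition vertices :: "((real^2) \<times> (real^2)) set \<Rightarrow> (real^2) set" where
  "vertices E = fst ` E \<union> snd ` E"

text \<open>Arc length on the boundary: the sum over the edges of the images of scaled Lebesgue measure.\<close>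

definition boundary_measure :: "((real^2) \<times> (real^2)) set \<Rightarrow> (real^2) measure" where
  "boundary_measure E =
     distr (density (count_space E \<Otimes>\<^sub>M lebesgue_on {0..1}) (\<lambda>((a, b), t). ennreal (dist a b)))
       borel (\<lambda>((a, b), t). (1 - t) *\<^sub>R a + t *\<^sub>R b)"

text \<open>The exterior unit normal exists, and is unique, at all boundary points except the corners.\<close>

definition outer_normal :: "(real^2) set \<Rightarrow> real^2 \<Rightarrow> real^2" where
  "outer_normal \<Omega> x =
     (THE n. norm n = 1 \<and> (\<exists>\<epsilon>>0. \<forall>y\<in>ball x \<epsilon>. y \<in> \<Omega> \<longleftrightarrow> (y - x) \<bullet> n < 0))"

text \<open>
  \<open>J_D\<close> and \<open>J_N\<close> are given as the sets of the vertices whose singletons are the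
  zero-dimensional boundary pieces.
\<close>

record boundary_data =
  edges :: "((real^2) \<times> (real^2)) set"
  G_hc :: "(real^2) set"
  G_ss :: "(real^2) set"
  G_sc :: "(real^2) set"
  G_f :: "(real^2) set"
  J_D :: "(real^2) set"
  J_N :: "(real^2) set"

definition boundary_decomposition :: "(real^2) set \<Rightarrow> boundary_data \<Rightarrow> bool" where
  "boundary_decomposition \<Omega> \<beta> \<longleftrightarrow>
     polygonal_boundary \<Omega> (edges \<beta>) \<and>
     (\<forall>P\<in>{G_hc \<beta>, G_ss \<beta>, G_sc \<beta>, G_f \<beta>}.
        openin (top_of_set (frontier \<Omega>)) P \<and>
        (\<exists>\<C>. P = \<Union>\<C> \<and>
          (\<forall>C\<in>\<C>. connected C \<and> emeasure (boundary_measure (edges \<beta>)) C > 0))) \<and>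
     J_D \<beta> \<subseteq> vertices (edges \<beta>) \<and> J_N \<beta> \<subseteq> vertices (edges \<beta>) \<and>
     disjnt (G_hc \<beta>) (G_ss \<beta>) \<and> disjnt (G_hc \<beta>) (G_sc \<beta>) \<and> disjnt (G_hc \<beta>) (G_f \<beta>) \<and>
     disjnt (G_ss \<beta>) (G_sc \<beta>) \<and> disjnt (G_ss \<beta>) (G_f \<beta>) \<and> disjnt (G_sc \<beta>) (G_f \<beta>) \<and>
     disjnt (J_D \<beta>) (J_N \<beta>) \<and>
     disjnt (J_D \<beta> \<union> J_N \<beta>) (G_hc \<beta> \<union> G_ss \<beta> \<union> G_sc \<beta> \<union> G_f \<beta>) \<and>
     frontier \<Omega> = closure (G_hc \<beta> \<union> G_ss \<beta> \<union> G_sc \<beta> \<union> G_f \<beta> \<union> (J_D \<beta> \<union> J_N \<beta>)) \<and>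
     (\<forall>p\<in>J_D \<beta> \<union> J_N \<beta>. \<exists>\<delta>>0. \<forall>y\<in>G_hc \<beta> \<union> G_ss \<beta>. dist p y \<ge> \<delta>)"

text \<open>
  The trace operator from \<open>H1 \<Omega>\<close> to the square-integrable functions on the boundary is the
  continuous extension of the restriction map of smooth functions.
\<close>

definition has_trace ::
    "(real^2) set \<Rightarrow> boundary_data \<Rightarrow> (real^2 \<Rightarrow> real) \<Rightarrow> (real^2 \<Rightarrow> real) \<Rightarrow> bool" where
  "has_trace \<Omega> \<beta> v \<tau> \<longleftrightarrow>
     v \<in> H1 \<Omega> \<and> \<tau> \<in> L2_space (boundary_measure (edges \<beta>)) \<and>
     (\<exists>\<theta>. (\<forall>k. smooth (\<theta> k)) \<and> H1_limit \<Omega> \<theta> v \<and>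
        (\<lambda>k. LINT x|boundary_measure (edges \<beta>). (\<theta> k x - \<tau> x)\<^sup>2) \<longlonglongrightarrow> 0)"

definition zero_trace_on ::
    "(real^2) set \<Rightarrow> boundary_data \<Rightarrow> (real^2) set \<Rightarrow> (real^2 \<Rightarrow> real) \<Rightarrow> bool" where
  "zero_trace_on \<Omega> \<beta> P v \<longleftrightarrow>
     (\<exists>\<tau>. has_trace \<Omega> \<beta> v \<tau> \<and> (AE x in boundary_measure (edges \<beta>). x \<in> P \<longrightarrow> \<tau> x = 0))"

definition zero_normal_derivative_on ::
    "(real^2) set \<Rightarrow> boundary_data \<Rightarrow> (real^2) set \<Rightarrow> (real^2 \<Rightarrow> real) \<Rightarrow> bool" where
  "zero_normal_derivative_on \<Omega> \<beta> P v \<longleftrightarrow>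
     (\<exists>\<tau> :: real^2 \<Rightarrow> real^2.
        (\<forall>i. has_trace \<Omega> \<beta> (\<lambda>x. weak_grad \<Omega> v x $ i) (\<lambda>x. \<tau> x $ i)) \<and>
        (AE x in boundary_measure (edges \<beta>). x \<in> P \<longrightarrow> outer_normal \<Omega> x \<bullet> \<tau> x = 0))"

text \<open>
  Point values at the boundary are those of the representative that is continuous up to the
  boundary, which exists for functions in \<open>H2 \<Omega>\<close> because the domain is two-dimensional.
\<close>

definition zero_at_points :: "(real^2) set \<Rightarrow> (real^2) set \<Rightarrow> (real^2 \<Rightarrow> real) \<Rightarrow> bool" where
  "zero_at_points \<Omega> J v \<longleftrightarrow>
     (\<exists>w. continuous_on (closure \<Omega>) w \<and> (AE x in lebesgue_on \<Omega>. w x = v x) \<and> (\<forall>p\<in>J. w p = 0))"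

definition H2_D :: "(real^2) set \<Rightarrow> boundary_data \<Rightarrow> (real^2 \<Rightarrow> real) set" where
  "H2_D \<Omega> \<beta> = {v \<in> H2 \<Omega>.
     zero_trace_on \<Omega> \<beta> (G_hc \<beta> \<union> G_ss \<beta>) v \<and>
     zero_normal_derivative_on \<Omega> \<beta> (G_hc \<beta> \<union> G_sc \<beta>) v \<and>
     zero_at_points \<Omega> (J_D \<beta>) v}"

definition tr_Ggrad :: "(real^2) set \<Rightarrow> (real^2 \<Rightarrow> real) \<Rightarrow> (real^2 \<Rightarrow> real^2^2) \<Rightarrow> real" where
  "tr_Ggrad \<Omega> v M = ip \<Omega> (dDiv \<Omega> M) v - ip \<Omega> M (weak_hess \<Omega> v)"

definition tr_dDiv :: "(real^2) set \<Rightarrow> (real^2 \<Rightarrow> real^2^2) \<Rightarrow> (real^2 \<Rightarrow> real) \<Rightarrow> real" where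
  "tr_dDiv \<Omega> M v = ip \<Omega> (dDiv \<Omega> M) v - ip \<Omega> M (weak_hess \<Omega> v)"

definition H_N :: "(real^2) set \<Rightarrow> boundary_data \<Rightarrow> (real^2 \<Rightarrow> real^2^2) set" where
  "H_N \<Omega> \<beta> = {M \<in> H_dDiv \<Omega>. \<forall>v\<in>H2_D \<Omega> \<beta>. tr_dDiv \<Omega> M v = 0}"

definition V_space ::
    "(real^2) set \<Rightarrow> boundary_data \<Rightarrow> (real^2 \<Rightarrow> real) \<Rightarrow> (real^2 \<Rightarrow> real) set" where
  "V_space \<Omega> \<beta> g = {v \<in> H2 \<Omega>. \<forall>N\<in>H_N \<Omega> \<beta>. tr_Ggrad \<Omega> v N = tr_Ggrad \<Omega> g N}"

definition W_space :: "(real^2) set \<Rightarrow> (real^2 \<Rightarrow> real) \<Rightarrow> (real^2 \<Rightarrow> real) set" where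
  "W_space \<Omega> \<eta> = {\<psi> \<in> H1 \<Omega>. (\<lambda>x. \<psi> x - \<eta> x) \<in> H1_0 \<Omega>}"

definition T_mat :: "real \<Rightarrow> real^2^2" where
  "T_mat \<psi> = vector [vector [(cos \<psi>)\<^sup>2, sin \<psi> * cos \<psi>], vector [sin \<psi> * cos \<psi>, (sin \<psi>)\<^sup>2]]"

definition T'_mat :: "real \<Rightarrow> real^2^2" where
  "T'_mat \<psi> = vector [vector [- sin (2 * \<psi>), cos (2 * \<psi>)], vector [cos (2 * \<psi>), sin (2 * \<psi>)]]"

definition dDiv_T ::
    "(real^2) set \<Rightarrow> real \<Rightarrow> (real^2 \<Rightarrow> real) \<Rightarrow> (real^2 \<Rightarrow> real^2^2) \<Rightarrow> real^2 \<Rightarrow> real" where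
  "dDiv_T \<Omega> q \<phi> M x = dDiv \<Omega> M x + q\<^sup>2 * (T_mat (\<phi> x) \<bullet> M x)"

definition dDiv_form ::
    "(real^2) set \<Rightarrow> real \<Rightarrow> real \<Rightarrow> real \<Rightarrow> (real^2 \<Rightarrow> real) \<Rightarrow>
     (real^2 \<Rightarrow> real^2^2) \<Rightarrow> (real^2 \<Rightarrow> real^2^2) \<Rightarrow> real" where
  "dDiv_form \<Omega> B m q \<phi> M N =
     B * ip \<Omega> M N + B\<^sup>2 / m * ip \<Omega> (dDiv_T \<Omega> q \<phi> M) (dDiv_T \<Omega> q \<phi> N)"

definition energy ::
    "(real^2) set \<Rightarrow> real \<Rightarrow> real \<Rightarrow> real \<Rightarrow> real \<Rightarrow> (real^2 \<Rightarrow> real) \<Rightarrow> (real^2 \<Rightarrow> real^2^2) \<Rightarrow>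
     (real^2 \<Rightarrow> real) \<Rightarrow> (real^2 \<Rightarrow> real) \<Rightarrow> real" where
  "energy \<Omega> B K m q f G v \<psi> =
     B / 2 * (LINT x|lebesgue_on \<Omega>. (norm (weak_hess \<Omega> v x + (q\<^sup>2 * v x) *\<^sub>R T_mat (\<psi> x)))\<^sup>2) +
     m / 2 * (LINT x|lebesgue_on \<Omega>. (v x)\<^sup>2) +
     K / 2 * (LINT x|lebesgue_on \<Omega>. (norm (weak_grad \<Omega> \<psi> x))\<^sup>2) -
     (LINT x|lebesgue_on \<Omega>. f x * v x) + B * tr_dDiv \<Omega> G v"

end

theory Submission
  imports Defs "HOL-Complex_Analysis.Great_Picard"
begin

text \<open>
  The energy is convex in the tuple of \<open>v\<close>, its weak derivatives, \<open>\<nabla>\<psi>\<close> and the field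
  \<open>A = \<nabla>\<^sup>2v + q\<^sup>2 T(\<psi>) v\<close>, but the coupling between \<open>A\<close> and \<open>(v, \<psi>)\<close> is not linear. Along a
  minimising sequence, \<open>v\<close> is bounded in \<open>H\<^sup>2\<close>: the Hessian is \<open>A\<close> up to a bounded multiple
  of \<open>v\<close>, and the gradient follows by interpolation along segments, as the domain is
  Lipschitz. By Rellich's theorem \<open>\<psi>\<close> converges strongly, up to a subsequence, to some \<open>\<phi>\<close>.
  Since \<open>T\<close> is Lipschitz, the coupling then holds up to a small error in \<open>L\<^sup>1\<close> with \<open>T(\<phi>)\<close> in place
  of \<open>T(\<psi>)\<close>, a condition stable under convex combinations. The tuples that satisfy it and
  have almost minimal energy form nested midpoint-convex sets, whose elements of almost minimal
  norm converge strongly in \<open>L\<^sup>2\<close>, and the limit is a minimiser.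

  The variational system is the Euler--Lagrange system with \<open>M = A\<close>. Testing the variation in \<open>u\<close>
  with test functions shows that \<open>A\<close> has an iterated divergence in \<open>L\<^sup>2\<close>. For the variation of \<open>\<phi>\<close> in
  direction \<open>\<zeta>\<close>, the product \<open>u \<zeta>\<close> has to be square integrable; this follows from an estimate
  of Gagliardo--Nirenberg type in the plane.
\<close>

subsection \<open>Square integrable functions\<close>

text \<open>In the coupling term two unknowns are multiplied, and passing to the limit in it takes
  strong convergence of one factor. That factor is \<psi>: \<open>T\<close> is bounded and
  Lipschitz, so exchanging \<psi> for \<phi> costs a multiple of the product of \<open>v\<close> and
  \<open>\<psi> - \<phi>\<close>. Both factors are estimated in L2 only, which is why the error is
  measured in L1. With \<phi> frozen the coupling is linear in \<open>(v, H, A)\<close>, and the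
  nested midpoint-convex sets play the part of weak compactness combined with Mazur's lemma.
  Rellich's theorem is applied to \<open>\<psi> - \<eta>\<close>, a limit of test functions. These
  extend by zero, so compactness follows from translations of the whole plane and averages over
  square cells. For \<open>v\<close> a bound is enough, but it has to include the gradient, which is
  one of the components that must converge to give a limit in \<open>H2\<close>. The same cells
  serve the product estimate: \<open>u \<zeta>\<close> has an integrable gradient, and in the plane
  the sum of the squared cell integrals is dominated by a sum over vertical strips times a sum over
  horizontal strips.\<close>

definition inner_L2 :: "'a measure \<Rightarrow> ('a \<Rightarrow> 'b::euclidean_space) \<Rightarrow> ('a \<Rightarrow> 'b) \<Rightarrow> real" where
  "inner_L2 M f g = (LINT x|M. f x \<bullet> g x)"

definition norm_L2 :: "'a measure \<Rightarrow> ('a \<Rightarrow> 'b::euclidean_space) \<Rightarrow> real" where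
  "norm_L2 M f = sqrt (LINT x|M. (norm (f x))\<^sup>2)"

lemma L2_spaceD:
  assumes "f \<in> L2_space M"
  shows "f \<in> borel_measurable M" "integrable M (\<lambda>x. (norm (f x))\<^sup>2)"
  using assms by (auto simp: L2_space_def)

lemma L2_spaceI:
  "f \<in> borel_measurable M \<Longrightarrow> integrable M (\<lambda>x. (norm (f x))\<^sup>2) \<Longrightarrow> f \<in> L2_space M"
  by (auto simp: L2_space_def)

lemma L2_space_bound:
  assumes "g \<in> L2_space M" "f \<in> borel_measurable M" "\<And>x. x \<in> space M \<Longrightarrow> norm (f x) \<le> c * norm (g x)"
  shows "f \<in> L2_space M"
proof (rule L2_spaceI[OF assms(2)])
  show "integrable M (\<lambda>x. (norm (f x))\<^sup>2)"
  proof (rule Bochner_Integration.integrable_bound)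
    show "integrable M (\<lambda>x. c\<^sup>2 * (norm (g x))\<^sup>2)"
      using L2_spaceD(2)[OF assms(1)] by simp
    show "(\<lambda>x. (norm (f x))\<^sup>2) \<in> borel_measurable M" using assms(2) by measurable
    show "AE x in M. norm ((norm (f x))\<^sup>2) \<le> norm (c\<^sup>2 * (norm (g x))\<^sup>2)"
    proof (rule AE_I2)
      fix x assume "x \<in> space M"
      then have "(norm (f x))\<^sup>2 \<le> (c * norm (g x))\<^sup>2"
        using assms(3) by (intro power_mono) auto
      then show "norm ((norm (f x))\<^sup>2) \<le> norm (c\<^sup>2 * (norm (g x))\<^sup>2)"
        by (simp add: power_mult_distrib)
    qed
  qed
qed

lemma L2_space_zero [simp]: "(\<lambda>x. 0) \<in> L2_space M"
  by (auto simp: L2_space_def)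

lemma L2_space_add:
  assumes "f \<in> L2_space M" "g \<in> L2_space M"
  shows "(\<lambda>x. f x + g x) \<in> L2_space M"
proof (rule L2_spaceI)
  have [measurable]: "f \<in> borel_measurable M" "g \<in> borel_measurable M"
    using assms by (auto simp: L2_space_def)
  show "(\<lambda>x. f x + g x) \<in> borel_measurable M" by measurable
  show "integrable M (\<lambda>x. (norm (f x + g x))\<^sup>2)"
  proof (rule Bochner_Integration.integrable_bound)
    show "integrable M (\<lambda>x. 2 * (norm (f x))\<^sup>2 + 2 * (norm (g x))\<^sup>2)"
      using assms by (auto simp: L2_space_def)
    have "(norm (a + b))\<^sup>2 \<le> 2 * (norm a)\<^sup>2 + 2 * (norm b)\<^sup>2" for a b :: 'b
    proof -
      have "(norm (a + b))\<^sup>2 + (norm (a - b))\<^sup>2 = 2 * (norm a)\<^sup>2 + 2 * (norm b)\<^sup>2"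
        by (simp add: power2_norm_eq_inner inner_simps inner_commute)
      then show ?thesis by (smt (verit) zero_le_power2)
    qed
    then show "AE x in M. norm ((norm (f x + g x))\<^sup>2) \<le> norm (2 * (norm (f x))\<^sup>2 + 2 * (norm (g x))\<^sup>2)"
      by auto
  qed measurable
qed

lemma L2_space_scaleR:
  assumes "f \<in> L2_space M"
  shows "(\<lambda>x. c *\<^sub>R f x) \<in> L2_space M"
  using assms by (intro L2_space_bound[OF assms, of _ "\<bar>c\<bar>"]) (auto simp: L2_space_def)

lemma L2_space_mult_left:
  fixes f :: "'a \<Rightarrow> real"
  shows "f \<in> L2_space M \<Longrightarrow> (\<lambda>x. c * f x) \<in> L2_space M"
  using L2_space_scaleR[of f M c] by simp

lemma L2_space_uminus: "f \<in> L2_space M \<Longrightarrow> (\<lambda>x. - f x) \<in> L2_space M"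
  using L2_space_scaleR[of f M "-1"] by simp

lemma L2_space_diff:
  assumes "f \<in> L2_space M" "g \<in> L2_space M"
  shows "(\<lambda>x. f x - g x) \<in> L2_space M"
  using L2_space_add[OF assms(1) L2_space_uminus[OF assms(2)]] by simp

lemma L2_space_nth:
  fixes f :: "'a \<Rightarrow> 'b::euclidean_space ^ 'n"
  assumes "f \<in> L2_space M"
  shows "(\<lambda>x. f x $ i) \<in> L2_space M"
proof (rule L2_space_bound[OF assms, of _ 1])
  show "(\<lambda>x. f x $ i) \<in> borel_measurable M"
    using L2_spaceD(1)[OF assms]
    by (rule measurable_compose) (intro borel_measurable_continuous_onI continuous_intros)
qed (use Finite_Cartesian_Product.norm_nth_le in auto)

lemma borel_measurable_vec_lambda:
  fixes f :: "'a \<Rightarrow> 'b::euclidean_space ^ 'n"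
  assumes "\<And>i. (\<lambda>x. f x $ i) \<in> borel_measurable M"
  shows "f \<in> borel_measurable M"
proof -
  have "(\<lambda>x. \<Sum>i\<in>UNIV. axis i (f x $ i)) \<in> borel_measurable M"
  proof (rule borel_measurable_sum)
    fix i :: 'n
    have "bounded_linear (axis i :: 'b \<Rightarrow> 'b ^ 'n)"
      by (rule bounded_linearI'[OF _ _, of _]) (auto simp: axis_def vec_eq_iff)
    then have "continuous_on UNIV (axis i :: 'b \<Rightarrow> 'b ^ 'n)"
      by (rule linear_continuous_on)
    then show "(\<lambda>x. axis i (f x $ i)) \<in> borel_measurable M"
      using assms by (intro measurable_compose[OF assms] borel_measurable_continuous_onI)
  qed
  also have "(\<lambda>x. \<Sum>i\<in>UNIV. axis i (f x $ i)) = f"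
    by (auto simp: vec_eq_iff axis_def if_distrib sum.delta fun_eq_iff cong: if_cong)
  finally show ?thesis .
qed

lemma L2_space_vec:
  fixes f :: "'a \<Rightarrow> 'b::euclidean_space ^ 'n"
  assumes "\<And>i. (\<lambda>x. f x $ i) \<in> L2_space M"
  shows "f \<in> L2_space M"
proof (rule L2_spaceI)
  show "f \<in> borel_measurable M"
    using assms by (intro borel_measurable_vec_lambda) (auto simp: L2_space_def)
  have "(\<lambda>x. (norm (f x))\<^sup>2) = (\<lambda>x. \<Sum>i\<in>UNIV. (norm (f x $ i))\<^sup>2)"
    by (auto simp: norm_vec_def L2_set_def sum_nonneg fun_eq_iff)
  then show "integrable M (\<lambda>x. (norm (f x))\<^sup>2)"
    using assms by (auto simp: L2_space_def)
qed

lemma L2_space_Pair: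
  assumes "f \<in> L2_space M" "g \<in> L2_space M"
  shows "(\<lambda>x. (f x, g x)) \<in> L2_space M"
  using assms by (auto simp: L2_space_def norm_Pair)

lemma L2_space_fst: 
  assumes "f \<in> L2_space M"
  shows "(\<lambda>x. fst (f x)) \<in> L2_space M"
proof -
  have [measurable]: "f \<in> borel_measurable M" using assms by (auto simp: L2_space_def)
  show ?thesis
    by (rule L2_space_bound[OF assms, of _ 1])
       (auto intro!: measurable_compose[OF _ borel_measurable_continuous_onI[OF continuous_on_fst[OF continuous_on_id]]] simp: norm_fst_le[of "fst (f x)" "snd (f x)" for x, simplified])
qed

lemma L2_space_snd:
  assumes "f \<in> L2_space M"
  shows "(\<lambda>x. snd (f x)) \<in> L2_space M"
proof -
  have [measurable]: "f \<in> borel_measurable M" using assms by (auto simp: L2_space_def)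
  show ?thesis
    by (rule L2_space_bound[OF assms, of _ 1])
       (auto intro!: measurable_compose[OF _ borel_measurable_continuous_onI[OF continuous_on_snd[OF continuous_on_id]]] simp: norm_snd_le[of "snd (f x)" "fst (f x)" for x, simplified])
qed

lemma L2_space_cong_AE:
  assumes "f \<in> L2_space M" "g \<in> borel_measurable M" "AE x in M. f x = g x"
  shows "g \<in> L2_space M"
proof (rule L2_spaceI[OF assms(2)])
  have [measurable]: "f \<in> borel_measurable M" "g \<in> borel_measurable M" using assms by (auto simp: L2_space_def)
  show "integrable M (\<lambda>x. (norm (g x))\<^sup>2)"
    using L2_spaceD(2)[OF assms(1)] assms(3)
    by (subst integrable_cong_AE[of _ _ "\<lambda>x. (norm (f x))\<^sup>2"]) auto
qed

lemma L2_space_imp_integrable: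
  fixes f :: "'a \<Rightarrow> 'b::euclidean_space"
  assumes "finite_measure M" "f \<in> L2_space M"
  shows "integrable M f"
proof (rule Bochner_Integration.integrable_bound)
  interpret finite_measure M by fact
  show "integrable M (\<lambda>x. 1 + (norm (f x))\<^sup>2)"
    using assms(2) by (auto simp: L2_space_def)
  show "f \<in> borel_measurable M" using assms(2) by (auto simp: L2_space_def)
  have "norm (f x) \<le> 1 + (norm (f x))\<^sup>2" for x
    using zero_le_power2[of "norm (f x) - 1"] norm_ge_zero[of "f x"] by (simp add: power2_diff del: norm_ge_zero)
  then show "AE x in M. norm (f x) \<le> norm (1 + (norm (f x))\<^sup>2)" by auto
qed

lemma L2_space_bounded_mult:
  fixes f :: "'a \<Rightarrow> real" and g :: "'a \<Rightarrow> 'b::euclidean_space"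
  assumes "g \<in> L2_space M" "f \<in> borel_measurable M" "\<And>x. x \<in> space M \<Longrightarrow> \<bar>f x\<bar> \<le> c"
  shows "(\<lambda>x. f x *\<^sub>R g x) \<in> L2_space M"
  by (rule L2_space_bound[OF assms(1), of _ c])
     (use assms in \<open>auto simp: L2_space_def intro!: mult_right_mono\<close>)

lemma L2_space_inner_bounded:
  fixes f g :: "'a \<Rightarrow> 'b::euclidean_space"
  assumes "g \<in> L2_space M" "f \<in> borel_measurable M" "\<And>x. x \<in> space M \<Longrightarrow> norm (f x) \<le> c"
  shows "(\<lambda>x. f x \<bullet> g x) \<in> L2_space M"
proof (rule L2_space_bound[OF assms(1), of _ c])
  show "(\<lambda>x. f x \<bullet> g x) \<in> borel_measurable M" using assms by (auto simp: L2_space_def)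
  show "norm (f x \<bullet> g x) \<le> c * norm (g x)" if "x \<in> space M" for x
    using Cauchy_Schwarz_ineq2[of "f x" "g x"] assms(3)[OF that]
    by (smt (verit) mult_right_mono norm_ge_zero real_norm_def)
qed

section \<open>Inner product, norm and Cauchy-Schwarz inequality in L2\<close>

lemma integrable_inner_L2:
  assumes "f \<in> L2_space M" "g \<in> L2_space M"
  shows "integrable M (\<lambda>x. f x \<bullet> g x)"
proof (rule Bochner_Integration.integrable_bound)
  show "integrable M (\<lambda>x. (norm (f x))\<^sup>2 + (norm (g x))\<^sup>2)"
    using assms by (auto simp: L2_space_def)
  show "(\<lambda>x. f x \<bullet> g x) \<in> borel_measurable M"
    using assms by (auto simp: L2_space_def)
  have "\<bar>a \<bullet> b\<bar> \<le> (norm a)\<^sup>2 + (norm b)\<^sup>2" for a b :: 'b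
  proof -
    have "\<bar>a \<bullet> b\<bar> \<le> norm a * norm b" by (rule Cauchy_Schwarz_ineq2)
    also have "\<dots> \<le> (norm a)\<^sup>2 + (norm b)\<^sup>2"
      using sum_squares_bound[of "norm a" "norm b"] mult_nonneg_nonneg[OF norm_ge_zero norm_ge_zero, of a b]
      by linarith
    finally show ?thesis .
  qed
  then show "AE x in M. norm (f x \<bullet> g x) \<le> norm ((norm (f x))\<^sup>2 + (norm (g x))\<^sup>2)"
    by auto
qed

lemma integrable_mult_L2:
  fixes f g :: "'a \<Rightarrow> real"
  assumes "f \<in> L2_space M" "g \<in> L2_space M"
  shows "integrable M (\<lambda>x. f x * g x)"
  using integrable_inner_L2[OF assms] by simp

lemma inner_L2_commute: "inner_L2 M f g = inner_L2 M g f"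
  by (simp add: inner_L2_def inner_commute)

lemma inner_L2_add:
  assumes "f \<in> L2_space M" "g \<in> L2_space M" "h \<in> L2_space M"
  shows "inner_L2 M (\<lambda>x. f x + g x) h = inner_L2 M f h + inner_L2 M g h"
    "inner_L2 M h (\<lambda>x. f x + g x) = inner_L2 M h f + inner_L2 M h g"
  using assms by (auto simp: inner_L2_def inner_add_left inner_add_right integrable_inner_L2)

lemma inner_L2_diff:
  assumes "f \<in> L2_space M" "g \<in> L2_space M" "h \<in> L2_space M"
  shows "inner_L2 M (\<lambda>x. f x - g x) h = inner_L2 M f h - inner_L2 M g h"
    "inner_L2 M h (\<lambda>x. f x - g x) = inner_L2 M h f - inner_L2 M h g"
  using assms by (auto simp: inner_L2_def inner_diff_left inner_diff_right integrable_inner_L2)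

lemma inner_L2_scaleR:
  "inner_L2 M (\<lambda>x. c *\<^sub>R f x) g = c * inner_L2 M f g"
  "inner_L2 M f (\<lambda>x. c *\<^sub>R g x) = c * inner_L2 M f g"
  by (auto simp: inner_L2_def)

lemma inner_L2_mult:
  fixes f g :: "'a \<Rightarrow> real"
  shows "inner_L2 M (\<lambda>x. c * f x) g = c * inner_L2 M f g"
    "inner_L2 M f (\<lambda>x. c * g x) = c * inner_L2 M f g"
  using inner_L2_scaleR(1)[of M c f g] inner_L2_scaleR(2)[of M f c g] by simp_all

lemma inner_L2_uminus:
  "inner_L2 M (\<lambda>x. - f x) g = - inner_L2 M f g" "inner_L2 M f (\<lambda>x. - g x) = - inner_L2 M f g"
  by (auto simp: inner_L2_def)

lemma inner_L2_cong_AE: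
  assumes "f \<in> borel_measurable M" "f' \<in> borel_measurable M" "g \<in> borel_measurable M" "g' \<in> borel_measurable M"
    "AE x in M. f x = f' x" "AE x in M. g x = g' x"
  shows "inner_L2 M f g = inner_L2 M f' g'"
  unfolding inner_L2_def using assms by (intro integral_cong_AE) auto

lemma norm_L2_cong_AE:
  assumes "f \<in> borel_measurable M" "f' \<in> borel_measurable M" "AE x in M. f x = f' x"
  shows "norm_L2 M f = norm_L2 M f'"
  unfolding norm_L2_def using assms by (intro arg_cong[where f=sqrt] integral_cong_AE) auto

lemma norm_L2_nonneg [simp]: "0 \<le> norm_L2 M f"
  by (simp add: norm_L2_def)

lemma norm_L2_power2: "(norm_L2 M f)\<^sup>2 = (LINT x|M. (norm (f x))\<^sup>2)"
  by (simp add: norm_L2_def)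

lemma inner_L2_self: "inner_L2 M f f = (norm_L2 M f)\<^sup>2"
  by (simp add: norm_L2_power2 inner_L2_def power2_norm_eq_inner)

lemma norm_L2_scaleR: "norm_L2 M (\<lambda>x. c *\<^sub>R f x) = \<bar>c\<bar> * norm_L2 M f"
  by (simp add: norm_L2_def power_mult_distrib real_sqrt_mult)

lemma norm_L2_mult:
  fixes f :: "'a \<Rightarrow> real"
  shows "norm_L2 M (\<lambda>x. c * f x) = \<bar>c\<bar> * norm_L2 M f"
  using norm_L2_scaleR[of M c f] by simp

lemma norm_L2_uminus [simp]: "norm_L2 M (\<lambda>x. - f x) = norm_L2 M f"
  by (simp add: norm_L2_def)

lemma norm_L2_zero [simp]: "norm_L2 M (\<lambda>x. 0) = 0"
  by (simp add: norm_L2_def)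

lemma norm_L2_minus_commute: "norm_L2 M (\<lambda>x. f x - g x) = norm_L2 M (\<lambda>x. g x - f x)"
  by (simp add: norm_L2_def norm_minus_commute)

lemma norm_L2_eq_0:
  assumes "f \<in> L2_space M" "norm_L2 M f = 0"
  shows "AE x in M. f x = 0"
  using assms integral_nonneg_eq_0_iff_AE[of M "\<lambda>x. (norm (f x))\<^sup>2"]
  by (auto simp: L2_space_def norm_L2_def)

lemma norm_L2_add_power2:
  assumes "f \<in> L2_space M" "g \<in> L2_space M"
  shows "(norm_L2 M (\<lambda>x. f x + g x))\<^sup>2 = (norm_L2 M f)\<^sup>2 + 2 * inner_L2 M f g + (norm_L2 M g)\<^sup>2"
  using assms by (simp add: inner_L2_self[symmetric] inner_L2_add L2_space_add inner_L2_commute[of M g f])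

lemma norm_L2_diff_power2:
  assumes "f \<in> L2_space M" "g \<in> L2_space M"
  shows "(norm_L2 M (\<lambda>x. f x - g x))\<^sup>2 = (norm_L2 M f)\<^sup>2 - 2 * inner_L2 M f g + (norm_L2 M g)\<^sup>2"
  using assms by (simp add: inner_L2_self[symmetric] inner_L2_diff L2_space_diff inner_L2_commute[of M g f])

lemma Cauchy_Schwarz_L2:
  assumes "f \<in> L2_space M" "g \<in> L2_space M"
  shows "\<bar>inner_L2 M f g\<bar> \<le> norm_L2 M f * norm_L2 M g"
proof (cases "norm_L2 M g = 0")
  case True
  then have "AE x in M. g x = 0" using norm_L2_eq_0 assms by blast
  then have "inner_L2 M f g = inner_L2 M f (\<lambda>x. 0)"
    using assms by (intro inner_L2_cong_AE) (auto simp: L2_space_def)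
  then show ?thesis by (simp add: inner_L2_def)
next
  case False
  define a where "a = norm_L2 M f"
  define b where "b = norm_L2 M g"
  define c where "c = inner_L2 M f g"
  have b: "b > 0" using False norm_L2_nonneg[of M g] by (simp add: b_def less_le)
  have a: "a \<ge> 0" by (simp add: a_def)
  \<comment> \<open>The coefficient \<open>c / b\<^sup>2\<close> is that of the projection of
    \<open>f\<close> onto \<open>g\<close>; it minimises this square.\<close>
  have "0 \<le> (norm_L2 M (\<lambda>x. f x - (c / b\<^sup>2) *\<^sub>R g x))\<^sup>2" by simp
  also have "\<dots> = a\<^sup>2 - 2 * (c / b\<^sup>2) * c + (c / b\<^sup>2)\<^sup>2 * b\<^sup>2"
    using norm_L2_diff_power2[OF assms(1) L2_space_scaleR[OF assms(2)], of "c / b\<^sup>2"]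
    by (simp only: norm_L2_scaleR inner_L2_scaleR a_def[symmetric] b_def[symmetric] c_def[symmetric]
        power_mult_distrib power2_abs mult.assoc)
  also have "\<dots> = a\<^sup>2 - c\<^sup>2 / b\<^sup>2"
    using b by (simp add: field_simps power2_eq_square)
  finally have "c\<^sup>2 \<le> (a * b)\<^sup>2"
    using b by (simp add: field_simps power_mult_distrib)
  then have "\<bar>c\<bar> \<le> a * b"
    using a b by (simp add: abs_le_square_iff[symmetric] abs_mult)
  then show ?thesis by (simp add: a_def b_def c_def)
qed

lemma norm_L2_add_le:
  assumes "f \<in> L2_space M" "g \<in> L2_space M"
  shows "norm_L2 M (\<lambda>x. f x + g x) \<le> norm_L2 M f + norm_L2 M g"
proof (rule power2_le_imp_le)
  show "(norm_L2 M (\<lambda>x. f x + g x))\<^sup>2 \<le> (norm_L2 M f + norm_L2 M g)\<^sup>2"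
    using Cauchy_Schwarz_L2[OF assms]
    by (simp add: norm_L2_add_power2[OF assms] power2_sum)
qed simp

lemma norm_L2_diff_le:
  assumes "f \<in> L2_space M" "g \<in> L2_space M"
  shows "norm_L2 M (\<lambda>x. f x - g x) \<le> norm_L2 M f + norm_L2 M g"
  using norm_L2_add_le[OF assms(1) L2_space_uminus[OF assms(2)]] by simp

lemma norm_L2_triangle:
  assumes "f \<in> L2_space M" "g \<in> L2_space M" "h \<in> L2_space M"
  shows "norm_L2 M (\<lambda>x. f x - h x) \<le> norm_L2 M (\<lambda>x. f x - g x) + norm_L2 M (\<lambda>x. g x - h x)"
  using norm_L2_add_le[of "\<lambda>x. f x - g x" M "\<lambda>x. g x - h x"] assms by (simp add: L2_space_diff)

lemma norm_L2_diff_ge: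
  assumes "f \<in> L2_space M" "g \<in> L2_space M"
  shows "\<bar>norm_L2 M f - norm_L2 M g\<bar> \<le> norm_L2 M (\<lambda>x. f x - g x)"
  using norm_L2_triangle[of f M g "\<lambda>x. 0"] norm_L2_triangle[of g M f "\<lambda>x. 0"]
    norm_L2_minus_commute[of M f g] assms by simp

lemma norm_L2_mono:
  assumes "g \<in> L2_space M" "f \<in> borel_measurable M" "\<And>x. x \<in> space M \<Longrightarrow> norm (f x) \<le> norm (g x)"
  shows "norm_L2 M f \<le> norm_L2 M g"
proof -
  have "f \<in> L2_space M" using L2_space_bound[OF assms(1,2), of 1] assms(3) by simp
  then show ?thesis
    unfolding norm_L2_def using assms
    by (intro real_sqrt_le_mono integral_mono) (auto simp: L2_space_def power_mono)
qed

lemma norm_L2_bounded_mult: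
  assumes "g \<in> L2_space M" "f \<in> borel_measurable M" "0 \<le> c"
    "\<And>x. x \<in> space M \<Longrightarrow> norm (f x) \<le> c * norm (g x)"
  shows "norm_L2 M f \<le> c * norm_L2 M g"
  using norm_L2_mono[of "\<lambda>x. c *\<^sub>R g x" M f] assms by (simp add: L2_space_scaleR norm_L2_scaleR)

text \<open>The parallelogram law, arranged so that the gain from averaging is a quarter of the
  squared distance. It yields both the Cauchy property of near-minimisers and the convexity of the
  energy.\<close>

lemma norm_L2_midpoint:
  assumes "f \<in> L2_space M" "g \<in> L2_space M"
  shows "(norm_L2 M (\<lambda>x. (1/2) *\<^sub>R (f x + g x)))\<^sup>2 + (norm_L2 M (\<lambda>x. f x - g x))\<^sup>2 / 4
    = ((norm_L2 M f)\<^sup>2 + (norm_L2 M g)\<^sup>2) / 2"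
  unfolding norm_L2_scaleR power_mult_distrib norm_L2_add_power2[OF assms] norm_L2_diff_power2[OF assms]
  by (simp add: power_divide field_simps)

text \<open>Cauchy-Schwarz against the constant 1. It converts L2 control into the L1 control in
  which subsequences are extracted and the coupling error is measured.\<close>

lemma L1_le_norm_L2:
  assumes "finite_measure M" "f \<in> L2_space M"
  shows "(LINT x|M. norm (f x)) \<le> norm_L2 M f * sqrt (measure M (space M))"
proof -
  interpret finite_measure M by fact
  have f: "(\<lambda>x. norm (f x)) \<in> L2_space M"
    using assms by (auto simp: L2_space_def)
  have one: "(\<lambda>x. 1::real) \<in> L2_space M" by (auto simp: L2_space_def)
  have "(LINT x|M. norm (f x)) \<le> \<bar>inner_L2 M (\<lambda>x. norm (f x)) (\<lambda>x. 1)\<bar>"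
    by (simp add: inner_L2_def)
  also have "\<dots> \<le> norm_L2 M (\<lambda>x. norm (f x)) * norm_L2 M (\<lambda>x. 1::real)"
    by (rule Cauchy_Schwarz_L2[OF f one])
  also have "\<dots> = norm_L2 M f * sqrt (measure M (space M))"
    by (simp add: norm_L2_def)
  finally show ?thesis .
qed

text \<open>Fatou's lemma for the squares. It gives membership in L2 and the bound at once, so a
  pointwise limit need not be known to be square integrable beforehand.\<close>

lemma L2_fatou:
  fixes F :: "nat \<Rightarrow> 'a \<Rightarrow> 'b::euclidean_space"
  assumes F: "\<And>n. F n \<in> L2_space M" and y: "y \<in> borel_measurable M"
    and lim: "AE x in M. (\<lambda>n. F n x) \<longlonglongrightarrow> y x"
    and bound: "eventually (\<lambda>n. norm_L2 M (F n) \<le> c) sequentially"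
  shows "y \<in> L2_space M" "norm_L2 M y \<le> c"
proof -
  have [measurable]: "F n \<in> borel_measurable M" for n using F by (auto simp: L2_space_def)
  note y[measurable]
  \<comment> \<open>Some index satisfies the bound, and norms are nonnegative.\<close>
  have c: "0 \<le> c"
  proof -
    obtain n where "norm_L2 M (F n) \<le> c" using eventually_happens[OF bound] by auto
    then show ?thesis using norm_L2_nonneg[of M "F n"] by linarith
  qed
  have "(\<integral>\<^sup>+x. ennreal ((norm (y x))\<^sup>2) \<partial>M) = (\<integral>\<^sup>+x. liminf (\<lambda>n. ennreal ((norm (F n x))\<^sup>2)) \<partial>M)"
  proof (rule nn_integral_cong_AE)
    show "AE x in M. ennreal ((norm (y x))\<^sup>2) = liminf (\<lambda>n. ennreal ((norm (F n x))\<^sup>2))"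
      using lim
    proof eventually_elim
      case (elim x)
      have "(\<lambda>n. ennreal ((norm (F n x))\<^sup>2)) \<longlonglongrightarrow> ennreal ((norm (y x))\<^sup>2)"
        by (intro tendsto_intros elim) 
      then show ?case using lim_imp_Liminf[OF sequentially_bot] by metis
    qed
  qed
  also have "\<dots> \<le> liminf (\<lambda>n. \<integral>\<^sup>+x. ennreal ((norm (F n x))\<^sup>2) \<partial>M)"
    by (rule nn_integral_liminf) measurable
  also have "\<dots> = liminf (\<lambda>n. ennreal ((norm_L2 M (F n))\<^sup>2))"
    by (subst nn_integral_eq_integral) (use F in \<open>auto simp: L2_space_def norm_L2_power2\<close>)
  also have "\<dots> \<le> ennreal (c\<^sup>2)"
  proof (rule Liminf_le)
    show "\<forall>\<^sub>F n in sequentially. ennreal ((norm_L2 M (F n))\<^sup>2) \<le> ennreal (c\<^sup>2)"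
      using bound by eventually_elim (auto intro!: ennreal_leI power_mono)
  qed simp
  finally have *: "(\<integral>\<^sup>+x. ennreal ((norm (y x))\<^sup>2) \<partial>M) \<le> ennreal (c\<^sup>2)" .
  then have "integrable M (\<lambda>x. (norm (y x))\<^sup>2)"
    by (intro integrableI_bounded) (auto intro: le_less_trans)
  then show "y \<in> L2_space M" by (auto simp: L2_space_def)
  have "(LINT x|M. (norm (y x))\<^sup>2) \<le> c\<^sup>2"
    using * \<open>integrable M _\<close> by (subst (asm) nn_integral_eq_integral) auto
  then show "norm_L2 M y \<le> c"
    using c by (simp add: norm_L2_def real_le_lsqrt)
qed

text \<open>On a finite measure space a Cauchy sequence in L2 is Cauchy in L1, where almost
  everywhere Cauchy subsequences can be extracted.\<close>

lemma L2_Cauchy_AE_subseq: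
  fixes F :: "nat \<Rightarrow> 'a \<Rightarrow> 'b::euclidean_space"
  assumes M: "finite_measure M" and F: "\<And>n. F n \<in> L2_space M"
    and Cau: "\<And>e. e > 0 \<Longrightarrow> \<exists>N. \<forall>i\<ge>N. \<forall>j\<ge>N. norm_L2 M (\<lambda>x. F i x - F j x) < e"
  obtains r where "strict_mono r" "AE x in M. Cauchy (\<lambda>i. F (r i) x)"
proof (rule cauchy_L1_AE_cauchy_subseq)
  interpret finite_measure M by fact
  show "integrable M (F n)" for n by (rule L2_space_imp_integrable[OF M F])
  fix e :: real assume "e > 0"
  \<comment> \<open>The summand 1 keeps the divisor positive even if the space has measure
    0.\<close>
  define K where "K = sqrt (measure M (space M)) + 1"
  have K: "K > 0" by (simp add: K_def add_nonneg_pos)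
  obtain N where N: "\<And>i j. i \<ge> N \<Longrightarrow> j \<ge> N \<Longrightarrow> norm_L2 M (\<lambda>x. F i x - F j x) < e / K"
    using Cau[of "e / K"] \<open>e > 0\<close> K by auto
  have "(LINT x|M. norm (F i x - F j x)) < e" if "i \<ge> N" "j \<ge> N" for i j
  proof -
    have "(LINT x|M. norm (F i x - F j x)) \<le> norm_L2 M (\<lambda>x. F i x - F j x) * sqrt (measure M (space M))"
      by (rule L1_le_norm_L2[OF M L2_space_diff[OF F F]])
    also have "\<dots> \<le> norm_L2 M (\<lambda>x. F i x - F j x) * K"
      by (rule mult_left_mono) (auto simp: K_def)
    also have "\<dots> < e" using N[OF that] K by (simp add: field_simps)
    finally show ?thesis .
  qed
  then show "\<exists>N. \<forall>i\<ge>N. \<forall>j\<ge>N. LINT x|M. norm (F i x - F j x) < e" by blast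
qed (use that in blast)

text \<open>The limit is built pointwise along a subsequence. Fatou's lemma, applied to
  \<open>F (r i) - F n\<close> with \<open>n\<close> fixed, then carries the Cauchy estimate over to
  \<open>y - F n\<close> for the full sequence.\<close>

lemma L2_complete:
  fixes F :: "nat \<Rightarrow> 'a \<Rightarrow> 'b::euclidean_space"
  assumes M: "finite_measure M" and F: "\<And>n. F n \<in> L2_space M"
    and Cau: "\<And>e. e > 0 \<Longrightarrow> \<exists>N. \<forall>i\<ge>N. \<forall>j\<ge>N. norm_L2 M (\<lambda>x. F i x - F j x) < e"
  obtains y where "y \<in> L2_space M" "(\<lambda>n. norm_L2 M (\<lambda>x. F n x - y x)) \<longlonglongrightarrow> 0"
proof -
  obtain r where r: "strict_mono r" and AE: "AE x in M. Cauchy (\<lambda>i. F (r i) x)"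
    using L2_Cauchy_AE_subseq[OF assms] by blast
  \<comment> \<open>\<open>lim\<close> is total, so \<open>y\<close> is defined and measurable
    everywhere; its values matter only where the subsequence is Cauchy.\<close>
  define y where "y x = lim (\<lambda>i. F (r i) x)" for x
  have [measurable]: "F n \<in> borel_measurable M" for n using F by (auto simp: L2_space_def)
  have y [measurable]: "y \<in> borel_measurable M"
    unfolding y_def by (rule borel_measurable_lim_metric) measurable
  have lim: "AE x in M. (\<lambda>i. F (r i) x) \<longlonglongrightarrow> y x"
    using AE by eventually_elim (auto simp: y_def Cauchy_convergent_iff convergent_LIMSEQ_iff)
  have main: "(\<lambda>x. y x - F n x) \<in> L2_space M \<and> norm_L2 M (\<lambda>x. y x - F n x) \<le> e"
    if "\<forall>i\<ge>N. \<forall>j\<ge>N. norm_L2 M (\<lambda>x. F i x - F j x) < e" "n \<ge> N" for n N e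
  proof -
    have 1: "(\<lambda>x. F (r i) x - F n x) \<in> L2_space M" for i by (rule L2_space_diff[OF F F])
    have 2: "AE x in M. (\<lambda>i. F (r i) x - F n x) \<longlonglongrightarrow> y x - F n x"
      using lim by eventually_elim (intro tendsto_intros)
    have 3: "(\<lambda>x. y x - F n x) \<in> borel_measurable M" by measurable
    have "norm_L2 M (\<lambda>x. F (r i) x - F n x) \<le> e" if "i \<ge> N" for i
    proof -
      have "r i \<ge> N" using seq_suble[OF r, of i] that by linarith
      then show ?thesis using \<open>\<forall>i\<ge>N. _\<close> \<open>n \<ge> N\<close> by (simp add: less_imp_le)
    qed
    then have 4: "\<forall>\<^sub>F i in sequentially. norm_L2 M (\<lambda>x. F (r i) x - F n x) \<le> e"
      unfolding eventually_sequentially by blast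
    show ?thesis using L2_fatou[OF 1 3 2 4] by blast
  qed
  obtain N where N: "\<forall>i\<ge>N. \<forall>j\<ge>N. norm_L2 M (\<lambda>x. F i x - F j x) < 1"
    using Cau[OF zero_less_one] by blast
  have yL2: "y \<in> L2_space M"
    using L2_space_add[OF conjunct1[OF main[OF N order_refl]] F[of N]] by simp
  moreover have "(\<lambda>n. norm_L2 M (\<lambda>x. F n x - y x)) \<longlonglongrightarrow> 0"
  proof (rule LIMSEQ_I)
    fix e :: real assume "e > 0"
    then obtain N where N: "\<forall>i\<ge>N. \<forall>j\<ge>N. norm_L2 M (\<lambda>x. F i x - F j x) < e / 2"
      using Cau[OF half_gt_zero] by blast
    have "norm (norm_L2 M (\<lambda>x. F n x - y x) - 0) < e" if "n \<ge> N" for n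
      using conjunct2[OF main[OF N that]] \<open>e > 0\<close> norm_L2_minus_commute[of M y "F n"] by simp
    then show "\<exists>N. \<forall>n\<ge>N. norm (norm_L2 M (\<lambda>x. F n x - y x) - 0) < e" by blast
  qed
  ultimately show ?thesis by (rule that)
qed

lemma L2_lim_AE_subseq:
  fixes F :: "nat \<Rightarrow> 'a \<Rightarrow> 'b::euclidean_space"
  assumes M: "finite_measure M" and F: "\<And>n. F n \<in> L2_space M" and y: "y \<in> L2_space M"
    and lim: "(\<lambda>n. norm_L2 M (\<lambda>x. F n x - y x)) \<longlonglongrightarrow> 0"
  obtains r where "strict_mono r" "AE x in M. (\<lambda>i. F (r i) x) \<longlonglongrightarrow> y x"
proof -
  have "(\<lambda>n. LINT x|M. norm (F n x - y x)) \<longlonglongrightarrow> 0"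
  proof (rule tendsto_sandwich[OF _ _ tendsto_const])
    show "(\<lambda>n. norm_L2 M (\<lambda>x. F n x - y x) * sqrt (measure M (space M))) \<longlonglongrightarrow> 0"
      using tendsto_mult_left_zero[OF lim] by simp
    show "\<forall>\<^sub>F n in sequentially. (LINT x|M. norm (F n x - y x))
      \<le> norm_L2 M (\<lambda>x. F n x - y x) * sqrt (measure M (space M))"
      by (intro always_eventually allI L1_le_norm_L2[OF M L2_space_diff[OF F y]])
  qed auto
  then obtain r where "strict_mono r" "AE x in M. (\<lambda>i. F (r i) x - y x) \<longlonglongrightarrow> 0"
    using tendsto_L1_AE_subseq[of M "\<lambda>n x. F n x - y x"] L2_space_imp_integrable[OF M L2_space_diff[OF F y]]
    by blast
  then show ?thesis
    by (intro that[of r]) (auto elim!: eventually_mono simp: LIM_zero_iff)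
qed

lemma tendsto_norm_L2:
  assumes "\<And>n. F n \<in> L2_space M" "y \<in> L2_space M" "(\<lambda>n. norm_L2 M (\<lambda>x. F n x - y x)) \<longlonglongrightarrow> 0"
  shows "(\<lambda>n. norm_L2 M (F n)) \<longlonglongrightarrow> norm_L2 M y"
proof (rule LIM_zero_cancel, rule Lim_null_comparison[OF _ assms(3)])
  show "\<forall>\<^sub>F n in sequentially. norm (norm_L2 M (F n) - norm_L2 M y) \<le> norm_L2 M (\<lambda>x. F n x - y x)"
    using norm_L2_diff_ge[OF assms(1,2)] by simp
qed

lemma tendsto_inner_L2:
  assumes "\<And>n. F n \<in> L2_space M" "y \<in> L2_space M" "g \<in> L2_space M" "(\<lambda>n. norm_L2 M (\<lambda>x. F n x - y x)) \<longlonglongrightarrow> 0"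
  shows "(\<lambda>n. inner_L2 M (F n) g) \<longlonglongrightarrow> inner_L2 M y g"
proof (rule LIM_zero_cancel, rule Lim_null_comparison)
  show "(\<lambda>n. norm_L2 M (\<lambda>x. F n x - y x) * norm_L2 M g) \<longlonglongrightarrow> 0"
    using tendsto_mult_left_zero[OF assms(4)] .
  show "\<forall>\<^sub>F n in sequentially. norm (inner_L2 M (F n) g - inner_L2 M y g) \<le> norm_L2 M (\<lambda>x. F n x - y x) * norm_L2 M g"
    using Cauchy_Schwarz_L2[OF L2_space_diff[OF assms(1,2)] assms(3)]
    by (simp add: inner_L2_diff assms)
qed

text \<open>
  Near-minimisers of the norm on the sets \<open>C n\<close> form a Cauchy sequence by the parallelogram law.
  This serves as a substitute for weak compactness and for orthogonal projections.
\<close>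

lemma L2_nested_midpoint_convex:
  fixes C :: "nat \<Rightarrow> ('a \<Rightarrow> 'b::euclidean_space) set"
  assumes M: "finite_measure M"
    and L2: "\<And>n. C n \<subseteq> L2_space M" and ne: "\<And>n. C n \<noteq> {}" and dec: "\<And>n. C (Suc n) \<subseteq> C n"
    and mid: "\<And>n f g. f \<in> C n \<Longrightarrow> g \<in> C n \<Longrightarrow> (\<lambda>x. (1/2) *\<^sub>R (f x + g x)) \<in> C n"
    and bdd: "\<And>n. \<exists>f\<in>C n. norm_L2 M f \<le> K"
  obtains F y where "\<And>n. F n \<in> C n" "y \<in> L2_space M" "(\<lambda>n. norm_L2 M (\<lambda>x. F n x - y x)) \<longlonglongrightarrow> 0"
    "\<And>n f. f \<in> C n \<Longrightarrow> norm_L2 M (F n) \<le> norm_L2 M f + 1 / Suc n"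
proof -
  \<comment> \<open>The distance of \<open>C n\<close> from the origin. It grows with
    \<open>n\<close> because the sets shrink, and \<open>bdd\<close> keeps it below
    \<open>K\<close>.\<close>
  define d where "d n = Inf (norm_L2 M ` C n)" for n
  have bb: "bdd_below (norm_L2 M ` C n)" for n by (rule bdd_belowI[of _ 0]) auto
  have d_le: "d n \<le> norm_L2 M f" if "f \<in> C n" for f n
    unfolding d_def using that bb by (intro cInf_lower) auto
  have d_nonneg: "0 \<le> d n" for n
    unfolding d_def using ne by (intro cInf_greatest) auto
  have "\<exists>f\<in>C n. norm_L2 M f < d n + 1 / Suc n" for n
  proof -
    have "Inf (norm_L2 M ` C n) < d n + 1 / Suc n" by (simp add: d_def)
    then show ?thesis using cInf_lessD[of "norm_L2 M ` C n"] ne by blast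
  qed
  then obtain F where F: "\<And>n. F n \<in> C n" and Fd: "\<And>n. norm_L2 M (F n) < d n + 1 / Suc n" by metis
  have C_mono: "C n \<subseteq> C m" if "m \<le> n" for m n
    using dec that by (rule lift_Suc_antimono_le)
  have d_mono: "d m \<le> d n" if "m \<le> n" for m n
    unfolding d_def by (rule cInf_superset_mono) (use C_mono[OF that] ne bb in auto)
  have d_K: "d n \<le> K" for n
    using bdd[of n] d_le[of _ n] by force
  have FL2: "F n \<in> L2_space M" for n using F L2 by blast
  have "convergent d"
    using d_mono d_K by (intro Bseq_mono_convergent BseqI'[of _ K]) (auto simp: d_nonneg)
  then obtain dd where dd: "d \<longlonglongrightarrow> dd" by (auto simp: convergent_def)
  have d_dd: "d n \<le> dd" for n
    using d_mono by (intro incseq_le[OF _ dd]) (auto simp: incseq_def)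
  \<comment> \<open>The midpoint of \<open>F i\<close> and \<open>F j\<close> lies in
    \<open>C n\<close> and so has norm at least \<open>d n\<close>, while both end points have norm
    at most \<open>dd + 1 / Suc n\<close>. The factor 4 clears the quarter in the parallelogram
    law.\<close>
  have est: "(norm_L2 M (\<lambda>x. F i x - F j x))\<^sup>2 \<le> 4 * ((dd + 1 / Suc n)\<^sup>2 - (d n)\<^sup>2)" if "i \<ge> n" "j \<ge> n" for i j n
  proof -
    have *: "F i \<in> C n" "F j \<in> C n" using F C_mono that by blast+
    have "d n \<le> norm_L2 M (\<lambda>x. (1/2) *\<^sub>R (F i x + F j x))"
      using d_le[OF mid[OF *]] .
    then have 1: "(d n)\<^sup>2 \<le> (norm_L2 M (\<lambda>x. (1/2) *\<^sub>R (F i x + F j x)))\<^sup>2"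
      using d_nonneg by (intro power_mono) auto
    have F2: "(norm_L2 M (F k))\<^sup>2 \<le> (dd + 1 / Suc n)\<^sup>2" if "k \<ge> n" for k
    proof (rule power_mono)
      have "1 / real (Suc k) \<le> 1 / real (Suc n)" using that by (simp add: frac_le)
      then show "norm_L2 M (F k) \<le> dd + 1 / Suc n" using Fd[of k] d_dd[of k] by linarith
    qed simp
    show ?thesis
      using norm_L2_midpoint[OF FL2 FL2, of i j] 1 F2[OF \<open>i \<ge> n\<close>] F2[OF \<open>j \<ge> n\<close>] by simp
  qed
  have lim0: "(\<lambda>n. 4 * ((dd + 1 / Suc n)\<^sup>2 - (d n)\<^sup>2)) \<longlonglongrightarrow> 4 * ((dd + 0)\<^sup>2 - dd\<^sup>2)"
    by (intro tendsto_intros dd LIMSEQ_Suc[OF lim_1_over_n])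
  have Cau: "\<exists>N. \<forall>i\<ge>N. \<forall>j\<ge>N. norm_L2 M (\<lambda>x. F i x - F j x) < e" if "e > 0" for e
  proof -
    have "eventually (\<lambda>n. 4 * ((dd + 1 / Suc n)\<^sup>2 - (d n)\<^sup>2) < e\<^sup>2) sequentially"
      using lim0 that by (intro order_tendstoD(2)[OF lim0]) auto
    then obtain N where N: "4 * ((dd + 1 / Suc N)\<^sup>2 - (d N)\<^sup>2) < e\<^sup>2"
      by (auto simp: eventually_sequentially)
    have "norm_L2 M (\<lambda>x. F i x - F j x) < e" if "i \<ge> N" "j \<ge> N" for i j
      using est[OF that] N \<open>e > 0\<close> by (intro power2_less_imp_less[of _ e]) auto
    then show ?thesis by blast
  qed
  obtain y where "y \<in> L2_space M" "(\<lambda>n. norm_L2 M (\<lambda>x. F n x - y x)) \<longlonglongrightarrow> 0"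
    using L2_complete[OF M FL2 Cau] by blast
  then show ?thesis
    using F Fd d_le by (intro that[of F y]) (auto intro: order.trans[OF less_imp_le[OF Fd]])
qed

subsection \<open>Smooth functions and cut-offs\<close>

lemma partial_eqI:
  assumes "(f has_derivative D) (at x)"
  shows "partial i f x = D (axis i 1)"
  using frechet_derivative_at[OF assms] by (simp add: partial_def)

lemma C_k_SucD: "C_k (Suc k) f \<Longrightarrow> C_k k f"
proof (induction k arbitrary: f)
  case 0
  then show ?case by (auto intro: differentiable_imp_continuous_on)
next
  case (Suc k)
  then show ?case by (metis C_k.simps(2))
qed

lemma C_k_differentiable: "C_k (Suc k) f \<Longrightarrow> f differentiable (at x)"
  by (simp add: differentiable_on_def)

text \<open>Lets inductions on \<open>k\<close> work with an explicit formula for the derivative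
  instead of \<open>partial\<close>, which is a Frechet derivative evaluated on an axis.\<close>

lemma C_k_SucI:
  assumes "\<And>x. (f has_derivative D x) (at x)" "\<And>i. C_k k (\<lambda>x. D x (axis i 1))"
  shows "C_k (Suc k) f"
proof -
  have "partial i f = (\<lambda>x. D x (axis i 1))" for i
    using partial_eqI[OF assms(1)] by blast
  then show ?thesis
    using assms by (auto simp: differentiable_on_def differentiable_def)
qed

lemma has_derivative_partial:
  assumes "f differentiable (at x)"
  shows "(f has_derivative (\<lambda>y. y \<bullet> grad f x)) (at x)"
proof -
  have D: "(f has_derivative frechet_derivative f (at x)) (at x)"
    using assms by (simp add: frechet_derivative_works)
  have "frechet_derivative f (at x) y = y \<bullet> grad f x" for y
  proof -
    have lin: "linear (frechet_derivative f (at x))"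
      using D has_derivative_linear by blast
    have "y = (\<Sum>i\<in>UNIV. y $ i *\<^sub>R axis i 1)"
      by (simp add: vec_eq_iff axis_def if_distrib sum.delta cong: if_cong)
    then have "frechet_derivative f (at x) y = frechet_derivative f (at x) (\<Sum>i\<in>UNIV. y $ i *\<^sub>R axis i 1)"
      by simp
    also have "\<dots> = (\<Sum>i\<in>UNIV. y $ i * partial i f x)"
      by (simp only: linear_sum[OF lin] linear_scale[OF lin] partial_def real_scaleR_def)
    also have "\<dots> = y \<bullet> grad f x"
      by (simp add: inner_vec_def grad_def)
    finally show ?thesis .
  qed
  then show ?thesis using D by (metis (no_types, lifting) has_derivative_eq_rhs ext)
qed

lemma inner_axis_grad [simp]: "axis i 1 \<bullet> grad f x = partial i f x"
  by (simp add: inner_axis' grad_def)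

lemma grad_nth [simp]: "grad f x $ i = partial i f x"
  by (simp add: grad_def)

lemma C_k_const: "C_k k (\<lambda>x. c)"
proof (induction k arbitrary: c)
  case (Suc k)
  show ?case by (rule C_k_SucI[of _ "\<lambda>x y. 0"]) (auto intro: Suc)
qed auto

lemma C_k_add: "C_k k f \<Longrightarrow> C_k k g \<Longrightarrow> C_k k (\<lambda>x. f x + g x)"
proof (induction k arbitrary: f g)
  case (Suc k)
  show ?case
  proof (rule C_k_SucI)
    show "((\<lambda>x. f x + g x) has_derivative (\<lambda>y. y \<bullet> grad f x + y \<bullet> grad g x)) (at x)" for x
      by (intro derivative_intros has_derivative_partial C_k_differentiable[OF Suc.prems(1)] C_k_differentiable[OF Suc.prems(2)])
    show "C_k k (\<lambda>x. axis i 1 \<bullet> grad f x + axis i 1 \<bullet> grad g x)" for i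
      using Suc by (auto simp: fun_eq_iff)
  qed
qed (auto intro: continuous_intros)

lemma C_k_mult: "C_k k f \<Longrightarrow> C_k k g \<Longrightarrow> C_k k (\<lambda>x. f x * g x)"
proof (induction k arbitrary: f g)
  case (Suc k)
  show ?case
  proof (rule C_k_SucI)
    show "((\<lambda>x. f x * g x) has_derivative (\<lambda>y. f x * (y \<bullet> grad g x) + (y \<bullet> grad f x) * g x)) (at x)" for x
      by (intro derivative_intros has_derivative_partial C_k_differentiable[OF Suc.prems(1)] C_k_differentiable[OF Suc.prems(2)])
    show "C_k k (\<lambda>x. f x * (axis i 1 \<bullet> grad g x) + (axis i 1 \<bullet> grad f x) * g x)" for i
      using Suc C_k_SucD[OF Suc.prems(1)] C_k_SucD[OF Suc.prems(2)]
      by (auto intro!: C_k_add Suc.IH)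
  qed
qed (auto intro: continuous_intros)

lemma smooth_const: "smooth (\<lambda>x. c)"
  by (simp add: smooth_def C_k_const)

lemma smooth_add: "smooth f \<Longrightarrow> smooth g \<Longrightarrow> smooth (\<lambda>x. f x + g x)"
  by (simp add: smooth_def C_k_add)

lemma smooth_mult: "smooth f \<Longrightarrow> smooth g \<Longrightarrow> smooth (\<lambda>x. f x * g x)"
  by (simp add: smooth_def C_k_mult)

lemma smooth_partial: "smooth f \<Longrightarrow> smooth (partial i f)"
  by (simp add: smooth_def) (metis C_k.simps(2))

lemma smooth_differentiable: "smooth f \<Longrightarrow> f differentiable (at x)"
  unfolding smooth_def using C_k_differentiable by blast

lemma smooth_continuous: "smooth f \<Longrightarrow> continuous_on A f"
  unfolding smooth_def using C_k.simps(1) continuous_on_subset by blast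

lemma smooth_has_derivative: "smooth f \<Longrightarrow> (f has_derivative (\<lambda>y. y \<bullet> grad f x)) (at x)"
  by (intro has_derivative_partial smooth_differentiable)

lemma smooth_sum: "(\<And>i. i \<in> I \<Longrightarrow> smooth (f i)) \<Longrightarrow> smooth (\<lambda>x. \<Sum>i\<in>I. f i x)"
  by (induction I rule: infinite_finite_induct) (auto intro: smooth_add smooth_const)

lemma smooth_inner_grad: "smooth f \<Longrightarrow> smooth (\<lambda>x. e \<bullet> grad f x)"
  by (auto simp: inner_vec_def intro!: smooth_sum smooth_mult smooth_const smooth_partial)

lemma partial_add:
  assumes "f differentiable (at x)" "g differentiable (at x)"
  shows "partial i (\<lambda>x. f x + g x) x = partial i f x + partial i g x"
  using partial_eqI[OF has_derivative_add[OF has_derivative_partial[OF assms(1)] has_derivative_partial[OF assms(2)]]]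
  by simp

lemma partial_mult:
  assumes "f differentiable (at x)" "g differentiable (at x)"
  shows "partial i (\<lambda>x. f x * g x) x = f x * partial i g x + partial i f x * g x"
  using partial_eqI[OF has_derivative_mult[OF has_derivative_partial[OF assms(1)] has_derivative_partial[OF assms(2)]]]
  by simp

lemma partial_const [simp]: "partial i (\<lambda>x. c) x = 0"
  using partial_eqI[OF has_derivative_const] by simp

lemma partial_cmult:
  assumes "f differentiable (at x)"
  shows "partial i (\<lambda>x. c * f x) x = c * partial i f x"
  using partial_mult[of "\<lambda>x. c" x f i] assms by simp

lemma partial_diff:
  assumes "f differentiable (at x)" "g differentiable (at x)"
  shows "partial i (\<lambda>x. f x - g x) x = partial i f x - partial i g x"
  using partial_eqI[OF has_derivative_diff[OF has_derivative_partial[OF assms(1)] has_derivative_partial[OF assms(2)]]]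
  by simp

lemma has_derivative_translate:
  assumes "\<And>x. (f has_derivative D x) (at x)"
  shows "((\<lambda>x. f (x + a)) has_derivative D (x + a)) (at (x :: real^2))"
  by (rule has_derivative_compose[of "\<lambda>x. x + a" "\<lambda>y. y" x UNIV f "D (x + a)"])
     (auto intro!: derivative_eq_intros assms)

lemma C_k_translate: "C_k k f \<Longrightarrow> C_k k (\<lambda>x. f (x + a))"
proof (induction k arbitrary: f)
  case 0
  then show ?case by (auto intro!: continuous_intros continuous_on_compose2[of UNIV f])
next
  case (Suc k)
  show ?case
  proof (rule C_k_SucI)
    show "((\<lambda>x. f (x + a)) has_derivative (\<lambda>y. y \<bullet> grad f (x + a))) (at x)" for x
      by (rule has_derivative_translate[of f "\<lambda>x y. y \<bullet> grad f x"])
         (intro has_derivative_partial C_k_differentiable[OF Suc.prems])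
    show "C_k k (\<lambda>x. axis i 1 \<bullet> grad f (x + a))" for i
      using Suc by (auto simp: fun_eq_iff)
  qed
qed

lemma smooth_translate: "smooth f \<Longrightarrow> smooth (\<lambda>x. f (x + a))"
  by (simp add: smooth_def C_k_translate)

lemma partial_translate:
  assumes "smooth f"
  shows "partial i (\<lambda>x. f (x + a)) x = partial i f (x + a)"
  using partial_eqI[OF has_derivative_translate[of f "\<lambda>x y. y \<bullet> grad f x", OF smooth_has_derivative[OF assms]]]
  by simp

section \<open>Derivatives along lines and symmetry of second derivatives\<close>

lemma DERIV_along_line:
  assumes "smooth f"
  shows "((\<lambda>t. f (x + t *\<^sub>R e)) has_real_derivative (e \<bullet> grad f (x + t *\<^sub>R e))) (at t)"
proof -
  have "((\<lambda>t. f (x + t *\<^sub>R e)) has_derivative (\<lambda>s. (s *\<^sub>R e) \<bullet> grad f (x + t *\<^sub>R e))) (at t)"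
    by (rule has_derivative_compose[of "\<lambda>t. x + t *\<^sub>R e" "\<lambda>s. s *\<^sub>R e" t UNIV f])
       (auto intro!: derivative_eq_intros smooth_has_derivative assms)
  then show ?thesis
    by (simp add: has_field_derivative_def mult_commute_abs)
qed

text \<open>Both mixed derivatives are limits of the same second difference quotient.\<close>

lemma second_difference:
  assumes f: "smooth f" and h: "h > 0"
  obtains y where "dist y x \<le> h * (norm a + norm b)"
    "f (x + h *\<^sub>R a + h *\<^sub>R b) - f (x + h *\<^sub>R a) - f (x + h *\<^sub>R b) + f x
      = h * h * (b \<bullet> grad (\<lambda>x. a \<bullet> grad f x) y)"
proof -
  \<comment> \<open>The second difference is the increment of \<open>g\<close>, a difference in
    direction \<open>b\<close> seen as a function of the step in direction \<open>a\<close>. One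
    mean value theorem extracts the derivative along \<open>a\<close>, a second one that along
    \<open>b\<close>.\<close>
  define g where "g s = f ((x + h *\<^sub>R b) + s *\<^sub>R a) - f (x + s *\<^sub>R a)" for s
  have g': "(g has_real_derivative (a \<bullet> grad f (x + h *\<^sub>R b + s *\<^sub>R a) - a \<bullet> grad f (x + s *\<^sub>R a))) (at s)" for s
    unfolding g_def by (intro derivative_intros DERIV_along_line f)
  obtain s where s: "0 < s" "s < h"
    "g h - g 0 = (h - 0) * (a \<bullet> grad f (x + h *\<^sub>R b + s *\<^sub>R a) - a \<bullet> grad f (x + s *\<^sub>R a))"
    using MVT2[OF h g'] by blast
  define k where "k t = a \<bullet> grad f ((x + s *\<^sub>R a) + t *\<^sub>R b)" for t
  have k': "(k has_real_derivative (b \<bullet> grad (\<lambda>x. a \<bullet> grad f x) ((x + s *\<^sub>R a) + t *\<^sub>R b))) (at t)" for t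
    unfolding k_def by (rule DERIV_along_line[OF smooth_inner_grad[OF f]])
  obtain t where t: "0 < t" "t < h" "k h - k 0 = (h - 0) * (b \<bullet> grad (\<lambda>x. a \<bullet> grad f x) ((x + s *\<^sub>R a) + t *\<^sub>R b))"
    using MVT2[OF h k'] by blast
  show ?thesis
  proof (rule that)
    have "dist (x + s *\<^sub>R a + t *\<^sub>R b) x = norm (s *\<^sub>R a + t *\<^sub>R b)"
      by (simp add: dist_norm add.assoc)
    also have "\<dots> \<le> norm (s *\<^sub>R a) + norm (t *\<^sub>R b)"
      by (rule norm_triangle_ineq)
    also have "\<dots> \<le> h * (norm a + norm b)"
      using s t h by (auto simp: algebra_simps intro!: add_mono mult_right_mono)
    finally show "dist (x + s *\<^sub>R a + t *\<^sub>R b) x \<le> h * (norm a + norm b)" .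
    show "f (x + h *\<^sub>R a + h *\<^sub>R b) - f (x + h *\<^sub>R a) - f (x + h *\<^sub>R b) + f x
      = h * h * (b \<bullet> grad (\<lambda>x. a \<bullet> grad f x) (x + s *\<^sub>R a + t *\<^sub>R b))"
      using s(3) t(3) by (simp add: g_def k_def algebra_simps)
  qed
qed

text \<open>Exchanging \<open>a\<close> and \<open>b\<close> does not change the second difference,
  so for each step \<open>h n\<close> the two mixed derivatives agree at two points within distance
  \<open>2 * h n\<close> of \<open>x\<close>. Continuity gives equality at \<open>x\<close>
  itself.\<close>

lemma partial_commute:
  assumes f: "smooth f"
  shows "partial i (partial j f) x = partial j (partial i f) x"
proof -
  define a b :: "real^2" where "a = axis i 1" and "b = axis j 1"
  have ab: "norm a = 1" "norm b = 1" by (auto simp: a_def b_def)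
  define h where "h n = 1 / real (Suc n)" for n
  have h: "h n > 0" for n by (simp add: h_def)
  have h0: "h \<longlonglongrightarrow> 0" unfolding h_def by (rule LIMSEQ_Suc[OF lim_1_over_n])
  have "\<exists>y z. dist y x \<le> h n * 2 \<and> dist z x \<le> h n * 2 \<and>
    b \<bullet> grad (\<lambda>x. a \<bullet> grad f x) y = a \<bullet> grad (\<lambda>x. b \<bullet> grad f x) z" for n
  proof -
    obtain y where y: "dist y x \<le> h n * (norm a + norm b)"
      "f (x + h n *\<^sub>R a + h n *\<^sub>R b) - f (x + h n *\<^sub>R a) - f (x + h n *\<^sub>R b) + f x
      = h n * h n * (b \<bullet> grad (\<lambda>x. a \<bullet> grad f x) y)"
      using second_difference[OF f h] by blast
    obtain z where z: "dist z x \<le> h n * (norm b + norm a)"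
      "f (x + h n *\<^sub>R b + h n *\<^sub>R a) - f (x + h n *\<^sub>R b) - f (x + h n *\<^sub>R a) + f x
      = h n * h n * (a \<bullet> grad (\<lambda>x. b \<bullet> grad f x) z)"
      using second_difference[OF f h] by blast
    have "f (x + h n *\<^sub>R b + h n *\<^sub>R a) = f (x + h n *\<^sub>R a + h n *\<^sub>R b)"
      by (simp add: add_ac)
    then have "h n * h n * (b \<bullet> grad (\<lambda>x. a \<bullet> grad f x) y) = h n * h n * (a \<bullet> grad (\<lambda>x. b \<bullet> grad f x) z)"
      using y(2) z(2) by linarith
    moreover have "h n * h n \<noteq> 0" using h[of n] by simp
    ultimately have "b \<bullet> grad (\<lambda>x. a \<bullet> grad f x) y = a \<bullet> grad (\<lambda>x. b \<bullet> grad f x) z"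
      using mult_cancel_left by blast
    then show ?thesis using y(1) z(1) ab by (intro exI[of _ y] exI[of _ z]) simp
  qed
  then obtain y z where yz: "\<And>n. dist (y n) x \<le> h n * 2" "\<And>n. dist (z n) x \<le> h n * 2"
    "\<And>n. b \<bullet> grad (\<lambda>x. a \<bullet> grad f x) (y n) = a \<bullet> grad (\<lambda>x. b \<bullet> grad f x) (z n)" by metis
  have lim2: "(\<lambda>n. h n * 2) \<longlonglongrightarrow> 0" using tendsto_mult_left_zero[OF h0] .
  have y: "y \<longlonglongrightarrow> x" and z: "z \<longlonglongrightarrow> x"
    by (rule metric_tendsto_imp_tendsto[OF lim2], simp add: yz h less_imp_le abs_of_pos)+
  have cont: "continuous_on UNIV (\<lambda>y. c \<bullet> grad (\<lambda>x. d \<bullet> grad f x) y)" for c d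
    by (intro smooth_continuous smooth_inner_grad f)
  have "(\<lambda>n. b \<bullet> grad (\<lambda>x. a \<bullet> grad f x) (y n)) \<longlonglongrightarrow> b \<bullet> grad (\<lambda>x. a \<bullet> grad f x) x"
    using continuous_on_tendsto_compose[OF cont y] by simp
  moreover have "(\<lambda>n. b \<bullet> grad (\<lambda>x. a \<bullet> grad f x) (y n)) \<longlonglongrightarrow> a \<bullet> grad (\<lambda>x. b \<bullet> grad f x) x"
    unfolding yz(3) using continuous_on_tendsto_compose[OF cont z] by simp
  ultimately have "b \<bullet> grad (\<lambda>x. a \<bullet> grad f x) x = a \<bullet> grad (\<lambda>x. b \<bullet> grad f x) x"
    by (rule LIMSEQ_unique)
  then show ?thesis by (simp add: a_def b_def)
qed

text \<open>The classical flat function \<open>exp (- c / t)\<close>. The power \<open>k\<close>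
  makes the family closed under differentiation up to linear combinations; the parameter
  \<open>c\<close> is sent to 0 later to approximate indicators.\<close>

definition exp_inv :: "nat \<Rightarrow> real \<Rightarrow> real \<Rightarrow> real" where
  "exp_inv k c t = (if t > 0 then (1 / t) ^ k * exp (- c / t) else 0)"

text \<open>With \<open>u = c / t\<close> this is the decay of \<open>u ^ k / exp u\<close> at
  infinity; from the left the function vanishes identically.\<close>

lemma exp_inv_tendsto_0:
  assumes "c > 0"
  shows "(exp_inv k c \<longlongrightarrow> 0) (at 0)"
proof -
  have "((\<lambda>u :: real. u ^ k / exp u) \<longlongrightarrow> 0) at_top" by (rule tendsto_power_div_exp_0)
  then have "((\<lambda>t. (c / t) ^ k / exp (c / t)) \<longlongrightarrow> 0) (at_right 0)"
  proof (rule filterlim_compose)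
    show "filterlim (\<lambda>t. c / t) at_top (at_right 0)"
      using filterlim_tendsto_pos_mult_at_top[OF tendsto_const assms filterlim_inverse_at_top_right]
      by (simp add: divide_inverse)
  qed
  then have "((\<lambda>t. (1 / c ^ k) * ((c / t) ^ k / exp (c / t))) \<longlongrightarrow> 0) (at_right 0)"
    by (rule tendsto_mult_right_zero)
  moreover have "eventually (\<lambda>t. (1 / c ^ k) * ((c / t) ^ k / exp (c / t)) = exp_inv k c t) (at_right 0)"
    using eventually_at_right_less
  proof eventually_elim
    case (elim t)
    have "exp (- c / t) = 1 / exp (c / t)" by (simp add: exp_minus divide_inverse)
    then show ?case using elim assms by (simp add: exp_inv_def power_divide)
  qed
  ultimately have right: "(exp_inv k c \<longlongrightarrow> 0) (at_right 0)"
    using Lim_transform_eventually by blast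
  have "eventually (\<lambda>t. exp_inv k c t = 0) (at_left 0)"
    by (auto simp: exp_inv_def eventually_at_filter)
  then have "(exp_inv k c \<longlongrightarrow> 0) (at_left 0)"
    by (rule tendsto_eventually)
  then show ?thesis using right by (simp add: filterlim_at_split)
qed

lemma DERIV_exp_inv:
  assumes c: "c > 0"
  shows "(exp_inv k c has_real_derivative (c * exp_inv (k + 2) c t - real k * exp_inv (k + 1) c t)) (at t)"
proof -
  consider "t > 0" | "t < 0" | "t = 0" by linarith
  then show ?thesis
  proof cases
    case 1
    have "((\<lambda>t. (1 / t) ^ k * exp (- c / t)) has_real_derivative
      (c * exp_inv (k + 2) c t - real k * exp_inv (k + 1) c t)) (at t)"
    proof -
      have "((\<lambda>t. 1 / t) has_real_derivative - ((1 / t) * (1 / t))) (at t)"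
        using 1 by (auto intro!: derivative_eq_intros)
      from DERIV_power[OF this, of k]
      have 2: "((\<lambda>t. (1 / t) ^ k) has_real_derivative - (real k * (1 / t) ^ (k + 1))) (at t)"
        by (rule DERIV_cong) (cases k, auto)
      have "((\<lambda>t. exp (- c / t)) has_real_derivative exp (- c / t) * (c * ((1 / t) * (1 / t)))) (at t)"
        using 1 by (auto intro!: derivative_eq_intros)
      from DERIV_mult[OF 2 this] show ?thesis
        by (rule DERIV_cong) (use 1 in \<open>simp add: exp_inv_def algebra_simps\<close>)
    qed
    then show ?thesis
      by (rule DERIV_cong_ev[THEN iffD1, rotated -1])
         (use 1 in \<open>auto simp: exp_inv_def intro!: eventually_mono[OF eventually_nhds_in_open[of "{0<..}"]]\<close>)
  next
    case 2
    have "((\<lambda>t. 0) has_real_derivative (c * exp_inv (k + 2) c t - real k * exp_inv (k + 1) c t)) (at t)"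
      using 2 by (simp add: exp_inv_def)
    then show ?thesis
      by (rule DERIV_cong_ev[THEN iffD1, rotated -1])
         (use 2 in \<open>auto simp: exp_inv_def intro!: eventually_mono[OF eventually_nhds_in_open[of "{..<0}"]]\<close>)
  next
    case 3
    \<comment> \<open>At the origin the difference quotient of \<open>exp_inv k c\<close> is
      \<open>exp_inv (k + 1) c\<close> itself, whose limit is 0.\<close>
    have "(\<lambda>h. (exp_inv k c (0 + h) - exp_inv k c 0) / h) = exp_inv (k + 1) c"
      by (auto simp: exp_inv_def fun_eq_iff)
    then show ?thesis
      using 3 exp_inv_tendsto_0[OF c, of "k + 1"] by (simp add: DERIV_def exp_inv_def)
  qed
qed

lemma has_derivative_coord:
  assumes "(h has_real_derivative d) (at (s * x $ i + t))"
  shows "((\<lambda>x :: real^2. h (s * x $ i + t)) has_derivative (\<lambda>y. d * s * y $ i)) (at x)"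
proof -
  have "(h has_derivative (\<lambda>y. d * y)) (at (s * x $ i + t))"
    using assms by (simp add: has_field_derivative_def)
  then have "((\<lambda>x. h (s * x $ i + t)) has_derivative (\<lambda>y. d * (s * y $ i))) (at x)"
    by (intro has_derivative_compose[of "\<lambda>x :: real^2. s * x $ i + t" "\<lambda>y. s * y $ i" x UNIV h "\<lambda>y. d * y"])
       (auto intro!: derivative_eq_intros bounded_linear.has_derivative[OF bounded_linear_vec_nth])
  then show ?thesis by (simp add: mult.assoc)
qed

text \<open>The exponent \<open>k\<close> is generalised in the induction on the order of
  differentiability, because each derivative raises it.\<close>

lemma smooth_exp_inv_coord:
  assumes c: "c > 0"
  shows "smooth (\<lambda>x. exp_inv k c (s * x $ i + t))"
proof -
  have "C_k n (\<lambda>x. exp_inv k c (s * x $ i + t))" for n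
  proof (induction n arbitrary: k)
    case 0
    have "continuous_on UNIV (exp_inv k c)"
      by (auto intro!: continuous_at_imp_continuous_on DERIV_isCont[OF DERIV_exp_inv[OF c]])
    then have "continuous_on UNIV (\<lambda>x :: real^2. exp_inv k c (s * x $ i + t))"
      by (rule continuous_on_compose2) (auto intro!: continuous_intros)
    then show ?case by simp
  next
    case (Suc n)
    let ?d = "\<lambda>x :: real^2. c * exp_inv (k + 2) c (s * x $ i + t) - real k * exp_inv (k + 1) c (s * x $ i + t)"
    show ?case
    proof (rule C_k_SucI)
      show "((\<lambda>x. exp_inv k c (s * x $ i + t)) has_derivative (\<lambda>y. ?d x * s * y $ i)) (at x)" for x
        by (rule has_derivative_coord[OF DERIV_exp_inv[OF c]])
      have "C_k n (\<lambda>x. (c * exp_inv (k + 2) c (s * x $ i + t) + (- real k) * exp_inv (k + 1) c (s * x $ i + t))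
          * (s * axis j 1 $ i))" for j
        by (intro C_k_mult C_k_add C_k_const Suc.IH)
      then show "C_k n (\<lambda>x. ?d x * s * axis j 1 $ i)" for j
        by (simp add: mult.assoc)
    qed
  qed
  then show ?thesis by (simp add: smooth_def)
qed

text \<open>The decay constants \<open>1 / Suc n\<close> tend to 0, so these cut-offs converge to
  the indicator of the open interval and stay between 0 and 1. Indicators of boxes are thus
  approximated without mollification.\<close>

definition bump1 :: "real \<Rightarrow> real \<Rightarrow> nat \<Rightarrow> real \<Rightarrow> real" where
  "bump1 a b n t = exp_inv 0 (1 / Suc n) (t - a) * exp_inv 0 (1 / Suc n) (b - t)"

lemma smooth_bump1_coord: "smooth (\<lambda>x. bump1 a b n (x $ i))"
  using smooth_mult[OF smooth_exp_inv_coord[of "1 / Suc n" 0 1 i "-a"] smooth_exp_inv_coord[of "1 / Suc n" 0 "-1" i b]]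
  by (simp add: bump1_def algebra_simps)

lemma exp_inv_0_bounds: "c > 0 \<Longrightarrow> 0 \<le> exp_inv 0 c t \<and> exp_inv 0 c t \<le> 1"
  by (auto simp: exp_inv_def)

lemma bump1_bounds: "0 \<le> bump1 a b n t" "bump1 a b n t \<le> 1"
  using exp_inv_0_bounds[of "1 / Suc n" "t - a"] exp_inv_0_bounds[of "1 / Suc n" "b - t"]
  by (auto simp: bump1_def mult_le_one)

lemma bump1_eq_0: "t \<notin> {a<..<b} \<Longrightarrow> bump1 a b n t = 0"
  by (auto simp: bump1_def exp_inv_def)

lemma bump1_tendsto: "(\<lambda>n. bump1 a b n t) \<longlonglongrightarrow> indicator {a<..<b} t"
proof (cases "t \<in> {a<..<b}")
  case True
  have "(\<lambda>n. exp (- (1 / Suc n) / u)) \<longlonglongrightarrow> exp (- 0 / u)" if "u > 0" for u :: real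
    by (intro tendsto_intros LIMSEQ_Suc[OF lim_1_over_n]) (use that in auto)
  then have "(\<lambda>n. exp (- (1 / Suc n) / (t - a)) * exp (- (1 / Suc n) / (b - t))) \<longlonglongrightarrow> exp (- 0 / (t - a)) * exp (- 0 / (b - t))"
    using True by (intro tendsto_mult) auto
  then show ?thesis using True by (simp add: bump1_def exp_inv_def)
next
  case False
  then show ?thesis by (simp add: bump1_eq_0)
qed

lemma continuous_bump1: "continuous_on UNIV (bump1 a b n)"
proof -
  have *: "continuous_on UNIV (exp_inv 0 (1 / Suc n))"
    by (auto intro!: continuous_at_imp_continuous_on DERIV_isCont[OF DERIV_exp_inv])
  show ?thesis
    unfolding bump1_def by (intro continuous_intros continuous_on_compose2[OF *]) auto
qed

text \<open>A primitive of a cut-off is constant outside the interval, hence not compactly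
  supported, but it is smooth and bounded by the length of the interval. That is what a multiplier
  of a test function in the product estimate has to satisfy.\<close>

lemma bump1_primitive:
  assumes "a \<le> b"
  obtains A where "smooth (\<lambda>x. A (x $ i))" "\<And>t. (A has_real_derivative bump1 a b n t) (at t)"
    "\<And>t. 0 \<le> A t \<and> A t \<le> b - a"
proof -
  define A where "A t = integral {a..t} (bump1 a b n)" for t
  have int: "bump1 a b n integrable_on {u..v}" for u v
    using continuous_bump1 continuous_on_subset by (intro integrable_continuous_real) blast
  have A0: "A t = 0" if "t \<le> a" for t
    using that by (cases "t = a") (auto simp: A_def)
  have A': "(A has_real_derivative bump1 a b n t) (at t)" for t
  proof -
    \<comment> \<open>A base point to the left of both \<open>a\<close> and \<open>t\<close> makes
      \<open>t\<close> an interior point, so the fundamental theorem on an interval gives a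
      two-sided derivative. Near \<open>t\<close> the two primitives agree, since the integrand
      vanishes to the left of \<open>a\<close>.\<close>
    let ?c = "min (a - 1) (t - 1)"
    define B where "B s = integral {?c..s} (bump1 a b n)" for s
    have "(B has_real_derivative bump1 a b n t) (at t within {?c..t+1})"
      unfolding B_def using continuous_bump1 continuous_on_subset
      by (intro integral_has_real_derivative) (auto, blast)
    then have "(B has_real_derivative bump1 a b n t) (at t)"
      by (subst (asm) at_within_interior) auto
    moreover have "B s = A s" if "s > ?c" for s
    proof (cases "s \<le> a")
      case True
      have "B s = integral {?c..s} (\<lambda>x. 0)"
        unfolding B_def using True by (intro integral_cong) (auto simp: bump1_eq_0)
      then show ?thesis using A0 True by simp
    next
      case False
      have "integral {?c..a} (bump1 a b n) + integral {a..s} (bump1 a b n) = B s"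
        unfolding B_def using False by (intro Henstock_Kurzweil_Integration.integral_combine int) auto
      moreover have "integral {?c..a} (bump1 a b n) = integral {?c..a} (\<lambda>x. 0)"
        by (intro integral_cong) (auto simp: bump1_eq_0)
      ultimately show ?thesis by (simp add: A_def)
    qed
    then have "eventually (\<lambda>s. B s = A s) (nhds t)"
      by (intro eventually_mono[OF eventually_nhds_in_open[of "{?c<..}"]]) auto
    ultimately show ?thesis using DERIV_cong_ev[OF refl _ refl] by blast
  qed
  have "C_k m (\<lambda>x. A (x $ i))" for m
  proof -
    have "C_k (Suc m) (\<lambda>x. A (x $ i))"
    proof (rule C_k_SucI)
      show "((\<lambda>x. A (x $ i)) has_derivative (\<lambda>y. bump1 a b n (x $ i) * 1 * y $ i)) (at x)" for x :: "real^2"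
        using has_derivative_coord[of A _ 1 x i 0] A' by simp
      have "smooth (\<lambda>x. bump1 a b n (x $ i) * (1 * axis j 1 $ i))" for j
        by (intro smooth_mult smooth_bump1_coord smooth_const)
      then show "C_k m (\<lambda>x. bump1 a b n (x $ i) * 1 * axis j 1 $ i)" for j
        by (simp add: smooth_def)
    qed
    then show ?thesis by (rule C_k_SucD)
  qed
  then have "smooth (\<lambda>x. A (x $ i))" by (simp add: smooth_def)
  moreover have "0 \<le> A t \<and> A t \<le> b - a" for t
  proof -
    have mono: "A s \<le> A t" if "s \<le> t" for s t
      using DERIV_nonneg_imp_nondecreasing[OF that] A' bump1_bounds by blast
    have "A t \<ge> 0" using mono[of "min a t" t] A0[of "min a t"] by simp
    moreover have "A t \<le> b - a"
    proof -
      have "A (max b t) = A b"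
      proof (cases "b < t")
        case True
        have cont: "continuous_on {b..t} A"
          by (intro continuous_at_imp_continuous_on ballI DERIV_isCont[OF A'])
        have "(A has_real_derivative 0) (at s)" if "b < s" "s < t" for s
          using A'[of s] that by (simp add: bump1_eq_0)
        from DERIV_isconst_end[OF True cont this] True show ?thesis by simp
      qed simp
      moreover have "A b \<le> integral {a..b} (\<lambda>x. 1)"
        unfolding A_def by (intro integral_le int) (auto simp: bump1_bounds)
      ultimately show ?thesis using mono[of t "max b t"] assms by simp
    qed
    ultimately show ?thesis by blast
  qed
  ultimately show ?thesis using A' that by blast
qed

subsection \<open>Test functions\<close>

lemma test_functionsD:
  assumes "\<theta> \<in> test_functions \<Omega>"
  shows "smooth \<theta>" "compact (closure {x. \<theta> x \<noteq> 0})" "closure {x. \<theta> x \<noteq> 0} \<subseteq> \<Omega>"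
  using assms by (auto simp: test_functions_def)

lemma support_memI: "\<theta> x \<noteq> 0 \<Longrightarrow> x \<in> closure {x. \<theta> x \<noteq> 0}"
  by (rule closure_subset[THEN subsetD]) simp

lemma test_functions_eq_0: "\<theta> \<in> test_functions \<Omega> \<Longrightarrow> x \<notin> \<Omega> \<Longrightarrow> \<theta> x = 0"
  using test_functionsD(3)[of \<theta> \<Omega>] support_memI[of \<theta> x] by blast

lemma test_functions_supportI:
  assumes "smooth \<theta>" "compact K" "K \<subseteq> \<Omega>" "\<And>x. \<theta> x \<noteq> 0 \<Longrightarrow> x \<in> K"
  shows "\<theta> \<in> test_functions \<Omega>"
proof -
  have "closure {x. \<theta> x \<noteq> 0} \<subseteq> K"
    using assms by (intro closure_minimal) (auto simp: compact_imp_closed)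
  then show ?thesis
    using assms by (auto simp: test_functions_def intro: compact_closure[THEN iffD2] bounded_subset[OF compact_imp_bounded]
        closure_subset[THEN subset_trans])
qed

lemma test_functions_mono: "\<Omega> \<subseteq> \<Omega>' \<Longrightarrow> test_functions \<Omega> \<subseteq> test_functions \<Omega>'"
  by (auto simp: test_functions_def)

lemma partial_eq_0_outside_support:
  assumes "x \<notin> closure {x. \<theta> x \<noteq> 0}"
  shows "partial i \<theta> x = 0"
proof -
  have "eventually (\<lambda>y. \<theta> y = 0) (nhds x)"
    by (rule eventually_mono[OF eventually_nhds_in_open[of "- closure {x. \<theta> x \<noteq> 0}" x]])
       (use assms support_memI[of \<theta>] in auto)
  then have "eventually (\<lambda>y. \<theta> y = 0) (at x)" "\<theta> x = 0"
    by (simp_all add: eventually_nhds_conv_at)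
  then have "eventually (\<lambda>y. 0 = \<theta> y) (at x)" "0 = \<theta> x"
    by (simp_all add: eq_commute[of 0])
  then have "(\<theta> has_derivative (\<lambda>y. 0)) (at x)"
    by (rule has_derivative_transform_eventually[OF has_derivative_const]) simp
  then show ?thesis by (rule partial_eqI)
qed

lemma test_functions_partial:
  assumes "\<theta> \<in> test_functions \<Omega>"
  shows "partial i \<theta> \<in> test_functions \<Omega>"
  using test_functionsD[OF assms] partial_eq_0_outside_support
  by (intro test_functions_supportI[of _ "closure {x. \<theta> x \<noteq> 0}"]) (auto intro: smooth_partial)

lemma test_functions_mult:
  assumes "\<theta> \<in> test_functions \<Omega>" "smooth f"
  shows "(\<lambda>x. f x * \<theta> x) \<in> test_functions \<Omega>"
  using test_functionsD[OF assms(1)] assms(2) closure_subset[of "{x. \<theta> x \<noteq> 0}"]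
  by (intro test_functions_supportI[of _ "closure {x. \<theta> x \<noteq> 0}"]) (auto intro: smooth_mult)

lemma test_functions_add:
  assumes "\<theta> \<in> test_functions \<Omega>" "\<xi> \<in> test_functions \<Omega>"
  shows "(\<lambda>x. \<theta> x + \<xi> x) \<in> test_functions \<Omega>"
proof (rule test_functions_supportI)
  let ?K = "closure {x. \<theta> x \<noteq> 0} \<union> closure {x. \<xi> x \<noteq> 0}"
  show "smooth (\<lambda>x. \<theta> x + \<xi> x)" "compact ?K" "?K \<subseteq> \<Omega>"
    using test_functionsD[OF assms(1)] test_functionsD[OF assms(2)] by (auto intro: smooth_add)
  show "x \<in> ?K" if "\<theta> x + \<xi> x \<noteq> 0" for x
    using that support_memI[of \<theta> x] support_memI[of \<xi> x] by (cases "\<theta> x = 0") auto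
qed

lemma test_functions_cmult: "\<theta> \<in> test_functions \<Omega> \<Longrightarrow> (\<lambda>x. c * \<theta> x) \<in> test_functions \<Omega>"
  using test_functions_mult[of \<theta> \<Omega> "\<lambda>x. c"] smooth_const by blast

lemma test_functions_diff:
  assumes "\<theta> \<in> test_functions \<Omega>" "\<xi> \<in> test_functions \<Omega>"
  shows "(\<lambda>x. \<theta> x - \<xi> x) \<in> test_functions \<Omega>"
  using test_functions_add[OF assms(1) test_functions_cmult[OF assms(2), of "-1"]] by simp

lemma test_functions_sum:
  assumes "\<And>i. i \<in> I \<Longrightarrow> f i \<in> test_functions \<Omega>"
  shows "(\<lambda>x. \<Sum>i\<in>I. f i x) \<in> test_functions \<Omega>"
  using assms
proof (induction I rule: infinite_finite_induct)
  case (infinite A)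
  then show ?case by (auto simp: test_functions_def smooth_const)
next
  case empty
  then show ?case by (auto simp: test_functions_def smooth_const)
qed (auto intro: test_functions_add)

lemma test_functions_zero: "(\<lambda>x. 0) \<in> test_functions \<Omega>"
  by (auto simp: test_functions_def smooth_const)

lemma test_functions_inner_grad:
  assumes "\<theta> \<in> test_functions \<Omega>"
  shows "(\<lambda>x. e \<bullet> grad \<theta> x) \<in> test_functions \<Omega>"
  unfolding inner_vec_def
  using test_functions_sum[of UNIV "\<lambda>i x. e $ i * partial i \<theta> x"] test_functions_cmult test_functions_partial[OF assms]
  by auto

lemma test_functions_translate:
  assumes "\<theta> \<in> test_functions \<Omega>" "\<And>x. x \<in> \<Omega> \<Longrightarrow> x + a \<in> \<Omega>'"
  shows "(\<lambda>x. \<theta> (x - a)) \<in> test_functions \<Omega>'"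
proof (rule test_functions_supportI)
  show "smooth (\<lambda>x. \<theta> (x - a))"
    using smooth_translate[OF test_functionsD(1)[OF assms(1)], of "-a"] by simp
  show "compact ((\<lambda>x. x + a) ` closure {x. \<theta> x \<noteq> 0})"
    using test_functionsD(2)[OF assms(1)] by (intro compact_continuous_image continuous_intros)
  show "(\<lambda>x. x + a) ` closure {x. \<theta> x \<noteq> 0} \<subseteq> \<Omega>'"
    using test_functionsD(3)[OF assms(1)] assms(2) by blast
  show "x \<in> (\<lambda>x. x + a) ` closure {x. \<theta> x \<noteq> 0}" if "\<theta> (x - a) \<noteq> 0" for x
    using that closure_subset[of "{x. \<theta> x \<noteq> 0}"] by (intro image_eqI[of _ _ "x - a"]) auto
qed

lemma test_functions_continuous: "\<theta> \<in> test_functions \<Omega> \<Longrightarrow> continuous_on A \<theta>"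
  using test_functionsD(1) smooth_continuous by blast

lemma test_functions_bounded:
  assumes "\<theta> \<in> test_functions \<Omega>"
  obtains C where "0 \<le> C" "\<And>x. \<bar>\<theta> x\<bar> \<le> C"
proof -
  have "bounded (\<theta> ` closure {x. \<theta> x \<noteq> 0})"
    using test_functionsD(2)[OF assms] test_functions_continuous[OF assms]
    by (intro compact_imp_bounded compact_continuous_image)
  then obtain C where C: "\<And>x. x \<in> closure {x. \<theta> x \<noteq> 0} \<Longrightarrow> \<bar>\<theta> x\<bar> \<le> C"
    by (auto simp: bounded_iff)
  have "\<bar>\<theta> x\<bar> \<le> max C 0" for x
    using C[OF support_memI[of \<theta> x]] by (cases "\<theta> x = 0") auto
  then show ?thesis using that[of "max C 0"] by auto
qed

lemma test_functions_measurable: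
  assumes "\<theta> \<in> test_functions \<Omega>"
  shows "\<theta> \<in> borel_measurable borel" "\<theta> \<in> borel_measurable lborel" "\<theta> \<in> borel_measurable lebesgue"
    "\<theta> \<in> borel_measurable (lebesgue_on A)"
proof -
  show 1: "\<theta> \<in> borel_measurable borel"
    using test_functions_continuous[OF assms] borel_measurable_continuous_onI by blast
  then show "\<theta> \<in> borel_measurable lborel" by simp
  then show "\<theta> \<in> borel_measurable lebesgue" by (rule measurable_completion)
  then show "\<theta> \<in> borel_measurable (lebesgue_on A)" by (rule measurable_restrict_space1)
qed

lemma test_functions_grad_measurable:
  assumes "\<theta> \<in> test_functions \<Omega>"
  shows "grad \<theta> \<in> borel_measurable borel" "grad \<theta> \<in> borel_measurable (lebesgue_on A)"
  using test_functions_measurable[OF test_functions_partial[OF assms]]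
  by (auto intro!: borel_measurable_vec_lambda)

text \<open>Translations act on the whole plane with \<open>lborel\<close>, whereas the problem
  lives on \<open>lebesgue_on \<Omega>\<close>. Test functions vanish outside \<Omega>, and this
  carries their integrals from one side to the other.\<close>

lemma integral_lebesgue_on_support:
  fixes f :: "real^2 \<Rightarrow> 'b::euclidean_space"
  assumes "\<Omega> \<in> sets lebesgue" "f \<in> borel_measurable borel" "\<And>x. x \<notin> \<Omega> \<Longrightarrow> f x = 0"
  shows "(LINT x|lebesgue_on \<Omega>. f x) = (LINT x|lborel. f x)"
proof -
  have "(LINT x|lebesgue_on \<Omega>. f x) = (LINT x|lebesgue. indicator \<Omega> x *\<^sub>R f x)"
    using assms(1) by (subst integral_restrict_space) auto
  also have "(\<lambda>x. indicator \<Omega> x *\<^sub>R f x) = f"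
    using assms(3) by (auto simp: indicator_def fun_eq_iff)
  also have "(LINT x|lebesgue. f x) = (LINT x|lborel. f x)"
    using assms(2) by (intro integral_completion) auto
  finally show ?thesis .
qed

section \<open>Duality between L2 and test functions on a bounded open set\<close>

definition bump2 :: "real^2 \<Rightarrow> real^2 \<Rightarrow> nat \<Rightarrow> real^2 \<Rightarrow> real" where
  "bump2 a b n x = bump1 (a $ 1) (b $ 1) n (x $ 1) * bump1 (a $ 2) (b $ 2) n (x $ 2)"

lemma bump2_test_function:
  assumes "cbox a b \<subseteq> \<Omega>"
  shows "bump2 a b n \<in> test_functions \<Omega>"
proof (rule test_functions_supportI[OF _ compact_cbox assms])
  show "smooth (bump2 a b n)"
    unfolding bump2_def by (intro smooth_mult smooth_bump1_coord)
  show "x \<in> cbox a b" if "bump2 a b n x \<noteq> 0" for x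
  proof -
    have "x $ 1 \<in> {a $ 1<..<b $ 1}" "x $ 2 \<in> {a $ 2<..<b $ 2}"
      using that bump1_eq_0 by (force simp: bump2_def)+
    then show ?thesis by (auto simp: mem_box_cart forall_2)
  qed
qed

lemma bump2_bounds: "0 \<le> bump2 a b n x" "bump2 a b n x \<le> 1"
  by (auto simp: bump2_def bump1_bounds mult_le_one)

lemma bump2_tendsto: "(\<lambda>n. bump2 a b n x) \<longlonglongrightarrow> indicator (box a b) x"
proof -
  have "(\<lambda>n. bump2 a b n x) \<longlonglongrightarrow> indicator {a $ 1<..<b $ 1} (x $ 1) * indicator {a $ 2<..<b $ 2} (x $ 2)"
    unfolding bump2_def by (intro tendsto_mult bump1_tendsto)
  also have "indicator {a $ 1<..<b $ 1} (x $ 1) * indicator {a $ 2<..<b $ 2} (x $ 2) = (indicator (box a b) x :: real)"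
    by (auto simp: indicator_def mem_box_cart forall_2)
  finally show ?thesis .
qed

text \<open>Openness and boundedness are all that is fixed here, so that the locale can be
  interpreted again for an open subset of the domain, as the interpolation estimate does.\<close>

locale bounded_domain =
  fixes \<Omega> :: "(real^2) set"
  assumes open_domain: "open \<Omega>" and bounded_domain: "bounded \<Omega>"
begin

abbreviation "M \<equiv> lebesgue_on \<Omega>"

lemma domain_lmeasurable: "\<Omega> \<in> lmeasurable"
  by (simp add: bounded_domain open_domain lmeasurable_open)

lemma domain_sets [simp, measurable]: "\<Omega> \<in> sets lebesgue"
  using domain_lmeasurable by (rule fmeasurableD)

lemma finite_measure_domain: "finite_measure M"
  using domain_lmeasurable by (rule finite_measure_lebesgue_on)

lemma integrable_L2: "f \<in> L2 \<Omega> \<Longrightarrow> integrable M f"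
  using L2_space_imp_integrable[OF finite_measure_domain] .

lemma bounded_imp_L2:
  fixes f :: "real^2 \<Rightarrow> 'b::euclidean_space"
  assumes "f \<in> borel_measurable M" "\<And>x. norm (f x) \<le> c"
  shows "f \<in> L2 \<Omega>"
proof (rule L2_space_bound[OF _ assms(1)])
  interpret finite_measure M by (rule finite_measure_domain)
  show "(\<lambda>x. 1 :: real) \<in> L2 \<Omega>" by (auto simp: L2_space_def)
  show "norm (f x) \<le> c * norm (1 :: real)" for x using assms(2) by simp
qed

lemma test_L2: "\<theta> \<in> test_functions A \<Longrightarrow> \<theta> \<in> L2 \<Omega>"
  using test_functions_bounded test_functions_measurable bounded_imp_L2
  by (metis real_norm_def)

lemma test_grad_L2: "\<theta> \<in> test_functions A \<Longrightarrow> grad \<theta> \<in> L2 \<Omega>"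
  by (rule L2_space_vec) (simp, rule test_L2[OF test_functions_partial])

text \<open>The test functions \<open>bump2 a b n\<close> tend to the indicator of the open box and
  are bounded by 1, so dominated convergence with majorant \<open>\<bar>h x\<bar>\<close> applies;
  the faces of the box are negligible.\<close>

lemma integral_box_eq_0:
  fixes h :: "real^2 \<Rightarrow> real"
  assumes h: "h \<in> L2 \<Omega>" and orth: "\<And>\<theta>. \<theta> \<in> test_functions \<Omega> \<Longrightarrow> inner_L2 M h \<theta> = 0"
    and ab: "cbox a b \<subseteq> \<Omega>"
  shows "integral (cbox a b) h = 0"
proof -
  have [measurable]: "h \<in> borel_measurable M" using h by (auto simp: L2_space_def)
  have box: "box a b \<subseteq> \<Omega>" using ab box_subset_cbox by blast
  have ibox: "integrable M (\<lambda>x. indicator (box a b) x * h x)"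
    using integrable_mult_indicator[OF _ integrable_L2[OF h], of "box a b"] box
    by (simp add: sets_restrict_space_iff)
  have "(\<lambda>n. LINT x|M. bump2 a b n x * h x) \<longlonglongrightarrow> (LINT x|M. indicator (box a b) x * h x)"
  proof (rule integral_dominated_convergence)
    show "integrable M (\<lambda>x. \<bar>h x\<bar>)" using integrable_L2[OF h] by simp
    show "(\<lambda>x. indicator (box a b) x * h x) \<in> borel_measurable M" using ibox by simp
    show "(\<lambda>x. bump2 a b n x * h x) \<in> borel_measurable M" for n
      using test_functions_measurable(4)[OF bump2_test_function[OF ab]] by measurable
    show "AE x in M. (\<lambda>n. bump2 a b n x * h x) \<longlonglongrightarrow> indicator (box a b) x * h x"
      by (intro AE_I2 tendsto_intros bump2_tendsto)
    show "AE x in M. norm (bump2 a b n x * h x) \<le> \<bar>h x\<bar>" for n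
      using bump2_bounds by (auto simp: abs_mult intro!: mult_left_le_one_le)
  qed
  moreover have "(LINT x|M. bump2 a b n x * h x) = 0" for n
    using orth[OF bump2_test_function[OF ab]] by (simp add: inner_L2_def mult.commute)
  ultimately have "(LINT x|M. indicator (box a b) x * h x) = 0"
    using LIMSEQ_const_iff[of 0 "LINT x|M. indicator (box a b) x * h x"] by simp
  then have "integral \<Omega> (\<lambda>x. indicator (box a b) x * h x) = 0"
    using lebesgue_integral_eq_integral[OF ibox domain_sets] by simp
  also have "(\<lambda>x. indicator (box a b) x * h x) = (\<lambda>x. if x \<in> box a b then h x else 0)"
    by (auto simp: indicator_def)
  also have "integral \<Omega> \<dots> = integral (box a b) h"
    using box by (simp add: integral_restrict_Int Int_absorb2)
  finally show ?thesis by (simp add: integral_open_interval)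
qed

text \<open>The fundamental lemma of the calculus of variations. By Lebesgue differentiation almost
  every value of \<open>h\<close> is a limit of averages over small cubes, and all these averages
  vanish.\<close>

lemma orthogonal_test_functions_imp_AE_0:
  fixes h :: "real^2 \<Rightarrow> real"
  assumes h: "h \<in> L2 \<Omega>" and orth: "\<And>\<theta>. \<theta> \<in> test_functions \<Omega> \<Longrightarrow> inner_L2 M h \<theta> = 0"
  shows "AE x in M. h x = 0"
proof -
  define f where "f x = (if x \<in> \<Omega> then h x else 0)" for x
  have "integrable lebesgue f"
  proof -
    have "(\<lambda>x. indicator \<Omega> x *\<^sub>R h x) = f"
      by (auto simp: f_def indicator_def)
    then show ?thesis
      using integrable_L2[OF h] by (subst (asm) integrable_restrict_space) auto
  qed
  then have "f absolutely_integrable_on UNIV" by (simp add: set_integrable_def)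
  then have "f integrable_on cbox a b" for a b
    by (meson absolutely_integrable_on_def integrable_on_subcbox subset_UNIV)
  then obtain N where N: "negligible N" "\<And>x e. \<lbrakk>x \<notin> N; 0 < e\<rbrakk> \<Longrightarrow>
      \<exists>d>0. \<forall>s. 0 < s \<and> s < d \<longrightarrow> norm (integral (cbox x (x + s *\<^sub>R One)) f /\<^sub>R s ^ DIM(real^2) - f x) < e"
    using integrable_ccontinuous_explicit[of f] by blast
  have zero: "h x = 0" if x: "x \<in> \<Omega>" "x \<notin> N" for x
  proof (rule ccontr)
    assume "h x \<noteq> 0"
    then obtain d where d: "d > 0" "\<And>s. 0 < s \<Longrightarrow> s < d \<Longrightarrow>
        norm (integral (cbox x (x + s *\<^sub>R One)) f /\<^sub>R s ^ DIM(real^2) - f x) < \<bar>h x\<bar>"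
      using N(2)[of x "\<bar>h x\<bar>"] x by auto
    obtain r where r: "r > 0" "cball x r \<subseteq> \<Omega>"
      using open_domain x by (meson open_contains_cball)
    \<comment> \<open>The first bound meets the smallness required by differentiation, the second
      keeps the cube of side \<open>s\<close> with corner \<open>x\<close> inside the ball of radius
      \<open>r\<close>.\<close>
    define s where "s = min (d / 2) (r / norm (One :: real^2))"
    have One: "norm (One :: real^2) > 0" by simp
    have s: "0 < s" "s < d" using d(1) r(1) One by (auto simp: s_def min_less_iff_disj)
    have "cbox x (x + s *\<^sub>R One) \<subseteq> cball x r"
    proof
      fix y assume y: "y \<in> cbox x (x + s *\<^sub>R One)"
      have "norm (y - x) \<le> norm (s *\<^sub>R One :: real^2)"
        using y s by (intro norm_le_componentwise) (auto simp: mem_box inner_simps)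
      also have "\<dots> \<le> r" using s One by (simp add: s_def min_def field_simps split: if_splits)
      finally show "y \<in> cball x r" by (simp add: dist_norm norm_minus_commute)
    qed
    then have sub: "cbox x (x + s *\<^sub>R One) \<subseteq> \<Omega>" using r by blast
    have "integral (cbox x (x + s *\<^sub>R One)) f = integral (cbox x (x + s *\<^sub>R One)) h"
      using sub by (intro integral_cong) (auto simp: f_def)
    also have "\<dots> = 0" by (rule integral_box_eq_0[OF h orth sub])
    finally show False using d(2)[OF s] x by (simp add: f_def)
  qed
  have "AE x in lebesgue. x \<notin> N"
    using N(1) AE_not_in negligible_iff_null_sets by blast
  then have "AE x in lebesgue. x \<in> \<Omega> \<longrightarrow> h x = 0"
    by eventually_elim (use zero in blast)
  then show ?thesis by (subst AE_restrict_space_iff) auto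
qed

text \<open>An orthogonal projection: residuals \<open>D - \<theta>\<close> of almost minimal norm
  converge to some \<open>y\<close>, minimality makes \<open>y\<close> orthogonal to all test
  functions, and hence \<open>y\<close> vanishes. The lemma on nested convex sets is used with a
  constant sequence of sets.\<close>

lemma test_functions_dense:
  fixes D :: "real^2 \<Rightarrow> real"
  assumes D: "D \<in> L2 \<Omega>"
  obtains \<theta> where "\<And>n. \<theta> n \<in> test_functions \<Omega>" "(\<lambda>n. norm_L2 M (\<lambda>x. \<theta> n x - D x)) \<longlonglongrightarrow> 0"
proof -
  define C where "C = (\<lambda>\<theta> x. D x - \<theta> x) ` test_functions \<Omega>"
  have C_L2: "C \<subseteq> L2 \<Omega>"
    unfolding C_def using L2_space_diff[OF D] test_L2 by blast
  have "D \<in> C" unfolding C_def using test_functions_zero by force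
  have C_diff: "(\<lambda>x. f x - t * \<theta> x) \<in> C" if "f \<in> C" "\<theta> \<in> test_functions \<Omega>" for f t \<theta>
  proof -
    obtain \<xi> where "\<xi> \<in> test_functions \<Omega>" "f = (\<lambda>x. D x - \<xi> x)"
      using \<open>f \<in> C\<close> unfolding C_def by blast
    then show ?thesis
      unfolding C_def
      by (intro image_eqI[of _ _ "\<lambda>x. \<xi> x + t * \<theta> x"] test_functions_add test_functions_cmult that) (auto simp: fun_eq_iff)
  qed
  obtain F y where F: "\<And>n. F n \<in> C" and y: "y \<in> L2 \<Omega>" and lim: "(\<lambda>n. norm_L2 M (\<lambda>x. F n x - y x)) \<longlonglongrightarrow> 0"
    and small: "\<And>n f. f \<in> C \<Longrightarrow> norm_L2 M (F n) \<le> norm_L2 M f + 1 / Suc n"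
  proof (rule L2_nested_midpoint_convex[of M "\<lambda>n. C" "norm_L2 M D"])
    show "(\<lambda>x. (1/2) *\<^sub>R (f x + g x)) \<in> C" if "f \<in> C" "g \<in> C" for f g
    proof -
      obtain \<xi> \<theta> where *: "\<xi> \<in> test_functions \<Omega>" "f = (\<lambda>x. D x - \<xi> x)" "\<theta> \<in> test_functions \<Omega>" "g = (\<lambda>x. D x - \<theta> x)"
        using \<open>f \<in> C\<close> \<open>g \<in> C\<close> unfolding C_def by blast
      show ?thesis
        unfolding C_def *(2,4)
        by (intro image_eqI[of _ _ "\<lambda>x. (1/2) * (\<xi> x + \<theta> x)"] test_functions_add test_functions_cmult *)
           (auto simp: fun_eq_iff field_simps)
    qed
  qed (use C_L2 \<open>D \<in> C\<close> finite_measure_domain in auto)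
  have FL2: "F n \<in> L2 \<Omega>" for n using F C_L2 by blast
  have "inner_L2 M y \<theta> = 0" if \<theta>: "\<theta> \<in> test_functions \<Omega>" for \<theta>
  proof -
    have \<theta>L2: "(\<lambda>x. t * \<theta> x) \<in> L2 \<Omega>" for t using test_L2[OF \<theta>] by (rule L2_space_mult_left)
    \<comment> \<open>\<open>C\<close> is stable under subtracting multiples of \<theta>, and
      \<open>F m\<close> is minimal in it up to \<open>1 / Suc m\<close>. In the limit
      \<open>y\<close> is at most as long as \<open>y - t \<theta>\<close>.\<close>
    have le: "norm_L2 M y \<le> norm_L2 M (\<lambda>x. y x - t * \<theta> x)" for t
    proof -
      have 1: "(\<lambda>m. norm_L2 M (\<lambda>x. F m x - t * \<theta> x)) \<longlonglongrightarrow> norm_L2 M (\<lambda>x. y x - t * \<theta> x)"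
        by (rule tendsto_norm_L2) (auto intro!: L2_space_diff FL2 y \<theta>L2 simp: lim)
      have 2: "(\<lambda>n. norm_L2 M (F n)) \<longlonglongrightarrow> norm_L2 M y"
        by (rule tendsto_norm_L2[OF FL2 y lim])
      have "norm_L2 M (F m) \<le> norm_L2 M (\<lambda>x. F m x - t * \<theta> x) + 1 / Suc m" for m
        by (rule small[OF C_diff[OF F \<theta>]])
      moreover have "(\<lambda>m. norm_L2 M (\<lambda>x. F m x - t * \<theta> x) + 1 / Suc m) \<longlonglongrightarrow> norm_L2 M (\<lambda>x. y x - t * \<theta> x) + 0"
        by (intro tendsto_intros 1 LIMSEQ_Suc[OF lim_1_over_n])
      ultimately show ?thesis using LIMSEQ_le[OF 2] by auto
    qed
    define c where "c = inner_L2 M y \<theta>"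
    define K where "K = (norm_L2 M \<theta>)\<^sup>2"
    have K: "K \<ge> 0" by (simp add: K_def)
    have ineq: "0 \<le> t\<^sup>2 * K - 2 * t * c" for t
    proof -
      have "(norm_L2 M y)\<^sup>2 \<le> (norm_L2 M (\<lambda>x. y x - t *\<^sub>R \<theta> x))\<^sup>2"
        using le[of t] by (intro power_mono) auto
      also have "\<dots> = (norm_L2 M y)\<^sup>2 - 2 * (t * c) + t\<^sup>2 * K"
        using norm_L2_diff_power2[OF y, of "\<lambda>x. t *\<^sub>R \<theta> x"] \<theta>L2
        by (simp add: norm_L2_mult inner_L2_mult c_def K_def power_mult_distrib)
      finally show ?thesis by simp
    qed
    \<comment> \<open>With this \<open>t\<close> the inequality becomes
      \<open>t\<^sup>2 * (K + 2) \<le> 0\<close>, which forces \<open>c = 0\<close>. The summand 1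
      covers a test function of norm 0.\<close>
    define t where "t = c / (K + 1)"
    have c: "c = t * (K + 1)" using K by (simp add: t_def)
    have "t\<^sup>2 * (K + 2) \<le> 0"
      using ineq[of t] by (simp add: c algebra_simps power2_eq_square)
    then have "t = 0" using K by (auto simp: mult_le_0_iff)
    then show ?thesis using c by (simp add: c_def)
  qed
  then have y0: "AE x in M. y x = 0" by (rule orthogonal_test_functions_imp_AE_0[OF y])
  obtain \<theta> where \<theta>: "\<And>n. \<theta> n \<in> test_functions \<Omega>" "\<And>n. F n = (\<lambda>x. D x - \<theta> n x)"
    using F unfolding C_def image_iff by metis
  have [measurable]: "D \<in> borel_measurable M" "y \<in> borel_measurable M" "\<theta> n \<in> borel_measurable M" for n
    using D y test_L2[OF \<theta>(1)] by (auto simp: L2_space_def)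
  have "norm_L2 M (\<lambda>x. \<theta> n x - D x) = norm_L2 M (\<lambda>x. F n x - y x)" for n
    unfolding norm_L2_minus_commute[of M "\<theta> n"] \<theta>(2)
    using y0 by (intro norm_L2_cong_AE) auto
  then have "(\<lambda>n. norm_L2 M (\<lambda>x. \<theta> n x - D x)) \<longlonglongrightarrow> 0"
    using lim by simp
  then show ?thesis using that \<theta>(1) by blast
qed

text \<open>Test functions that converge to \<open>D\<close> itself turn the assumed bound into
  \<open>norm_L2 M D * norm_L2 M D \<le> C * norm_L2 M D\<close>. Estimates of weak derivatives thus
  reduce to pairings with smooth functions.\<close>

lemma norm_L2_le_by_duality:
  fixes D :: "real^2 \<Rightarrow> real"
  assumes D: "D \<in> L2 \<Omega>" and le: "\<And>\<theta>. \<theta> \<in> test_functions \<Omega> \<Longrightarrow> \<bar>inner_L2 M D \<theta>\<bar> \<le> C * norm_L2 M \<theta>"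
    and C: "0 \<le> C"
  shows "norm_L2 M D \<le> C"
proof -
  obtain \<theta> where \<theta>: "\<And>n. \<theta> n \<in> test_functions \<Omega>" "(\<lambda>n. norm_L2 M (\<lambda>x. \<theta> n x - D x)) \<longlonglongrightarrow> 0"
    using test_functions_dense[OF D] by blast
  have "(\<lambda>n. inner_L2 M D (\<theta> n)) \<longlonglongrightarrow> inner_L2 M D D"
    using tendsto_inner_L2[OF test_L2[OF \<theta>(1)] D D \<theta>(2)] by (simp add: inner_L2_commute)
  moreover have "(\<lambda>n. C * norm_L2 M (\<theta> n)) \<longlonglongrightarrow> C * norm_L2 M D"
    by (intro tendsto_intros tendsto_norm_L2 test_L2[OF \<theta>(1)] D \<theta>)
  ultimately have "inner_L2 M D D \<le> C * norm_L2 M D"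
    using le[OF \<theta>(1)] by (intro LIMSEQ_le) (auto simp: abs_le_iff)
  then have "norm_L2 M D * norm_L2 M D \<le> C * norm_L2 M D"
    by (simp add: inner_L2_self power2_eq_square)
  then show ?thesis
    using C norm_L2_nonneg[of M D] by (cases "norm_L2 M D = 0") auto
qed

end

subsection \<open>Translations and weak gradients\<close>

lemma smooth_lipschitz_along_line:
  assumes "smooth f" "\<And>x. \<bar>e \<bullet> grad f x\<bar> \<le> C"
  shows "\<bar>f (x + t *\<^sub>R e) - f x\<bar> \<le> C * \<bar>t\<bar>"
proof -
  have "norm (f (x + t *\<^sub>R e) - f (x + 0 *\<^sub>R e)) \<le> C * norm (t - 0)"
    by (rule field_differentiable_bound[where S = UNIV and f' = "\<lambda>t. e \<bullet> grad f (x + t *\<^sub>R e)"])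
       (use assms DERIV_along_line in auto)
  then show ?thesis by simp
qed

lemma test_functions_Taylor:
  assumes \<theta>: "\<theta> \<in> test_functions A"
  obtains C where "0 \<le> C" "\<And>x t. \<bar>\<theta> (x + t *\<^sub>R e) - \<theta> x - t * (e \<bullet> grad \<theta> x)\<bar> \<le> C * t\<^sup>2"
proof -
  let ?D = "\<lambda>x. e \<bullet> grad \<theta> x"
  have D: "?D \<in> test_functions A" by (rule test_functions_inner_grad[OF \<theta>])
  obtain C where C: "0 \<le> C" "\<And>x. \<bar>e \<bullet> grad ?D x\<bar> \<le> C"
    using test_functions_bounded[OF test_functions_inner_grad[OF D]] by blast
  have "\<bar>\<theta> (x + t *\<^sub>R e) - \<theta> x - t * ?D x\<bar> \<le> C * t\<^sup>2" for x t
  proof -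
    let ?h = "\<lambda>s. \<theta> (x + s *\<^sub>R e) - s * ?D x"
    have "norm (?h t - ?h 0) \<le> (C * \<bar>t\<bar>) * norm (t - 0)"
    proof (rule field_differentiable_bound[where S = "closed_segment 0 t" and f' = "\<lambda>s. ?D (x + s *\<^sub>R e) - ?D x"])
      fix s assume s: "s \<in> closed_segment 0 t"
      have "(?h has_real_derivative ?D (x + s *\<^sub>R e) - 1 * ?D x) (at s)"
        by (auto intro!: derivative_eq_intros DERIV_along_line test_functionsD(1)[OF \<theta>])
      then show "(?h has_field_derivative ?D (x + s *\<^sub>R e) - ?D x) (at s within closed_segment 0 t)"
        by (simp add: has_field_derivative_at_within)
      have "\<bar>s\<bar> \<le> \<bar>t\<bar>" using s by (auto simp: closed_segment_eq_real_ivl split: if_splits)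
      then have "C * \<bar>s\<bar> \<le> C * \<bar>t\<bar>" using C by (intro mult_left_mono) auto
      then show "norm (?D (x + s *\<^sub>R e) - ?D x) \<le> C * \<bar>t\<bar>"
        using smooth_lipschitz_along_line[OF test_functionsD(1)[OF D] C(2), of x s] by simp
    qed auto
    then show ?thesis by (simp add: power2_eq_square mult.assoc abs_mult_self_eq)
  qed
  then show ?thesis using that C(1) by blast
qed

lemma integrable_indicator_cball: "integrable lborel (indicator (cball 0 R) :: real^2 \<Rightarrow> real)"
  using emeasure_lborel_cball_finite[of "0 :: real^2" R] by (intro integrable_real_indicator) auto

lemma indicator_L2_lborel: "(indicator (cball 0 R) :: real^2 \<Rightarrow> real) \<in> L2_space lborel"
proof (rule L2_spaceI)
  have "(\<lambda>x. (norm (indicator (cball 0 R) x :: real))\<^sup>2) = (indicator (cball 0 R) :: real^2 \<Rightarrow> real)"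
    by (auto simp: indicator_def)
  then show "integrable lborel (\<lambda>x :: real^2. (norm (indicator (cball 0 R) x :: real))\<^sup>2)"
    by (simp only: integrable_indicator_cball)
qed (use integrable_indicator_cball in blast)

lemma test_functions_support_bound:
  assumes "\<theta> \<in> test_functions A"
  obtains R where "\<And>x. norm x > R \<Longrightarrow> \<theta> x = 0"
proof -
  have "bounded {x. \<theta> x \<noteq> 0}"
    using test_functionsD(2)[OF assms] bounded_subset[OF compact_imp_bounded closure_subset] by blast
  then obtain R where R: "\<And>x. \<theta> x \<noteq> 0 \<Longrightarrow> norm x \<le> R" by (auto simp: bounded_iff)
  show ?thesis by (rule that[of R]) (use R in force)
qed

text \<open>The Taylor remainder is pointwise of order \<open>t\<^sup>2\<close> and, for
  \<open>\<bar>t\<bar> \<le> 1\<close>, supported in one fixed ball. Its L2 norm and its integral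
  therefore have the same order.\<close>

lemma test_functions_remainder:
  assumes \<theta>: "\<theta> \<in> test_functions A"
  shows "\<exists>C\<ge>0. \<forall>t. \<bar>t\<bar> \<le> 1 \<longrightarrow>
    norm_L2 lborel (\<lambda>x. \<theta> (x + t *\<^sub>R e) - \<theta> x - t * (e \<bullet> grad \<theta> x)) \<le> C * t\<^sup>2 \<and>
    (\<lambda>x. \<theta> (x + t *\<^sub>R e) - \<theta> x - t * (e \<bullet> grad \<theta> x)) \<in> L2_space lborel \<and>
    integrable lborel (\<lambda>x. \<theta> (x + t *\<^sub>R e) - \<theta> x - t * (e \<bullet> grad \<theta> x)) \<and>
    \<bar>LINT x|lborel. \<theta> (x + t *\<^sub>R e) - \<theta> x - t * (e \<bullet> grad \<theta> x)\<bar> \<le> C * t\<^sup>2"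
proof -
  obtain C where C: "0 \<le> C" "\<And>x t. \<bar>\<theta> (x + t *\<^sub>R e) - \<theta> x - t * (e \<bullet> grad \<theta> x)\<bar> \<le> C * t\<^sup>2"
    using test_functions_Taylor[OF \<theta>] by blast
  obtain R0 where R0: "\<And>x. norm x > R0 \<Longrightarrow> \<theta> x = 0" using test_functions_support_bound[OF \<theta>] by blast
  obtain R1 where R1: "\<And>x. norm x > R1 \<Longrightarrow> e \<bullet> grad \<theta> x = 0"
    using test_functions_support_bound[OF test_functions_inner_grad[OF \<theta>]] by blast
  \<comment> \<open>Enlarging the radius by \<open>norm e\<close> keeps the supports of all
    translates by \<open>t *\<^sub>R e\<close> with \<open>\<bar>t\<bar> \<le> 1\<close> inside the
    ball.\<close>
  define R where "R = max R0 R1 + norm e"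
  let ?I = "indicator (cball 0 R) :: real^2 \<Rightarrow> real"
  let ?r = "\<lambda>t x. \<theta> (x + t *\<^sub>R e) - \<theta> x - t * (e \<bullet> grad \<theta> x)"
  have le: "norm (?r t x) \<le> (C * t\<^sup>2) * norm (?I x)" if "\<bar>t\<bar> \<le> 1" for t x
  proof (cases "norm x \<le> R")
    case True
    then show ?thesis using C(2)[of x t] by simp
  next
    case False
    have "norm (t *\<^sub>R e) \<le> norm e" using that by (simp add: mult_left_le_one_le)
    then have "norm (x + t *\<^sub>R e) > max R0 R1" "norm x > max R0 R1"
      using False norm_diff_ineq[of x "t *\<^sub>R e"] norm_ge_zero[of e] unfolding R_def by linarith+
    then show ?thesis using R0 R1 C(1) by auto
  qed
  have [measurable]: "\<theta> \<in> borel_measurable borel" "(\<lambda>x. e \<bullet> grad \<theta> x) \<in> borel_measurable borel"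
    using test_functions_measurable(1)[OF \<theta>] test_functions_measurable(1)[OF test_functions_inner_grad[OF \<theta>]] by auto
  have meas: "?r t \<in> borel_measurable lborel" for t by measurable
  note I = indicator_L2_lborel[of R]
  have int_I: "integrable lborel (\<lambda>x. c * norm (?I x))" for c
    using integrable_indicator_cball by auto
  have int: "integrable lborel (?r t)" if "\<bar>t\<bar> \<le> 1" for t
    by (rule Bochner_Integration.integrable_bound[OF int_I[of "C * t\<^sup>2"] meas]) (use le[OF that] C in auto)
  let ?K = "C * (norm_L2 lborel ?I + (LINT x|lborel. norm (?I x)))"
  show ?thesis
  proof (rule exI[of _ ?K], intro conjI allI impI)
    let ?K = "C * (norm_L2 lborel ?I + (LINT x|lborel. norm (?I x)))"
    have nn: "0 \<le> (LINT x|lborel. norm (?I x))" by simp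
    show "0 \<le> ?K" using C nn by simp
    show "?r t \<in> L2_space lborel" if "\<bar>t\<bar> \<le> 1" for t
      by (rule L2_space_bound[OF I meas le[OF that]])
    show "integrable lborel (?r t)" if "\<bar>t\<bar> \<le> 1" for t using int[OF that] .
    have "norm_L2 lborel (?r t) \<le> (C * t\<^sup>2) * norm_L2 lborel ?I" if "\<bar>t\<bar> \<le> 1" for t
      using C by (intro norm_L2_bounded_mult[OF I meas _ le[OF that]]) auto
    moreover have "(C * t\<^sup>2) * norm_L2 lborel ?I \<le> ?K * t\<^sup>2" for t
      using C nn by (simp add: algebra_simps)
    ultimately show "norm_L2 lborel (?r t) \<le> ?K * t\<^sup>2" if "\<bar>t\<bar> \<le> 1" for t
      using that order_trans by blast
    have "\<bar>LINT x|lborel. ?r t x\<bar> \<le> (LINT x|lborel. (C * t\<^sup>2) * norm (?I x))" if "\<bar>t\<bar> \<le> 1" for t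
      unfolding real_norm_def[symmetric]
      by (rule Bochner_Integration.integral_norm_bound_integral[OF int[OF that] int_I]) (use le[OF that] in auto)
    moreover have "(LINT x|lborel. (C * t\<^sup>2) * norm (?I x)) \<le> ?K * t\<^sup>2" for t
    proof -
      have "(LINT x|lborel. (C * t\<^sup>2) * norm (?I x)) = (C * t\<^sup>2) * (LINT x|lborel. norm (?I x))"
        by (rule integral_mult_right_zero)
      then show ?thesis using C norm_L2_nonneg[of lborel ?I] by (simp add: algebra_simps)
    qed
    ultimately show "\<bar>LINT x|lborel. ?r t x\<bar> \<le> ?K * t\<^sup>2" if "\<bar>t\<bar> \<le> 1" for t
      using that order_trans by blast
  qed
qed

lemma test_functions_L2_lborel:
  assumes "\<theta> \<in> test_functions A"
  shows "\<theta> \<in> L2_space lborel"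
proof -
  obtain R where R: "\<And>x. norm x > R \<Longrightarrow> \<theta> x = 0" using test_functions_support_bound[OF assms] by blast
  obtain C where C: "0 \<le> C" "\<And>x. \<bar>\<theta> x\<bar> \<le> C" using test_functions_bounded[OF assms] by blast
  have "norm (\<theta> x) \<le> C * norm (indicator (cball 0 R) x :: real)" for x
    using R[of x] C(2)[of x] by (cases "norm x \<le> R") auto
  then show ?thesis
    by (intro L2_space_bound[OF indicator_L2_lborel test_functions_measurable(2)[OF assms]]) auto
qed

lemma test_functions_integrable:
  assumes "\<theta> \<in> test_functions A"
  shows "integrable lborel \<theta>"
proof -
  obtain R where R: "\<And>x. norm x > R \<Longrightarrow> \<theta> x = 0" using test_functions_support_bound[OF assms] by blast
  obtain C where C: "0 \<le> C" "\<And>x. \<bar>\<theta> x\<bar> \<le> C" using test_functions_bounded[OF assms] by blast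
  have "norm (\<theta> x) \<le> norm (C * indicator (cball 0 R) x :: real)" for x
    using R[of x] C(1) C(2)[of x] by (cases "norm x \<le> R") auto
  then show ?thesis
    by (intro Bochner_Integration.integrable_bound[OF _ test_functions_measurable(2)[OF assms], of "\<lambda>x. C * indicator (cball 0 R) x"])
       (use integrable_indicator_cball in auto)
qed

lemma lborel_integral_translate:
  fixes f :: "'a::euclidean_space \<Rightarrow> 'b::euclidean_space"
  assumes [measurable]: "f \<in> borel_measurable borel"
  shows "(LINT x|lborel. f (x + a)) = (LINT x|lborel. f x)"
proof -
  have "(LINT x|lborel. f x) = (LINT x|distr lborel borel ((+) a). f x)"
    by (simp add: lborel_distr_plus)
  also have "\<dots> = (LINT x|lborel. f (a + x))"
    by (rule integral_distr) auto
  finally show ?thesis by (simp add: add.commute)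
qed

lemma lborel_integrable_translate:
  fixes f :: "'a::euclidean_space \<Rightarrow> 'b::euclidean_space"
  assumes "f \<in> borel_measurable borel" "integrable lborel f"
  shows "integrable lborel (\<lambda>x. f (x + a))"
proof -
  have "integrable (distr lborel borel ((+) a)) f"
    using assms(2) by (simp add: lborel_distr_plus)
  then have "integrable lborel (\<lambda>x. f (a + x))"
    using assms(1) by (subst (asm) integrable_distr_eq) auto
  then show ?thesis by (simp add: add.commute)
qed

lemma norm_L2_translate:
  fixes f :: "'a::euclidean_space \<Rightarrow> 'b::euclidean_space"
  assumes [measurable]: "f \<in> borel_measurable borel"
  shows "norm_L2 lborel (\<lambda>x. f (x + a)) = norm_L2 lborel f"
  unfolding norm_L2_def by (subst lborel_integral_translate[of "\<lambda>x. (norm (f x))\<^sup>2" a]) auto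

text \<open>By translation invariance the two values of \<theta> cancel in the integrated remainder,
  so \<open>t\<close> times the integral of the derivative is of order \<open>t\<^sup>2\<close>.
  Division by \<open>t\<close> and \<open>t \<rightarrow> 0\<close> give 0. This is the integration
  by parts behind weak gradients of test functions.\<close>

lemma integral_inner_grad_eq_0:
  assumes \<theta>: "\<theta> \<in> test_functions A"
  shows "(LINT x|lborel. e \<bullet> grad \<theta> x) = 0"
proof -
  let ?D = "\<lambda>x. e \<bullet> grad \<theta> x"
  obtain C where C: "0 \<le> C" "\<And>t. \<bar>t\<bar> \<le> 1 \<Longrightarrow> \<bar>LINT x|lborel. \<theta> (x + t *\<^sub>R e) - \<theta> x - t * ?D x\<bar> \<le> C * t\<^sup>2"
    using test_functions_remainder[OF \<theta>, of e] by blast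
  have eq: "(LINT x|lborel. \<theta> (x + t *\<^sub>R e) - \<theta> x - t * ?D x) = - t * (LINT x|lborel. ?D x)" for t
    using test_functions_integrable[OF \<theta>] test_functions_integrable[OF test_functions_inner_grad[OF \<theta>, of e]]
      lborel_integrable_translate[OF test_functions_measurable(1)[OF \<theta>] test_functions_integrable[OF \<theta>]]
      lborel_integral_translate[OF test_functions_measurable(1)[OF \<theta>]]
    by simp
  have "\<bar>LINT x|lborel. ?D x\<bar> \<le> C / Suc n" for n
  proof -
    define t where "t = 1 / real (Suc n)"
    have t: "0 < t" "t \<le> 1" by (auto simp: t_def)
    have "t * \<bar>LINT x|lborel. ?D x\<bar> \<le> t * (C * t)"
      using C(2)[of t] t unfolding eq by (simp add: abs_mult power2_eq_square mult_ac)
    then have "\<bar>LINT x|lborel. ?D x\<bar> \<le> C * t" using t by simp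
    then show ?thesis by (simp add: t_def)
  qed
  then have "\<bar>LINT x|lborel. ?D x\<bar> \<le> 0"
    by (intro LIMSEQ_le_const[OF LIMSEQ_Suc[OF lim_const_over_n[of C]]]) blast
  then show ?thesis by simp
qed

text \<open>The increments of \<open>\<theta>\<close> are subadditive, so only small increments have to be expanded.\<close>

lemma norm_L2_increment_le:
  assumes \<theta>: "\<theta> \<in> test_functions A"
  shows "norm_L2 lborel (\<lambda>x. \<theta> (x + e) - \<theta> x) \<le> norm_L2 lborel (\<lambda>x. e \<bullet> grad \<theta> x)"
proof -
  let ?D = "\<lambda>x. e \<bullet> grad \<theta> x"
  have [measurable]: "\<theta> \<in> borel_measurable borel" using test_functions_measurable(1)[OF \<theta>] .
  have \<theta>L2: "(\<lambda>x. \<theta> (x + a)) \<in> L2_space lborel" for a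
    using test_functions_L2_lborel[OF test_functions_translate[OF \<theta>, of "- a" UNIV]] by simp
  have DL2: "?D \<in> L2_space lborel" by (rule test_functions_L2_lborel[OF test_functions_inner_grad[OF \<theta>]])
  define N where "N t = norm_L2 lborel (\<lambda>x. \<theta> (x + t *\<^sub>R e) - \<theta> x)" for t
  have NL2: "(\<lambda>x. \<theta> (x + a) - \<theta> (x + b)) \<in> L2_space lborel" for a b
    by (intro L2_space_diff \<theta>L2)
  have sub: "N (s + t) \<le> N s + N t" for s t
  proof -
    have "N (s + t) \<le> norm_L2 lborel (\<lambda>x. \<theta> (x + (s + t) *\<^sub>R e) - \<theta> (x + t *\<^sub>R e)) + N t"
      unfolding N_def using norm_L2_triangle[OF \<theta>L2 \<theta>L2 \<theta>L2[of 0]] by simp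
    also have "norm_L2 lborel (\<lambda>x. \<theta> (x + (s + t) *\<^sub>R e) - \<theta> (x + t *\<^sub>R e)) = N s"
      using norm_L2_translate[of "\<lambda>x. \<theta> (x + s *\<^sub>R e) - \<theta> x" "t *\<^sub>R e"]
      by (simp add: N_def algebra_simps)
    finally show ?thesis .
  qed
  have mult: "N (real k * t) \<le> real k * N t" for k t
  proof (induction k)
    case 0
    then show ?case by (simp add: N_def)
  next
    case (Suc k)
    then show ?case using sub[of "real k * t" t] by (simp add: algebra_simps)
  qed
  obtain C where C: "0 \<le> C" "\<And>t. \<bar>t\<bar> \<le> 1 \<Longrightarrow> norm_L2 lborel (\<lambda>x. \<theta> (x + t *\<^sub>R e) - \<theta> x - t * ?D x) \<le> C * t\<^sup>2"
     "\<And>t. \<bar>t\<bar> \<le> 1 \<Longrightarrow> (\<lambda>x. \<theta> (x + t *\<^sub>R e) - \<theta> x - t * ?D x) \<in> L2_space lborel"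
    using test_functions_remainder[OF \<theta>, of e] by blast
  have "N 1 \<le> norm_L2 lborel ?D + C / Suc n" for n
  proof -
    define t where "t = 1 / real (Suc n)"
    have t: "0 < t" "t \<le> 1" by (auto simp: t_def)
    have "N t \<le> norm_L2 lborel (\<lambda>x. \<theta> (x + t *\<^sub>R e) - \<theta> x - t * ?D x) + norm_L2 lborel (\<lambda>x. t * ?D x)"
      unfolding N_def
      using norm_L2_add_le[OF C(3) L2_space_mult_left[OF DL2], of t t] t by simp
    also have "\<dots> \<le> C * t\<^sup>2 + t * norm_L2 lborel ?D"
      using C(2)[of t] t by (simp add: norm_L2_mult)
    finally have Nt: "N t \<le> C * t\<^sup>2 + t * norm_L2 lborel ?D" .
    \<comment> \<open>The unit step is split into \<open>Suc n\<close> steps of length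
      \<open>t\<close>. Each contributes an error \<open>C * t\<^sup>2\<close>, which adds up to
      \<open>C / Suc n\<close>.\<close>
    have "N 1 = N (real (Suc n) * t)" by (simp add: t_def del: of_nat_Suc)
    also have "\<dots> \<le> real (Suc n) * N t" by (rule mult)
    also have "\<dots> \<le> real (Suc n) * (C * t\<^sup>2 + t * norm_L2 lborel ?D)"
      by (intro mult_left_mono Nt) auto
    also have "\<dots> = norm_L2 lborel ?D + C / Suc n"
      by (simp add: t_def power2_eq_square field_simps del: of_nat_Suc)
    finally show ?thesis .
  qed
  then have "N 1 \<le> norm_L2 lborel ?D + 0"
    by (intro LIMSEQ_le_const[OF tendsto_add[OF tendsto_const LIMSEQ_Suc[OF lim_const_over_n[of C]]]]) blast
  then show ?thesis by (simp add: N_def)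
qed

section \<open>Calculus of weak gradients\<close>

context bounded_domain
begin

lemma norm_L2_test:
  assumes "\<theta> \<in> test_functions \<Omega>"
  shows "norm_L2 M \<theta> = norm_L2 lborel \<theta>"
  unfolding norm_L2_def using test_functions_eq_0[OF assms] test_functions_measurable(1)[OF assms]
  by (subst integral_lebesgue_on_support) auto

lemma integral_test:
  assumes "\<theta> \<in> test_functions \<Omega>"
  shows "(LINT x|M. \<theta> x) = (LINT x|lborel. \<theta> x)"
  using test_functions_eq_0[OF assms] test_functions_measurable(1)[OF assms]
  by (intro integral_lebesgue_on_support) auto

lemma is_weak_gradD:
  assumes "is_weak_grad \<Omega> v D"
  shows "D \<in> L2 \<Omega>" "\<theta> \<in> test_functions \<Omega> \<Longrightarrow> inner_L2 M v (partial i \<theta>) = - inner_L2 M (\<lambda>x. D x $ i) \<theta>"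
    "(\<lambda>x. D x $ i) \<in> L2 \<Omega>"
  using assms L2_space_nth by (auto simp: is_weak_grad_def ip_def inner_L2_def)

lemma is_weak_gradI:
  assumes "D \<in> L2 \<Omega>" "\<And>\<theta> i. \<theta> \<in> test_functions \<Omega> \<Longrightarrow> inner_L2 M v (partial i \<theta>) = - inner_L2 M (\<lambda>x. D x $ i) \<theta>"
  shows "is_weak_grad \<Omega> v D"
  using assms by (auto simp: is_weak_grad_def ip_def inner_L2_def)

lemma AE_vec_eqI:
  fixes f g :: "real^2 \<Rightarrow> 'b ^ 2"
  assumes "\<And>i. AE x in M. f x $ i = g x $ i"
  shows "AE x in M. f x = g x"
  using assms[of 1] assms[of 2] by eventually_elim (auto simp: vec_eq_iff forall_2)

lemma is_weak_grad_unique: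
  assumes "is_weak_grad \<Omega> v D" "is_weak_grad \<Omega> v E"
  shows "AE x in M. D x = E x"
proof (rule AE_vec_eqI)
  fix i
  note D = is_weak_gradD[OF assms(1)] and E = is_weak_gradD[OF assms(2)]
  have "AE x in M. D x $ i - E x $ i = 0"
  proof (rule orthogonal_test_functions_imp_AE_0)
    show "(\<lambda>x. D x $ i - E x $ i) \<in> L2 \<Omega>" using D(3) E(3) by (rule L2_space_diff)
    fix \<theta> assume \<theta>: "\<theta> \<in> test_functions \<Omega>"
    then show "inner_L2 M (\<lambda>x. D x $ i - E x $ i) \<theta> = 0"
      using D(2)[OF \<theta>, of i] E(2)[OF \<theta>, of i] D(3) E(3) test_L2[OF \<theta>] by (simp add: inner_L2_diff)
  qed
  then show "AE x in M. D x $ i = E x $ i" by simp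
qed

lemma is_weak_grad_cong:
  assumes "is_weak_grad \<Omega> v D" "v \<in> borel_measurable M" "w \<in> borel_measurable M" "AE x in M. v x = w x"
    "E \<in> borel_measurable M" "AE x in M. D x = E x"
  shows "is_weak_grad \<Omega> w E"
proof (rule is_weak_gradI)
  note D = is_weak_gradD[OF assms(1)]
  show E: "E \<in> L2 \<Omega>" using L2_space_cong_AE[OF D(1) assms(5,6)] .
  fix \<theta> i assume \<theta>: "\<theta> \<in> test_functions \<Omega>"
  have "inner_L2 M w (partial i \<theta>) = inner_L2 M v (partial i \<theta>)"
    using assms test_functions_measurable(4)[OF test_functions_partial[OF \<theta>]]
    by (intro inner_L2_cong_AE) auto
  moreover have "inner_L2 M (\<lambda>x. E x $ i) \<theta> = inner_L2 M (\<lambda>x. D x $ i) \<theta>"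
    using assms(6) L2_spaceD(1)[OF L2_space_nth[OF E]] L2_spaceD(1)[OF D(3)] test_functions_measurable(4)[OF \<theta>]
    by (intro inner_L2_cong_AE) auto
  ultimately show "inner_L2 M w (partial i \<theta>) = - inner_L2 M (\<lambda>x. E x $ i) \<theta>"
    using D(2)[OF \<theta>] by simp
qed

lemma is_weak_grad_lincomb:
  assumes "is_weak_grad \<Omega> v D" "is_weak_grad \<Omega> w E" "v \<in> L2 \<Omega>" "w \<in> L2 \<Omega>"
  shows "is_weak_grad \<Omega> (\<lambda>x. a * v x + b * w x) (\<lambda>x. a *\<^sub>R D x + b *\<^sub>R E x)"
proof (rule is_weak_gradI)
  note D = is_weak_gradD[OF assms(1)] and E = is_weak_gradD[OF assms(2)]
  show "(\<lambda>x. a *\<^sub>R D x + b *\<^sub>R E x) \<in> L2 \<Omega>"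
    by (intro L2_space_add L2_space_scaleR D(1) E(1))
  fix \<theta> i assume \<theta>: "\<theta> \<in> test_functions \<Omega>"
  then show "inner_L2 M (\<lambda>x. a * v x + b * w x) (partial i \<theta>) = - inner_L2 M (\<lambda>x. (a *\<^sub>R D x + b *\<^sub>R E x) $ i) \<theta>"
    using D(2)[OF \<theta>, of i] E(2)[OF \<theta>, of i]
    by (simp add: inner_L2_add inner_L2_mult L2_space_mult_left assms D(3) E(3) test_L2[OF \<theta>] test_L2[OF test_functions_partial[OF \<theta>]])
qed

text \<open>Both sides of the defining identity are continuous in L2 for a fixed test function. This
  closedness is the form in which the completeness of Sobolev spaces is used.\<close>

lemma is_weak_grad_limit:
  assumes "\<And>n. is_weak_grad \<Omega> (v n) (D n)" "\<And>n. v n \<in> L2 \<Omega>" "w \<in> L2 \<Omega>" "E \<in> L2 \<Omega>"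
    "(\<lambda>n. norm_L2 M (\<lambda>x. v n x - w x)) \<longlonglongrightarrow> 0" "(\<lambda>n. norm_L2 M (\<lambda>x. D n x - E x)) \<longlonglongrightarrow> 0"
  shows "is_weak_grad \<Omega> w E"
proof (rule is_weak_gradI[OF assms(4)])
  fix \<theta> i assume \<theta>: "\<theta> \<in> test_functions \<Omega>"
  note D = is_weak_gradD[OF assms(1)]
  have 1: "(\<lambda>n. inner_L2 M (v n) (partial i \<theta>)) \<longlonglongrightarrow> inner_L2 M w (partial i \<theta>)"
    by (rule tendsto_inner_L2[OF assms(2,3) test_L2[OF test_functions_partial[OF \<theta>]] assms(5)])
  have "(\<lambda>n. norm_L2 M (\<lambda>x. D n x $ i - E x $ i)) \<longlonglongrightarrow> 0"
  proof (rule tendsto_sandwich[OF _ _ tendsto_const assms(6)])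
    show "\<forall>\<^sub>F n in sequentially. norm_L2 M (\<lambda>x. D n x $ i - E x $ i) \<le> norm_L2 M (\<lambda>x. D n x - E x)"
    proof (intro always_eventually allI norm_L2_mono L2_space_diff D(1) assms(4) L2_spaceD(1)[OF L2_space_diff] L2_space_nth)
      show "norm (D n x $ i - E x $ i) \<le> norm (D n x - E x)" for n x
        using Finite_Cartesian_Product.norm_nth_le[of "D n x - E x" i] by simp
    qed
  qed auto
  then have "(\<lambda>n. inner_L2 M (\<lambda>x. D n x $ i) \<theta>) \<longlonglongrightarrow> inner_L2 M (\<lambda>x. E x $ i) \<theta>"
    by (rule tendsto_inner_L2[OF D(3) L2_space_nth[OF assms(4)] test_L2[OF \<theta>]])
  then have "(\<lambda>n. - inner_L2 M (\<lambda>x. D n x $ i) \<theta>) \<longlonglongrightarrow> - inner_L2 M (\<lambda>x. E x $ i) \<theta>"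
    by (rule tendsto_minus)
  then show "inner_L2 M w (partial i \<theta>) = - inner_L2 M (\<lambda>x. E x $ i) \<theta>"
    using 1 unfolding D(2)[OF \<theta>] by (rule LIMSEQ_unique[rotated])
qed

text \<open>The product of two test functions is a test function, so the integral of its derivative
  vanishes.\<close>

lemma is_weak_grad_test:
  assumes \<theta>: "\<theta> \<in> test_functions \<Omega>"
  shows "is_weak_grad \<Omega> \<theta> (grad \<theta>)"
proof (rule is_weak_gradI[OF test_grad_L2[OF \<theta>]])
  fix \<xi> i assume \<xi>: "\<xi> \<in> test_functions \<Omega>"
  have prod: "(\<lambda>x. \<theta> x * \<xi> x) \<in> test_functions \<Omega>"
    by (rule test_functions_mult[OF \<xi> test_functionsD(1)[OF \<theta>]])
  have "0 = (LINT x|M. partial i (\<lambda>x. \<theta> x * \<xi> x) x)"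
    using integral_test[OF test_functions_partial[OF prod]] integral_inner_grad_eq_0[OF prod, of "axis i 1"] by simp
  also have "\<dots> = (LINT x|M. \<theta> x * partial i \<xi> x + partial i \<theta> x * \<xi> x)"
    by (simp add: partial_mult smooth_differentiable test_functionsD(1)[OF \<theta>] test_functionsD(1)[OF \<xi>])
  also have "\<dots> = (LINT x|M. \<theta> x * partial i \<xi> x) + (LINT x|M. partial i \<theta> x * \<xi> x)"
    by (intro Bochner_Integration.integral_add integrable_mult_L2 test_L2[OF \<theta>] test_L2[OF \<xi>]
        test_L2[OF test_functions_partial[OF \<theta>]] test_L2[OF test_functions_partial[OF \<xi>]])
  finally show "inner_L2 M \<theta> (partial i \<xi>) = - inner_L2 M (\<lambda>x. grad \<theta> x $ i) \<xi>"
    by (simp add: inner_L2_def)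
qed

lemma H1_I: "v \<in> L2 \<Omega> \<Longrightarrow> is_weak_grad \<Omega> v D \<Longrightarrow> v \<in> H1 \<Omega>"
  by (auto simp: H1_def)

lemma H1_weak_grad:
  assumes "v \<in> H1 \<Omega>"
  shows "v \<in> L2 \<Omega>" "is_weak_grad \<Omega> v (weak_grad \<Omega> v)" "weak_grad \<Omega> v \<in> L2 \<Omega>"
proof -
  show "v \<in> L2 \<Omega>" using assms by (simp add: H1_def)
  show *: "is_weak_grad \<Omega> v (weak_grad \<Omega> v)"
    using assms unfolding H1_def weak_grad_def by (auto intro: someI_ex[of "is_weak_grad \<Omega> v"])
  show "weak_grad \<Omega> v \<in> L2 \<Omega>" by (rule is_weak_gradD(1)[OF *])
qed

lemma weak_grad_AE_eq:
  assumes "v \<in> L2 \<Omega>" "is_weak_grad \<Omega> v D"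
  shows "AE x in M. weak_grad \<Omega> v x = D x"
  using is_weak_grad_unique[OF H1_weak_grad(2)[OF H1_I[OF assms]] assms(2)] .

text \<open>A shift by the diameter \<open>2 * R\<close> moves the support off itself. Then \<theta>
  and its translate are orthogonal, the squared norm of the increment is twice that of \<theta>, and
  the increment is bounded by the gradient. A factor 2 is given away.\<close>

lemma poincare_test:
  assumes R: "\<Omega> \<subseteq> ball 0 R" and \<theta>: "\<theta> \<in> test_functions \<Omega>"
  shows "norm_L2 M \<theta> \<le> 2 * R * norm_L2 M (grad \<theta>)"
proof (cases "\<Omega> = {}")
  case True
  then have "\<theta> = (\<lambda>x. 0)" using test_functions_eq_0[OF \<theta>] by auto
  moreover have "grad (\<lambda>x. 0) = (\<lambda>x. 0)" by (auto simp: grad_def vec_eq_iff)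
  ultimately show ?thesis by simp
next
  case False
  have "R > 0" using False R by (metis ball_eq_empty not_less subset_empty)
  define e :: "real^2" where "e = (2 * R) *\<^sub>R axis 1 1"
  have ne: "norm e = 2 * R" using \<open>R > 0\<close> by (simp add: e_def)
  have disj: "\<theta> (x + e) * \<theta> x = 0" for x
  proof (rule ccontr)
    assume "\<theta> (x + e) * \<theta> x \<noteq> 0"
    then have "x + e \<in> \<Omega>" "x \<in> \<Omega>" using test_functions_eq_0[OF \<theta>] by auto
    then have "norm (x + e) < R" "norm x < R" using R by (auto simp: subset_iff)
    then show False using norm_triangle_ineq4[of "x + e" x] ne by simp
  qed
  have L2: "\<theta> \<in> L2_space lborel" "(\<lambda>x. \<theta> (x + e)) \<in> L2_space lborel"
    using test_functions_L2_lborel[OF \<theta>] test_functions_L2_lborel[OF test_functions_translate[OF \<theta>, of "- e" UNIV]] by auto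
  have "inner_L2 lborel (\<lambda>x. \<theta> (x + e)) \<theta> = 0"
    by (simp only: inner_L2_def inner_real_def disj) simp
  then have "2 * (norm_L2 lborel \<theta>)\<^sup>2 = (norm_L2 lborel (\<lambda>x. \<theta> (x + e) - \<theta> x))\<^sup>2"
    by (simp add: norm_L2_diff_power2[OF L2(2,1)] norm_L2_translate[OF test_functions_measurable(1)[OF \<theta>]])
  then have "(norm_L2 lborel \<theta>)\<^sup>2 \<le> (norm_L2 lborel (\<lambda>x. \<theta> (x + e) - \<theta> x))\<^sup>2"
    by (smt (verit) zero_le_power2)
  then have "norm_L2 lborel \<theta> \<le> norm_L2 lborel (\<lambda>x. \<theta> (x + e) - \<theta> x)"
    by (simp add: power2_le_iff_abs_le)
  also have "\<dots> \<le> norm_L2 lborel (\<lambda>x. e \<bullet> grad \<theta> x)" by (rule norm_L2_increment_le[OF \<theta>])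
  also have "\<dots> = norm_L2 M (\<lambda>x. e \<bullet> grad \<theta> x)"
    by (rule norm_L2_test[symmetric, OF test_functions_inner_grad[OF \<theta>]])
  also have "\<dots> \<le> 2 * R * norm_L2 M (grad \<theta>)"
    using \<open>R > 0\<close> Cauchy_Schwarz_ineq2[of e] ne
    by (intro norm_L2_bounded_mult test_grad_L2[OF \<theta>] test_functions_measurable(4)[OF test_functions_inner_grad[OF \<theta>]]) auto
  finally show ?thesis by (simp add: norm_L2_test[OF \<theta>])
qed

end

subsection \<open>Compactness of bounded families of test functions\<close>

lemma One_nth: "(\<Sum>x\<in>(Basis :: (real^2) set). x $ i) = 1"
proof -
  have "axis i 1 \<in> (Basis :: (real^2) set)" by (auto simp: Basis_vec_def)
  from inner_sum_Basis[OF this] show ?thesis by (simp add: inner_axis)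
qed

text \<open>Rounding down gives half-open squares of side \<open>h\<close>, so the cells partition
  the plane and every point has exactly one index.\<close>

definition cell_index :: "real \<Rightarrow> real^2 \<Rightarrow> int \<times> int" where
  "cell_index h x = (\<lfloor>x $ 1 / h\<rfloor>, \<lfloor>x $ 2 / h\<rfloor>)"

definition cell :: "real \<Rightarrow> int \<times> int \<Rightarrow> (real^2) set" where
  "cell h k = {x. cell_index h x = k}"

definition cell_corner :: "real \<Rightarrow> int \<times> int \<Rightarrow> real^2" where
  "cell_corner h k = (\<chi> i. if i = 1 then h * of_int (fst k) else h * of_int (snd k))"

lemma mem_cell_iff:
  assumes "h > 0"
  shows "x \<in> cell h k \<longleftrightarrow> (h * of_int (fst k) \<le> x $ 1 \<and> x $ 1 < h * (of_int (fst k) + 1) \<and>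
    h * of_int (snd k) \<le> x $ 2 \<and> x $ 2 < h * (of_int (snd k) + 1))"
  using assms
  by (cases k) (auto simp: cell_def cell_index_def floor_eq_iff field_simps)

lemma cell_sets [measurable]: "h > 0 \<Longrightarrow> cell h k \<in> sets borel"
proof -
  assume h: "h > 0"
  have "cell h k = {x. h * of_int (fst k) \<le> x $ 1} \<inter> {x. x $ 1 < h * (of_int (fst k) + 1)} \<inter>
    {x. h * of_int (snd k) \<le> x $ 2} \<inter> {x. x $ 2 < h * (of_int (snd k) + 1)}"
    by (auto simp: mem_cell_iff[OF h])
  also have "\<dots> \<in> sets borel"
    by (intro sets.Int borel_closed borel_open closed_Collect_le open_Collect_less continuous_intros)
  finally show ?thesis .
qed

lemma cell_between:
  assumes "h > 0"
  shows "box (cell_corner h k) (cell_corner h k + h *\<^sub>R One) \<subseteq> cell h k"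
    "cell h k \<subseteq> cbox (cell_corner h k) (cell_corner h k + h *\<^sub>R One)"
proof -
  note One = One_nth
  show "box (cell_corner h k) (cell_corner h k + h *\<^sub>R One) \<subseteq> cell h k"
    "cell h k \<subseteq> cbox (cell_corner h k) (cell_corner h k + h *\<^sub>R One)"
    by (auto simp: mem_box_cart forall_2 cell_corner_def mem_cell_iff[OF assms] One algebra_simps)
qed

lemma emeasure_cell:
  assumes h: "h > 0"
  shows "emeasure lborel (cell h k) = ennreal (h\<^sup>2)"
proof -
  let ?a = "cell_corner h k"
  have prod: "(\<Prod>b\<in>Basis. (?a + h *\<^sub>R One - ?a) \<bullet> b) = h\<^sup>2"
    by simp
  have "emeasure lborel (cell h k) \<le> emeasure lborel (cbox ?a (?a + h *\<^sub>R One))"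
    using h cell_between(2)[OF h] by (intro emeasure_mono) auto
  also have "\<dots> = ennreal (h\<^sup>2)"
    using h prod by (subst emeasure_lborel_cbox) (auto simp: inner_simps)
  finally have 1: "emeasure lborel (cell h k) \<le> ennreal (h\<^sup>2)" .
  have "ennreal (h\<^sup>2) = emeasure lborel (box ?a (?a + h *\<^sub>R One))"
    using h prod by (subst emeasure_lborel_box) (auto simp: inner_simps)
  also have "\<dots> \<le> emeasure lborel (cell h k)"
    using h cell_between(1)[OF h] by (intro emeasure_mono) auto
  finally show ?thesis using 1 by (rule antisym[rotated])
qed

lemma cell_L2:
  assumes "h > 0"
  shows "(indicator (cell h k) :: real^2 \<Rightarrow> real) \<in> L2_space lborel"
    "norm_L2 lborel (indicator (cell h k) :: real^2 \<Rightarrow> real) = h"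
proof -
  have sq: "(\<lambda>x. (norm (indicator (cell h k) x :: real))\<^sup>2) = (indicator (cell h k) :: real^2 \<Rightarrow> real)"
    by (auto simp: indicator_def)
  have int: "integrable lborel (indicator (cell h k) :: real^2 \<Rightarrow> real)"
    using assms by (intro integrable_real_indicator) (auto simp: emeasure_cell)
  then show "(indicator (cell h k) :: real^2 \<Rightarrow> real) \<in> L2_space lborel"
    using sq by (intro L2_spaceI) auto
  show "norm_L2 lborel (indicator (cell h k) :: real^2 \<Rightarrow> real) = h"
    unfolding norm_L2_def sq using assms by (simp add: measure_def emeasure_cell)
qed

text \<open>Local averages control a function up to its oscillation on the cells.\<close>

lemma cell_average_bound:
  fixes w :: "real^2 \<Rightarrow> real"
  assumes h: "h > 0" and w: "w \<in> L2_space lborel" and x: "x \<in> cell h k"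
  shows "(w x)\<^sup>2 \<le> 2 / h\<^sup>2 * (LINT y|lborel. indicator (cell h k) y * (w x - w y)\<^sup>2)
    + 2 / h ^ 4 * (LINT y|lborel. indicator (cell h k) y * w y)\<^sup>2"
proof -
  let ?i = "indicator (cell h k) :: real^2 \<Rightarrow> real"
  note i = cell_L2[OF h, of k]
  have [measurable]: "w \<in> borel_measurable borel" using w by (auto simp: L2_space_def)
  have iw: "(\<lambda>y. ?i y * w y) \<in> L2_space lborel"
    using L2_space_bounded_mult[OF w, of ?i 1] h by auto
  have d: "(\<lambda>y. ?i y * (w x - w y)) \<in> L2_space lborel"
    using L2_space_diff[OF L2_space_mult_left[OF i(1), of "w x"] iw] by (simp add: algebra_simps)
  define I where "I = (LINT y|lborel. ?i y * w y)"
  define J where "J = (LINT y|lborel. ?i y * (w x - w y)\<^sup>2)"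
  have ii: "?i y * ?i y = ?i y" for y by (auto simp: indicator_def)
  \<comment> \<open>\<open>h\<^sup>2 * w x - I\<close> is the integral of \<open>w x - w y\<close>
    over the cell. It is paired with the indicator of the cell, whose norm is
    \<open>h\<close>.\<close>
  have "inner_L2 lborel ?i (\<lambda>y. ?i y * (w x - w y)) = (LINT y|lborel. ?i y * w x - ?i y * w y)"
    unfolding inner_L2_def by (intro Bochner_Integration.integral_cong) (auto simp: algebra_simps ii indicator_def)
  also have "\<dots> = (LINT y|lborel. ?i y * w x) - I"
    unfolding I_def
    using integrable_mult_L2[OF i(1) w] h emeasure_cell[OF h, of k]
    by (intro Bochner_Integration.integral_diff) auto
  also have "(LINT y|lborel. ?i y * w x) = h\<^sup>2 * w x"
    using h by (simp add: measure_def emeasure_cell)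
  finally have "\<bar>h\<^sup>2 * w x - I\<bar> \<le> h * norm_L2 lborel (\<lambda>y. ?i y * (w x - w y))"
    using Cauchy_Schwarz_L2[OF i(1) d] i(2) by simp
  then have "\<bar>h\<^sup>2 * w x - I\<bar>\<^sup>2 \<le> (h * norm_L2 lborel (\<lambda>y. ?i y * (w x - w y)))\<^sup>2"
    by (intro power_mono) auto
  also have "\<dots> = h\<^sup>2 * J"
    unfolding power_mult_distrib norm_L2_power2 J_def
    by (intro arg_cong2[where f="(*)"] refl Bochner_Integration.integral_cong) (auto simp: indicator_def)
  finally have 1: "(h\<^sup>2 * w x - I)\<^sup>2 \<le> h\<^sup>2 * J" by simp
  have "(h\<^sup>2 * w x)\<^sup>2 \<le> 2 * (h\<^sup>2 * w x - I)\<^sup>2 + 2 * I\<^sup>2"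
    using sum_squares_bound[of "h\<^sup>2 * w x - I" I] by (simp add: power2_eq_square algebra_simps)
  also have "\<dots> \<le> 2 * (h\<^sup>2 * J) + 2 * I\<^sup>2" using 1 by simp
  finally have "h ^ 4 * (w x)\<^sup>2 \<le> 2 * h\<^sup>2 * J + 2 * I\<^sup>2"
    by (simp add: power_mult_distrib)
  then have "(w x)\<^sup>2 \<le> (2 * h\<^sup>2 * J + 2 * I\<^sup>2) / h ^ 4"
    using h by (simp add: pos_le_divide_eq mult.commute)
  also have "\<dots> = 2 / h\<^sup>2 * J + 2 / h ^ 4 * I\<^sup>2"
    using h by (simp add: add_divide_distrib power4_eq_xxxx power2_eq_square)
  finally show ?thesis by (simp add: I_def J_def)
qed

lemma nn_integral_translate:
  fixes f :: "'a::euclidean_space \<Rightarrow> ennreal"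
  assumes [measurable]: "f \<in> borel_measurable borel"
  shows "(\<integral>\<^sup>+x. f (a + x) \<partial>lborel) = (\<integral>\<^sup>+x. f x \<partial>lborel)"
proof -
  have "(\<integral>\<^sup>+x. f x \<partial>lborel) = (\<integral>\<^sup>+x. f x \<partial>distr lborel borel ((+) a))"
    by (simp add: lborel_distr_plus)
  also have "\<dots> = (\<integral>\<^sup>+x. f (a + x) \<partial>lborel)"
    by (rule nn_integral_distr) auto
  finally show ?thesis by simp
qed

text \<open>Points of one cell differ by some \<open>z\<close> in a square of area
  \<open>4 * h\<^sup>2\<close>. For fixed \<open>z\<close> the integral over \<open>x\<close> is the
  squared norm of an increment, at most \<open>L\<^sup>2 * (2 * h)\<^sup>2\<close>. The product of
  the two is the stated constant.\<close>

lemma oscillation_bound: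
  fixes w :: "real^2 \<Rightarrow> real"
  assumes h: "h > 0" and w[measurable]: "w \<in> borel_measurable borel" and L: "0 \<le> L"
    and wL2: "\<And>z. (\<lambda>x. w (x + z) - w x) \<in> L2_space lborel"
    and incr: "\<And>z. norm_L2 lborel (\<lambda>x. w (x + z) - w x) \<le> L * norm z"
  shows "(\<integral>\<^sup>+x. \<integral>\<^sup>+y. ennreal (indicator (cell h (cell_index h x)) y * (w x - w y)\<^sup>2) \<partial>lborel \<partial>lborel)
    \<le> ennreal (16 * h ^ 4 * L\<^sup>2)"
proof -
  let ?B = "cbox (- h *\<^sub>R One) (h *\<^sub>R One) :: (real^2) set"
  let ?g = "\<lambda>x z. ennreal (indicator ?B z * (w (x + z) - w x)\<^sup>2)"
  note One = One_nth
  have "(\<integral>\<^sup>+x. \<integral>\<^sup>+y. ennreal (indicator (cell h (cell_index h x)) y * (w x - w y)\<^sup>2) \<partial>lborel \<partial>lborel)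
    \<le> (\<integral>\<^sup>+x. \<integral>\<^sup>+y. ennreal (indicator ?B (y - x) * (w y - w x)\<^sup>2) \<partial>lborel \<partial>lborel)"
  proof (intro nn_integral_mono ennreal_leI)
    fix x y :: "real^2"
    have "y - x \<in> ?B" if "y \<in> cell h (cell_index h x)"
    proof -
      have "x \<in> cell h (cell_index h x)" by (simp add: cell_def)
      then show ?thesis
        using that by (auto simp: mem_cell_iff[OF h] mem_box_cart forall_2 One algebra_simps)
    qed
    then show "indicator (cell h (cell_index h x)) y * (w x - w y)\<^sup>2 \<le> indicator ?B (y - x) * (w y - w x)\<^sup>2"
      by (auto simp: indicator_def power2_commute)
  qed
  also have "\<dots> = (\<integral>\<^sup>+x. \<integral>\<^sup>+z. ?g x z \<partial>lborel \<partial>lborel)"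
  proof (rule nn_integral_cong)
    fix x :: "real^2"
    show "(\<integral>\<^sup>+y. ennreal (indicator ?B (y - x) * (w y - w x)\<^sup>2) \<partial>lborel) = (\<integral>\<^sup>+z. ?g x z \<partial>lborel)"
      by (subst nn_integral_translate[of "\<lambda>y. ennreal (indicator ?B (y - x) * (w y - w x)\<^sup>2)" x, symmetric]) auto
  qed
  \<comment> \<open>The integrand is nonnegative, so measurability alone allows the
    exchange.\<close>
  also have "\<dots> = (\<integral>\<^sup>+z. \<integral>\<^sup>+x. ?g x z \<partial>lborel \<partial>lborel)"
    by (rule lborel_pair.Fubini') measurable
  also have "\<dots> \<le> (\<integral>\<^sup>+z. ennreal (4 * h\<^sup>2 * L\<^sup>2) * indicator ?B z \<partial>lborel)"
  proof (rule nn_integral_mono)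
    fix z :: "real^2"
    show "(\<integral>\<^sup>+x. ?g x z \<partial>lborel) \<le> ennreal (4 * h\<^sup>2 * L\<^sup>2) * indicator ?B z"
    proof (cases "z \<in> ?B")
      case True
      have "norm z \<le> norm (z $ 1) + norm (z $ 2)"
        using norm_le_l1_cart[of z] by (simp add: UNIV_2)
      also have "\<dots> \<le> 2 * h"
        using True by (auto simp: mem_box_cart forall_2 One)
      finally have "L * norm z \<le> L * (2 * h)" using L by (intro mult_left_mono)
      then have le: "norm_L2 lborel (\<lambda>x. w (x + z) - w x) \<le> L * (2 * h)" using incr[of z] by linarith
      have "(\<integral>\<^sup>+x. ?g x z \<partial>lborel) = (\<integral>\<^sup>+x. ennreal ((norm (w (x + z) - w x))\<^sup>2) \<partial>lborel)"
        using True by simp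
      also have "\<dots> = ennreal ((norm_L2 lborel (\<lambda>x. w (x + z) - w x))\<^sup>2)"
        unfolding norm_L2_power2 by (rule nn_integral_eq_integral) (use wL2[of z] in \<open>auto simp: L2_space_def\<close>)
      also have "\<dots> \<le> ennreal ((L * (2 * h))\<^sup>2)"
        by (intro ennreal_leI power_mono le) auto
      also have "(L * (2 * h))\<^sup>2 = 4 * h\<^sup>2 * L\<^sup>2" by (simp add: power_mult_distrib)
      finally show ?thesis using True by simp
    qed simp
  qed
  also have "\<dots> = ennreal (4 * h\<^sup>2 * L\<^sup>2) * emeasure lborel ?B"
    by (rule nn_integral_cmult_indicator) auto
  also have "emeasure lborel ?B = ennreal ((2 * h)\<^sup>2)"
  proof -
    have "(\<Prod>b\<in>Basis. (h *\<^sub>R One - (- h *\<^sub>R One) :: real^2) \<bullet> b) = (\<Prod>b\<in>(Basis :: (real^2) set). 2 * h)"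
    proof (intro prod.cong refl)
      fix b :: "real^2" assume b: "b \<in> Basis"
      have "h *\<^sub>R One - (- h *\<^sub>R One) = (2 * h) *\<^sub>R (One :: real^2)" by (simp add: scaleR_2 flip: scaleR_scaleR)
      then show "(h *\<^sub>R One - (- h *\<^sub>R One)) \<bullet> b = 2 * h"
        by (simp only: inner_scaleR_left inner_sum_Basis[OF b])
    qed
    then show ?thesis
      using h by (subst emeasure_lborel_cbox) (auto simp: inner_simps)
  qed
  also have "ennreal (4 * h\<^sup>2 * L\<^sup>2) * ennreal ((2 * h)\<^sup>2) = ennreal (4 * h\<^sup>2 * L\<^sup>2 * (2 * h)\<^sup>2)"
    by (rule ennreal_mult[symmetric]) auto
  also have "4 * h\<^sup>2 * L\<^sup>2 * (2 * h)\<^sup>2 = 16 * h ^ 4 * L\<^sup>2"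
    by (simp add: power4_eq_xxxx power2_eq_square)
  finally show ?thesis .
qed

text \<open>Integrates the local bound over all cells. The oscillation part gives
  \<open>2 / h\<^sup>2 * 16 * h ^ 4 * L\<^sup>2\<close>; in the other part the area
  \<open>h\<^sup>2\<close> of a cell turns \<open>2 / h ^ 4\<close> into
  \<open>2 / h\<^sup>2\<close>. For small \<open>h\<close>, a function with controlled increments is
  determined up to a small error by finitely many cell integrals.\<close>

lemma grid_estimate:
  fixes w :: "real^2 \<Rightarrow> real"
  assumes h: "h > 0" and w: "w \<in> L2_space lborel" and L: "0 \<le> L" and K: "finite K" "\<And>x. w x \<noteq> 0 \<Longrightarrow> cell_index h x \<in> K"
    and wL2: "\<And>z. (\<lambda>x. w (x + z) - w x) \<in> L2_space lborel"
    and incr: "\<And>z. norm_L2 lborel (\<lambda>x. w (x + z) - w x) \<le> L * norm z"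
  shows "(norm_L2 lborel w)\<^sup>2 \<le> 32 * h\<^sup>2 * L\<^sup>2 + 2 / h\<^sup>2 * (\<Sum>k\<in>K. (LINT y|lborel. indicator (cell h k) y * w y)\<^sup>2)"
proof -
  have wm[measurable]: "w \<in> borel_measurable borel" using w by (auto simp: L2_space_def)
  let ?I = "\<lambda>k. LINT y|lborel. indicator (cell h k) y * w y"
  let ?J = "\<lambda>x. \<integral>\<^sup>+y. ennreal (indicator (cell h (cell_index h x)) y * (w x - w y)\<^sup>2) \<partial>lborel"
  have [measurable]: "(\<lambda>x :: real^2. x $ i) \<in> borel_measurable borel" for i
    by (intro borel_measurable_continuous_onI continuous_intros)
  \<comment> \<open>Spelled out with floors, the indicator is visibly measurable in \<open>x\<close>
    and \<open>y\<close> jointly.\<close>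
  have ind_eq: "indicator (cell h (cell_index h x)) y =
    (if \<lfloor>x $ 1 / h\<rfloor> = \<lfloor>y $ 1 / h\<rfloor> \<and> \<lfloor>x $ 2 / h\<rfloor> = \<lfloor>y $ 2 / h\<rfloor> then 1 else 0 :: real)" for x y
    by (auto simp: cell_def cell_index_def indicator_def)
  have Jm[measurable]: "?J \<in> borel_measurable lborel"
    unfolding ind_eq by measurable
  have pt: "ennreal ((w x)\<^sup>2) \<le> ennreal (2 / h\<^sup>2) * ?J x + (\<Sum>k\<in>K. ennreal (2 / h ^ 4 * (?I k)\<^sup>2) * indicator (cell h k) x)" for x
  proof (cases "w x = 0")
    case False
    let ?k = "cell_index h x"
    have x: "x \<in> cell h ?k" by (simp add: cell_def)
    have int: "integrable lborel (\<lambda>y. indicator (cell h ?k) y * (w x - w y)\<^sup>2)"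
    proof -
      have "(\<lambda>y. indicator (cell h ?k) y *\<^sub>R w y) \<in> L2_space lborel"
        using h by (intro L2_space_bounded_mult[OF w, of _ 1]) auto
      then have "(\<lambda>y. w x * indicator (cell h ?k) y - indicator (cell h ?k) y *\<^sub>R w y) \<in> L2_space lborel"
        by (intro L2_space_diff L2_space_mult_left cell_L2 h)
      then have "integrable lborel (\<lambda>y. (norm (w x * indicator (cell h ?k) y - indicator (cell h ?k) y *\<^sub>R w y))\<^sup>2)"
        by (simp add: L2_space_def)
      also have "(\<lambda>y. (norm (w x * indicator (cell h ?k) y - indicator (cell h ?k) y *\<^sub>R w y))\<^sup>2)
        = (\<lambda>y. indicator (cell h ?k) y * (w x - w y)\<^sup>2)"
        by (auto simp: indicator_def)
      finally show ?thesis .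
    qed
    have "(w x)\<^sup>2 \<le> 2 / h\<^sup>2 * (LINT y|lborel. indicator (cell h ?k) y * (w x - w y)\<^sup>2) + 2 / h ^ 4 * (?I ?k)\<^sup>2"
      by (rule cell_average_bound[OF h w x])
    then have "ennreal ((w x)\<^sup>2) \<le> ennreal (2 / h\<^sup>2 * (LINT y|lborel. indicator (cell h ?k) y * (w x - w y)\<^sup>2) + 2 / h ^ 4 * (?I ?k)\<^sup>2)"
      by (rule ennreal_leI)
    also have "\<dots> = ennreal (2 / h\<^sup>2) * ennreal (LINT y|lborel. indicator (cell h ?k) y * (w x - w y)\<^sup>2) + ennreal (2 / h ^ 4 * (?I ?k)\<^sup>2)"
      by (subst ennreal_plus) (auto simp: ennreal_mult'[symmetric] intro!: mult_nonneg_nonneg integral_nonneg_AE)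
    also have "ennreal (LINT y|lborel. indicator (cell h ?k) y * (w x - w y)\<^sup>2) = ?J x"
      by (rule nn_integral_eq_integral[symmetric, OF int]) auto
    also have "ennreal (2 / h ^ 4 * (?I ?k)\<^sup>2) = ennreal (2 / h ^ 4 * (?I ?k)\<^sup>2) * indicator (cell h ?k) x"
      using x by simp
    also have "\<dots> \<le> (\<Sum>k\<in>K. ennreal (2 / h ^ 4 * (?I k)\<^sup>2) * indicator (cell h k) x)"
      using K False by (intro member_le_sum) auto
    finally show ?thesis by (simp add: add_left_mono)
  qed simp
  have "ennreal ((norm_L2 lborel w)\<^sup>2) = (\<integral>\<^sup>+x. ennreal ((w x)\<^sup>2) \<partial>lborel)"
    unfolding norm_L2_power2 using w by (subst nn_integral_eq_integral[symmetric]) (auto simp: L2_space_def)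
  also have "\<dots> \<le> (\<integral>\<^sup>+x. ennreal (2 / h\<^sup>2) * ?J x + (\<Sum>k\<in>K. ennreal (2 / h ^ 4 * (?I k)\<^sup>2) * indicator (cell h k) x) \<partial>lborel)"
    by (intro nn_integral_mono pt)
  also have "\<dots> = (\<integral>\<^sup>+x. ennreal (2 / h\<^sup>2) * ?J x \<partial>lborel) + (\<integral>\<^sup>+x. (\<Sum>k\<in>K. ennreal (2 / h ^ 4 * (?I k)\<^sup>2) * indicator (cell h k) x) \<partial>lborel)"
    using h by (intro nn_integral_add) (auto intro!: borel_measurable_sum)
  also have "(\<integral>\<^sup>+x. ennreal (2 / h\<^sup>2) * ?J x \<partial>lborel) = ennreal (2 / h\<^sup>2) * (\<integral>\<^sup>+x. ?J x \<partial>lborel)"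
    by (rule nn_integral_cmult) measurable
  also have "(\<integral>\<^sup>+x. (\<Sum>k\<in>K. ennreal (2 / h ^ 4 * (?I k)\<^sup>2) * indicator (cell h k) x) \<partial>lborel)
    = (\<Sum>k\<in>K. ennreal (2 / h ^ 4 * (?I k)\<^sup>2) * emeasure lborel (cell h k))"
    using h by (subst nn_integral_sum) (auto intro!: sum.cong nn_integral_cmult_indicator)
  also have "\<dots> = (\<Sum>k\<in>K. ennreal (2 / h\<^sup>2 * (?I k)\<^sup>2))"
    using h by (intro sum.cong refl)
      (simp add: emeasure_cell ennreal_mult[symmetric] power4_eq_xxxx power2_eq_square)
  also have "\<dots> = ennreal (2 / h\<^sup>2 * (\<Sum>k\<in>K. (?I k)\<^sup>2))"
    unfolding sum_distrib_left by (rule sum_ennreal) auto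
  also have "ennreal (2 / h\<^sup>2) * (\<integral>\<^sup>+x. ?J x \<partial>lborel) + ennreal (2 / h\<^sup>2 * (\<Sum>k\<in>K. (?I k)\<^sup>2))
    \<le> ennreal (2 / h\<^sup>2) * ennreal (16 * h ^ 4 * L\<^sup>2) + ennreal (2 / h\<^sup>2 * (\<Sum>k\<in>K. (?I k)\<^sup>2))"
    by (intro add_right_mono mult_left_mono oscillation_bound h wm L wL2 incr) auto
  also have "\<dots> = ennreal (2 / h\<^sup>2 * (16 * h ^ 4 * L\<^sup>2) + 2 / h\<^sup>2 * (\<Sum>k\<in>K. (?I k)\<^sup>2))"
    by (subst ennreal_plus)
       (auto simp: ennreal_mult[symmetric] intro!: mult_nonneg_nonneg sum_nonneg divide_nonneg_nonneg)
  finally have "ennreal ((norm_L2 lborel w)\<^sup>2) \<le> ennreal (2 / h\<^sup>2 * (16 * h ^ 4 * L\<^sup>2) + 2 / h\<^sup>2 * (\<Sum>k\<in>K. (?I k)\<^sup>2))" .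
  moreover have "0 \<le> 2 / h\<^sup>2 * (16 * h ^ 4 * L\<^sup>2) + 2 / h\<^sup>2 * (\<Sum>k\<in>K. (?I k)\<^sup>2)"
    by (intro add_nonneg_nonneg mult_nonneg_nonneg sum_nonneg divide_nonneg_nonneg zero_le_power2) auto
  ultimately have "(norm_L2 lborel w)\<^sup>2 \<le> 2 / h\<^sup>2 * (16 * h ^ 4 * L\<^sup>2) + 2 / h\<^sup>2 * (\<Sum>k\<in>K. (?I k)\<^sup>2)"
    by (simp only: ennreal_le_iff)
  also have "2 / h\<^sup>2 * (16 * h ^ 4 * L\<^sup>2) = 32 * h\<^sup>2 * L\<^sup>2"
    using h by (simp add: power4_eq_xxxx power2_eq_square)
  finally show ?thesis .
qed

section \<open>Rellich's theorem for test functions\<close>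

context bounded_domain
begin

lemma norm_L2_increment_grad:
  assumes \<theta>: "\<theta> \<in> test_functions \<Omega>"
  shows "norm_L2 lborel (\<lambda>x. \<theta> (x + z) - \<theta> x) \<le> norm_L2 M (grad \<theta>) * norm z"
proof -
  have "norm_L2 lborel (\<lambda>x. \<theta> (x + z) - \<theta> x) \<le> norm_L2 lborel (\<lambda>x. z \<bullet> grad \<theta> x)"
    by (rule norm_L2_increment_le[OF \<theta>])
  also have "\<dots> = norm_L2 M (\<lambda>x. z \<bullet> grad \<theta> x)"
    by (rule norm_L2_test[symmetric, OF test_functions_inner_grad[OF \<theta>]])
  also have "\<dots> \<le> norm z * norm_L2 M (grad \<theta>)"
    using Cauchy_Schwarz_ineq2[of z]
    by (intro norm_L2_bounded_mult test_grad_L2[OF \<theta>] test_functions_measurable(4)[OF test_functions_inner_grad[OF \<theta>]]) auto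
  finally show ?thesis by (simp add: mult.commute)
qed

lemma finite_cells:
  assumes h: "h > 0"
  obtains K where "finite K" "\<And>\<theta> x. \<theta> \<in> test_functions \<Omega> \<Longrightarrow> \<theta> x \<noteq> 0 \<Longrightarrow> cell_index h x \<in> K"
proof -
  obtain R where R: "\<And>x. x \<in> \<Omega> \<Longrightarrow> norm x \<le> R"
    using bounded_domain by (auto simp: bounded_iff)
  define N where "N = \<lceil>R / h\<rceil> + 1"
  have "cell_index h x \<in> {-N..N} \<times> {-N..N}" if "x \<in> \<Omega>" for x
  proof -
    have "\<lfloor>x $ i / h\<rfloor> \<in> {-N..N}" for i
    proof -
      have "\<bar>x $ i\<bar> \<le> R" using component_le_norm_cart[of x i] R[OF that] by linarith
      then have "- (R / h) \<le> x $ i / h" "x $ i / h \<le> R / h"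
        using h by (auto simp: field_simps)
      then show ?thesis unfolding N_def atLeastAtMost_iff by linarith
    qed
    then show ?thesis by (simp add: cell_index_def)
  qed
  then have "cell_index h x \<in> {-N..N} \<times> {-N..N}" if "\<theta> \<in> test_functions \<Omega>" "\<theta> x \<noteq> 0" for \<theta> x
    using test_functions_eq_0[OF that(1), of x] that(2) by blast
  then show ?thesis by (rule that[rotated]) auto
qed

lemma test_grad_diff:
  assumes "\<theta> \<in> test_functions A" "\<xi> \<in> test_functions A"
  shows "grad (\<lambda>x. \<theta> x - \<xi> x) = (\<lambda>x. grad \<theta> x - grad \<xi> x)"
  by (auto simp: vec_eq_iff fun_eq_iff partial_diff smooth_differentiable test_functionsD(1)[OF assms(1)] test_functionsD(1)[OF assms(2)])

text \<open>A diagonal subsequence makes every cell integral converge, for all mesh sizes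
  simultaneously. Given \<open>e\<close>, the mesh is chosen first so that the gradient term is
  small, and then the finitely many cell integrals of that mesh are made small.\<close>

lemma rellich_test:
  fixes \<theta> :: "nat \<Rightarrow> real^2 \<Rightarrow> real"
  assumes \<theta>: "\<And>n. \<theta> n \<in> test_functions \<Omega>" and C: "\<And>n. norm_L2 M (grad (\<theta> n)) \<le> C"
  obtains r :: "nat \<Rightarrow> nat" where "strict_mono r" "\<forall>e>0. \<exists>N. \<forall>m\<ge>N. \<forall>n\<ge>N. norm_L2 M (\<lambda>x. \<theta> (r m) x - \<theta> (r n) x) < e"
proof -
  obtain R where R: "\<Omega> \<subseteq> ball 0 R" "R > 0"
    using bounded_domain bounded_subset_ballD[of \<Omega> 0] by blast
  have C0: "0 \<le> C" using C norm_L2_nonneg order_trans by blast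
  define h where "h j = 1 / real (Suc j)" for j
  have h: "0 < h j" "h j \<le> 1" for j by (auto simp: h_def)
  define I where "I w jk = (LINT y|lborel. indicator (cell (h (fst jk)) (snd jk)) y * w y)" for w :: "real^2 \<Rightarrow> real" and jk
  have \<theta>L2: "\<theta> n \<in> L2_space lborel" for n by (rule test_functions_L2_lborel[OF \<theta>])
  have I_le: "norm (I (\<theta> n) jk) \<le> 2 * R * C" for n jk
  proof -
    have "\<bar>I (\<theta> n) jk\<bar> \<le> h (fst jk) * norm_L2 lborel (\<theta> n)"
      using Cauchy_Schwarz_L2[OF cell_L2(1)[OF h(1)[of "fst jk"], of "snd jk"] \<theta>L2[of n]]
      by (simp add: I_def inner_L2_def cell_L2(2)[OF h(1)])
    also have "\<dots> \<le> 1 * norm_L2 lborel (\<theta> n)" using h by (intro mult_right_mono) auto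
    also have "\<dots> = norm_L2 M (\<theta> n)" by (simp add: norm_L2_test[OF \<theta>])
    also have "\<dots> \<le> 2 * R * norm_L2 M (grad (\<theta> n))" by (rule poincare_test[OF R(1) \<theta>])
    also have "\<dots> \<le> 2 * R * C" using R C by (intro mult_left_mono) auto
    finally show ?thesis by simp
  qed
  \<comment> \<open>Pairs of a mesh index and a cell form one countable index set, so a single
    extraction suffices.\<close>
  have "countable (UNIV :: (nat \<times> (int \<times> int)) set)" by simp
  then obtain r where r: "strict_mono r" and conv: "\<And>jk. \<exists>l. (\<lambda>n. I (\<theta> (r n)) jk) \<longlonglongrightarrow> l"
    using function_convergent_subsequence[of UNIV "\<lambda>n. I (\<theta> n)" "2 * R * C"] I_le by (metis UNIV_I)
  have "\<exists>N. \<forall>m\<ge>N. \<forall>n\<ge>N. norm_L2 M (\<lambda>x. \<theta> (r m) x - \<theta> (r n) x) < e" if e: "e > 0" for e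
  proof -
    have "(\<lambda>j. 32 * (h j)\<^sup>2 * (2 * C)\<^sup>2) \<longlonglongrightarrow> 32 * 0\<^sup>2 * (2 * C)\<^sup>2"
      unfolding h_def by (intro tendsto_intros LIMSEQ_Suc[OF lim_1_over_n])
    then have "eventually (\<lambda>j. 32 * (h j)\<^sup>2 * (2 * C)\<^sup>2 < e\<^sup>2 / 2) sequentially"
      by (rule order_tendstoD(2)) (use e in simp)
    then obtain j where j: "32 * (h j)\<^sup>2 * (2 * C)\<^sup>2 < e\<^sup>2 / 2" by (auto simp: eventually_sequentially)
    obtain K where K: "finite K" "\<And>\<theta> x. \<theta> \<in> test_functions \<Omega> \<Longrightarrow> \<theta> x \<noteq> 0 \<Longrightarrow> cell_index (h j) x \<in> K"
      using finite_cells[OF h(1)] by blast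
    \<comment> \<open>Chosen so that \<open>card K\<close> terms of size \<open>d\<close>,
      multiplied by \<open>2 / (h j)\<^sup>2\<close>, stay below \<open>e\<^sup>2 / 2\<close>. The
      summand 1 covers an empty \<open>K\<close>.\<close>
    define d where "d = e\<^sup>2 * (h j)\<^sup>2 / (4 * (real (card K) + 1))"
    have d: "d > 0" using e h[of j] by (simp add: d_def)
    have "\<exists>N. \<forall>m\<ge>N. \<forall>n\<ge>N. (I (\<theta> (r m)) (j, k) - I (\<theta> (r n)) (j, k))\<^sup>2 < d" for k
    proof -
      have "Cauchy (\<lambda>n. I (\<theta> (r n)) (j, k))"
        using conv[of "(j, k)"] LIMSEQ_imp_Cauchy by blast
      then obtain N where N: "\<And>m n. m \<ge> N \<Longrightarrow> n \<ge> N \<Longrightarrow> norm (I (\<theta> (r m)) (j, k) - I (\<theta> (r n)) (j, k)) < sqrt d"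
        using d by (metis CauchyD real_sqrt_gt_zero)
      have "(I (\<theta> (r m)) (j, k) - I (\<theta> (r n)) (j, k))\<^sup>2 < d" if "m \<ge> N" "n \<ge> N" for m n
        using N[OF that] d by (metis real_norm_def real_sqrt_abs real_sqrt_less_iff)
      then show ?thesis by blast
    qed
    then obtain N where N: "\<And>k m n. m \<ge> N k \<Longrightarrow> n \<ge> N k \<Longrightarrow> (I (\<theta> (r m)) (j, k) - I (\<theta> (r n)) (j, k))\<^sup>2 < d" by metis
    \<comment> \<open>The element 0 keeps the set nonempty when there are no cells.\<close>
    define N' where "N' = Max (insert 0 (N ` K))"
    have N': "N k \<le> N'" if "k \<in> K" for k
      unfolding N'_def using K that by (intro Max_ge) auto
    have "norm_L2 M (\<lambda>x. \<theta> (r m) x - \<theta> (r n) x) < e" if mn: "m \<ge> N'" "n \<ge> N'" for m n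
    proof -
      let ?w = "\<lambda>x. \<theta> (r m) x - \<theta> (r n) x"
      have w: "?w \<in> test_functions \<Omega>" by (rule test_functions_diff[OF \<theta> \<theta>])
      have gw: "norm_L2 M (grad ?w) \<le> 2 * C"
        unfolding test_grad_diff[OF \<theta> \<theta>]
        using norm_L2_diff_le[OF test_grad_L2[OF \<theta>] test_grad_L2[OF \<theta>], of "r m" "r n"] C[of "r m"] C[of "r n"] by linarith
      have Iw: "I ?w (j, k) = I (\<theta> (r m)) (j, k) - I (\<theta> (r n)) (j, k)" for k
        unfolding I_def fst_conv snd_conv
        using integrable_mult_L2[OF cell_L2(1)[OF h(1), of j k] \<theta>L2]
        by (simp add: right_diff_distrib)
      have "(norm_L2 lborel ?w)\<^sup>2 \<le> 32 * (h j)\<^sup>2 * (2 * C)\<^sup>2 + 2 / (h j)\<^sup>2 * (\<Sum>k\<in>K. (LINT y|lborel. indicator (cell (h j) k) y * ?w y)\<^sup>2)"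
      proof (rule grid_estimate[OF h(1) test_functions_L2_lborel[OF w] _ K(1)])
        show "0 \<le> 2 * C" using C0 by simp
        show "?w x \<noteq> 0 \<Longrightarrow> cell_index (h j) x \<in> K" for x using K(2)[OF w] .
        show "(\<lambda>x. ?w (x + z) - ?w x) \<in> L2_space lborel" for z
          using L2_space_diff[OF test_functions_L2_lborel[OF test_functions_translate[OF w, of "- z" UNIV]] test_functions_L2_lborel[OF w]]
          by simp
        show "norm_L2 lborel (\<lambda>x. ?w (x + z) - ?w x) \<le> 2 * C * norm z" for z
          using norm_L2_increment_grad[OF w, of z] mult_right_mono[OF gw norm_ge_zero[of z]] by linarith
      qed
      also have "(\<Sum>k\<in>K. (LINT y|lborel. indicator (cell (h j) k) y * ?w y)\<^sup>2) \<le> (\<Sum>k\<in>K. d)"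
      proof (rule sum_mono)
        fix k assume "k \<in> K"
        then have "(I ?w (j, k))\<^sup>2 < d" unfolding Iw using N N'[of k] mn by (meson order_trans)
        then show "(LINT y|lborel. indicator (cell (h j) k) y * ?w y)\<^sup>2 \<le> d" by (simp add: I_def)
      qed
      also have "2 / (h j)\<^sup>2 * (\<Sum>k\<in>K. d) = e\<^sup>2 / 2 * (real (card K) / (real (card K) + 1))"
        using h(1)[of j] by (simp add: d_def field_simps)
      also have "\<dots> \<le> e\<^sup>2 / 2 * 1" by (intro mult_left_mono) auto
      finally have "(norm_L2 lborel ?w)\<^sup>2 < e\<^sup>2" using j h(1)[of j] by (simp add: divide_right_mono)
      then have "norm_L2 lborel ?w < e" using e by (intro power2_less_imp_less[of _ e]) auto
      then show ?thesis by (simp add: norm_L2_test[OF w])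
    qed
    then show ?thesis by blast
  qed
  then have "\<forall>e>0. \<exists>N. \<forall>m\<ge>N. \<forall>n\<ge>N. norm_L2 M (\<lambda>x. \<theta> (r m) x - \<theta> (r n) x) < e"
    by blast
  then show ?thesis by (rule that[OF r])
qed

end

subsection \<open>Interpolation on Lipschitz domains\<close>

lemma integrable_lebesgue_on_subset:
  fixes f :: "'a::euclidean_space \<Rightarrow> real"
  assumes "integrable (lebesgue_on S) f" "T \<subseteq> S" "S \<in> sets lebesgue" "T \<in> sets lebesgue"
  shows "integrable (lebesgue_on T) f"
proof -
  have "integrable lebesgue (\<lambda>x. indicator S x *\<^sub>R f x)"
    using assms(1,3) by (subst (asm) integrable_restrict_space) auto
  from integrable_mult_indicator[OF assms(4) this]
  have "integrable lebesgue (\<lambda>x. indicator T x *\<^sub>R (indicator S x *\<^sub>R f x))" .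
  also have "(\<lambda>x. indicator T x *\<^sub>R (indicator S x *\<^sub>R f x)) = (\<lambda>x. indicator T x *\<^sub>R f x)"
    using assms(2) by (auto simp: indicator_def fun_eq_iff)
  finally show ?thesis using assms(4) by (subst integrable_restrict_space) auto
qed

text \<open>Near a boundary point the domain lies below a graph of slope at most \<open>L\<close>.
  Moving down at rate \<open>L + 1\<close> while moving sideways at rate 1 stays below the graph, on
  either side. The two directions are independent, so the two directional derivatives control the
  whole gradient; at interior points the coordinate axes serve.\<close>

lemma lipschitz_domain_cone:
  assumes lip: "lipschitz_domain \<Omega>" and p: "p \<in> closure \<Omega>"
  obtains r \<tau> d1 d2 where "r > 0" "\<tau> > 0" "\<And>w :: real^2. norm w \<le> \<bar>d1 \<bullet> w\<bar> + \<bar>d2 \<bullet> w\<bar>"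
    "\<And>x t. x \<in> \<Omega> \<inter> ball p r \<Longrightarrow> 0 \<le> t \<Longrightarrow> t \<le> \<tau> \<Longrightarrow> x + t *\<^sub>R d1 \<in> \<Omega> \<and> x + t *\<^sub>R d2 \<in> \<Omega>"
proof (cases "p \<in> \<Omega>")
  case True
  have "open \<Omega>" using lip by (simp add: lipschitz_domain_def)
  then obtain e where e: "e > 0" "ball p e \<subseteq> \<Omega>" using True by (meson open_contains_ball)
  show ?thesis
  proof (rule that[of "e / 2" "e / 2" "axis 1 1" "axis 2 1"])
    show "norm w \<le> \<bar>axis 1 1 \<bullet> w\<bar> + \<bar>axis 2 1 \<bullet> w\<bar>" for w :: "real^2"
      using norm_le_l1_cart[of w] by (simp add: UNIV_2 inner_axis')
    have *: "x + t *\<^sub>R axis i 1 \<in> \<Omega>" if "x \<in> \<Omega> \<inter> ball p (e / 2)" "0 \<le> t" "t \<le> e / 2" for x t i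
    proof -
      have "dist p (x + t *\<^sub>R axis i 1) \<le> dist p x + t"
        using norm_triangle_ineq4[of "p - x" "t *\<^sub>R axis i 1"] that by (simp add: dist_norm algebra_simps)
      then have "x + t *\<^sub>R axis i 1 \<in> ball p e" using that by auto
      then show ?thesis using e by blast
    qed
    show "x + t *\<^sub>R axis 1 1 \<in> \<Omega> \<and> x + t *\<^sub>R axis 2 1 \<in> \<Omega>" if "x \<in> \<Omega> \<inter> ball p (e / 2)" "0 \<le> t" "t \<le> e / 2" for x t
      using *[OF that] by blast
  qed (use e in auto)
next
  case False
  have "open \<Omega>" using lip by (simp add: lipschitz_domain_def)
  then have "p \<in> frontier \<Omega>" using False p by (simp add: frontier_def interior_open)
  then obtain R \<epsilon> L h where R: "orthogonal_transformation (R :: real^2 \<Rightarrow> real^2)" and \<epsilon>: "\<epsilon> > 0"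
    and L: "L-lipschitz_on UNIV (h :: real \<Rightarrow> real)"
    and graph: "\<And>y. y \<in> ball p \<epsilon> \<Longrightarrow> y \<in> \<Omega> \<longleftrightarrow> R (y - p) $ 2 < h (R (y - p) $ 1)"
    using lip unfolding lipschitz_domain_def by metis
  have L0: "L \<ge> 0" using L lipschitz_on_nonneg by blast
  have lin: "linear R" using R by (simp add: orthogonal_transformation_def)
  have inner: "R v \<bullet> R w = v \<bullet> w" for v w using R by (simp add: orthogonal_transformation_def)
  obtain e1 e2 where e: "R e1 = axis 1 1" "R e2 = axis 2 1"
    using orthogonal_transformation_surj[OF R] by (metis surjD)
  define d where "d s = s *\<^sub>R e1 - (L + 1) *\<^sub>R e2" for s :: real
  have Rd: "R (d s) = s *\<^sub>R axis 1 1 - (L + 1) *\<^sub>R axis 2 1" for s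
    by (simp add: d_def linear_diff[OF lin] linear_scale[OF lin] e)
  have Rd_nth: "R (d s) $ 1 = s" "R (d s) $ 2 = - (L + 1)" for s
    by (auto simp: Rd axis_def)
  \<comment> \<open>Segments of this length change the position by at most
    \<open>\<epsilon> / 2\<close>, so starting in \<open>ball p (\<epsilon> / 2)\<close> they remain
    where the graph describes the domain.\<close>
  define \<tau> where "\<tau> = \<epsilon> / (2 * (norm (d 1) + norm (d (-1)) + 1))"
  have den: "norm (d 1) + norm (d (-1)) + 1 > 0" using norm_ge_zero[of "d 1"] norm_ge_zero[of "d (-1)"] by linarith
  have \<tau>: "\<tau> > 0" using \<epsilon> den by (simp add: \<tau>_def)
  have main: "x + t *\<^sub>R d s \<in> \<Omega>" if x: "x \<in> \<Omega> \<inter> ball p (\<epsilon> / 2)" and t: "0 \<le> t" "t \<le> \<tau>" and s: "s = 1 \<or> s = -1" for x t s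
  proof -
    have "t * norm (d s) \<le> \<tau> * (norm (d 1) + norm (d (-1)) + 1)"
      using t s norm_ge_zero[of "d 1"] norm_ge_zero[of "d (-1)"] \<tau> by (intro mult_mono) auto
    also have "\<dots> = \<epsilon> / 2" using den by (simp add: \<tau>_def field_simps)
    finally have "norm (t *\<^sub>R d s) \<le> \<epsilon> / 2" using t by simp
    moreover have "norm (x - p) < \<epsilon> / 2" using x by (simp add: dist_norm norm_minus_commute)
    ultimately have "norm ((x - p) + t *\<^sub>R d s) < \<epsilon>"
      using norm_triangle_ineq[of "x - p" "t *\<^sub>R d s"] by linarith
    moreover have "norm (p - (x + t *\<^sub>R d s)) = norm ((x - p) + t *\<^sub>R d s)"
      by (subst norm_minus_commute) (simp add: algebra_simps)
    ultimately have in_ball: "x + t *\<^sub>R d s \<in> ball p \<epsilon>" by (simp add: dist_norm)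
    have "x \<in> ball p \<epsilon>" using x \<epsilon> by auto
    then have below: "R (x - p) $ 2 < h (R (x - p) $ 1)" using graph x by blast
    have Rx: "R (x + t *\<^sub>R d s - p) = R (x - p) + t *\<^sub>R R (d s)"
      using linear_add[OF lin, of "x - p" "t *\<^sub>R d s"] by (simp add: linear_scale[OF lin] algebra_simps)
    have "\<bar>h (R (x - p) $ 1) - h (R (x - p) $ 1 + t * s)\<bar> \<le> L * \<bar>t * s\<bar>"
      using lipschitz_onD[OF L, of "R (x - p) $ 1" "R (x - p) $ 1 + t * s"] by (simp add: dist_real_def)
    moreover have "\<bar>t * s\<bar> = t" using s t by auto
    ultimately have "h (R (x - p) $ 1) \<le> h (R (x - p) $ 1 + t * s) + L * t" by simp
    then have "R (x - p) $ 2 - t * (L + 1) < h (R (x - p) $ 1 + t * s)"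
      using below t by (simp add: algebra_simps)
    then have "R (x + t *\<^sub>R d s - p) $ 2 < h (R (x + t *\<^sub>R d s - p) $ 1)"
      by (simp add: Rx Rd_nth algebra_simps)
    then show ?thesis using graph[OF in_ball] by blast
  qed
  show ?thesis
  proof (rule that[of "\<epsilon> / 2" \<tau> "d 1" "d (-1)"])
    show "norm w \<le> \<bar>d 1 \<bullet> w\<bar> + \<bar>d (-1) \<bullet> w\<bar>" for w
    proof -
      define a b where "a = e1 \<bullet> w" and "b = e2 \<bullet> w"
      have "norm w = norm (R w)" using inner[of w w] by (simp add: norm_eq_sqrt_inner)
      also have "\<dots> \<le> \<bar>R w $ 1\<bar> + \<bar>R w $ 2\<bar>"
        using norm_le_l1_cart[of "R w"] by (simp add: UNIV_2)
      also have "R w $ 1 = a" using inner[of e1 w] by (simp add: a_def e inner_axis')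
      also have "R w $ 2 = b" using inner[of e2 w] by (simp add: b_def e inner_axis')
      finally have 1: "norm w \<le> \<bar>a\<bar> + \<bar>b\<bar>" .
      have d: "d 1 \<bullet> w = a - (L + 1) * b" "d (-1) \<bullet> w = - a - (L + 1) * b"
        by (auto simp: d_def a_def b_def inner_diff_left inner_scaleR_left)
      \<comment> \<open>The difference of the two inner products is \<open>2 * a\<close> and their
        sum is \<open>- 2 * (L + 1) * b\<close>. Hence the sum of their absolute values dominates
        both \<open>2 * \<bar>a\<bar>\<close> and \<open>2 * \<bar>b\<bar>\<close>.\<close>
      have "\<bar>b\<bar> \<le> \<bar>(L + 1) * b\<bar>" using L0 by (simp add: abs_mult mult_le_cancel_right1)
      then show ?thesis using 1 unfolding d by linarith
    qed
    show "x + t *\<^sub>R d 1 \<in> \<Omega> \<and> x + t *\<^sub>R d (- 1) \<in> \<Omega>" if "x \<in> \<Omega> \<inter> ball p (\<epsilon> / 2)" "0 \<le> t" "t \<le> \<tau>" for x t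
      using main[OF that] by blast
  qed (use \<epsilon> \<tau> in auto)
qed

text \<open>Gradient and Hessian are explicit arguments rather than chosen representatives. Linear
  combinations and limits can then be formed componentwise, without corrections on null
  sets.\<close>

definition is_H2 :: "(real^2) set \<Rightarrow> (real^2 \<Rightarrow> real) \<Rightarrow> (real^2 \<Rightarrow> real^2) \<Rightarrow> (real^2 \<Rightarrow> real^2^2) \<Rightarrow> bool" where
  "is_H2 \<Omega> v D H \<longleftrightarrow> v \<in> L2 \<Omega> \<and> is_weak_grad \<Omega> v D \<and> (\<forall>i. is_weak_grad \<Omega> (\<lambda>x. D x $ i) (\<lambda>x. H x $ i))"

context bounded_domain
begin

lemma is_H2D:
  assumes "is_H2 \<Omega> v D H"
  shows "v \<in> L2 \<Omega>" "is_weak_grad \<Omega> v D" "is_weak_grad \<Omega> (\<lambda>x. D x $ i) (\<lambda>x. H x $ i)"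
    "D \<in> L2 \<Omega>" "H \<in> L2 \<Omega>"
proof -
  show "v \<in> L2 \<Omega>" "is_weak_grad \<Omega> v D" "is_weak_grad \<Omega> (\<lambda>x. D x $ i) (\<lambda>x. H x $ i)" for i
    using assms by (auto simp: is_H2_def)
  then show "D \<in> L2 \<Omega>" "H \<in> L2 \<Omega>"
    by (auto intro: is_weak_gradD(1) L2_space_vec)
qed

lemma L2_space_inner_const:
  assumes "D \<in> L2 \<Omega>"
  shows "(\<lambda>x. d \<bullet> D x) \<in> L2 \<Omega>"
  using assms by (intro L2_space_inner_bounded[of _ _ "\<lambda>x. d" "norm d"]) auto

lemma weak_directional_derivative:
  assumes D: "is_weak_grad \<Omega> v D" and v: "v \<in> L2 \<Omega>" and \<theta>: "\<theta> \<in> test_functions \<Omega>"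
  shows "inner_L2 M v (\<lambda>x. d \<bullet> grad \<theta> x) = - inner_L2 M (\<lambda>x. d \<bullet> D x) \<theta>"
proof -
  note DD = is_weak_gradD[OF D]
  note P = test_L2[OF test_functions_partial[OF \<theta>]]
  have "inner_L2 M v (\<lambda>x. d \<bullet> grad \<theta> x) = inner_L2 M v (\<lambda>x. d $ 1 * partial 1 \<theta> x + d $ 2 * partial 2 \<theta> x)"
    by (simp add: inner_vec_def UNIV_2)
  also have "\<dots> = d $ 1 * inner_L2 M v (partial 1 \<theta>) + d $ 2 * inner_L2 M v (partial 2 \<theta>)"
    by (simp add: inner_L2_add L2_space_mult_left P v inner_L2_mult)
  also have "\<dots> = - (d $ 1 * inner_L2 M (\<lambda>x. D x $ 1) \<theta> + d $ 2 * inner_L2 M (\<lambda>x. D x $ 2) \<theta>)"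
    by (simp add: DD(2)[OF \<theta>])
  also have "d $ 1 * inner_L2 M (\<lambda>x. D x $ 1) \<theta> + d $ 2 * inner_L2 M (\<lambda>x. D x $ 2) \<theta>
    = inner_L2 M (\<lambda>x. d $ 1 * D x $ 1 + d $ 2 * D x $ 2) \<theta>"
    by (simp add: inner_L2_add L2_space_mult_left DD(3) test_L2[OF \<theta>] inner_L2_mult)
  also have "\<dots> = inner_L2 M (\<lambda>x. d \<bullet> D x) \<theta>"
    by (simp add: inner_vec_def UNIV_2)
  finally show ?thesis .
qed

text \<open>Both derivatives are moved from \<theta> onto \<open>v\<close>, which leaves the Hessian
  applied twice to \<open>d\<close>. The factor 2 comes from estimating the two rows of
  \<open>H\<close> separately.\<close>

lemma weak_second_directional_derivative:
  assumes v: "is_H2 \<Omega> v D H" and \<theta>: "\<theta> \<in> test_functions \<Omega>"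
  shows "\<bar>inner_L2 M v (\<lambda>x. d \<bullet> grad (\<lambda>x. d \<bullet> grad \<theta> x) x)\<bar> \<le> 2 * (norm d)\<^sup>2 * norm_L2 M H * norm_L2 M \<theta>"
proof -
  note H = is_H2D[OF v]
  let ?S = "\<lambda>x. d $ 1 *\<^sub>R H x $ 1 + d $ 2 *\<^sub>R H x $ 2"
  have "is_weak_grad \<Omega> (\<lambda>x. d $ 1 * D x $ 1 + d $ 2 * D x $ 2) ?S"
    by (rule is_weak_grad_lincomb[OF H(3) H(3)]) (use is_weak_gradD(3)[OF H(2)] in auto)
  then have S: "is_weak_grad \<Omega> (\<lambda>x. d \<bullet> D x) ?S"
    by (simp add: inner_vec_def UNIV_2)
  have "inner_L2 M v (\<lambda>x. d \<bullet> grad (\<lambda>x. d \<bullet> grad \<theta> x) x) = - inner_L2 M (\<lambda>x. d \<bullet> D x) (\<lambda>x. d \<bullet> grad \<theta> x)"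
    by (rule weak_directional_derivative[OF H(2,1) test_functions_inner_grad[OF \<theta>]])
  also have "\<dots> = inner_L2 M (\<lambda>x. d \<bullet> ?S x) \<theta>"
    using weak_directional_derivative[OF S L2_space_inner_const[OF H(4)] \<theta>, of d] by simp
  finally have eq: "inner_L2 M v (\<lambda>x. d \<bullet> grad (\<lambda>x. d \<bullet> grad \<theta> x) x) = inner_L2 M (\<lambda>x. d \<bullet> ?S x) \<theta>" .
  have SL2: "(\<lambda>x. d \<bullet> ?S x) \<in> L2 \<Omega>" by (rule L2_space_inner_const[OF is_weak_gradD(1)[OF S]])
  have "norm_L2 M (\<lambda>x. d \<bullet> ?S x) \<le> (2 * (norm d)\<^sup>2) * norm_L2 M H"
  proof (rule norm_L2_bounded_mult[OF H(5) L2_spaceD(1)[OF SL2]])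
    fix x
    have "norm (d $ i *\<^sub>R H x $ i) \<le> norm d * norm (H x)" for i
      using component_le_norm_cart[of d i] Finite_Cartesian_Product.norm_nth_le[of "H x" i]
      by (auto intro!: mult_mono)
    from this[of 1] this[of 2] have "norm (?S x) \<le> 2 * (norm d * norm (H x))"
      using norm_triangle_ineq[of "d $ 1 *\<^sub>R H x $ 1" "d $ 2 *\<^sub>R H x $ 2"] by linarith
    then have "norm d * norm (?S x) \<le> norm d * (2 * (norm d * norm (H x)))"
      by (intro mult_left_mono) auto
    then show "norm (d \<bullet> ?S x) \<le> 2 * (norm d)\<^sup>2 * norm (H x)"
      using Cauchy_Schwarz_ineq2[of d "?S x"] by (simp add: power2_eq_square mult_ac)
  qed simp
  then have "norm_L2 M (\<lambda>x. d \<bullet> ?S x) * norm_L2 M \<theta> \<le> 2 * (norm d)\<^sup>2 * norm_L2 M H * norm_L2 M \<theta>"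
    by (intro mult_right_mono) auto
  then show ?thesis
    using Cauchy_Schwarz_L2[OF SL2 test_L2[OF \<theta>]] unfolding eq by linarith
qed

text \<open>The Taylor constant of \<theta> does not depend on the point and \<open>v\<close> is
  integrable, so the difference quotient deviates from the claimed derivative by at most
  \<open>K * \<bar>s\<bar>\<close>.\<close>

lemma DERIV_inner_translate:
  assumes v: "v \<in> L2 \<Omega>" and \<theta>: "\<theta> \<in> test_functions A"
  shows "((\<lambda>t. inner_L2 M v (\<lambda>x. \<theta> (x - t *\<^sub>R d))) has_real_derivative
    - inner_L2 M v (\<lambda>x. d \<bullet> grad \<theta> (x - t *\<^sub>R d))) (at t)"
proof -
  obtain C where C: "0 \<le> C" "\<And>x t. \<bar>\<theta> (x + t *\<^sub>R (- d)) - \<theta> x - t * (- d \<bullet> grad \<theta> x)\<bar> \<le> C * t\<^sup>2"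
    using test_functions_Taylor[OF \<theta>, of "- d"] by blast
  define F where "F t = inner_L2 M v (\<lambda>x. \<theta> (x - t *\<^sub>R d))" for t
  define F' where "F' = - inner_L2 M v (\<lambda>x. d \<bullet> grad \<theta> (x - t *\<^sub>R d))"
  define K where "K = C * (LINT x|M. \<bar>v x\<bar>)"
  have tr: "(\<lambda>x. \<xi> (x - a)) \<in> L2 \<Omega>" if "\<xi> \<in> test_functions A" for \<xi> a
    by (rule test_L2[OF test_functions_translate[OF that, of a UNIV]]) simp
  have \<theta>L2: "(\<lambda>x. \<theta> (x - a)) \<in> L2 \<Omega>" for a by (rule tr[OF \<theta>])
  have dL2: "(\<lambda>x. d \<bullet> grad \<theta> (x - a)) \<in> L2 \<Omega>" for a by (rule tr[OF test_functions_inner_grad[OF \<theta>]])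
  have int: "integrable M (\<lambda>x. v x * \<xi> x)" if "\<xi> \<in> L2 \<Omega>" for \<xi> by (rule integrable_mult_L2[OF v that])
  have est: "\<bar>F (t + s) - F t - s * F'\<bar> \<le> K * s\<^sup>2" for s
  proof -
    let ?r = "\<lambda>x. \<theta> (x - (t + s) *\<^sub>R d) - \<theta> (x - t *\<^sub>R d) + s * (d \<bullet> grad \<theta> (x - t *\<^sub>R d))"
    have rL2: "?r \<in> L2 \<Omega>" by (intro L2_space_add L2_space_diff \<theta>L2 L2_space_mult_left dL2)
    have r: "\<bar>?r x\<bar> \<le> C * s\<^sup>2" for x
      using C(2)[of "x - t *\<^sub>R d" s] by (simp add: algebra_simps)
    have "F (t + s) - F t - s * F' = inner_L2 M v ?r"
      by (simp add: F_def F'_def inner_L2_add inner_L2_diff L2_space_diff L2_space_mult_left \<theta>L2 dL2 v inner_L2_mult)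
    also have "\<bar>\<dots>\<bar> \<le> (LINT x|M. \<bar>v x\<bar> * (C * s\<^sup>2))"
      unfolding inner_L2_def inner_real_def real_norm_def[symmetric]
    proof (rule Bochner_Integration.integral_norm_bound_integral[OF int[OF rL2]])
      show "integrable M (\<lambda>x. norm (v x) * (C * s\<^sup>2))" using integrable_L2[OF v] by simp
      show "norm (v x * ?r x) \<le> norm (v x) * (C * s\<^sup>2)" for x
        using r[of x] by (auto simp: abs_mult intro!: mult_left_mono)
    qed
    also have "\<dots> = K * s\<^sup>2" by (simp add: K_def mult_ac)
    finally show ?thesis .
  qed
  have "(\<lambda>s. (F (t + s) - F t) / s) \<midarrow>0\<rightarrow> F'"
  proof (rule LIM_zero_cancel, rule Lim_null_comparison)
    show "\<forall>\<^sub>F s in at 0. norm ((F (t + s) - F t) / s - F') \<le> K * \<bar>s\<bar>"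
    proof (rule eventually_at_filter[THEN iffD2, OF always_eventually], intro allI impI)
      fix s :: real assume s: "s \<noteq> 0"
      have "(F (t + s) - F t) / s - F' = (F (t + s) - F t - s * F') / s"
        using s by (simp add: diff_divide_distrib)
      then have "\<bar>s\<bar> * \<bar>(F (t + s) - F t) / s - F'\<bar> = \<bar>F (t + s) - F t - s * F'\<bar>"
        using s by simp
      also have "\<dots> \<le> \<bar>s\<bar> * (K * \<bar>s\<bar>)" using est[of s] by (simp add: power2_eq_square mult_ac)
      finally show "norm ((F (t + s) - F t) / s - F') \<le> K * \<bar>s\<bar>" using s by simp
    qed
    show "((\<lambda>s. K * \<bar>s\<bar>) \<longlongrightarrow> 0) (at 0)" by (auto intro!: tendsto_eq_intros)
  qed
  then show ?thesis by (simp add: DERIV_def F_def F'_def)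
qed

text \<open>Interpolation along a segment: a first derivative is controlled by the function and its second derivative.\<close>

lemma directional_interpolation:
  assumes v: "is_H2 \<Omega> v D H" and \<tau>: "\<tau> > 0" and U: "open U" "U \<subseteq> \<Omega>"
    and seg: "\<And>x t. x \<in> U \<Longrightarrow> 0 \<le> t \<Longrightarrow> t \<le> \<tau> \<Longrightarrow> x + t *\<^sub>R d \<in> \<Omega>"
  shows "norm_L2 (lebesgue_on U) (\<lambda>x. d \<bullet> D x) \<le> 2 / \<tau> * norm_L2 M v + 2 * \<tau> * (norm d)\<^sup>2 * norm_L2 M H"
proof -
  interpret U: bounded_domain U
    using U bounded_domain bounded_subset by unfold_locales auto
  note H = is_H2D[OF v]
  let ?C = "2 / \<tau> * norm_L2 M v + 2 * \<tau> * (norm d)\<^sup>2 * norm_L2 M H"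
  let ?dD = "\<lambda>x. d \<bullet> D x"
  have restr: "integrable (lebesgue_on U) f" if "integrable M f" for f :: "real^2 \<Rightarrow> real"
    by (rule integrable_lebesgue_on_subset[OF that U(2) domain_sets U.domain_sets])
  have dDL2: "?dD \<in> L2 \<Omega>" by (rule L2_space_inner_const[OF H(4)])
  have dDU: "?dD \<in> L2 U"
  proof (rule L2_spaceI)
    show "?dD \<in> borel_measurable (lebesgue_on U)"
      using measurable_restrict_mono[OF L2_spaceD(1)[OF dDL2] U(2)] .
    show "integrable (lebesgue_on U) (\<lambda>x. (norm (?dD x))\<^sup>2)"
      by (rule restr[OF L2_spaceD(2)[OF dDL2]])
  qed
  show ?thesis
  proof (rule U.norm_L2_le_by_duality[OF dDU])
    show "0 \<le> ?C" using \<tau> by simp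
    fix \<theta> assume \<theta>: "\<theta> \<in> test_functions U"
    have \<theta>\<Omega>: "\<theta> \<in> test_functions \<Omega>" using \<theta> test_functions_mono[OF U(2)] by blast
    \<comment> \<open>Translating the test function replaces the translation of \<open>v\<close>:
      \<open>F t\<close> stands for \<theta> paired with \<open>v\<close> displaced by
      \<open>t *\<^sub>R d\<close>. Supports in \<open>U\<close> are carried into the domain, so no
      derivative of \<open>v\<close> beyond the weak ones is involved.\<close>
    define F where "F t = inner_L2 M v (\<lambda>x. \<theta> (x - t *\<^sub>R d))" for t
    define F1 where "F1 t = - inner_L2 M v (\<lambda>x. d \<bullet> grad \<theta> (x - t *\<^sub>R d))" for t
    define N where "N = norm_L2 (lebesgue_on U) \<theta>"
    have tr: "(\<lambda>x. \<theta> (x - t *\<^sub>R d)) \<in> test_functions \<Omega>" if "0 \<le> t" "t \<le> \<tau>" for t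
      by (rule test_functions_translate[OF \<theta>]) (use seg that in auto)
    have Ntr: "norm_L2 M (\<lambda>x. \<theta> (x - t *\<^sub>R d)) \<le> N" if "0 \<le> t" "t \<le> \<tau>" for t
    proof -
      have "norm_L2 M (\<lambda>x. \<theta> (x - t *\<^sub>R d)) = norm_L2 lborel (\<lambda>x. \<theta> (x + (- t *\<^sub>R d)))"
        using norm_L2_test[OF tr[OF that]] by simp
      also have "\<dots> = norm_L2 lborel \<theta>"
        by (rule norm_L2_translate[OF test_functions_measurable(1)[OF \<theta>]])
      finally show ?thesis by (simp add: N_def U.norm_L2_test[OF \<theta>])
    qed
    have F: "(F has_real_derivative F1 t) (at t)" for t
      unfolding F_def F1_def by (rule DERIV_inner_translate[OF H(1) \<theta>])
    have F1: "(F1 has_real_derivative inner_L2 M v (\<lambda>x. d \<bullet> grad (\<lambda>x. d \<bullet> grad \<theta> x) (x - t *\<^sub>R d))) (at t)" for t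
      unfolding F1_def using DERIV_minus[OF DERIV_inner_translate[OF H(1) test_functions_inner_grad[OF \<theta>], of d d t]] by simp
    define K where "K = 2 * (norm d)\<^sup>2 * norm_L2 M H * N"
    have F2: "\<bar>inner_L2 M v (\<lambda>x. d \<bullet> grad (\<lambda>x. d \<bullet> grad \<theta> x) (x - t *\<^sub>R d))\<bar> \<le> K" if "0 \<le> t" "t \<le> \<tau>" for t
    proof -
      let ?\<xi> = "\<lambda>x. \<theta> (x - t *\<^sub>R d)"
      have g1: "d \<bullet> grad ?\<xi> x = d \<bullet> grad \<theta> (x - t *\<^sub>R d)" for x
        using partial_translate[OF test_functionsD(1)[OF \<theta>], of _ "- (t *\<^sub>R d)"]
        by (simp add: inner_vec_def)
      have "d \<bullet> grad (\<lambda>x. d \<bullet> grad ?\<xi> x) x = d \<bullet> grad (\<lambda>x. d \<bullet> grad \<theta> x) (x - t *\<^sub>R d)" for x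
        unfolding g1
        using partial_translate[OF test_functionsD(1)[OF test_functions_inner_grad[OF \<theta>, of d]], of _ "- (t *\<^sub>R d)"]
        by (simp add: inner_vec_def[of d "grad _ _"])
      then have "\<bar>inner_L2 M v (\<lambda>x. d \<bullet> grad (\<lambda>x. d \<bullet> grad \<theta> x) (x - t *\<^sub>R d))\<bar> \<le> 2 * (norm d)\<^sup>2 * norm_L2 M H * norm_L2 M ?\<xi>"
        using weak_second_directional_derivative[OF v tr[OF that], of d] by simp
      also have "\<dots> \<le> K"
        unfolding K_def using Ntr[OF that] by (intro mult_left_mono) auto
      finally show ?thesis .
    qed
    \<comment> \<open>At some intermediate \<open>s\<close> the derivative equals the slope of
      \<open>F\<close> over the segment and is bounded by \<open>v\<close> alone. Returning from
      \<open>s\<close> to 0 costs at most \<tau> times the bound \<open>K\<close> on the second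
      derivative.\<close>
    obtain s where s: "0 < s" "s < \<tau>" "F \<tau> - F 0 = (\<tau> - 0) * F1 s" using MVT2[OF \<tau> F] by blast
    obtain r where r: "0 < r" "r < s"
      "F1 s - F1 0 = (s - 0) * inner_L2 M v (\<lambda>x. d \<bullet> grad (\<lambda>x. d \<bullet> grad \<theta> x) (x - r *\<^sub>R d))"
      using MVT2[OF s(1) F1] by blast
    have "\<bar>F1 s - F1 0\<bar> \<le> \<tau> * K"
      unfolding r(3) abs_mult using F2[of r] r s by (intro mult_mono) auto
    then have "\<tau> * \<bar>F1 s - F1 0\<bar> \<le> \<tau> * (\<tau> * K)" using \<tau> by (intro mult_left_mono) auto
    moreover have "\<bar>F t\<bar> \<le> norm_L2 M v * N" if "0 \<le> t" "t \<le> \<tau>" for t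
    proof -
      have "\<bar>F t\<bar> \<le> norm_L2 M v * norm_L2 M (\<lambda>x. \<theta> (x - t *\<^sub>R d))"
        unfolding F_def by (rule Cauchy_Schwarz_L2[OF H(1) test_L2[OF tr[OF that]]])
      also have "\<dots> \<le> norm_L2 M v * N" by (intro mult_left_mono Ntr that) auto
      finally show ?thesis .
    qed
    from this[of 0] this[of \<tau>] have "\<tau> * \<bar>F1 s\<bar> \<le> 2 * norm_L2 M v * N"
      using s(3) \<tau> abs_triangle_ineq4[of "F \<tau>" "F 0"] by (simp add: abs_mult)
    moreover have "\<bar>F1 0\<bar> \<le> \<bar>F1 s\<bar> + \<bar>F1 s - F1 0\<bar>" by linarith
    then have "\<tau> * \<bar>F1 0\<bar> \<le> \<tau> * \<bar>F1 s\<bar> + \<tau> * \<bar>F1 s - F1 0\<bar>"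
      using \<tau> by (metis distrib_left less_imp_le mult_left_mono)
    ultimately have "\<tau> * \<bar>F1 0\<bar> \<le> 2 * norm_L2 M v * N + \<tau> * (\<tau> * K)" by linarith
    also have "\<dots> = \<tau> * (?C * N)" using \<tau> by (simp add: K_def field_simps)
    finally have "\<bar>F1 0\<bar> \<le> ?C * N" using \<tau> by simp
    moreover have "F1 0 = inner_L2 M ?dD \<theta>"
      unfolding F1_def using weak_directional_derivative[OF H(2,1) \<theta>\<Omega>, of d] by simp
    moreover have "inner_L2 M ?dD \<theta> = inner_L2 (lebesgue_on U) ?dD \<theta>"
    proof -
      have "inner_L2 M ?dD \<theta> = (LINT x|lebesgue. indicator \<Omega> x *\<^sub>R (?dD x * \<theta> x))"
        unfolding inner_L2_def by (subst integral_restrict_space) auto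
      also have "\<dots> = (LINT x|lebesgue. indicator U x *\<^sub>R (?dD x * \<theta> x))"
        using test_functions_eq_0[OF \<theta>] U(2) by (intro Bochner_Integration.integral_cong) (auto simp: indicator_def)
      also have "\<dots> = inner_L2 (lebesgue_on U) ?dD \<theta>"
        unfolding inner_L2_def by (subst integral_restrict_space) auto
      finally show ?thesis .
    qed
    ultimately show "\<bar>inner_L2 (lebesgue_on U) ?dD \<theta>\<bar> \<le> ?C * norm_L2 (lebesgue_on U) \<theta>"
      by (simp add: N_def)
  qed
qed

lemma L2_subdomain:
  fixes f :: "real^2 \<Rightarrow> 'b::euclidean_space"
  assumes f: "f \<in> L2 \<Omega>" and U: "U \<subseteq> \<Omega>" "U \<in> sets lebesgue"
  shows "f \<in> L2 U"
proof (rule L2_spaceI)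
  show "f \<in> borel_measurable (lebesgue_on U)"
    by (rule measurable_restrict_mono[OF L2_spaceD(1)[OF f] U(1)])
  show "integrable (lebesgue_on U) (\<lambda>x. (norm (f x))\<^sup>2)"
    by (rule integrable_lebesgue_on_subset[OF L2_spaceD(2)[OF f] U(1) domain_sets U(2)])
qed

lemma norm_L2_cover:
  fixes f :: "real^2 \<Rightarrow> 'b::euclidean_space"
  assumes f: "f \<in> L2 \<Omega>" and P: "finite P" "\<Omega> \<subseteq> (\<Union>p\<in>P. U p)" "\<And>p. p \<in> P \<Longrightarrow> open (U p)"
    and c: "\<And>p. p \<in> P \<Longrightarrow> norm_L2 (lebesgue_on (\<Omega> \<inter> U p)) f \<le> c p"
  shows "norm_L2 M f \<le> (\<Sum>p\<in>P. c p)"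
proof -
  have c0: "0 \<le> c p" if "p \<in> P" for p using c[OF that] norm_L2_nonneg order_trans by blast
  have int: "integrable lebesgue (\<lambda>x. indicator \<Omega> x *\<^sub>R (norm (f x))\<^sup>2)"
    using L2_spaceD(2)[OF f] by (subst (asm) integrable_restrict_space) auto
  have sets: "\<Omega> \<inter> U p \<in> sets lebesgue" if "p \<in> P" for p using P(3)[OF that] open_domain by auto
  have intp: "integrable lebesgue (\<lambda>x. indicator (\<Omega> \<inter> U p) x *\<^sub>R (norm (f x))\<^sup>2)" if "p \<in> P" for p
    using L2_spaceD(2)[OF L2_subdomain[OF f Int_lower1 sets[OF that]]] sets[OF that]
    by (subst (asm) integrable_restrict_space) auto
  have "(norm_L2 M f)\<^sup>2 = (LINT x|lebesgue. indicator \<Omega> x *\<^sub>R (norm (f x))\<^sup>2)"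
    unfolding norm_L2_power2 by (subst integral_restrict_space) auto
  also have "\<dots> \<le> (LINT x|lebesgue. (\<Sum>p\<in>P. indicator (\<Omega> \<inter> U p) x *\<^sub>R (norm (f x))\<^sup>2))"
  proof (rule integral_mono[OF int])
    show "integrable lebesgue (\<lambda>x. \<Sum>p\<in>P. indicator (\<Omega> \<inter> U p) x *\<^sub>R (norm (f x))\<^sup>2)"
      by (rule Bochner_Integration.integrable_sum[OF intp])
    fix x
    show "indicator \<Omega> x *\<^sub>R (norm (f x))\<^sup>2 \<le> (\<Sum>p\<in>P. indicator (\<Omega> \<inter> U p) x *\<^sub>R (norm (f x))\<^sup>2)"
    proof (cases "x \<in> \<Omega>")
      case True
      then obtain p where p: "p \<in> P" "x \<in> U p" using P(2) by blast
      have "indicator \<Omega> x *\<^sub>R (norm (f x))\<^sup>2 = indicator (\<Omega> \<inter> U p) x *\<^sub>R (norm (f x))\<^sup>2" using True p by simp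
      also have "\<dots> \<le> (\<Sum>p\<in>P. indicator (\<Omega> \<inter> U p) x *\<^sub>R (norm (f x))\<^sup>2)"
        by (rule member_le_sum[OF p(1)]) (use P in auto)
      finally show ?thesis .
    qed (auto intro: sum_nonneg)
  qed
  also have "\<dots> = (\<Sum>p\<in>P. LINT x|lebesgue. indicator (\<Omega> \<inter> U p) x *\<^sub>R (norm (f x))\<^sup>2)"
    by (rule Bochner_Integration.integral_sum[OF intp])
  also have "\<dots> = (\<Sum>p\<in>P. (norm_L2 (lebesgue_on (\<Omega> \<inter> U p)) f)\<^sup>2)"
    unfolding norm_L2_power2 by (intro sum.cong refl, subst integral_restrict_space) (use sets in auto)
  also have "\<dots> \<le> (\<Sum>p\<in>P. (c p)\<^sup>2)"
    by (intro sum_mono power_mono c) auto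
  \<comment> \<open>For nonnegative numbers the sum of squares is at most the square of the
    sum.\<close>
  also have "\<dots> \<le> (\<Sum>p\<in>P. c p)\<^sup>2"
    using P(1) c0
  proof (induction P rule: finite_induct)
    case (insert p P)
    then have "0 \<le> c p * (\<Sum>p\<in>P. c p)" by (auto intro!: mult_nonneg_nonneg sum_nonneg)
    then show ?case using insert by (simp add: power2_sum)
  qed simp
  finally have "(norm_L2 M f)\<^sup>2 \<le> (\<Sum>p\<in>P. c p)\<^sup>2" .
  then show ?thesis by (rule power2_le_imp_le) (rule sum_nonneg[OF c0])
qed

text \<open>Each point of the closure has a ball on which the two cone directions control the
  gradient. Compactness of the closure leaves finitely many balls, and the local constants are
  added.\<close>

lemma gradient_bound:
  assumes lip: "lipschitz_domain \<Omega>"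
  obtains C where "0 \<le> C" "\<And>v D H. is_H2 \<Omega> v D H \<Longrightarrow> norm_L2 M D \<le> C * (norm_L2 M v + norm_L2 M H)"
proof -
  have local: "\<exists>r>0. \<exists>c\<ge>0. \<forall>v D H. is_H2 \<Omega> v D H \<longrightarrow> norm_L2 (lebesgue_on (\<Omega> \<inter> ball p r)) D \<le> c * (norm_L2 M v + norm_L2 M H)"
    if p: "p \<in> closure \<Omega>" for p
  proof -
    obtain r \<tau> d1 d2 where r: "r > 0" and \<tau>: "\<tau> > 0" and ind: "\<And>w :: real^2. norm w \<le> \<bar>d1 \<bullet> w\<bar> + \<bar>d2 \<bullet> w\<bar>"
      and cone: "\<And>x t. x \<in> \<Omega> \<inter> ball p r \<Longrightarrow> 0 \<le> t \<Longrightarrow> t \<le> \<tau> \<Longrightarrow> x + t *\<^sub>R d1 \<in> \<Omega> \<and> x + t *\<^sub>R d2 \<in> \<Omega>"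
      using lipschitz_domain_cone[OF lip p] by blast
    let ?U = "\<Omega> \<inter> ball p r"
    \<comment> \<open>The sum of the interpolation constants for \<open>d1\<close> and
      \<open>d2\<close>; the term \<open>4 / \<tau>\<close> is twice
      \<open>2 / \<tau>\<close>.\<close>
    define c where "c = 4 / \<tau> + 2 * \<tau> * (norm d1)\<^sup>2 + 2 * \<tau> * (norm d2)\<^sup>2"
    have U: "open ?U" "?U \<subseteq> \<Omega>" "?U \<in> sets lebesgue" using open_domain by auto
    have "norm_L2 (lebesgue_on ?U) D \<le> c * (norm_L2 M v + norm_L2 M H)" if v: "is_H2 \<Omega> v D H" for v D H
    proof -
      note H = is_H2D[OF v]
      let ?a = "\<lambda>x. \<bar>d1 \<bullet> D x\<bar>" and ?b = "\<lambda>x. \<bar>d2 \<bullet> D x\<bar>"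
      have DU: "D \<in> L2 ?U" by (rule L2_subdomain[OF H(4) U(2,3)])
      have ab: "(\<lambda>x. d \<bullet> D x) \<in> L2 ?U" "(\<lambda>x. \<bar>d \<bullet> D x\<bar>) \<in> L2 ?U" for d
        using L2_subdomain[OF L2_space_inner_const[OF H(4)] U(2,3), of d] by (auto simp: L2_space_def)
      have abs: "norm_L2 (lebesgue_on ?U) (\<lambda>x. \<bar>d \<bullet> D x\<bar>) = norm_L2 (lebesgue_on ?U) (\<lambda>x. d \<bullet> D x)" for d
        by (simp add: norm_L2_def)
      have "norm_L2 (lebesgue_on ?U) D \<le> norm_L2 (lebesgue_on ?U) (\<lambda>x. ?a x + ?b x)"
        using ind by (intro norm_L2_mono L2_space_add ab L2_spaceD(1)[OF DU]) auto
      also have "\<dots> \<le> norm_L2 (lebesgue_on ?U) (\<lambda>x. d1 \<bullet> D x) + norm_L2 (lebesgue_on ?U) (\<lambda>x. d2 \<bullet> D x)"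
        using norm_L2_add_le[OF ab(2)[of d1] ab(2)[of d2]] by (simp add: abs)
      also have "\<dots> \<le> (2 / \<tau> * norm_L2 M v + 2 * \<tau> * (norm d1)\<^sup>2 * norm_L2 M H)
          + (2 / \<tau> * norm_L2 M v + 2 * \<tau> * (norm d2)\<^sup>2 * norm_L2 M H)"
        using cone by (intro add_mono directional_interpolation[OF v \<tau> U(1,2)]) blast+
      also have "\<dots> = (4 / \<tau>) * norm_L2 M v + (2 * \<tau> * (norm d1)\<^sup>2 + 2 * \<tau> * (norm d2)\<^sup>2) * norm_L2 M H"
        by (simp add: algebra_simps)
      also have "\<dots> \<le> c * norm_L2 M v + c * norm_L2 M H"
        using \<tau> by (intro add_mono mult_right_mono) (auto simp: c_def)
      finally show ?thesis by (simp add: algebra_simps)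
    qed
    moreover have "c \<ge> 0" using \<tau> by (simp add: c_def)
    ultimately show ?thesis using r by blast
  qed
  then obtain r c where rc: "\<And>p. p \<in> closure \<Omega> \<Longrightarrow> r p > 0" "\<And>p. p \<in> closure \<Omega> \<Longrightarrow> c p \<ge> (0::real)"
    "\<And>p v D H. p \<in> closure \<Omega> \<Longrightarrow> is_H2 \<Omega> v D H \<Longrightarrow> norm_L2 (lebesgue_on (\<Omega> \<inter> ball p (r p))) D \<le> c p * (norm_L2 M v + norm_L2 M H)"
    by metis
  have "compact (closure \<Omega>)" using bounded_domain by simp
  moreover have "closure \<Omega> \<subseteq> (\<Union>p\<in>closure \<Omega>. ball p (r p))" using rc(1) by auto
  ultimately obtain P where P: "P \<subseteq> closure \<Omega>" "finite P" "closure \<Omega> \<subseteq> (\<Union>p\<in>P. ball p (r p))"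
    using compactE_image[of "closure \<Omega>" "closure \<Omega>" "\<lambda>p. ball p (r p)"] by (metis open_ball)
  show ?thesis
  proof (rule that)
    show "0 \<le> (\<Sum>p\<in>P. c p)" using rc(2) P(1) by (intro sum_nonneg) auto
    show "norm_L2 M D \<le> (\<Sum>p\<in>P. c p) * (norm_L2 M v + norm_L2 M H)" if v: "is_H2 \<Omega> v D H" for v D H
      unfolding sum_distrib_right
      using P rc(3)[OF _ v] closure_subset[of \<Omega>]
      by (intro norm_L2_cover[OF is_H2D(4)[OF v], of P "\<lambda>p. ball p (r p)"]) auto
  qed
qed

end

subsection \<open>A product estimate and the space \<open>H1_0\<close>\<close>

lemma integral_abs_mult_le:
  fixes f g :: "'a \<Rightarrow> real"
  assumes "f \<in> L2_space M" "g \<in> L2_space M"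
  shows "(LINT x|M. \<bar>f x * g x\<bar>) \<le> norm_L2 M f * norm_L2 M g"
proof -
  have abs: "(\<lambda>x. \<bar>f x\<bar>) \<in> L2_space M" if "f \<in> L2_space M" for f :: "'a \<Rightarrow> real"
    using that by (auto simp: L2_space_def)
  have n: "norm_L2 M (\<lambda>x. \<bar>f x\<bar>) = norm_L2 M f" for f :: "'a \<Rightarrow> real"
    by (simp add: norm_L2_def)
  have "(LINT x|M. \<bar>f x * g x\<bar>) \<le> \<bar>inner_L2 M (\<lambda>x. \<bar>f x\<bar>) (\<lambda>x. \<bar>g x\<bar>)\<bar>"
    by (simp add: inner_L2_def abs_mult)
  also have "\<dots> \<le> norm_L2 M (\<lambda>x. \<bar>f x\<bar>) * norm_L2 M (\<lambda>x. \<bar>g x\<bar>)"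
    by (rule Cauchy_Schwarz_L2[OF abs[OF assms(1)] abs[OF assms(2)]])
  finally show ?thesis by (simp only: n)
qed

lemma bump2_eq: "i \<noteq> j \<Longrightarrow> bump2 a b n x = bump1 (a $ i) (b $ i) n (x $ i) * bump1 (a $ j) (b $ j) n (x $ j)"
  using exhaust_2[of i] exhaust_2[of j] by (auto simp: bump2_def)

lemma sum_indicator_strips_le_1:
  fixes t h :: real
  assumes "finite K" "h > 0"
  shows "(\<Sum>k\<in>K. indicator {h * of_int k<..<h * (of_int k + 1)} t) \<le> (1 :: real)"
proof -
  have "(\<Sum>k\<in>K. indicator {h * of_int k<..<h * (of_int k + 1)} t) \<le> (\<Sum>k\<in>K. if k = \<lfloor>t / h\<rfloor> then 1 else 0 :: real)"
  proof (rule sum_mono)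
    fix k
    show "indicator {h * of_int k<..<h * (of_int k + 1)} t \<le> (if k = \<lfloor>t / h\<rfloor> then 1 else 0 :: real)"
    proof (cases "t \<in> {h * of_int k<..<h * (of_int k + 1)}")
      case True
      then have "\<lfloor>t / h\<rfloor> = k"
        using assms(2) by (intro floor_unique) (auto simp: field_simps)
      then show ?thesis by simp
    qed simp
  qed
  also have "\<dots> \<le> 1" using assms(1) by (simp add: sum.delta)
  finally show ?thesis .
qed

lemma sum_indicator_cells_le_1:
  assumes "finite K"
  shows "(\<Sum>k\<in>K. indicator (cell h k) x) \<le> (1 :: real)"
proof -
  have "(\<Sum>k\<in>K. indicator (cell h k) x) = (\<Sum>k\<in>K. if k = cell_index h x then 1 else 0 :: real)"
    by (intro sum.cong refl) (auto simp: indicator_def cell_def)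
  also have "\<dots> \<le> 1" using assms by (simp add: sum.delta)
  finally show ?thesis .
qed

context bounded_domain
begin

lemma norm_L2_domain_le:
  fixes f :: "real^2 \<Rightarrow> real"
  assumes L2: "f \<in> L2_space lborel"
  shows "f \<in> L2 \<Omega>" "norm_L2 M f \<le> norm_L2 lborel f"
proof -
  have fm: "f \<in> borel_measurable lborel" using L2 by (simp add: L2_space_def)
  then have [measurable]: "f \<in> borel_measurable borel" by simp
  have i: "integrable lebesgue (\<lambda>x. (norm (f x))\<^sup>2)"
    using L2 by (subst integrable_completion) (auto simp: L2_space_def)
  have eq: "(LINT x|M. (norm (f x))\<^sup>2) = (LINT x|lebesgue. indicator \<Omega> x *\<^sub>R (norm (f x))\<^sup>2)"
    by (subst integral_restrict_space) auto
  also have "\<dots> \<le> (LINT x|lebesgue. (norm (f x))\<^sup>2)"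
    using i integrable_mult_indicator[OF domain_sets i]
    by (intro integral_mono) (auto simp: indicator_def)
  also have "\<dots> = (LINT x|lborel. (norm (f x))\<^sup>2)"
    by (rule integral_completion) auto
  finally show "norm_L2 M f \<le> norm_L2 lborel f" unfolding norm_L2_def by (rule real_sqrt_le_mono)
  show "f \<in> L2 \<Omega>"
  proof (rule L2_spaceI)
    show "f \<in> borel_measurable M" using measurable_completion[OF fm] by (rule measurable_restrict_space1)
    show "integrable M (\<lambda>x. (norm (f x))\<^sup>2)"
      using integrable_mult_indicator[OF domain_sets i] by (subst integrable_restrict_space) auto
  qed
qed

lemma test_mult_L2:
  assumes "u \<in> L2 \<Omega>" "\<theta> \<in> test_functions A"
  shows "(\<lambda>x. u x * \<theta> x) \<in> L2 \<Omega>"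
proof -
  obtain C where "\<And>x. \<bar>\<theta> x\<bar> \<le> C" using test_functions_bounded[OF assms(2)] by blast
  then show ?thesis
    using L2_space_bounded_mult[OF assms(1) test_functions_measurable(4)[OF assms(2)], of C] by (simp add: mult.commute)
qed

text \<open>The Leibniz formula for the weak derivative of \<open>u \<theta>\<close> in direction
  \<open>i\<close>. As a sum of products of L2 functions it is integrable.\<close>

definition product_derivative :: "(real^2 \<Rightarrow> real) \<Rightarrow> (real^2 \<Rightarrow> real^2) \<Rightarrow> (real^2 \<Rightarrow> real) \<Rightarrow> 2 \<Rightarrow> real^2 \<Rightarrow> real" where
  "product_derivative u D \<theta> i x = u x * partial i \<theta> x + D x $ i * \<theta> x"

lemma product_derivative_integrable:
  assumes "u \<in> L2 \<Omega>" "D \<in> L2 \<Omega>" "\<theta> \<in> test_functions \<Omega>"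
  shows "integrable M (product_derivative u D \<theta> i)"
    "(LINT x|M. \<bar>product_derivative u D \<theta> i x\<bar>) \<le> norm_L2 M u * norm_L2 M (grad \<theta>) + norm_L2 M D * norm_L2 M \<theta>"
proof -
  note P = test_L2[OF test_functions_partial[OF assms(3)], of i] and T = test_L2[OF assms(3)]
  note Di = L2_space_nth[OF assms(2), of i]
  have i1: "integrable M (\<lambda>x. u x * partial i \<theta> x)" by (rule integrable_mult_L2[OF assms(1) P])
  have i2: "integrable M (\<lambda>x. D x $ i * \<theta> x)" by (rule integrable_mult_L2[OF Di T])
  show int: "integrable M (product_derivative u D \<theta> i)"
    unfolding product_derivative_def using i1 i2 by simp
  have "(LINT x|M. \<bar>product_derivative u D \<theta> i x\<bar>) \<le> (LINT x|M. \<bar>u x * partial i \<theta> x\<bar> + \<bar>D x $ i * \<theta> x\<bar>)"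
    using int i1 i2 by (intro integral_mono) (auto simp: product_derivative_def abs_triangle_ineq)
  also have "\<dots> = (LINT x|M. \<bar>u x * partial i \<theta> x\<bar>) + (LINT x|M. \<bar>D x $ i * \<theta> x\<bar>)"
    using i1 i2 by simp
  also have "\<dots> \<le> norm_L2 M u * norm_L2 M (partial i \<theta>) + norm_L2 M (\<lambda>x. D x $ i) * norm_L2 M \<theta>"
    by (intro add_mono integral_abs_mult_le assms(1) P Di T)
  also have "\<dots> \<le> norm_L2 M u * norm_L2 M (grad \<theta>) + norm_L2 M D * norm_L2 M \<theta>"
  proof (intro add_mono mult_left_mono mult_right_mono)
    show "norm_L2 M (partial i \<theta>) \<le> norm_L2 M (grad \<theta>)"
      using Finite_Cartesian_Product.norm_nth_le[of "grad \<theta> _" i]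
      by (intro norm_L2_mono[OF test_grad_L2[OF assms(3)] L2_spaceD(1)[OF P]]) simp
    show "norm_L2 M (\<lambda>x. D x $ i) \<le> norm_L2 M D"
      by (intro norm_L2_mono[OF assms(2) L2_spaceD(1)[OF Di]] Finite_Cartesian_Product.norm_nth_le)
  qed auto
  finally show "(LINT x|M. \<bar>product_derivative u D \<theta> i x\<bar>) \<le> norm_L2 M u * norm_L2 M (grad \<theta>) + norm_L2 M D * norm_L2 M \<theta>" .
qed

text \<open>Test with a cut-off in one direction and the primitive of a cut-off in the other one.\<close>

lemma product_box_estimate:
  assumes u: "u \<in> L2 \<Omega>" and D: "is_weak_grad \<Omega> u D" and \<theta>: "\<theta> \<in> test_functions \<Omega>"
    and ij: "i \<noteq> j" and ab: "a $ i \<le> b $ i"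
  shows "\<bar>LINT x|M. indicator (box a b) x * (u x * \<theta> x)\<bar>
    \<le> (b $ i - a $ i) * (LINT x|M. indicator {a $ j<..<b $ j} (x $ j) * \<bar>product_derivative u D \<theta> i x\<bar>)"
proof -
  note DD = is_weak_gradD[OF D]
  let ?P = "product_derivative u D \<theta> i"
  let ?S = "LINT x|M. indicator {a $ j<..<b $ j} (x $ j) * \<bar>?P x\<bar>"
  have intP: "integrable M ?P" by (rule product_derivative_integrable(1)[OF u DD(1) \<theta>])
  have [measurable]: "(\<lambda>x :: real^2. x $ k) \<in> borel_measurable M" for k
    by (intro measurable_restrict_space1 measurable_completion) (auto intro!: borel_measurable_continuous_onI continuous_intros)
  have intS: "integrable M (\<lambda>x. indicator {a $ j<..<b $ j} (x $ j) * \<bar>?P x\<bar>)"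
    by (rule Bochner_Integration.integrable_bound[OF integrable_abs[OF intP]])
       (use intP in \<open>auto simp: indicator_def\<close>)
  have est: "\<bar>LINT x|M. bump2 a b n x * (u x * \<theta> x)\<bar> \<le> (b $ i - a $ i) * ?S" for n
  proof -
    obtain A where A: "smooth (\<lambda>x. A (x $ i))" "\<And>t. (A has_real_derivative bump1 (a $ i) (b $ i) n t) (at t)"
      "\<And>t. 0 \<le> A t \<and> A t \<le> b $ i - a $ i"
      using bump1_primitive[OF ab, of i n] by blast
    let ?\<beta> = "\<lambda>x :: real^2. bump1 (a $ j) (b $ j) n (x $ j)"
    let ?\<Psi> = "\<lambda>x. A (x $ i) * ?\<beta> x"
    have \<Psi>: "smooth ?\<Psi>" by (intro smooth_mult A(1) smooth_bump1_coord)
    have \<Theta>: "(\<lambda>x. ?\<Psi> x * \<theta> x) \<in> test_functions \<Omega>" by (rule test_functions_mult[OF \<theta> \<Psi>])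
    have pA: "partial i (\<lambda>x. A (x $ i)) x = bump1 (a $ i) (b $ i) n (x $ i)" for x
      using partial_eqI[OF has_derivative_coord[of A "bump1 (a $ i) (b $ i) n (x $ i)" 1 x i 0], of i] A(2) by simp
    \<comment> \<open>The second factor depends on the coordinate \<open>j\<close> only, so it is
      constant along axis \<open>i\<close>.\<close>
    have p\<beta>: "partial i ?\<beta> x = 0" for x
    proof -
      have "(?\<beta> has_derivative (\<lambda>y. y \<bullet> grad ?\<beta> x)) (at x)" by (rule smooth_has_derivative[OF smooth_bump1_coord])
      then have "((\<lambda>t. ?\<beta> (x + t *\<^sub>R axis i 1)) has_real_derivative (axis i 1 \<bullet> grad ?\<beta> (x + 0 *\<^sub>R axis i 1))) (at 0)"
        using DERIV_along_line[OF smooth_bump1_coord] by blast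
      moreover have "(\<lambda>t. ?\<beta> (x + t *\<^sub>R axis i 1)) = (\<lambda>t. ?\<beta> x)"
        using ij by (simp add: axis_def)
      ultimately show ?thesis using DERIV_unique[OF _ DERIV_const] by fastforce
    qed
    have p\<Theta>: "partial i (\<lambda>x. ?\<Psi> x * \<theta> x) x = ?\<Psi> x * partial i \<theta> x + bump2 a b n x * \<theta> x" for x
      using smooth_differentiable[OF \<Psi>] smooth_differentiable[OF test_functionsD(1)[OF \<theta>]]
        smooth_differentiable[OF A(1)] smooth_differentiable[OF smooth_bump1_coord]
      by (simp add: partial_mult pA p\<beta> bump2_eq[OF ij])
    have L2s: "(\<lambda>x. ?\<Psi> x * partial i \<theta> x) \<in> L2 \<Omega>" "(\<lambda>x. bump2 a b n x * \<theta> x) \<in> L2 \<Omega>" "(\<lambda>x. ?\<Psi> x * \<theta> x) \<in> L2 \<Omega>"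
    proof -
      show "(\<lambda>x. ?\<Psi> x * partial i \<theta> x) \<in> L2 \<Omega>"
        by (rule test_L2[OF test_functions_mult[OF test_functions_partial[OF \<theta>] \<Psi>]])
      have "smooth (bump2 a b n)" unfolding bump2_def by (intro smooth_mult smooth_bump1_coord)
      then show "(\<lambda>x. bump2 a b n x * \<theta> x) \<in> L2 \<Omega>" by (rule test_L2[OF test_functions_mult[OF \<theta>]])
      show "(\<lambda>x. ?\<Psi> x * \<theta> x) \<in> L2 \<Omega>" by (rule test_L2[OF \<Theta>])
    qed
    \<comment> \<open>The weak derivative of \<open>u\<close> is tested with
      \<open>?\<Psi> x * \<theta> x\<close>. Differentiating the primitive produces the cut-off of
      the box; all other terms combine to \<open>?\<Psi>\<close> times the product
      derivative.\<close>
    have "inner_L2 M u (\<lambda>x. ?\<Psi> x * partial i \<theta> x + bump2 a b n x * \<theta> x) = - inner_L2 M (\<lambda>x. D x $ i) (\<lambda>x. ?\<Psi> x * \<theta> x)"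
      using DD(2)[OF \<Theta>, of i] unfolding p\<Theta>[abs_def] .
    then have "inner_L2 M u (\<lambda>x. bump2 a b n x * \<theta> x) = - (inner_L2 M u (\<lambda>x. ?\<Psi> x * partial i \<theta> x) + inner_L2 M (\<lambda>x. D x $ i) (\<lambda>x. ?\<Psi> x * \<theta> x))"
      by (simp add: inner_L2_add u L2s)
    also have "inner_L2 M u (\<lambda>x. ?\<Psi> x * partial i \<theta> x) + inner_L2 M (\<lambda>x. D x $ i) (\<lambda>x. ?\<Psi> x * \<theta> x) = (LINT x|M. ?\<Psi> x * ?P x)"
      unfolding inner_L2_def
      using integrable_mult_L2[OF u L2s(1)] integrable_mult_L2[OF DD(3)[of i] L2s(3)]
      by (subst Bochner_Integration.integral_add[symmetric]) (auto simp: product_derivative_def algebra_simps)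
    finally have eq: "\<bar>LINT x|M. bump2 a b n x * (u x * \<theta> x)\<bar> = \<bar>LINT x|M. ?\<Psi> x * ?P x\<bar>"
      by (simp add: inner_L2_def mult_ac)
    \<comment> \<open>The primitive contributes the width of the box in direction \<open>i\<close>,
      the cut-off the strip in direction \<open>j\<close>. This is the shape of the claimed
      bound.\<close>
    have le: "\<bar>?\<Psi> x * ?P x\<bar> \<le> (b $ i - a $ i) * (indicator {a $ j<..<b $ j} (x $ j) * \<bar>?P x\<bar>)" for x
    proof -
      have "?\<beta> x \<le> indicator {a $ j<..<b $ j} (x $ j)"
        using bump1_eq_0[of "x $ j" "a $ j" "b $ j" n] bump1_bounds[of "a $ j" "b $ j" n "x $ j"] by (auto simp: indicator_def)
      then have "?\<Psi> x \<le> (b $ i - a $ i) * indicator {a $ j<..<b $ j} (x $ j)"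
        using A(3) bump1_bounds ab by (intro mult_mono) auto
      moreover have "0 \<le> ?\<Psi> x" using A(3) bump1_bounds by simp
      ultimately show ?thesis by (simp add: abs_mult mult.assoc[symmetric] mult_right_mono)
    qed
    have intS': "integrable M (\<lambda>x. (b $ i - a $ i) * (indicator {a $ j<..<b $ j} (x $ j) * \<bar>?P x\<bar>))"
      using intS by (rule integrable_mult_right)
    have \<Psi>m: "?\<Psi> \<in> borel_measurable M"
      using smooth_continuous[OF \<Psi>, of UNIV]
      by (intro measurable_restrict_space1 measurable_completion) (simp add: borel_measurable_continuous_onI)
    have int\<Psi>: "integrable M (\<lambda>x. ?\<Psi> x * ?P x)"
    proof (rule Bochner_Integration.integrable_bound[OF intS'])
      show "(\<lambda>x. ?\<Psi> x * ?P x) \<in> borel_measurable M"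
        using \<Psi>m borel_measurable_integrable[OF intP] by (rule borel_measurable_times)
      show "AE x in M. norm (?\<Psi> x * ?P x) \<le> norm ((b $ i - a $ i) * (indicator {a $ j<..<b $ j} (x $ j) * \<bar>?P x\<bar>))"
      proof (rule AE_I2)
        show "norm (?\<Psi> x * ?P x) \<le> norm ((b $ i - a $ i) * (indicator {a $ j<..<b $ j} (x $ j) * \<bar>?P x\<bar>))" for x
          unfolding real_norm_def by (rule order_trans[OF le abs_ge_self])
      qed
    qed
    have "\<bar>LINT x|M. ?\<Psi> x * ?P x\<bar> \<le> (LINT x|M. (b $ i - a $ i) * (indicator {a $ j<..<b $ j} (x $ j) * \<bar>?P x\<bar>))"
      unfolding real_norm_def[symmetric]
      by (rule Bochner_Integration.integral_norm_bound_integral[OF int\<Psi>])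
         (use intS' le in \<open>simp_all only: real_norm_def\<close>)
    then show ?thesis unfolding eq by simp
  qed
  have u\<theta>: "integrable M (\<lambda>x. u x * \<theta> x)" by (rule integrable_L2[OF test_mult_L2[OF u \<theta>]])
  have ub: "integrable M (\<lambda>x. \<bar>u x * \<theta> x\<bar>)" using u\<theta> by simp
  have lim: "(\<lambda>n. LINT x|M. bump2 a b n x * (u x * \<theta> x)) \<longlonglongrightarrow> (LINT x|M. indicator (box a b) x * (u x * \<theta> x))"
  proof (rule integral_dominated_convergence[OF _ _ ub])
    have [measurable]: "(indicator (box a b) :: real^2 \<Rightarrow> real) \<in> borel_measurable M"
      by (intro measurable_restrict_space1 measurable_completion) simp
    have [measurable]: "bump2 a b n \<in> borel_measurable M" for n
      by (rule test_functions_measurable(4)[OF bump2_test_function[of a b UNIV]]) simp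
    have [measurable]: "(\<lambda>x. u x * \<theta> x) \<in> borel_measurable M" using u\<theta> by simp
    show "(\<lambda>x. indicator (box a b) x * (u x * \<theta> x)) \<in> borel_measurable M" by measurable
    show "(\<lambda>x. bump2 a b n x * (u x * \<theta> x)) \<in> borel_measurable M" for n by measurable
    show "AE x in M. (\<lambda>n. bump2 a b n x * (u x * \<theta> x)) \<longlonglongrightarrow> indicator (box a b) x * (u x * \<theta> x)"
      by (intro AE_I2 tendsto_intros bump2_tendsto)
    show "AE x in M. norm (bump2 a b n x * (u x * \<theta> x)) \<le> \<bar>u x * \<theta> x\<bar>" for n
    proof (rule AE_I2)
      show "norm (bump2 a b n x * (u x * \<theta> x)) \<le> \<bar>u x * \<theta> x\<bar>" for x
        using mult_left_le_one_le[of "\<bar>u x * \<theta> x\<bar>" "bump2 a b n x"] bump2_bounds[of a b n x]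
        by (simp add: abs_mult)
    qed
  qed
  show ?thesis
    by (rule LIMSEQ_le_const2[OF tendsto_rabs[OF lim]]) (use est in blast)
qed

text \<open>The Gagliardo-Nirenberg argument on a grid. A cell integral is bounded by
  \<open>h\<close> times a strip integral in either direction. Multiplying the two bounds gives a
  term that factors over columns and rows, and each factor sums to at most \<open>Q\<close> because
  parallel strips are disjoint.\<close>

lemma product_cells:
  assumes u: "u \<in> L2 \<Omega>" and D: "is_weak_grad \<Omega> u D" and \<theta>: "\<theta> \<in> test_functions \<Omega>" and h: "h > 0" and K: "finite K"
  defines "Q \<equiv> norm_L2 M u * norm_L2 M (grad \<theta>) + norm_L2 M D * norm_L2 M \<theta>"
  shows "(\<Sum>k\<in>K. (LINT x|M. indicator (cell h k) x * (u x * \<theta> x))\<^sup>2) \<le> h\<^sup>2 * Q\<^sup>2"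
proof -
  note DD = is_weak_gradD[OF D]
  let ?P = "\<lambda>i. product_derivative u D \<theta> i"
  define I where "I k = (LINT x|M. indicator (cell h k) x * (u x * \<theta> x))" for k
  \<comment> \<open>In the index type \<open>2\<close> the expression \<open>3 - i\<close> denotes
    the other coordinate.\<close>
  define S where "S i (k :: int) = (LINT x|M. indicator {h * of_int k<..<h * (of_int k + 1)} (x $ (3 - i)) * \<bar>?P i x\<bar>)" for i :: 2 and k
  have intP: "integrable M (?P i)" for i by (rule product_derivative_integrable(1)[OF u DD(1) \<theta>])
  have [measurable]: "(\<lambda>x :: real^2. x $ k) \<in> borel_measurable M" for k
    by (intro measurable_restrict_space1 measurable_completion) (auto intro!: borel_measurable_continuous_onI continuous_intros)
  have intS: "integrable M (\<lambda>x. indicator {c<..<d} (x $ j) * \<bar>?P i x\<bar>)" for c d j i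
    by (rule Bochner_Integration.integrable_bound[OF integrable_abs[OF intP[of i]]])
       (use intP in \<open>auto simp: indicator_def\<close>)
  have I_box: "I k = (LINT x|M. indicator (box (cell_corner h k) (cell_corner h k + h *\<^sub>R One)) x * (u x * \<theta> x))" for k
  proof -
    let ?b = "box (cell_corner h k) (cell_corner h k + h *\<^sub>R One)" and ?c = "cbox (cell_corner h k) (cell_corner h k + h *\<^sub>R One)"
    \<comment> \<open>A half-open cell and the open box differ only by points of the faces, a null
      set.\<close>
    have "AE x in lebesgue. x \<notin> ?c - ?b"
      using AE_not_in negligible_iff_null_sets negligible_frontier_interval by blast
    then have "AE x in lebesgue. x \<in> \<Omega> \<longrightarrow> indicator (cell h k) x = (indicator ?b x :: real)"
      by eventually_elim (use cell_between[OF h, of k] in \<open>auto simp: indicator_def\<close>)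
    then have AE: "AE x in M. indicator (cell h k) x = (indicator ?b x :: real)"
      by (subst AE_restrict_space_iff) auto
    have [measurable]: "(\<lambda>x. u x * \<theta> x) \<in> borel_measurable M"
      using test_mult_L2[OF u \<theta>] by (simp add: L2_space_def)
    have [measurable]: "(indicator A :: real^2 \<Rightarrow> real) \<in> borel_measurable M" if "A \<in> sets borel" for A
      using that by (intro measurable_restrict_space1 measurable_completion) simp
    show ?thesis
      unfolding I_def using AE h by (intro integral_cong_AE) auto
  qed
  have S1: "\<bar>I k\<bar> \<le> h * S 1 (snd k)" for k
    using product_box_estimate[OF u D \<theta>, of 1 2 "cell_corner h k" "cell_corner h k + h *\<^sub>R One"] h
    unfolding I_box S_def by (simp add: cell_corner_def One_nth algebra_simps)
  have S2: "\<bar>I k\<bar> \<le> h * S 2 (fst k)" for k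
    using product_box_estimate[OF u D \<theta>, of 2 1 "cell_corner h k" "cell_corner h k + h *\<^sub>R One"] h
    unfolding I_box S_def by (simp add: cell_corner_def One_nth algebra_simps)
  have S0: "0 \<le> S i k" for i k unfolding S_def by (intro Bochner_Integration.integral_nonneg) auto
  have SQ: "(\<Sum>k\<in>K'. S i k) \<le> Q" if "finite K'" for i K'
  proof -
    have "(\<Sum>k\<in>K'. S i k) = (LINT x|M. (\<Sum>k\<in>K'. indicator {h * of_int k<..<h * (of_int k + 1)} (x $ (3 - i)) * \<bar>?P i x\<bar>))"
      unfolding S_def by (rule Bochner_Integration.integral_sum[symmetric]) (rule intS)
    also have "\<dots> \<le> (LINT x|M. \<bar>?P i x\<bar>)"
    proof (rule integral_mono)
      show "integrable M (\<lambda>x. \<Sum>k\<in>K'. indicator {h * of_int k<..<h * (of_int k + 1)} (x $ (3 - i)) * \<bar>?P i x\<bar>)"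
        by (intro Bochner_Integration.integrable_sum intS)
      show "integrable M (\<lambda>x. \<bar>?P i x\<bar>)" using intP by simp
      show "(\<Sum>k\<in>K'. indicator {h * of_int k<..<h * (of_int k + 1)} (x $ (3 - i)) * \<bar>?P i x\<bar>) \<le> \<bar>?P i x\<bar>" for x
        unfolding sum_distrib_right[symmetric]
        by (intro mult_left_le_one_le sum_indicator_strips_le_1 that h sum_nonneg) auto
    qed
    also have "\<dots> \<le> Q" unfolding Q_def by (rule product_derivative_integrable(2)[OF u DD(1) \<theta>])
    finally show ?thesis .
  qed
  \<comment> \<open>Enlarging the index set to a Cartesian product lets the double sum
    factorise.\<close>
  have "(\<Sum>k\<in>K. (I k)\<^sup>2) \<le> (\<Sum>k\<in>fst ` K \<times> snd ` K. (I k)\<^sup>2)"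
    using K by (intro sum_mono2) force+
  also have "\<dots> \<le> (\<Sum>k\<in>fst ` K \<times> snd ` K. h\<^sup>2 * (S 2 (fst k) * S 1 (snd k)))"
  proof (rule sum_mono)
    fix k
    have "\<bar>I k\<bar> * \<bar>I k\<bar> \<le> (h * S 2 (fst k)) * (h * S 1 (snd k))"
      using S1 S2 S0 h by (intro mult_mono) auto
    then show "(I k)\<^sup>2 \<le> h\<^sup>2 * (S 2 (fst k) * S 1 (snd k))"
      by (simp add: power2_eq_square mult_ac)
  qed
  also have "\<dots> = h\<^sup>2 * (\<Sum>k\<in>fst ` K \<times> snd ` K. S 2 (fst k) * S 1 (snd k))"
    by (rule sum_distrib_left[symmetric])
  also have "(\<Sum>k\<in>fst ` K \<times> snd ` K. S 2 (fst k) * S 1 (snd k)) = (\<Sum>k\<in>fst ` K. S 2 k) * (\<Sum>k\<in>snd ` K. S 1 k)"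
    unfolding sum_product sum.cartesian_product by (simp add: case_prod_unfold)
  also have "h\<^sup>2 * ((\<Sum>k\<in>fst ` K. S 2 k) * (\<Sum>k\<in>snd ` K. S 1 k)) \<le> h\<^sup>2 * (Q * Q)"
  proof -
    have "0 \<le> Q" by (simp add: Q_def)
    then show ?thesis
      using K S0 by (intro mult_left_mono mult_mono SQ sum_nonneg) auto
  qed
  finally show ?thesis by (simp add: I_def power2_eq_square)
qed

text \<open>Cauchy-Schwarz on each cell, followed by disjointness of the cells. It handles the error
  made when \<open>u \<theta>\<close> is replaced by a test function.\<close>

lemma cells_L2:
  fixes g :: "real^2 \<Rightarrow> real"
  assumes g: "g \<in> L2 \<Omega>" and h: "h > 0" and K: "finite K"
  shows "(\<Sum>k\<in>K. (LINT x|M. indicator (cell h k) x * g x)\<^sup>2) \<le> h\<^sup>2 * (norm_L2 M g)\<^sup>2"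
proof -
  let ?i = "\<lambda>k. indicator (cell h k) :: real^2 \<Rightarrow> real"
  have im[measurable]: "?i k \<in> borel_measurable M" for k
    using h by (intro measurable_restrict_space1 measurable_completion) simp
  have i: "?i k \<in> L2 \<Omega>" "norm_L2 M (?i k) \<le> h" for k
    using norm_L2_domain_le[OF cell_L2(1)[OF h]] cell_L2(2)[OF h] by auto
  have ig: "(\<lambda>x. ?i k x * g x) \<in> L2 \<Omega>" for k
    using L2_space_bounded_mult[OF g im, of k 1] by simp
  have gm[measurable]: "g \<in> borel_measurable M" by (rule L2_spaceD(1)[OF g])
  have int: "integrable M (\<lambda>x. ?i k x * (g x)\<^sup>2)" for k
  proof (rule Bochner_Integration.integrable_bound[OF L2_spaceD(2)[OF g]])
    show "(\<lambda>x. ?i k x * (g x)\<^sup>2) \<in> borel_measurable M" by measurable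
  qed (auto simp: indicator_def)
  have "(LINT x|M. ?i k x * g x)\<^sup>2 \<le> h\<^sup>2 * (LINT x|M. ?i k x * (g x)\<^sup>2)" for k
  proof -
    have "(LINT x|M. ?i k x * g x) = inner_L2 M (?i k) (\<lambda>x. ?i k x * g x)"
      unfolding inner_L2_def by (intro Bochner_Integration.integral_cong) (auto simp: indicator_def)
    then have "\<bar>LINT x|M. ?i k x * g x\<bar> \<le> norm_L2 M (?i k) * norm_L2 M (\<lambda>x. ?i k x * g x)"
      using Cauchy_Schwarz_L2[OF i(1) ig] by simp
    also have "\<dots> \<le> h * norm_L2 M (\<lambda>x. ?i k x * g x)" by (intro mult_right_mono i) auto
    finally have "\<bar>LINT x|M. ?i k x * g x\<bar>\<^sup>2 \<le> (h * norm_L2 M (\<lambda>x. ?i k x * g x))\<^sup>2" by (rule power_mono) auto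
    also have "\<dots> = h\<^sup>2 * (LINT x|M. ?i k x * (g x)\<^sup>2)"
      unfolding power_mult_distrib norm_L2_power2
      by (intro arg_cong2[where f="(*)"] refl Bochner_Integration.integral_cong) (auto simp: indicator_def)
    finally show ?thesis by simp
  qed
  then have "(\<Sum>k\<in>K. (LINT x|M. ?i k x * g x)\<^sup>2) \<le> (\<Sum>k\<in>K. h\<^sup>2 * (LINT x|M. ?i k x * (g x)\<^sup>2))"
    by (rule sum_mono)
  also have "\<dots> = h\<^sup>2 * (LINT x|M. (\<Sum>k\<in>K. ?i k x * (g x)\<^sup>2))"
  proof -
    from int show ?thesis by (simp add: sum_distrib_left)
  qed
  also have "\<dots> \<le> h\<^sup>2 * (LINT x|M. (norm (g x))\<^sup>2)"
  proof (intro mult_left_mono integral_mono L2_spaceD(2)[OF g] Bochner_Integration.integrable_sum)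
    show "integrable M (\<lambda>x. ?i k x * (g x)\<^sup>2)" for k by (rule int)
    show "(\<Sum>k\<in>K. ?i k x * (g x)\<^sup>2) \<le> (norm (g x))\<^sup>2" for x
      unfolding sum_distrib_right[symmetric] real_norm_def power2_abs
      by (intro mult_left_le_one_le sum_indicator_cells_le_1 K sum_nonneg) auto
  qed simp
  finally show ?thesis by (simp add: norm_L2_power2)
qed

text \<open>A product estimate of Gagliardo--Nirenberg type; the constant is not optimal.\<close>

lemma product_bound:
  assumes u: "u \<in> L2 \<Omega>" and D: "is_weak_grad \<Omega> u D" and \<theta>: "\<theta> \<in> test_functions \<Omega>"
  shows "norm_L2 M (\<lambda>x. u x * \<theta> x) \<le> 2 * (norm_L2 M u * norm_L2 M (grad \<theta>) + norm_L2 M D * norm_L2 M \<theta>)"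
proof -
  define Q where "Q = norm_L2 M u * norm_L2 M (grad \<theta>) + norm_L2 M D * norm_L2 M \<theta>"
  let ?w = "\<lambda>x. u x * \<theta> x"
  have w: "?w \<in> L2 \<Omega>" by (rule test_mult_L2[OF u \<theta>])
  \<comment> \<open>The grid estimate is applied to a test function \<xi> near
    \<open>u \<theta>\<close>. The gradient of \<xi> is not controlled uniformly, but its term
    carries \<open>h\<^sup>2\<close>, so for fixed \<xi> it disappears as
    \<open>h \<rightarrow> 0\<close>; the cell sums scale like \<open>h\<^sup>2\<close> and survive.
    Only afterwards does \<xi> approach \<open>u \<theta>\<close>.\<close>
  have key: "(norm_L2 M \<xi>)\<^sup>2 \<le> 4 * Q\<^sup>2 + 4 * (norm_L2 M (\<lambda>x. \<xi> x - ?w x))\<^sup>2" if \<xi>: "\<xi> \<in> test_functions \<Omega>" for \<xi>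
  proof -
    define L where "L = norm_L2 M (grad \<xi>)"
    define e where "e = norm_L2 M (\<lambda>x. \<xi> x - ?w x)"
    have \<xi>w: "(\<lambda>x. \<xi> x - ?w x) \<in> L2 \<Omega>" by (rule L2_space_diff[OF test_L2[OF \<xi>] w])
    have "(norm_L2 M \<xi>)\<^sup>2 \<le> 32 * h\<^sup>2 * L\<^sup>2 + (4 * Q\<^sup>2 + 4 * e\<^sup>2)" if h: "h > 0" for h
    proof -
      obtain K where K: "finite K" "\<And>x. \<xi> x \<noteq> 0 \<Longrightarrow> cell_index h x \<in> K"
        using finite_cells[OF h] \<xi> by metis
      let ?i = "\<lambda>k. indicator (cell h k) :: real^2 \<Rightarrow> real"
      have I\<xi>: "(LINT y|lborel. ?i k y * \<xi> y) = (LINT y|M. ?i k y * \<xi> y)" for k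
        using test_functions_eq_0[OF \<xi>] test_functions_measurable(1)[OF \<xi>] h
        by (intro integral_lebesgue_on_support[symmetric]) auto
      have im: "?i k \<in> borel_measurable M" for k
        using h by (intro measurable_restrict_space1 measurable_completion) simp
      have ig: "integrable M (\<lambda>x. ?i k x * g x)" if "g \<in> L2 \<Omega>" for g k
        using integrable_L2[OF L2_space_bounded_mult[OF that im, of k 1]] by simp
      have sq: "(LINT y|lborel. ?i k y * \<xi> y)\<^sup>2 \<le> 2 * (LINT y|M. ?i k y * ?w y)\<^sup>2 + 2 * (LINT y|M. ?i k y * (\<xi> y - ?w y))\<^sup>2" for k
      proof -
        have "(LINT y|M. ?i k y * \<xi> y) = (LINT y|M. ?i k y * ?w y) + (LINT y|M. ?i k y * (\<xi> y - ?w y))"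
          using ig[OF w] ig[OF \<xi>w] by (subst Bochner_Integration.integral_add[symmetric]) (auto simp: algebra_simps)
        then show ?thesis
          unfolding I\<xi> using sum_squares_bound[of "LINT y|M. ?i k y * ?w y" "LINT y|M. ?i k y * (\<xi> y - ?w y)"]
          by (simp add: power2_sum)
      qed
      have "(norm_L2 lborel \<xi>)\<^sup>2 \<le> 32 * h\<^sup>2 * L\<^sup>2 + 2 / h\<^sup>2 * (\<Sum>k\<in>K. (LINT y|lborel. ?i k y * \<xi> y)\<^sup>2)"
      proof (rule grid_estimate[OF h test_functions_L2_lborel[OF \<xi>] _ K])
        show "0 \<le> L" by (simp add: L_def)
        show "(\<lambda>x. \<xi> (x + z) - \<xi> x) \<in> L2_space lborel" for z
          using L2_space_diff[OF test_functions_L2_lborel[OF test_functions_translate[OF \<xi>, of "- z" UNIV]] test_functions_L2_lborel[OF \<xi>]]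
          by simp
        show "norm_L2 lborel (\<lambda>x. \<xi> (x + z) - \<xi> x) \<le> L * norm z" for z
          unfolding L_def by (rule norm_L2_increment_grad[OF \<xi>])
      qed
      also have "(\<Sum>k\<in>K. (LINT y|lborel. ?i k y * \<xi> y)\<^sup>2)
        \<le> (\<Sum>k\<in>K. 2 * (LINT y|M. ?i k y * ?w y)\<^sup>2 + 2 * (LINT y|M. ?i k y * (\<xi> y - ?w y))\<^sup>2)"
        by (rule sum_mono[OF sq])
      also have "\<dots> = 2 * (\<Sum>k\<in>K. (LINT y|M. ?i k y * ?w y)\<^sup>2) + 2 * (\<Sum>k\<in>K. (LINT y|M. ?i k y * (\<xi> y - ?w y))\<^sup>2)"
        by (simp add: sum.distrib sum_distrib_left)
      also have "\<dots> \<le> 2 * (h\<^sup>2 * Q\<^sup>2) + 2 * (h\<^sup>2 * e\<^sup>2)"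
        using product_cells[OF u D \<theta> h K(1)] cells_L2[OF \<xi>w h K(1)] by (simp add: Q_def e_def)
      also have "2 / h\<^sup>2 * (2 * (h\<^sup>2 * Q\<^sup>2) + 2 * (h\<^sup>2 * e\<^sup>2)) = 4 * Q\<^sup>2 + 4 * e\<^sup>2"
        using h by (simp add: field_simps)
      finally show ?thesis using h by (simp add: norm_L2_test[OF \<xi>] divide_right_mono)
    qed
    then have *: "(norm_L2 M \<xi>)\<^sup>2 \<le> 32 * (1 / real (Suc n))\<^sup>2 * L\<^sup>2 + (4 * Q\<^sup>2 + 4 * e\<^sup>2)" for n by simp
    have "(\<lambda>n. 32 * (1 / real (Suc n))\<^sup>2 * L\<^sup>2 + (4 * Q\<^sup>2 + 4 * e\<^sup>2)) \<longlonglongrightarrow> 32 * 0\<^sup>2 * L\<^sup>2 + (4 * Q\<^sup>2 + 4 * e\<^sup>2)"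
      by (intro tendsto_intros LIMSEQ_Suc[OF lim_1_over_n])
    then have "(norm_L2 M \<xi>)\<^sup>2 \<le> 32 * 0\<^sup>2 * L\<^sup>2 + (4 * Q\<^sup>2 + 4 * e\<^sup>2)"
      by (rule LIMSEQ_le_const) (use * in blast)
    then show ?thesis by (simp add: e_def)
  qed
  obtain \<xi> where \<xi>: "\<And>n. \<xi> n \<in> test_functions \<Omega>" and lim: "(\<lambda>n. norm_L2 M (\<lambda>x. \<xi> n x - ?w x)) \<longlonglongrightarrow> 0"
    using test_functions_dense[OF w] by blast
  have 1: "(\<lambda>n. (norm_L2 M (\<xi> n))\<^sup>2) \<longlonglongrightarrow> (norm_L2 M ?w)\<^sup>2"
    by (intro tendsto_power tendsto_norm_L2 test_L2[OF \<xi>] w lim)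
  have 2: "(\<lambda>n. 4 * Q\<^sup>2 + 4 * (norm_L2 M (\<lambda>x. \<xi> n x - ?w x))\<^sup>2) \<longlonglongrightarrow> 4 * Q\<^sup>2 + 4 * 0\<^sup>2"
    by (intro tendsto_intros lim)
  have "(norm_L2 M ?w)\<^sup>2 \<le> 4 * Q\<^sup>2 + 4 * 0\<^sup>2"
    by (rule LIMSEQ_le[OF 1 2]) (use key[OF \<xi>] in blast)
  then have "(norm_L2 M ?w)\<^sup>2 \<le> (2 * Q)\<^sup>2" by (simp add: power_mult_distrib)
  then have "norm_L2 M ?w \<le> 2 * Q"
    by (rule power2_le_imp_le) (simp add: Q_def)
  then show ?thesis by (simp add: Q_def)
qed

section \<open>\<open>H1_0\<close> as the closure of the test functions\<close>

lemma H1_limit_iff: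
  "H1_limit \<Omega> \<theta> v \<longleftrightarrow> (\<lambda>k. norm_L2 M (\<lambda>x. \<theta> k x - v x)) \<longlonglongrightarrow> 0 \<and>
    (\<lambda>k. norm_L2 M (\<lambda>x. grad (\<theta> k) x - weak_grad \<Omega> v x)) \<longlonglongrightarrow> 0"
proof -
  have "(LINT x|M. (\<theta> k x - v x)\<^sup>2) = (norm_L2 M (\<lambda>x. \<theta> k x - v x))\<^sup>2" for k
    by (simp add: norm_L2_power2)
  then show ?thesis
    unfolding H1_limit_def by (simp add: norm_L2_power2[symmetric])
qed

text \<open>Replaces the chosen weak gradient by an arbitrary one, and the approximating sequence by
  single approximants, which are easier to combine.\<close>

lemma H1_0_iff:
  assumes v: "v \<in> L2 \<Omega>" and D: "is_weak_grad \<Omega> v D"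
  shows "v \<in> H1_0 \<Omega> \<longleftrightarrow>
    (\<forall>e>0. \<exists>\<theta>\<in>test_functions \<Omega>. norm_L2 M (\<lambda>x. \<theta> x - v x) < e \<and> norm_L2 M (\<lambda>x. grad \<theta> x - D x) < e)"
proof -
  have vH1: "v \<in> H1 \<Omega>" by (rule H1_I[OF v D])
  have AE: "AE x in M. weak_grad \<Omega> v x = D x" by (rule weak_grad_AE_eq[OF v D])
  have [measurable]: "D \<in> borel_measurable M" "weak_grad \<Omega> v \<in> borel_measurable M"
    using L2_spaceD(1)[OF is_weak_gradD(1)[OF D]] L2_spaceD(1)[OF H1_weak_grad(3)[OF vH1]] by auto
  have eq: "norm_L2 M (\<lambda>x. grad \<theta> x - weak_grad \<Omega> v x) = norm_L2 M (\<lambda>x. grad \<theta> x - D x)"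
    if "\<theta> \<in> test_functions \<Omega>" for \<theta>
  proof -
    have [measurable]: "grad \<theta> \<in> borel_measurable M" by (rule test_functions_grad_measurable(2)[OF that])
    show ?thesis using AE by (intro norm_L2_cong_AE) auto
  qed
  show ?thesis
  proof
    assume "v \<in> H1_0 \<Omega>"
    then obtain \<theta> where \<theta>: "\<And>k. \<theta> k \<in> test_functions \<Omega>" "H1_limit \<Omega> \<theta> v" by (auto simp: H1_0_def)
    show "\<forall>e>0. \<exists>\<theta>\<in>test_functions \<Omega>. norm_L2 M (\<lambda>x. \<theta> x - v x) < e \<and> norm_L2 M (\<lambda>x. grad \<theta> x - D x) < e"
    proof (intro allI impI)
      fix e :: real assume "e > 0"
      have 1: "(\<lambda>k. norm_L2 M (\<lambda>x. \<theta> k x - v x)) \<longlonglongrightarrow> 0" and 2: "(\<lambda>k. norm_L2 M (\<lambda>x. grad (\<theta> k) x - D x)) \<longlonglongrightarrow> 0"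
        using \<theta>(2) unfolding H1_limit_iff eq[OF \<theta>(1)] by auto
      have "eventually (\<lambda>k. norm_L2 M (\<lambda>x. \<theta> k x - v x) < e \<and> norm_L2 M (\<lambda>x. grad (\<theta> k) x - D x) < e) sequentially"
        by (intro eventually_conj order_tendstoD(2)[OF 1] order_tendstoD(2)[OF 2] \<open>e > 0\<close>)
      then obtain k where "norm_L2 M (\<lambda>x. \<theta> k x - v x) < e \<and> norm_L2 M (\<lambda>x. grad (\<theta> k) x - D x) < e"
        by (auto simp: eventually_sequentially)
      then show "\<exists>\<theta>\<in>test_functions \<Omega>. norm_L2 M (\<lambda>x. \<theta> x - v x) < e \<and> norm_L2 M (\<lambda>x. grad \<theta> x - D x) < e"
        using \<theta>(1) by blast
    qed
  next
    assume *: "\<forall>e>0. \<exists>\<theta>\<in>test_functions \<Omega>. norm_L2 M (\<lambda>x. \<theta> x - v x) < e \<and> norm_L2 M (\<lambda>x. grad \<theta> x - D x) < e"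
    have "\<forall>k. \<exists>\<theta>. \<theta> \<in> test_functions \<Omega> \<and> norm_L2 M (\<lambda>x. \<theta> x - v x) < 1 / real (Suc k) \<and> norm_L2 M (\<lambda>x. grad \<theta> x - D x) < 1 / real (Suc k)"
    proof
      fix k :: nat
      show "\<exists>\<theta>. \<theta> \<in> test_functions \<Omega> \<and> norm_L2 M (\<lambda>x. \<theta> x - v x) < 1 / real (Suc k) \<and> norm_L2 M (\<lambda>x. grad \<theta> x - D x) < 1 / real (Suc k)"
        using *[rule_format, of "1 / real (Suc k)"] by auto
    qed
    from choice[OF this] obtain \<theta> where \<theta>: "\<And>k. \<theta> k \<in> test_functions \<Omega>"
      "\<And>k. norm_L2 M (\<lambda>x. \<theta> k x - v x) < 1 / real (Suc k)" "\<And>k. norm_L2 M (\<lambda>x. grad (\<theta> k) x - D x) < 1 / real (Suc k)"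
      by blast
    have lim: "f \<longlonglongrightarrow> 0" if "\<And>k. f k < 1 / real (Suc k)" "\<And>k. 0 \<le> f k" for f :: "nat \<Rightarrow> real"
      by (rule tendsto_sandwich[OF _ _ tendsto_const LIMSEQ_Suc[OF lim_1_over_n]])
         (use that in \<open>auto intro!: always_eventually less_imp_le\<close>)
    have "H1_limit \<Omega> \<theta> v"
      unfolding H1_limit_iff eq[OF \<theta>(1)] using \<theta>(2,3) by (auto intro!: lim)
    then show "v \<in> H1_0 \<Omega>" using vH1 \<theta>(1) by (auto simp: H1_0_def)
  qed
qed

lemma H1_0_D: "v \<in> H1_0 \<Omega> \<Longrightarrow> v \<in> H1 \<Omega>"
  by (simp add: H1_0_def)

lemma H1_0_approx_limit:
  assumes "v \<in> H1_0 \<Omega>" "is_weak_grad \<Omega> v D"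
  obtains \<theta> where "\<And>n :: nat. \<theta> n \<in> test_functions \<Omega>" "(\<lambda>n. norm_L2 M (\<lambda>x. \<theta> n x - v x)) \<longlonglongrightarrow> 0"
    "(\<lambda>n. norm_L2 M (\<lambda>x. grad (\<theta> n) x - D x)) \<longlonglongrightarrow> 0"
proof -
  have "\<forall>n. \<exists>\<theta>. \<theta> \<in> test_functions \<Omega> \<and> norm_L2 M (\<lambda>x. \<theta> x - v x) < 1 / real (Suc n) \<and> norm_L2 M (\<lambda>x. grad \<theta> x - D x) < 1 / real (Suc n)"
  proof
    fix n :: nat
    have "1 / real (Suc n) > 0" by simp
    then show "\<exists>\<theta>. \<theta> \<in> test_functions \<Omega> \<and> norm_L2 M (\<lambda>x. \<theta> x - v x) < 1 / real (Suc n) \<and> norm_L2 M (\<lambda>x. grad \<theta> x - D x) < 1 / real (Suc n)"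
      using H1_0_iff[OF H1_weak_grad(1)[OF H1_0_D[OF assms(1)]] assms(2)] assms(1) by blast
  qed
  from choice[OF this] obtain \<theta> where \<theta>: "\<And>k. \<theta> k \<in> test_functions \<Omega>"
    "\<And>k. norm_L2 M (\<lambda>x. \<theta> k x - v x) < 1 / real (Suc k)" "\<And>k. norm_L2 M (\<lambda>x. grad (\<theta> k) x - D x) < 1 / real (Suc k)"
    by blast
  have lim: "f \<longlonglongrightarrow> 0" if "\<And>k. f k < 1 / real (Suc k)" "\<And>k. 0 \<le> f k" for f :: "nat \<Rightarrow> real"
    by (rule tendsto_sandwich[OF _ _ tendsto_const LIMSEQ_Suc[OF lim_1_over_n]])
       (use that in \<open>auto intro!: always_eventually less_imp_le\<close>)
  show ?thesis
    by (rule that[OF \<theta>(1) lim[OF \<theta>(2) norm_L2_nonneg] lim[OF \<theta>(3) norm_L2_nonneg]])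
qed

lemma test_in_H1_0: "\<theta> \<in> test_functions \<Omega> \<Longrightarrow> \<theta> \<in> H1_0 \<Omega>"
  using H1_0_iff[OF test_L2 is_weak_grad_test, of \<theta> \<Omega>] by (auto intro!: bexI[of _ \<theta>])

lemma H1_0_limit:
  assumes v: "\<And>n. v n \<in> H1_0 \<Omega>" "\<And>n. is_weak_grad \<Omega> (v n) (D n)" and w: "w \<in> L2 \<Omega>" "E \<in> L2 \<Omega>"
    and lim: "(\<lambda>n. norm_L2 M (\<lambda>x. v n x - w x)) \<longlonglongrightarrow> 0" "(\<lambda>n. norm_L2 M (\<lambda>x. D n x - E x)) \<longlonglongrightarrow> 0"
  shows "w \<in> H1_0 \<Omega>" "is_weak_grad \<Omega> w E"
proof -
  have vL2: "v n \<in> L2 \<Omega>" for n by (rule H1_weak_grad(1)[OF H1_0_D[OF v(1)]])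
  note DL2 = is_weak_gradD(1)[OF v(2)]
  show E: "is_weak_grad \<Omega> w E" by (rule is_weak_grad_limit[OF v(2) vL2 w lim])
  have "\<exists>\<theta>\<in>test_functions \<Omega>. norm_L2 M (\<lambda>x. \<theta> x - w x) < e \<and> norm_L2 M (\<lambda>x. grad \<theta> x - E x) < e" if e: "e > 0" for e
  proof -
    have "eventually (\<lambda>k. norm_L2 M (\<lambda>x. v k x - w x) < e / 2 \<and> norm_L2 M (\<lambda>x. D k x - E x) < e / 2) sequentially"
      using e by (intro eventually_conj order_tendstoD(2)[OF lim(1)] order_tendstoD(2)[OF lim(2)]) auto
    then obtain k where k: "norm_L2 M (\<lambda>x. v k x - w x) < e / 2" "norm_L2 M (\<lambda>x. D k x - E x) < e / 2"
      by (auto simp: eventually_sequentially)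
    obtain \<theta> where \<theta>: "\<theta> \<in> test_functions \<Omega>" "norm_L2 M (\<lambda>x. \<theta> x - v k x) < e / 2" "norm_L2 M (\<lambda>x. grad \<theta> x - D k x) < e / 2"
      using H1_0_iff[OF vL2 v(2), of k] v(1)[of k] e half_gt_zero by blast
    show ?thesis
      using norm_L2_triangle[OF test_L2[OF \<theta>(1)] vL2[of k] w(1)] norm_L2_triangle[OF test_grad_L2[OF \<theta>(1)] DL2[of k] w(2)] k \<theta>
      by (intro bexI[OF _ \<theta>(1)]) linarith
  qed
  then show "w \<in> H1_0 \<Omega>" using H1_0_iff[OF w(1) E] by blast
qed

lemma grad_lincomb:
  assumes "\<theta> \<in> test_functions A" "\<xi> \<in> test_functions A"
  shows "grad (\<lambda>x. a * \<theta> x + b * \<xi> x) = (\<lambda>x. a *\<^sub>R grad \<theta> x + b *\<^sub>R grad \<xi> x)"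
  using test_functionsD(1)[OF assms(1)] test_functionsD(1)[OF assms(2)]
  by (auto simp: vec_eq_iff fun_eq_iff partial_add partial_cmult smooth_differentiable smooth_mult smooth_const)

lemma H1_0_lincomb:
  assumes "v \<in> H1_0 \<Omega>" "w \<in> H1_0 \<Omega>"
  shows "(\<lambda>x. a * v x + b * w x) \<in> H1_0 \<Omega>"
proof -
  note V = H1_weak_grad[OF H1_0_D[OF assms(1)]] and W = H1_weak_grad[OF H1_0_D[OF assms(2)]]
  obtain \<theta> where \<theta>: "\<And>n :: nat. \<theta> n \<in> test_functions \<Omega>" "(\<lambda>n. norm_L2 M (\<lambda>x. \<theta> n x - v x)) \<longlonglongrightarrow> 0"
    "(\<lambda>n. norm_L2 M (\<lambda>x. grad (\<theta> n) x - weak_grad \<Omega> v x)) \<longlonglongrightarrow> 0"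
    using H1_0_approx_limit[OF assms(1) V(2)] by blast
  obtain \<xi> where \<xi>: "\<And>n :: nat. \<xi> n \<in> test_functions \<Omega>" "(\<lambda>n. norm_L2 M (\<lambda>x. \<xi> n x - w x)) \<longlonglongrightarrow> 0"
    "(\<lambda>n. norm_L2 M (\<lambda>x. grad (\<xi> n) x - weak_grad \<Omega> w x)) \<longlonglongrightarrow> 0"
    using H1_0_approx_limit[OF assms(2) W(2)] by blast
  have comb: "(\<lambda>n. norm_L2 M (\<lambda>x. (a *\<^sub>R F n x + b *\<^sub>R G n x) - (a *\<^sub>R f x + b *\<^sub>R g x))) \<longlonglongrightarrow> 0"
    if "(\<lambda>n. norm_L2 M (\<lambda>x. F n x - f x)) \<longlonglongrightarrow> 0" "(\<lambda>n. norm_L2 M (\<lambda>x. G n x - g x)) \<longlonglongrightarrow> 0"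
      "\<And>n. F n \<in> L2 \<Omega>" "f \<in> L2 \<Omega>" "\<And>n. G n \<in> L2 \<Omega>" "g \<in> L2 \<Omega>"
    for F G :: "nat \<Rightarrow> real^2 \<Rightarrow> 'b::euclidean_space" and f g
  proof (rule tendsto_sandwich[OF _ _ tendsto_const])
    show "(\<lambda>n. \<bar>a\<bar> * norm_L2 M (\<lambda>x. F n x - f x) + \<bar>b\<bar> * norm_L2 M (\<lambda>x. G n x - g x)) \<longlonglongrightarrow> 0"
      using tendsto_add[OF tendsto_mult_right_zero[OF that(1)] tendsto_mult_right_zero[OF that(2)]] by simp
    have "norm_L2 M (\<lambda>x. (a *\<^sub>R F n x + b *\<^sub>R G n x) - (a *\<^sub>R f x + b *\<^sub>R g x))
      \<le> \<bar>a\<bar> * norm_L2 M (\<lambda>x. F n x - f x) + \<bar>b\<bar> * norm_L2 M (\<lambda>x. G n x - g x)" for n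
      using norm_L2_add_le[OF L2_space_scaleR[OF L2_space_diff[OF that(3,4)], of a] L2_space_scaleR[OF L2_space_diff[OF that(5,6)], of b], of n n]
        norm_L2_scaleR[of M a "\<lambda>x. F n x - f x"] norm_L2_scaleR[of M b "\<lambda>x. G n x - g x"]
      by (simp add: scaleR_diff_right algebra_simps)
    then show "\<forall>\<^sub>F n in sequentially. norm_L2 M (\<lambda>x. (a *\<^sub>R F n x + b *\<^sub>R G n x) - (a *\<^sub>R f x + b *\<^sub>R g x))
      \<le> \<bar>a\<bar> * norm_L2 M (\<lambda>x. F n x - f x) + \<bar>b\<bar> * norm_L2 M (\<lambda>x. G n x - g x)" by simp
  qed auto
  show ?thesis
  proof (rule H1_0_limit(1))
    have t: "(\<lambda>x. a * \<theta> n x + b * \<xi> n x) \<in> test_functions \<Omega>" for n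
      by (intro test_functions_add test_functions_cmult \<theta>(1) \<xi>(1))
    show "(\<lambda>x. a * \<theta> n x + b * \<xi> n x) \<in> H1_0 \<Omega>" for n by (rule test_in_H1_0[OF t])
    show "is_weak_grad \<Omega> (\<lambda>x. a * \<theta> n x + b * \<xi> n x) (\<lambda>x. a *\<^sub>R grad (\<theta> n) x + b *\<^sub>R grad (\<xi> n) x)" for n
      using is_weak_grad_test[OF t] by (simp only: grad_lincomb[OF \<theta>(1) \<xi>(1)])
    show "(\<lambda>x. a * v x + b * w x) \<in> L2 \<Omega>" by (intro L2_space_add L2_space_mult_left V W)
    show "(\<lambda>x. a *\<^sub>R weak_grad \<Omega> v x + b *\<^sub>R weak_grad \<Omega> w x) \<in> L2 \<Omega>" by (intro L2_space_add L2_space_scaleR V W)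
    show "(\<lambda>n. norm_L2 M (\<lambda>x. a * \<theta> n x + b * \<xi> n x - (a * v x + b * w x))) \<longlonglongrightarrow> 0"
      using comb[OF \<theta>(2) \<xi>(2) test_L2[OF \<theta>(1)] V(1) test_L2[OF \<xi>(1)] W(1)] by simp
    show "(\<lambda>n. norm_L2 M (\<lambda>x. a *\<^sub>R grad (\<theta> n) x + b *\<^sub>R grad (\<xi> n) x - (a *\<^sub>R weak_grad \<Omega> v x + b *\<^sub>R weak_grad \<Omega> w x))) \<longlonglongrightarrow> 0"
      by (rule comb[OF \<theta>(3) \<xi>(3) test_grad_L2[OF \<theta>(1)] V(3) test_grad_L2[OF \<xi>(1)] W(3)])
  qed
qed

lemma poincare_H1_0:
  assumes R: "\<Omega> \<subseteq> ball 0 R" and v: "v \<in> H1_0 \<Omega>" "is_weak_grad \<Omega> v D"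
  shows "norm_L2 M v \<le> 2 * R * norm_L2 M D"
proof -
  obtain \<theta> where \<theta>: "\<And>n :: nat. \<theta> n \<in> test_functions \<Omega>" "(\<lambda>n. norm_L2 M (\<lambda>x. \<theta> n x - v x)) \<longlonglongrightarrow> 0"
    "(\<lambda>n. norm_L2 M (\<lambda>x. grad (\<theta> n) x - D x)) \<longlonglongrightarrow> 0"
    using H1_0_approx_limit[OF v] by blast
  have 1: "(\<lambda>n. norm_L2 M (\<theta> n)) \<longlonglongrightarrow> norm_L2 M v"
    by (rule tendsto_norm_L2[OF test_L2[OF \<theta>(1)] H1_weak_grad(1)[OF H1_0_D[OF v(1)]] \<theta>(2)])
  have 2: "(\<lambda>n. 2 * R * norm_L2 M (grad (\<theta> n))) \<longlonglongrightarrow> 2 * R * norm_L2 M D"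
    by (intro tendsto_intros tendsto_norm_L2[OF test_grad_L2[OF \<theta>(1)] is_weak_gradD(1)[OF v(2)] \<theta>(3)])
  show ?thesis by (rule LIMSEQ_le[OF 1 2]) (use poincare_test[OF R \<theta>(1)] in blast)
qed

text \<open>The function with index \<open>n\<close> is replaced by a test function at distance
  below \<open>1 / Suc n\<close> in both norms. The gradient bound grows by at most 1, and the
  Cauchy property of the test functions passes back.\<close>

lemma rellich_H1_0:
  assumes v: "\<And>n :: nat. v n \<in> H1_0 \<Omega>" "\<And>n. is_weak_grad \<Omega> (v n) (D n)" and C: "\<And>n. norm_L2 M (D n) \<le> C"
  obtains r :: "nat \<Rightarrow> nat" where "strict_mono r"
    "\<forall>e>0. \<exists>N. \<forall>m\<ge>N. \<forall>n\<ge>N. norm_L2 M (\<lambda>x. v (r m) x - v (r n) x) < e"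
proof -
  have vL2: "v n \<in> L2 \<Omega>" for n by (rule H1_weak_grad(1)[OF H1_0_D[OF v(1)]])
  have "\<forall>n. \<exists>\<theta>. \<theta> \<in> test_functions \<Omega> \<and> norm_L2 M (\<lambda>x. \<theta> x - v n x) < 1 / real (Suc n) \<and> norm_L2 M (\<lambda>x. grad \<theta> x - D n x) < 1 / real (Suc n)"
  proof
    fix n :: nat
    have "1 / real (Suc n) > 0" by simp
    then show "\<exists>\<theta>. \<theta> \<in> test_functions \<Omega> \<and> norm_L2 M (\<lambda>x. \<theta> x - v n x) < 1 / real (Suc n) \<and> norm_L2 M (\<lambda>x. grad \<theta> x - D n x) < 1 / real (Suc n)"
      using H1_0_iff[OF vL2 v(2), of n] v(1)[of n] by blast
  qed
  from choice[OF this] obtain \<theta> where \<theta>: "\<And>n. \<theta> n \<in> test_functions \<Omega>" "\<And>n. norm_L2 M (\<lambda>x. \<theta> n x - v n x) < 1 / Suc n"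
    "\<And>n. norm_L2 M (\<lambda>x. grad (\<theta> n) x - D n x) < 1 / Suc n" by blast
  have grad_le: "norm_L2 M (grad (\<theta> n)) \<le> C + 1" for n
  proof -
    have "1 / real (Suc n) \<le> 1" by simp
    then show ?thesis
      using norm_L2_diff_ge[OF test_grad_L2[OF \<theta>(1)] is_weak_gradD(1)[OF v(2)], of n n] \<theta>(3)[of n] C[of n] by linarith
  qed
  show ?thesis
  proof (rule rellich_test[of \<theta> "C + 1", OF \<theta>(1) grad_le])
    fix r :: "nat \<Rightarrow> nat"
    assume r: "strict_mono r" "\<forall>e>0. \<exists>N. \<forall>m\<ge>N. \<forall>n\<ge>N. norm_L2 M (\<lambda>x. \<theta> (r m) x - \<theta> (r n) x) < e"
    have "\<exists>N. \<forall>m\<ge>N. \<forall>n\<ge>N. norm_L2 M (\<lambda>x. v (r m) x - v (r n) x) < e" if e: "e > 0" for e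
    proof -
      obtain N1 where N1: "\<And>m n. m \<ge> N1 \<Longrightarrow> n \<ge> N1 \<Longrightarrow> norm_L2 M (\<lambda>x. \<theta> (r m) x - \<theta> (r n) x) < e / 3"
        using r(2) e by (meson divide_pos_pos zero_less_numeral)
      obtain N2 :: nat where N2: "1 / (e / 3) < real N2" using reals_Archimedean2 by blast
      have close: "norm_L2 M (\<lambda>x. \<theta> (r n) x - v (r n) x) < e / 3" if "n \<ge> N2" for n
      proof -
        have "real N2 \<le> real (Suc (r n))" using that seq_suble[OF r(1), of n] by linarith
        then have "1 / (e / 3) < real (Suc (r n))" using N2 by linarith
        then have "1 / real (Suc (r n)) < e / 3" using e by (simp add: field_simps)
        then show ?thesis using \<theta>(2)[of "r n"] by linarith
      qed
      have "norm_L2 M (\<lambda>x. v (r m) x - v (r n) x) < e" if "m \<ge> max N1 N2" "n \<ge> max N1 N2" for m n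
      proof -
        have "norm_L2 M (\<lambda>x. v (r m) x - v (r n) x) \<le> norm_L2 M (\<lambda>x. v (r m) x - \<theta> (r m) x) + norm_L2 M (\<lambda>x. \<theta> (r m) x - v (r n) x)"
          by (rule norm_L2_triangle[OF vL2 test_L2[OF \<theta>(1)] vL2])
        moreover have "norm_L2 M (\<lambda>x. \<theta> (r m) x - v (r n) x) \<le> norm_L2 M (\<lambda>x. \<theta> (r m) x - \<theta> (r n) x) + norm_L2 M (\<lambda>x. \<theta> (r n) x - v (r n) x)"
          by (rule norm_L2_triangle[OF test_L2[OF \<theta>(1)] test_L2[OF \<theta>(1)] vL2])
        moreover have "norm_L2 M (\<lambda>x. v (r m) x - \<theta> (r m) x) < e / 3"
          using close[of m] that norm_L2_minus_commute[of M "v (r m)" "\<theta> (r m)"] by simp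
        ultimately show ?thesis using N1[of m n] close[of n] that by simp
      qed
      then show ?thesis by blast
    qed
    then have "\<forall>e>0. \<exists>N. \<forall>m\<ge>N. \<forall>n\<ge>N. norm_L2 M (\<lambda>x. v (r m) x - v (r n) x) < e" by blast
    then show ?thesis by (rule that[OF r(1)])
  qed
qed

text \<open>Along approximating test functions the product estimate gives a uniform bound, since
  their values and gradients converge in L2. Fatou's lemma along an almost everywhere convergent
  subsequence passes it to the product.\<close>

lemma H1_times_H1_0:
  assumes u: "u \<in> H1 \<Omega>" and \<zeta>: "\<zeta> \<in> H1_0 \<Omega>"
  shows "(\<lambda>x. u x * \<zeta> x) \<in> L2 \<Omega>"
proof -
  note U = H1_weak_grad[OF u] and Z = H1_weak_grad[OF H1_0_D[OF \<zeta>]]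
  obtain \<theta> where \<theta>: "\<And>n :: nat. \<theta> n \<in> test_functions \<Omega>" "(\<lambda>n. norm_L2 M (\<lambda>x. \<theta> n x - \<zeta> x)) \<longlonglongrightarrow> 0"
    "(\<lambda>n. norm_L2 M (\<lambda>x. grad (\<theta> n) x - weak_grad \<Omega> \<zeta> x)) \<longlonglongrightarrow> 0"
    using H1_0_approx_limit[OF \<zeta> Z(2)] by blast
  obtain r where r: "strict_mono r" and AE: "AE x in M. (\<lambda>i. \<theta> (r i) x) \<longlonglongrightarrow> \<zeta> x"
    using L2_lim_AE_subseq[OF finite_measure_domain test_L2[OF \<theta>(1)] Z(1) \<theta>(2)] by blast
  have "Bseq (\<lambda>n. norm_L2 M (\<theta> n))"
    by (intro convergent_imp_Bseq convergentI[OF tendsto_norm_L2[OF test_L2[OF \<theta>(1)] Z(1) \<theta>(2)]])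
  then obtain C1 where C1: "\<And>n. norm_L2 M (\<theta> n) \<le> C1" by (auto simp: Bseq_def)
  have "Bseq (\<lambda>n. norm_L2 M (grad (\<theta> n)))"
    by (intro convergent_imp_Bseq convergentI[OF tendsto_norm_L2[OF test_grad_L2[OF \<theta>(1)] Z(3) \<theta>(3)]])
  then obtain C2 where C2: "\<And>n. norm_L2 M (grad (\<theta> n)) \<le> C2" by (auto simp: Bseq_def)
  let ?C = "2 * (norm_L2 M u * C2 + norm_L2 M (weak_grad \<Omega> u) * C1)"
  show ?thesis
  proof (rule L2_fatou(1)[of "\<lambda>i x. u x * \<theta> (r i) x" M])
    show "(\<lambda>x. u x * \<theta> (r i) x) \<in> L2 \<Omega>" for i by (rule test_mult_L2[OF U(1) \<theta>(1)])
    show "(\<lambda>x. u x * \<zeta> x) \<in> borel_measurable M"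
      using L2_spaceD(1)[OF U(1)] L2_spaceD(1)[OF Z(1)] by (rule borel_measurable_times)
    show "AE x in M. (\<lambda>n. u x * \<theta> (r n) x) \<longlonglongrightarrow> u x * \<zeta> x"
      using AE by eventually_elim (intro tendsto_intros)
    have "norm_L2 M (\<lambda>x. u x * \<theta> n x) \<le> ?C" for n
    proof -
      have "2 * (norm_L2 M u * norm_L2 M (grad (\<theta> n)) + norm_L2 M (weak_grad \<Omega> u) * norm_L2 M (\<theta> n)) \<le> ?C"
        by (intro mult_left_mono add_mono C1 C2) auto
      with product_bound[OF U(1,2) \<theta>(1)[of n]] show ?thesis by (rule order_trans)
    qed
    then show "\<forall>\<^sub>F n in sequentially. norm_L2 M (\<lambda>x. u x * \<theta> (r n) x) \<le> ?C" by simp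
  qed
qed

end

subsection \<open>Weak Hessians and traces\<close>

lemma DERIV_T_mat: "((\<lambda>s. T_mat s $ i $ j) has_real_derivative T'_mat s $ i $ j) (at s)"
proof -
  have 1: "((\<lambda>s. (cos s)\<^sup>2) has_real_derivative - sin (2 * s)) (at s)"
    by (auto intro!: derivative_eq_intros simp: sin_double)
  have 2: "((\<lambda>s. sin s * cos s) has_real_derivative cos (2 * s)) (at s)"
    by (auto intro!: derivative_eq_intros simp: cos_double power2_eq_square)
  have 3: "((\<lambda>s. (sin s)\<^sup>2) has_real_derivative sin (2 * s)) (at s)"
    by (auto intro!: derivative_eq_intros simp: sin_double)
  show ?thesis
    using exhaust_2[of i] exhaust_2[of j] 1 2 3 by (auto simp: T_mat_def T'_mat_def)
qed

lemma norm_matrix_le_sum: "norm (A :: real^2^2) \<le> (\<Sum>i\<in>UNIV. \<Sum>j\<in>UNIV. \<bar>A $ i $ j\<bar>)"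
proof -
  have "norm A \<le> (\<Sum>i\<in>UNIV. norm (A $ i))"
    unfolding norm_vec_def by (rule L2_set_le_sum) simp
  also have "\<dots> \<le> (\<Sum>i\<in>UNIV. \<Sum>j\<in>UNIV. \<bar>A $ i $ j\<bar>)"
    by (intro sum_mono norm_le_l1_cart)
  finally show ?thesis .
qed

lemma T'_mat_le: "\<bar>T'_mat s $ i $ j\<bar> \<le> 1"
  using exhaust_2[of i] exhaust_2[of j] by (auto simp: T'_mat_def)

text \<open>Each of the four entries has a derivative bounded by 1, and the Frobenius norm is at
  most the sum of the absolute entries.\<close>

lemma T_mat_lipschitz: "norm (T_mat s - T_mat t) \<le> 4 * \<bar>s - t\<bar>"
proof -
  have "\<bar>T_mat s $ i $ j - T_mat t $ i $ j\<bar> \<le> \<bar>s - t\<bar>" for i j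
    using field_differentiable_bound[of UNIV "\<lambda>s. T_mat s $ i $ j" "\<lambda>s. T'_mat s $ i $ j" 1 s t]
      DERIV_T_mat T'_mat_le by simp
  then have "(\<Sum>i\<in>UNIV. \<Sum>j\<in>UNIV. \<bar>(T_mat s - T_mat t) $ i $ j\<bar>) \<le> (\<Sum>i\<in>(UNIV :: 2 set). \<Sum>j\<in>(UNIV :: 2 set). \<bar>s - t\<bar>)"
    by (intro sum_mono) simp
  then show ?thesis using norm_matrix_le_sum[of "T_mat s - T_mat t"] by simp
qed

text \<open>\<open>T_mat s\<close> is the orthogonal projection onto the unit vector with components
  \<open>cos s\<close> and \<open>sin s\<close>, and a rank-one projection has Frobenius norm
  1.\<close>

lemma norm_T_mat_le: "norm (T_mat s) \<le> 1"
proof -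
  have "(norm (T_mat s))\<^sup>2 = T_mat s \<bullet> T_mat s" by (rule power2_norm_eq_inner)
  also have "\<dots> = ((cos s)\<^sup>2)\<^sup>2 + (sin s * cos s)\<^sup>2 + ((sin s * cos s)\<^sup>2 + ((sin s)\<^sup>2)\<^sup>2)"
    by (simp add: inner_vec_def UNIV_2 T_mat_def power2_eq_square)
  also have "\<dots> = ((cos s)\<^sup>2 + (sin s)\<^sup>2)\<^sup>2"
  proof -
    have "(c\<^sup>2)\<^sup>2 + (d * c)\<^sup>2 + ((d * c)\<^sup>2 + (d\<^sup>2)\<^sup>2) = (c\<^sup>2 + d\<^sup>2)\<^sup>2" for c d :: real
      by (simp add: power2_eq_square algebra_simps)
    then show ?thesis .
  qed
  also have "\<dots> = 1\<^sup>2" by simp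
  finally show ?thesis by (simp add: power2_le_imp_le)
qed

lemma transpose_T_mat: "transpose (T_mat s) = T_mat s"
  by (auto simp: transpose_def T_mat_def vec_eq_iff forall_2)

lemma T_mat_measurable:
  assumes [measurable]: "\<psi> \<in> borel_measurable M"
  shows "(\<lambda>x. T_mat (\<psi> x)) \<in> borel_measurable M" "(\<lambda>x. T'_mat (\<psi> x)) \<in> borel_measurable M"
proof -
  have "(\<lambda>x. T_mat (\<psi> x) $ i $ j) \<in> borel_measurable M" "(\<lambda>x. T'_mat (\<psi> x) $ i $ j) \<in> borel_measurable M" for i j
    using exhaust_2[of i] exhaust_2[of j] by (auto simp: T_mat_def T'_mat_def)
  then show "(\<lambda>x. T_mat (\<psi> x)) \<in> borel_measurable M" "(\<lambda>x. T'_mat (\<psi> x)) \<in> borel_measurable M"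
    by (auto intro!: borel_measurable_vec_lambda)
qed

lemma T_mat_difference_quotient:
  "(\<lambda>n. real (Suc n) *\<^sub>R (T_mat (s + 1 / real (Suc n) * z) - T_mat s)) \<longlonglongrightarrow> z *\<^sub>R T'_mat s"
proof (intro vec_tendstoI)
  fix i j
  have "((\<lambda>t. T_mat (s + t * z) $ i $ j) has_real_derivative T'_mat (s + 0 * z) $ i $ j * z) (at 0)"
    by (rule DERIV_chain'[of "\<lambda>t. s + t * z" z 0 UNIV "\<lambda>s. T_mat s $ i $ j"])
       (auto intro!: derivative_eq_intros DERIV_T_mat)
  then have lim: "((\<lambda>t. (T_mat (s + t * z) $ i $ j - T_mat s $ i $ j) / t) \<longlongrightarrow> T'_mat s $ i $ j * z) (at 0)"
    by (simp add: DERIV_def)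
  have "filterlim (\<lambda>n. 1 / real (Suc n)) (at 0) sequentially"
    using LIMSEQ_Suc[OF lim_1_over_n] by (auto simp: filterlim_at)
  from filterlim_compose[OF lim this]
  show "(\<lambda>n. (real (Suc n) *\<^sub>R (T_mat (s + 1 / real (Suc n) * z) - T_mat s)) $ i $ j) \<longlonglongrightarrow> (z *\<^sub>R T'_mat s) $ i $ j"
    by (simp add: mult_ac)
qed

lemma quadratic_nonneg_imp_linear_coeff_0:
  fixes a b :: real
  assumes "\<And>t. 0 \<le> a * t\<^sup>2 + b * t"
  shows "b = 0"
proof -
  \<comment> \<open>The point \<open>- t\<close> makes the linear term win: the value there is at
    most \<open>- t\<^sup>2\<close>, whatever the sign of \<open>a\<close>.\<close>
  define t where "t = b / (\<bar>a\<bar> + 1)"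
  have b: "b = t * (\<bar>a\<bar> + 1)" by (simp add: t_def)
  have "0 \<le> a * t\<^sup>2 - b * t" using assms[of "- t"] by simp
  also have "\<dots> = (a - \<bar>a\<bar>) * t\<^sup>2 - t\<^sup>2" by (simp add: b algebra_simps power2_eq_square)
  also have "\<dots> \<le> - t\<^sup>2" by (simp add: mult_nonpos_nonneg)
  finally show ?thesis using b by simp
qed

lemma norm_L2_Pair_le:
  assumes "f \<in> L2_space M" "g \<in> L2_space M"
  shows "norm_L2 M (\<lambda>x. (f x, g x)) \<le> norm_L2 M f + norm_L2 M g"
proof (rule power2_le_imp_le)
  have "(norm_L2 M (\<lambda>x. (f x, g x)))\<^sup>2 = (norm_L2 M f)\<^sup>2 + (norm_L2 M g)\<^sup>2"
    using assms by (simp add: norm_L2_power2 norm_Pair L2_space_def)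
  then show "(norm_L2 M (\<lambda>x. (f x, g x)))\<^sup>2 \<le> (norm_L2 M f + norm_L2 M g)\<^sup>2"
    by (simp add: power2_sum)
qed simp

lemma norm_L2_Pair_ge:
  assumes "f \<in> L2_space M" "g \<in> L2_space M"
  shows "norm_L2 M f \<le> norm_L2 M (\<lambda>x. (f x, g x))" "norm_L2 M g \<le> norm_L2 M (\<lambda>x. (f x, g x))"
  using assms norm_fst_le norm_snd_le
  by (auto intro!: norm_L2_mono L2_space_Pair L2_spaceD(1))

lemma tendsto_norm_L2_Pair:
  assumes "\<And>n. f n \<in> L2_space M" "\<And>n. g n \<in> L2_space M" "a \<in> L2_space M" "b \<in> L2_space M"
    "(\<lambda>n. norm_L2 M (\<lambda>x. (f n x, g n x) - (a x, b x))) \<longlonglongrightarrow> 0"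
  shows "(\<lambda>n. norm_L2 M (\<lambda>x. f n x - a x)) \<longlonglongrightarrow> 0" "(\<lambda>n. norm_L2 M (\<lambda>x. g n x - b x)) \<longlonglongrightarrow> 0"
proof -
  have lim: "(\<lambda>n. norm_L2 M (\<lambda>x. (f n x - a x, g n x - b x))) \<longlonglongrightarrow> 0" using assms(5) by simp
  note ge = norm_L2_Pair_ge[OF L2_space_diff[OF assms(1,3)] L2_space_diff[OF assms(2,4)]]
  show "(\<lambda>n. norm_L2 M (\<lambda>x. f n x - a x)) \<longlonglongrightarrow> 0"
    by (rule tendsto_sandwich[OF _ _ tendsto_const lim]) (use ge(1) in auto)
  show "(\<lambda>n. norm_L2 M (\<lambda>x. g n x - b x)) \<longlonglongrightarrow> 0"
    by (rule tendsto_sandwich[OF _ _ tendsto_const lim]) (use ge(2) in auto)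
qed

lemma norm_L2_power2_midpoint_le:
  assumes "f \<in> L2_space M" "g \<in> L2_space M"
  shows "(norm_L2 M (\<lambda>x. (1/2) *\<^sub>R (f x + g x)))\<^sup>2 \<le> ((norm_L2 M f)\<^sup>2 + (norm_L2 M g)\<^sup>2) / 2"
  using norm_L2_midpoint[OF assms] zero_le_power2[of "norm_L2 M (\<lambda>x. f x - g x)"] by linarith

section \<open>Second weak derivatives and trace pairings\<close>

context bounded_domain
begin

lemma ip_eq_inner_L2: "ip \<Omega> f g = inner_L2 M f g"
  by (simp add: ip_def inner_L2_def)

lemma H2_is_H2:
  assumes "v \<in> H2 \<Omega>"
  shows "is_H2 \<Omega> v (weak_grad \<Omega> v) (weak_hess \<Omega> v)"
proof -
  have v: "v \<in> H1 \<Omega>" "\<And>i. (\<lambda>x. weak_grad \<Omega> v x $ i) \<in> H1 \<Omega>" using assms by (auto simp: H2_def)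
  show ?thesis
    using H1_weak_grad[OF v(1)] H1_weak_grad(2)[OF v(2)] by (simp add: is_H2_def weak_hess_def)
qed

text \<open>\<open>H2\<close> is defined through the chosen weak gradient. It agrees almost
  everywhere with \<open>D\<close>, so it has the same weak derivatives.\<close>

lemma is_H2_weak_grad_component:
  assumes "is_H2 \<Omega> v D H"
  shows "is_weak_grad \<Omega> (\<lambda>x. weak_grad \<Omega> v x $ i) (\<lambda>x. H x $ i)"
proof (rule is_weak_grad_cong[OF is_H2D(3)[OF assms]])
  note H = is_H2D[OF assms]
  note V = H1_weak_grad[OF H1_I[OF H(1,2)]]
  show "(\<lambda>x. D x $ i) \<in> borel_measurable M" "(\<lambda>x. weak_grad \<Omega> v x $ i) \<in> borel_measurable M"
    "(\<lambda>x. H x $ i) \<in> borel_measurable M"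
    using L2_space_nth[OF H(4)] L2_space_nth[OF V(3)] L2_space_nth[OF H(5)] by (auto simp: L2_space_def)
  show "AE x in M. D x $ i = weak_grad \<Omega> v x $ i"
    using weak_grad_AE_eq[OF H(1,2)] by eventually_elim simp
qed simp

lemma is_H2_imp_H2:
  assumes "is_H2 \<Omega> v D H"
  shows "v \<in> H2 \<Omega>" "AE x in M. weak_hess \<Omega> v x = H x"
proof -
  note H = is_H2D[OF assms]
  note V = H1_weak_grad[OF H1_I[OF H(1,2)]]
  note C = is_H2_weak_grad_component[OF assms]
  show "v \<in> H2 \<Omega>"
    unfolding H2_def using H1_I[OF H(1,2)] H1_I[OF L2_space_nth[OF V(3)] C] by blast
  show "AE x in M. weak_hess \<Omega> v x = H x"
  proof (rule AE_vec_eqI)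
    show "AE x in M. weak_hess \<Omega> v x $ i = H x $ i" for i
      using weak_grad_AE_eq[OF L2_space_nth[OF V(3)] C, of i] by (simp add: weak_hess_def)
  qed
qed

lemma is_H2_lincomb:
  assumes "is_H2 \<Omega> v D H" "is_H2 \<Omega> w E Z"
  shows "is_H2 \<Omega> (\<lambda>x. a * v x + b * w x) (\<lambda>x. a *\<^sub>R D x + b *\<^sub>R E x) (\<lambda>x. a *\<^sub>R H x + b *\<^sub>R Z x)"
  unfolding is_H2_def
proof (intro conjI allI)
  note V = is_H2D[OF assms(1)] and W = is_H2D[OF assms(2)]
  show "(\<lambda>x. a * v x + b * w x) \<in> L2 \<Omega>" by (intro L2_space_add L2_space_mult_left V W)
  show "is_weak_grad \<Omega> (\<lambda>x. a * v x + b * w x) (\<lambda>x. a *\<^sub>R D x + b *\<^sub>R E x)"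
    by (rule is_weak_grad_lincomb[OF V(2) W(2) V(1) W(1)])
  show "is_weak_grad \<Omega> (\<lambda>x. (a *\<^sub>R D x + b *\<^sub>R E x) $ i) (\<lambda>x. (a *\<^sub>R H x + b *\<^sub>R Z x) $ i)" for i
    using is_weak_grad_lincomb[OF V(3) W(3) is_weak_gradD(3)[OF V(2)] is_weak_gradD(3)[OF W(2)]] by simp
qed

lemma tendsto_norm_L2_nth:
  fixes F :: "nat \<Rightarrow> real^2 \<Rightarrow> 'b::euclidean_space ^ 'n"
  assumes "\<And>n. F n \<in> L2 \<Omega>" "y \<in> L2 \<Omega>" "(\<lambda>n. norm_L2 M (\<lambda>x. F n x - y x)) \<longlonglongrightarrow> 0"
  shows "(\<lambda>n. norm_L2 M (\<lambda>x. F n x $ i - y x $ i)) \<longlonglongrightarrow> 0"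
proof (rule tendsto_sandwich[OF _ _ tendsto_const assms(3)])
  have "norm_L2 M (\<lambda>x. F n x $ i - y x $ i) \<le> norm_L2 M (\<lambda>x. F n x - y x)" for n
    using Finite_Cartesian_Product.norm_nth_le[of "F n _ - y _" i]
    by (intro norm_L2_mono L2_space_diff assms L2_spaceD(1)[OF L2_space_diff] L2_space_nth) auto
  then show "\<forall>\<^sub>F n in sequentially. norm_L2 M (\<lambda>x. F n x $ i - y x $ i) \<le> norm_L2 M (\<lambda>x. F n x - y x)" by simp
qed auto

lemma is_H2_limit:
  assumes "\<And>n. is_H2 \<Omega> (v n) (D n) (H n)" "u \<in> L2 \<Omega>" "p \<in> L2 \<Omega>" "Z \<in> L2 \<Omega>"
    "(\<lambda>n. norm_L2 M (\<lambda>x. v n x - u x)) \<longlonglongrightarrow> 0" "(\<lambda>n. norm_L2 M (\<lambda>x. D n x - p x)) \<longlonglongrightarrow> 0"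
    "(\<lambda>n. norm_L2 M (\<lambda>x. H n x - Z x)) \<longlonglongrightarrow> 0"
  shows "is_H2 \<Omega> u p Z"
  unfolding is_H2_def
proof (intro conjI allI)
  note V = is_H2D[OF assms(1)]
  show "is_weak_grad \<Omega> u p"
    by (rule is_weak_grad_limit[OF V(2) V(1) assms(2,3,5,6)])
  show "is_weak_grad \<Omega> (\<lambda>x. p x $ i) (\<lambda>x. Z x $ i)" for i
    by (rule is_weak_grad_limit[OF V(3) is_weak_gradD(3)[OF V(2)] L2_space_nth[OF assms(3)] L2_space_nth[OF assms(4)]
          tendsto_norm_L2_nth[OF V(4) assms(3,6)] tendsto_norm_L2_nth[OF V(5) assms(4,7)]])
qed (rule assms(2))

lemma is_H2_test:
  assumes "\<theta> \<in> test_functions \<Omega>"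
  shows "is_H2 \<Omega> \<theta> (grad \<theta>) (hess \<theta>)"
proof -
  have "(\<lambda>x. hess \<theta> x $ i) = grad (partial i \<theta>)" for i
    by (auto simp: hess_def grad_def vec_eq_iff)
  then show ?thesis
    unfolding is_H2_def
    using test_L2[OF assms] is_weak_grad_test[OF assms] is_weak_grad_test[OF test_functions_partial[OF assms]]
    by simp
qed

text \<open>Tested with \<theta>, both off-diagonal entries become \<open>v\<close> paired with a
  mixed second derivative of \<theta>, and these commute. The symmetry puts the tensor of the
  minimiser into \<open>H_dDiv\<close>.\<close>

lemma is_H2_symmetric:
  assumes "is_H2 \<Omega> v D H"
  shows "AE x in M. transpose (H x) = H x"
proof -
  note V = is_H2D[OF assms]
  have HL2: "(\<lambda>x. H x $ i $ j) \<in> L2 \<Omega>" for i j using is_weak_gradD(3)[OF V(3)] .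
  have eq: "inner_L2 M (\<lambda>x. H x $ i $ j) \<theta> = inner_L2 M v (partial i (partial j \<theta>))" if \<theta>: "\<theta> \<in> test_functions \<Omega>" for \<theta> i j
    using is_weak_gradD(2)[OF V(3) \<theta>, of i j] is_weak_gradD(2)[OF V(2) test_functions_partial[OF \<theta>], of i j] by simp
  have "AE x in M. H x $ 1 $ 2 - H x $ 2 $ 1 = 0"
  proof (rule orthogonal_test_functions_imp_AE_0)
    show "(\<lambda>x. H x $ 1 $ 2 - H x $ 2 $ 1) \<in> L2 \<Omega>" by (intro L2_space_diff HL2)
    fix \<theta> assume \<theta>: "\<theta> \<in> test_functions \<Omega>"
    have "partial 1 (partial 2 \<theta>) = partial 2 (partial 1 \<theta>)"
      using partial_commute[OF test_functionsD(1)[OF \<theta>]] by blast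
    then show "inner_L2 M (\<lambda>x. H x $ 1 $ 2 - H x $ 2 $ 1) \<theta> = 0"
      by (simp add: inner_L2_diff HL2 test_L2[OF \<theta>] eq[OF \<theta>])
  qed
  then show ?thesis
    by eventually_elim (auto simp: transpose_def vec_eq_iff forall_2)
qed

lemma H_dDivD:
  assumes "N \<in> H_dDiv \<Omega>"
  shows "N \<in> L2 \<Omega>" "dDiv \<Omega> N \<in> L2 \<Omega>"
    "\<theta> \<in> test_functions \<Omega> \<Longrightarrow> inner_L2 M N (hess \<theta>) = inner_L2 M (dDiv \<Omega> N) \<theta>"
proof -
  have "is_dDiv \<Omega> N (dDiv \<Omega> N)"
    using assms unfolding H_dDiv_def dDiv_def by (auto intro: someI_ex[of "is_dDiv \<Omega> N"])
  then show "dDiv \<Omega> N \<in> L2 \<Omega>" "\<theta> \<in> test_functions \<Omega> \<Longrightarrow> inner_L2 M N (hess \<theta>) = inner_L2 M (dDiv \<Omega> N) \<theta>"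
    by (auto simp: is_dDiv_def ip_eq_inner_L2)
  show "N \<in> L2 \<Omega>" using assms by (simp add: H_dDiv_def L2_sym_def)
qed

lemma dDiv_AE_eq:
  assumes "N \<in> H_dDiv \<Omega>" "is_dDiv \<Omega> N w"
  shows "AE x in M. dDiv \<Omega> N x = w x"
proof -
  note N = H_dDivD[OF assms(1)]
  have w: "w \<in> L2 \<Omega>" using assms(2) by (simp add: is_dDiv_def)
  have "AE x in M. dDiv \<Omega> N x - w x = 0"
  proof (rule orthogonal_test_functions_imp_AE_0[OF L2_space_diff[OF N(2) w]])
    fix \<theta> assume \<theta>: "\<theta> \<in> test_functions \<Omega>"
    then show "inner_L2 M (\<lambda>x. dDiv \<Omega> N x - w x) \<theta> = 0"
      using N(3)[OF \<theta>] assms(2) by (simp add: inner_L2_diff N w test_L2[OF \<theta>] is_dDiv_def ip_eq_inner_L2)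
  qed
  then show ?thesis by simp
qed

lemma tr_eq:
  assumes "is_H2 \<Omega> v D H" "N \<in> H_dDiv \<Omega>"
  shows "tr_Ggrad \<Omega> v N = inner_L2 M (dDiv \<Omega> N) v - inner_L2 M N H"
    "tr_dDiv \<Omega> N v = inner_L2 M (dDiv \<Omega> N) v - inner_L2 M N H"
proof -
  note V = is_H2D[OF assms(1)] and N = H_dDivD[OF assms(2)]
  have "inner_L2 M N (weak_hess \<Omega> v) = inner_L2 M N H"
    using is_H2D(5)[OF H2_is_H2[OF is_H2_imp_H2(1)[OF assms(1)]]]
    by (intro inner_L2_cong_AE is_H2_imp_H2(2)[OF assms(1)] L2_spaceD(1) N V) auto
  then show "tr_Ggrad \<Omega> v N = inner_L2 M (dDiv \<Omega> N) v - inner_L2 M N H"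
    "tr_dDiv \<Omega> N v = inner_L2 M (dDiv \<Omega> N) v - inner_L2 M N H"
    by (simp_all add: tr_Ggrad_def tr_dDiv_def ip_eq_inner_L2)
qed

text \<open>This is the definition of the distributional \<open>dDiv\<close>. It makes every test
  function an admissible variation of \<open>u\<close>.\<close>

lemma tr_dDiv_test:
  assumes "\<theta> \<in> test_functions \<Omega>" "N \<in> H_dDiv \<Omega>"
  shows "tr_dDiv \<Omega> N \<theta> = 0"
  using tr_eq(2)[OF is_H2_test[OF assms(1)] assms(2)] H_dDivD(3)[OF assms(2,1)] by simp

lemma L2_space_times_T_mat:
  assumes v: "v \<in> L2 \<Omega>" and \<psi>: "\<psi> \<in> borel_measurable M"
  shows "(\<lambda>x. (c * v x) *\<^sub>R T_mat (\<psi> x)) \<in> L2 \<Omega>"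
    "norm_L2 M (\<lambda>x. (c * v x) *\<^sub>R T_mat (\<psi> x)) \<le> \<bar>c\<bar> * norm_L2 M v"
proof -
  have meas: "(\<lambda>x. (c * v x) *\<^sub>R T_mat (\<psi> x)) \<in> borel_measurable M"
    by (intro borel_measurable_scaleR T_mat_measurable(1)[OF \<psi>] borel_measurable_times borel_measurable_const L2_spaceD(1)[OF v])
  have le: "norm ((c * v x) *\<^sub>R T_mat (\<psi> x)) \<le> \<bar>c\<bar> * norm (v x)" for x
    using mult_left_mono[OF norm_T_mat_le[of "\<psi> x"], of "\<bar>c * v x\<bar>"] by (simp add: abs_mult)
  show "(\<lambda>x. (c * v x) *\<^sub>R T_mat (\<psi> x)) \<in> L2 \<Omega>" by (rule L2_space_bound[OF v meas le])
  show "norm_L2 M (\<lambda>x. (c * v x) *\<^sub>R T_mat (\<psi> x)) \<le> \<bar>c\<bar> * norm_L2 M v"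
    by (rule norm_L2_bounded_mult[OF v meas _ le]) simp
qed

end

subsection \<open>The relaxed minimisation problem\<close>

locale coupled_problem = bounded_domain \<Omega> for \<Omega> :: "(real^2) set" +
  fixes \<beta> :: boundary_data and q B K m :: real and f g \<eta> :: "real^2 \<Rightarrow> real" and G :: "real^2 \<Rightarrow> real^2^2"
  assumes lipschitz: "lipschitz_domain \<Omega>"
    and B: "B > 0" and K: "K > 0" and m: "m > 0"
    and f: "f \<in> L2 \<Omega>" and G: "G \<in> H_dDiv \<Omega>" and g: "g \<in> H2 \<Omega>" and \<eta>: "\<eta> \<in> H1 \<Omega>"
begin

abbreviation "V \<equiv> V_space \<Omega> \<beta> g"
abbreviation "W \<equiv> W_space \<Omega> \<eta>"

text \<open>The energy with the auxiliary fields as independent arguments, in which it is convex.\<close>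

definition convex_energy ::
    "(real^2 \<Rightarrow> real) \<Rightarrow> (real^2 \<Rightarrow> real^2^2) \<Rightarrow> (real^2 \<Rightarrow> real^2) \<Rightarrow> (real^2 \<Rightarrow> real^2^2) \<Rightarrow> real" where
  "convex_energy v H r A = B / 2 * (norm_L2 M A)\<^sup>2 + m / 2 * (norm_L2 M v)\<^sup>2 + K / 2 * (norm_L2 M r)\<^sup>2
    - inner_L2 M f v + B * (inner_L2 M (dDiv \<Omega> G) v - inner_L2 M G H)"

text \<open>The tensor \<open>M\<close> of the variational system. With \<open>H\<close> as an
  argument of its own the expression is linear in \<open>(v, H)\<close> for fixed \<psi>.\<close>

definition moment :: "(real^2 \<Rightarrow> real) \<Rightarrow> (real^2 \<Rightarrow> real^2^2) \<Rightarrow> (real^2 \<Rightarrow> real) \<Rightarrow> real^2 \<Rightarrow> real^2^2" where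
  "moment v H \<psi> x = H x + (q\<^sup>2 * v x) *\<^sub>R T_mat (\<psi> x)"

lemma moment_L2:
  assumes "v \<in> L2 \<Omega>" "H \<in> L2 \<Omega>" "\<psi> \<in> L2 \<Omega>"
  shows "moment v H \<psi> \<in> L2 \<Omega>"
  unfolding moment_def[abs_def]
  by (intro L2_space_add L2_space_times_T_mat assms L2_spaceD(1)[OF assms(3)])

lemma energy_eq:
  assumes v: "is_H2 \<Omega> v D H" and \<psi>: "is_weak_grad \<Omega> \<psi> r" "\<psi> \<in> L2 \<Omega>"
  shows "energy \<Omega> B K m q f G v \<psi> = convex_energy v H r (moment v H \<psi>)"
proof -
  note V = is_H2D[OF v]
  note HL2 = is_H2D(5)[OF H2_is_H2[OF is_H2_imp_H2(1)[OF v]]]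
  have "(LINT x|M. (norm (weak_hess \<Omega> v x + (q\<^sup>2 * v x) *\<^sub>R T_mat (\<psi> x)))\<^sup>2) = (norm_L2 M (moment v (weak_hess \<Omega> v) \<psi>))\<^sup>2"
    by (simp add: norm_L2_power2 moment_def)
  also have "norm_L2 M (moment v (weak_hess \<Omega> v) \<psi>) = norm_L2 M (moment v H \<psi>)"
    using is_H2_imp_H2(2)[OF v]
    by (intro norm_L2_cong_AE L2_spaceD(1) moment_L2 V HL2 \<psi>) (auto simp: moment_def elim: eventually_mono)
  finally have 1: "(LINT x|M. (norm (weak_hess \<Omega> v x + (q\<^sup>2 * v x) *\<^sub>R T_mat (\<psi> x)))\<^sup>2) = (norm_L2 M (moment v H \<psi>))\<^sup>2" .
  have 2: "(LINT x|M. (norm (weak_grad \<Omega> \<psi> x))\<^sup>2) = (norm_L2 M r)\<^sup>2"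
    unfolding norm_L2_power2[symmetric]
    using weak_grad_AE_eq[OF \<psi>(2,1)] is_weak_gradD(1)[OF \<psi>(1)] H1_weak_grad(3)[OF H1_I[OF \<psi>(2,1)]]
    by (intro arg_cong[where f = "\<lambda>x. x\<^sup>2"] norm_L2_cong_AE) (auto simp: L2_space_def)
  have 3: "(LINT x|M. (v x)\<^sup>2) = (norm_L2 M v)\<^sup>2" by (simp add: norm_L2_power2)
  show ?thesis
    unfolding energy_def convex_energy_def 1 2 3 tr_eq(2)[OF v G] by (simp add: inner_L2_def)
qed

text \<open>Young's inequality absorbs the linear terms, since \<open>H\<close> is \<open>A\<close> up to a multiple of \<open>v\<close>.\<close>

lemma coercive:
  obtains C where "0 \<le> C" "\<And>v H \<psi> r. v \<in> L2 \<Omega> \<Longrightarrow> H \<in> L2 \<Omega> \<Longrightarrow> \<psi> \<in> L2 \<Omega> \<Longrightarrow>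
    B / 4 * (norm_L2 M (moment v H \<psi>))\<^sup>2 + m / 4 * (norm_L2 M v)\<^sup>2 + K / 2 * (norm_L2 M r)\<^sup>2
      \<le> convex_energy v H r (moment v H \<psi>) + C"
proof -
  note GG = H_dDivD[OF G]
  \<comment> \<open>\<open>a\<close> and \<open>b\<close> collect the coefficients of the norms of
    the moment and of \<open>v\<close> in the linear terms. Eliminating \<open>H\<close> through the
    moment adds the term with \<open>q\<^sup>2\<close> to \<open>b\<close>.\<close>
  define a where "a = B * norm_L2 M G"
  define b where "b = norm_L2 M f + B * norm_L2 M (dDiv \<Omega> G) + B * norm_L2 M G * q\<^sup>2"
  \<comment> \<open>Completes the square; half of the quadratic term is spent on the linear
    one.\<close>
  have young: "c / 4 * t\<^sup>2 \<le> c / 2 * t\<^sup>2 - k * t + k\<^sup>2 / c" if "c > 0" for c t k :: real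
  proof -
    have "0 \<le> c * (t / 2 - k / c)\<^sup>2" using that by simp
    also have "\<dots> = c / 4 * t\<^sup>2 - k * t + k\<^sup>2 / c"
      using that by (simp add: power2_eq_square field_simps)
    finally show ?thesis by linarith
  qed
  have "B / 4 * (norm_L2 M (moment v H \<psi>))\<^sup>2 + m / 4 * (norm_L2 M v)\<^sup>2 + K / 2 * (norm_L2 M r)\<^sup>2
      \<le> convex_energy v H r (moment v H \<psi>) + (a\<^sup>2 / B + b\<^sup>2 / m)"
    if v: "v \<in> L2 \<Omega>" and H: "H \<in> L2 \<Omega>" and \<psi>: "\<psi> \<in> L2 \<Omega>" for v H \<psi> r
  proof -
    let ?A = "moment v H \<psi>"
    note A = moment_L2[OF v H \<psi>]
    note T = L2_space_times_T_mat[OF v L2_spaceD(1)[OF \<psi>], of "q\<^sup>2"]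
    have "inner_L2 M f v \<le> norm_L2 M f * norm_L2 M v"
      using Cauchy_Schwarz_L2[OF f v] by linarith
    moreover have "- inner_L2 M (dDiv \<Omega> G) v \<le> norm_L2 M (dDiv \<Omega> G) * norm_L2 M v"
      using Cauchy_Schwarz_L2[OF GG(2) v] by linarith
    from mult_left_mono[OF this, of B] have "- (B * inner_L2 M (dDiv \<Omega> G) v) \<le> B * norm_L2 M (dDiv \<Omega> G) * norm_L2 M v"
      using B by (simp add: mult.assoc)
    moreover have "inner_L2 M G H \<le> norm_L2 M G * norm_L2 M ?A + norm_L2 M G * (q\<^sup>2 * norm_L2 M v)"
    proof -
      have "H = (\<lambda>x. ?A x - (q\<^sup>2 * v x) *\<^sub>R T_mat (\<psi> x))" by (auto simp: moment_def)
      then have "inner_L2 M G H = inner_L2 M G ?A - inner_L2 M G (\<lambda>x. (q\<^sup>2 * v x) *\<^sub>R T_mat (\<psi> x))"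
        using inner_L2_diff(2)[OF A T(1) GG(1)] by simp
      moreover have "\<bar>inner_L2 M G (\<lambda>x. (q\<^sup>2 * v x) *\<^sub>R T_mat (\<psi> x))\<bar> \<le> norm_L2 M G * (q\<^sup>2 * norm_L2 M v)"
        using Cauchy_Schwarz_L2[OF GG(1) T(1)] mult_left_mono[OF T(2) norm_L2_nonneg[of M G]] by simp
      ultimately show ?thesis using Cauchy_Schwarz_L2[OF GG(1) A] by linarith
    qed
    then have "B * inner_L2 M G H \<le> B * (norm_L2 M G * norm_L2 M ?A + norm_L2 M G * (q\<^sup>2 * norm_L2 M v))"
      using B by (intro mult_left_mono) auto
    ultimately have "convex_energy v H r ?A \<ge> (B / 2 * (norm_L2 M ?A)\<^sup>2 - a * norm_L2 M ?A)
        + (m / 2 * (norm_L2 M v)\<^sup>2 - b * norm_L2 M v) + K / 2 * (norm_L2 M r)\<^sup>2"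
      by (simp add: convex_energy_def a_def b_def algebra_simps)
    then show ?thesis
      using young[OF B, of "norm_L2 M ?A" a] young[OF m, of "norm_L2 M v" b] by linarith
  qed
  then show ?thesis
    using B m by (intro that[of "a\<^sup>2 / B + b\<^sup>2 / m"]) auto
qed

text \<open>With an explicit Hessian, membership becomes a family of linear identities in
  \<open>(v, H)\<close>, stable under midpoints and L2 limits.\<close>

lemma V_iff:
  assumes v: "is_H2 \<Omega> v D H"
  shows "v \<in> V \<longleftrightarrow> (\<forall>N\<in>H_N \<Omega> \<beta>. inner_L2 M v (dDiv \<Omega> N) - inner_L2 M H N = tr_Ggrad \<Omega> g N)"
proof -
  have "tr_Ggrad \<Omega> v N = inner_L2 M v (dDiv \<Omega> N) - inner_L2 M H N" if "N \<in> H_N \<Omega> \<beta>" for N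
    using tr_eq(1)[OF v, of N] that by (simp add: H_N_def inner_L2_commute[of M v] inner_L2_commute[of M H])
  then show ?thesis using is_H2_imp_H2(1)[OF v] by (simp add: V_space_def)
qed

lemma W_D:
  assumes "\<psi> \<in> W"
  shows "\<psi> \<in> H1 \<Omega>" "(\<lambda>x. \<psi> x - \<eta> x) \<in> H1_0 \<Omega>"
    "is_weak_grad \<Omega> (\<lambda>x. \<psi> x - \<eta> x) (\<lambda>x. weak_grad \<Omega> \<psi> x - weak_grad \<Omega> \<eta> x)"
proof -
  show \<psi>: "\<psi> \<in> H1 \<Omega>" "(\<lambda>x. \<psi> x - \<eta> x) \<in> H1_0 \<Omega>" using assms by (auto simp: W_space_def)
  show "is_weak_grad \<Omega> (\<lambda>x. \<psi> x - \<eta> x) (\<lambda>x. weak_grad \<Omega> \<psi> x - weak_grad \<Omega> \<eta> x)"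
    using is_weak_grad_lincomb[OF H1_weak_grad(2)[OF \<psi>(1)] H1_weak_grad(2)[OF \<eta>] H1_weak_grad(1)[OF \<psi>(1)] H1_weak_grad(1)[OF \<eta>], of 1 "-1"]
    by simp
qed

lemma V_W_nonempty: "g \<in> V" "\<eta> \<in> W"
proof -
  show "g \<in> V" using g by (simp add: V_space_def)
  show "\<eta> \<in> W" using \<eta> test_in_H1_0[OF test_functions_zero] by (simp add: W_space_def)
qed

text \<open>Here \<phi> is the strong limit of the \<psi> components, \<open>I\<close> the infimum
  of the energy and \<open>e\<close> the tolerance. The field \<open>A\<close> is independent, tied
  to \<open>(v, H)\<close> only through \<phi> and only up to \<open>e\<close> in L1. Every clause
  is affine or a convex bound, unlike the original coupling, in which \<psi> varies together with
  \<open>v\<close>.\<close>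

definition relaxed ::
    "(real^2 \<Rightarrow> real) \<Rightarrow> real \<Rightarrow> real \<Rightarrow> (real^2 \<Rightarrow> real) \<Rightarrow> (real^2 \<Rightarrow> real^2) \<Rightarrow> (real^2 \<Rightarrow> real^2^2) \<Rightarrow>
     (real^2 \<Rightarrow> real) \<Rightarrow> (real^2 \<Rightarrow> real^2) \<Rightarrow> (real^2 \<Rightarrow> real^2^2) \<Rightarrow> bool" where
  "relaxed \<phi> I e v D H \<psi> r A \<longleftrightarrow>
     is_H2 \<Omega> v D H \<and>
     (\<forall>N\<in>H_N \<Omega> \<beta>. inner_L2 M v (dDiv \<Omega> N) - inner_L2 M H N = tr_Ggrad \<Omega> g N) \<and>
     \<psi> \<in> L2 \<Omega> \<and> is_weak_grad \<Omega> \<psi> r \<and> (\<lambda>x. \<psi> x - \<eta> x) \<in> H1_0 \<Omega> \<and> A \<in> L2 \<Omega> \<and>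
     norm_L2 M (\<lambda>x. \<psi> x - \<phi> x) \<le> e \<and>
     (LINT x|M. norm (A x - moment v H \<phi> x)) \<le> e \<and>
     convex_energy v H r A \<le> I + e"

text \<open>Affine clauses average, the two closeness clauses follow from the triangle inequality,
  and the energy clause from the convexity of squared norms.\<close>

lemma relaxed_midpoint:
  assumes \<phi>: "\<phi> \<in> L2 \<Omega>" and 1: "relaxed \<phi> I e v D H \<psi> r A" and 2: "relaxed \<phi> I e v' D' H' \<psi>' r' A'"
  shows "relaxed \<phi> I e (\<lambda>x. (1/2) *\<^sub>R (v x + v' x)) (\<lambda>x. (1/2) *\<^sub>R (D x + D' x)) (\<lambda>x. (1/2) *\<^sub>R (H x + H' x))
    (\<lambda>x. (1/2) *\<^sub>R (\<psi> x + \<psi>' x)) (\<lambda>x. (1/2) *\<^sub>R (r x + r' x)) (\<lambda>x. (1/2) *\<^sub>R (A x + A' x))"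
  unfolding relaxed_def
proof (intro conjI ballI)
  have R: "is_H2 \<Omega> v D H" "\<psi> \<in> L2 \<Omega>" "is_weak_grad \<Omega> \<psi> r" "(\<lambda>x. \<psi> x - \<eta> x) \<in> H1_0 \<Omega>" "A \<in> L2 \<Omega>"
    and R': "is_H2 \<Omega> v' D' H'" "\<psi>' \<in> L2 \<Omega>" "is_weak_grad \<Omega> \<psi>' r'" "(\<lambda>x. \<psi>' x - \<eta> x) \<in> H1_0 \<Omega>" "A' \<in> L2 \<Omega>"
    using 1 2 by (auto simp: relaxed_def)
  note S = is_H2D[OF R(1)] and S' = is_H2D[OF R'(1)]
  note rL2 = is_weak_gradD(1)[OF R(3)] and rL2' = is_weak_gradD(1)[OF R'(3)]
  note GG = H_dDivD[OF G]
  show "is_H2 \<Omega> (\<lambda>x. (1/2) *\<^sub>R (v x + v' x)) (\<lambda>x. (1/2) *\<^sub>R (D x + D' x)) (\<lambda>x. (1/2) *\<^sub>R (H x + H' x))"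
    using is_H2_lincomb[OF R(1) R'(1), of "1/2" "1/2"] by (simp only: real_scaleR_def distrib_left scaleR_add_right)
  have inner_mid: "inner_L2 M (\<lambda>x. (1/2) *\<^sub>R (a x + a' x)) c = (inner_L2 M a c + inner_L2 M a' c) / 2"
    if "a \<in> L2 \<Omega>" "a' \<in> L2 \<Omega>" "c \<in> L2 \<Omega>" for a a' c :: "real^2 \<Rightarrow> 'b::euclidean_space"
    by (simp only: inner_L2_scaleR inner_L2_add[OF that(1,2,3)])
  show "inner_L2 M (\<lambda>x. (1/2) *\<^sub>R (v x + v' x)) (dDiv \<Omega> N) - inner_L2 M (\<lambda>x. (1/2) *\<^sub>R (H x + H' x)) N = tr_Ggrad \<Omega> g N"
    if "N \<in> H_N \<Omega> \<beta>" for N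
  proof -
    have N: "N \<in> H_dDiv \<Omega>" using that by (simp add: H_N_def)
    have "inner_L2 M v (dDiv \<Omega> N) - inner_L2 M H N = tr_Ggrad \<Omega> g N"
      "inner_L2 M v' (dDiv \<Omega> N) - inner_L2 M H' N = tr_Ggrad \<Omega> g N"
      using 1 2 that by (auto simp: relaxed_def)
    then show ?thesis
      unfolding inner_mid[OF S(1) S'(1) H_dDivD(2)[OF N]] inner_mid[OF S(5) S'(5) H_dDivD(1)[OF N]] by (simp add: field_simps)
  qed
  show "(\<lambda>x. (1/2) *\<^sub>R (\<psi> x + \<psi>' x)) \<in> L2 \<Omega>" "(\<lambda>x. (1/2) *\<^sub>R (A x + A' x)) \<in> L2 \<Omega>"
    by (intro L2_space_scaleR L2_space_add R R')+
  show "is_weak_grad \<Omega> (\<lambda>x. (1/2) *\<^sub>R (\<psi> x + \<psi>' x)) (\<lambda>x. (1/2) *\<^sub>R (r x + r' x))"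
    using is_weak_grad_lincomb[OF R(3) R'(3) R(2) R'(2), of "1/2" "1/2"] by (simp only: real_scaleR_def distrib_left scaleR_add_right)
  have "(\<lambda>x. (1/2) *\<^sub>R (\<psi> x + \<psi>' x) - \<eta> x) = (\<lambda>x. 1/2 * (\<psi> x - \<eta> x) + 1/2 * (\<psi>' x - \<eta> x))"
    by (simp add: fun_eq_iff field_simps)
  then show "(\<lambda>x. (1/2) *\<^sub>R (\<psi> x + \<psi>' x) - \<eta> x) \<in> H1_0 \<Omega>"
    using H1_0_lincomb[OF R(4) R'(4), of "1/2" "1/2"] by simp
  show "norm_L2 M (\<lambda>x. (1/2) *\<^sub>R (\<psi> x + \<psi>' x) - \<phi> x) \<le> e"
  proof -
    have "(\<lambda>x. (1/2) *\<^sub>R (\<psi> x + \<psi>' x) - \<phi> x) = (\<lambda>x. (1/2) *\<^sub>R ((\<psi> x - \<phi> x) + (\<psi>' x - \<phi> x)))"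
      by (simp add: fun_eq_iff field_simps)
    moreover have "norm_L2 M (\<lambda>x. (1/2) *\<^sub>R ((\<psi> x - \<phi> x) + (\<psi>' x - \<phi> x))) \<le> (1/2) * (norm_L2 M (\<lambda>x. \<psi> x - \<phi> x) + norm_L2 M (\<lambda>x. \<psi>' x - \<phi> x))"
      unfolding norm_L2_scaleR using norm_L2_add_le[OF L2_space_diff[OF R(2) \<phi>] L2_space_diff[OF R'(2) \<phi>]] by simp
    ultimately show ?thesis using 1 2 unfolding relaxed_def by simp
  qed
  show "(LINT x|M. norm ((1/2) *\<^sub>R (A x + A' x) - moment (\<lambda>x. (1/2) *\<^sub>R (v x + v' x)) (\<lambda>x. (1/2) *\<^sub>R (H x + H' x)) \<phi> x)) \<le> e"
  proof -
    let ?X = "\<lambda>x. A x - moment v H \<phi> x" and ?X' = "\<lambda>x. A' x - moment v' H' \<phi> x"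
    have X: "integrable M ?X" "integrable M ?X'"
      by (intro integrable_L2 L2_space_diff R R' moment_L2 S S' \<phi>)+
    have eq: "(1/2) *\<^sub>R (A x + A' x) - moment (\<lambda>x. (1/2) *\<^sub>R (v x + v' x)) (\<lambda>x. (1/2) *\<^sub>R (H x + H' x)) \<phi> x = (1/2) *\<^sub>R (?X x + ?X' x)" for x
      by (simp add: moment_def algebra_simps add_divide_distrib)
    have "(LINT x|M. norm ((1/2) *\<^sub>R (?X x + ?X' x))) \<le> (LINT x|M. (1/2) * (norm (?X x) + norm (?X' x)))"
    proof (rule integral_mono)
      show "integrable M (\<lambda>x. norm ((1/2) *\<^sub>R (?X x + ?X' x)))" "integrable M (\<lambda>x. (1/2) * (norm (?X x) + norm (?X' x)))"
        using X by auto
      show "norm ((1/2) *\<^sub>R (?X x + ?X' x)) \<le> (1/2) * (norm (?X x) + norm (?X' x))" for x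
        using norm_triangle_ineq[of "?X x" "?X' x"] by simp
    qed
    also have "\<dots> = (1/2) * ((LINT x|M. norm (?X x)) + (LINT x|M. norm (?X' x)))"
      using X by simp
    also have "\<dots> \<le> e" using 1 2 unfolding relaxed_def by simp
    finally show ?thesis unfolding eq .
  qed
  show "convex_energy (\<lambda>x. (1/2) *\<^sub>R (v x + v' x)) (\<lambda>x. (1/2) *\<^sub>R (H x + H' x)) (\<lambda>x. (1/2) *\<^sub>R (r x + r' x)) (\<lambda>x. (1/2) *\<^sub>R (A x + A' x)) \<le> I + e"
  proof -
    have inner_mid': "inner_L2 M c (\<lambda>x. (1/2) *\<^sub>R (a x + a' x)) = (inner_L2 M c a + inner_L2 M c a') / 2"
      if "a \<in> L2 \<Omega>" "a' \<in> L2 \<Omega>" "c \<in> L2 \<Omega>" for a a' c :: "real^2 \<Rightarrow> 'b::euclidean_space"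
      using inner_mid[OF that] by (simp only: inner_L2_commute[of M c])
    have "B / 2 * (norm_L2 M (\<lambda>x. (1/2) *\<^sub>R (A x + A' x)))\<^sup>2 \<le> B / 2 * (((norm_L2 M A)\<^sup>2 + (norm_L2 M A')\<^sup>2) / 2)"
      "m / 2 * (norm_L2 M (\<lambda>x. (1/2) *\<^sub>R (v x + v' x)))\<^sup>2 \<le> m / 2 * (((norm_L2 M v)\<^sup>2 + (norm_L2 M v')\<^sup>2) / 2)"
      "K / 2 * (norm_L2 M (\<lambda>x. (1/2) *\<^sub>R (r x + r' x)))\<^sup>2 \<le> K / 2 * (((norm_L2 M r)\<^sup>2 + (norm_L2 M r')\<^sup>2) / 2)"
      using B m K by (intro mult_left_mono norm_L2_power2_midpoint_le R R' S S' rL2 rL2'; simp)+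
    then have "convex_energy (\<lambda>x. (1/2) *\<^sub>R (v x + v' x)) (\<lambda>x. (1/2) *\<^sub>R (H x + H' x)) (\<lambda>x. (1/2) *\<^sub>R (r x + r' x)) (\<lambda>x. (1/2) *\<^sub>R (A x + A' x))
        \<le> (convex_energy v H r A + convex_energy v' H' r' A') / 2"
      unfolding convex_energy_def inner_mid'[OF S(1) S'(1) f] inner_mid'[OF S(1) S'(1) GG(2)] inner_mid'[OF S(5) S'(5) GG(1)]
      by (simp add: field_simps)
    then show ?thesis using 1 2 unfolding relaxed_def by simp
  qed
qed

text \<open>The coupling \<open>A = H + q\<^sup>2 v T(\<phi>)\<close> is recovered from its validity up to an error in \<open>L\<^sup>1\<close>.\<close>

lemma relaxed_limit:
  assumes \<phi>: "\<phi> \<in> L2 \<Omega>" and e: "e \<longlonglongrightarrow> 0"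
    and R: "\<And>n. relaxed \<phi> I (e n) (v n) (D n) (H n) (\<psi> n) (r n) (A n)"
    and L2: "u \<in> L2 \<Omega>" "p \<in> L2 \<Omega>" "Z \<in> L2 \<Omega>" "\<omega> \<in> L2 \<Omega>" "s \<in> L2 \<Omega>" "Y \<in> L2 \<Omega>"
    and lim: "(\<lambda>n. norm_L2 M (\<lambda>x. v n x - u x)) \<longlonglongrightarrow> 0" "(\<lambda>n. norm_L2 M (\<lambda>x. D n x - p x)) \<longlonglongrightarrow> 0"
      "(\<lambda>n. norm_L2 M (\<lambda>x. H n x - Z x)) \<longlonglongrightarrow> 0" "(\<lambda>n. norm_L2 M (\<lambda>x. \<psi> n x - \<omega> x)) \<longlonglongrightarrow> 0"
      "(\<lambda>n. norm_L2 M (\<lambda>x. r n x - s x)) \<longlonglongrightarrow> 0" "(\<lambda>n. norm_L2 M (\<lambda>x. A n x - Y x)) \<longlonglongrightarrow> 0"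
  shows "u \<in> V" "\<omega> \<in> W" "energy \<Omega> B K m q f G u \<omega> \<le> I"
proof -
  have RR: "is_H2 \<Omega> (v n) (D n) (H n)" "\<psi> n \<in> L2 \<Omega>" "is_weak_grad \<Omega> (\<psi> n) (r n)" "(\<lambda>x. \<psi> n x - \<eta> x) \<in> H1_0 \<Omega>" "A n \<in> L2 \<Omega>"
    "norm_L2 M (\<lambda>x. \<psi> n x - \<phi> x) \<le> e n" "(LINT x|M. norm (A n x - moment (v n) (H n) \<phi> x)) \<le> e n"
    "convex_energy (v n) (H n) (r n) (A n) \<le> I + e n" for n
    using R[of n] by (auto simp: relaxed_def)
  note S = is_H2D[OF RR(1)]
  note rL2 = is_weak_gradD(1)[OF RR(3)]
  note GG = H_dDivD[OF G]
  have u: "is_H2 \<Omega> u p Z" by (rule is_H2_limit[OF RR(1) L2(1,2,3) lim(1,2,3)])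
  show "u \<in> V"
    unfolding V_iff[OF u]
  proof
    fix N assume N: "N \<in> H_N \<Omega> \<beta>"
    then have N': "N \<in> H_dDiv \<Omega>" by (simp add: H_N_def)
    have "(\<lambda>n. inner_L2 M (v n) (dDiv \<Omega> N) - inner_L2 M (H n) N) \<longlonglongrightarrow> inner_L2 M u (dDiv \<Omega> N) - inner_L2 M Z N"
      by (intro tendsto_diff tendsto_inner_L2 S L2 lim H_dDivD[OF N'])
    moreover have "inner_L2 M (v n) (dDiv \<Omega> N) - inner_L2 M (H n) N = tr_Ggrad \<Omega> g N" for n
      using R[of n] N by (auto simp: relaxed_def)
    ultimately show "inner_L2 M u (dDiv \<Omega> N) - inner_L2 M Z N = tr_Ggrad \<Omega> g N"
      by (simp add: LIMSEQ_const_iff)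
  qed
  have \<omega>: "is_weak_grad \<Omega> \<omega> s" by (rule is_weak_grad_limit[OF RR(3) RR(2) L2(4,5) lim(4,5)])
  note E = H1_weak_grad[OF \<eta>]
  have "(\<lambda>x. \<omega> x - \<eta> x) \<in> H1_0 \<Omega>"
  proof (rule H1_0_limit(1)[OF RR(4)])
    show "is_weak_grad \<Omega> (\<lambda>x. \<psi> n x - \<eta> x) (\<lambda>x. r n x - weak_grad \<Omega> \<eta> x)" for n
      using is_weak_grad_lincomb[OF RR(3) E(2) RR(2) E(1), where a = 1 and b = "-1"] by simp
    show "(\<lambda>x. \<omega> x - \<eta> x) \<in> L2 \<Omega>" "(\<lambda>x. s x - weak_grad \<Omega> \<eta> x) \<in> L2 \<Omega>"
      by (intro L2_space_diff L2 E)+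
  qed (use lim in simp_all)
  then show "\<omega> \<in> W" using H1_I[OF L2(4) \<omega>] by (simp add: W_space_def)
  \<comment> \<open>The components \<open>\<psi> n\<close> tend to \<omega> by assumption and to
    \<phi> by the closeness clause. This puts \<omega> into the coupling in place of \<phi>.\<close>
  have "AE x in M. \<omega> x - \<phi> x = 0"
  proof (rule norm_L2_eq_0[OF L2_space_diff[OF L2(4) \<phi>]])
    have "(\<lambda>n. norm_L2 M (\<lambda>x. \<psi> n x - \<phi> x)) \<longlonglongrightarrow> norm_L2 M (\<lambda>x. \<omega> x - \<phi> x)"
      by (rule tendsto_norm_L2) (use lim(4) in \<open>auto intro!: L2_space_diff RR \<phi> L2\<close>)
    then have "norm_L2 M (\<lambda>x. \<omega> x - \<phi> x) \<le> 0" by (rule LIMSEQ_le[OF _ e]) (use RR(6) in blast)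
    then show "norm_L2 M (\<lambda>x. \<omega> x - \<phi> x) = 0" using norm_L2_nonneg by (rule antisym)
  qed
  then have \<omega>\<phi>: "AE x in M. \<omega> x = \<phi> x" by simp
  have XL2: "(\<lambda>x. Y x - moment u Z \<phi> x) \<in> L2 \<Omega>" "(\<lambda>x. A n x - moment (v n) (H n) \<phi> x) \<in> L2 \<Omega>" for n
    by (intro L2_space_diff moment_L2 L2 \<phi> S RR)+
  have "AE x in M. Y x - moment u Z \<phi> x = 0"
  proof -
    let ?X = "\<lambda>x. Y x - moment u Z \<phi> x" and ?Xn = "\<lambda>n x. A n x - moment (v n) (H n) \<phi> x"
    define c where "c = sqrt (measure M (space M))"
    \<comment> \<open>The coupling defect depends linearly on \<open>(v, H, A)\<close> and
      \<open>T_mat\<close> has norm at most 1, so strong convergence of these components carries the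
      defect to its limit.\<close>
    have diff: "norm_L2 M (\<lambda>x. ?X x - ?Xn n x) \<le> norm_L2 M (\<lambda>x. A n x - Y x) + (norm_L2 M (\<lambda>x. H n x - Z x) + q\<^sup>2 * norm_L2 M (\<lambda>x. v n x - u x))" for n
    proof -
      let ?T = "\<lambda>x. (q\<^sup>2 * (v n x - u x)) *\<^sub>R T_mat (\<phi> x)"
      have T: "?T \<in> L2 \<Omega>" "norm_L2 M ?T \<le> q\<^sup>2 * norm_L2 M (\<lambda>x. v n x - u x)"
        using L2_space_times_T_mat[OF L2_space_diff[OF S(1) L2(1)] L2_spaceD(1)[OF \<phi>], of "q\<^sup>2"] by auto
      have HL: "(\<lambda>x. H n x - Z x) \<in> L2 \<Omega>" "(\<lambda>x. A n x - Y x) \<in> L2 \<Omega>" by (intro L2_space_diff S L2 RR)+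
      have "norm_L2 M (\<lambda>x. ?X x - ?Xn n x) = norm_L2 M (\<lambda>x. ((H n x - Z x) + ?T x) - (A n x - Y x))"
        by (intro arg_cong[where f = "norm_L2 M"]) (auto simp: moment_def algebra_simps)
      also have "\<dots> \<le> norm_L2 M (\<lambda>x. (H n x - Z x) + ?T x) + norm_L2 M (\<lambda>x. A n x - Y x)"
        by (rule norm_L2_diff_le[OF L2_space_add[OF HL(1) T(1)] HL(2)])
      also have "norm_L2 M (\<lambda>x. (H n x - Z x) + ?T x) \<le> norm_L2 M (\<lambda>x. H n x - Z x) + norm_L2 M ?T"
        by (rule norm_L2_add_le[OF HL(1) T(1)])
      finally show ?thesis using T(2) by simp
    qed
    have "(LINT x|M. norm (?X x)) \<le> e n + (norm_L2 M (\<lambda>x. A n x - Y x) + (norm_L2 M (\<lambda>x. H n x - Z x) + q\<^sup>2 * norm_L2 M (\<lambda>x. v n x - u x))) * c" for n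
    proof -
      have "(LINT x|M. norm (?X x)) \<le> (LINT x|M. norm (?Xn n x) + norm (?X x - ?Xn n x))"
        using integrable_L2[OF XL2(1)] integrable_L2[OF XL2(2)] integrable_L2[OF L2_space_diff[OF XL2(1) XL2(2)]]
        by (intro integral_mono) (auto simp: norm_triangle_sub)
      also have "\<dots> = (LINT x|M. norm (?Xn n x)) + (LINT x|M. norm (?X x - ?Xn n x))"
        using integrable_L2[OF XL2(2)] integrable_L2[OF L2_space_diff[OF XL2(1) XL2(2)]]
        by (intro Bochner_Integration.integral_add) auto
      also have "\<dots> \<le> e n + norm_L2 M (\<lambda>x. ?X x - ?Xn n x) * c"
        unfolding c_def by (intro add_mono RR(7) L1_le_norm_L2[OF finite_measure_domain L2_space_diff[OF XL2(1) XL2(2)]])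
      also have "\<dots> \<le> e n + (norm_L2 M (\<lambda>x. A n x - Y x) + (norm_L2 M (\<lambda>x. H n x - Z x) + q\<^sup>2 * norm_L2 M (\<lambda>x. v n x - u x))) * c"
        by (intro add_left_mono mult_right_mono diff) (simp add: c_def)
      finally show ?thesis .
    qed
    moreover have "(\<lambda>n. e n + (norm_L2 M (\<lambda>x. A n x - Y x) + (norm_L2 M (\<lambda>x. H n x - Z x) + q\<^sup>2 * norm_L2 M (\<lambda>x. v n x - u x))) * c)
        \<longlonglongrightarrow> 0 + (0 + (0 + q\<^sup>2 * 0)) * c"
      by (intro tendsto_intros e lim)
    ultimately have "(LINT x|M. norm (?X x)) \<le> 0 + (0 + (0 + q\<^sup>2 * 0)) * c"
      by (intro LIMSEQ_le_const[where X = "\<lambda>n. e n + (norm_L2 M (\<lambda>x. A n x - Y x) + (norm_L2 M (\<lambda>x. H n x - Z x) + q\<^sup>2 * norm_L2 M (\<lambda>x. v n x - u x))) * c"]) blast+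
    moreover have "0 \<le> (LINT x|M. norm (?X x))" by simp
    ultimately have "(LINT x|M. norm (?X x)) = 0" by simp
    then show ?thesis
      using integral_nonneg_eq_0_iff_AE[of M "\<lambda>x. norm (?X x)"] integrable_L2[OF XL2(1)] by auto
  qed
  then have Y: "AE x in M. Y x = moment u Z \<omega> x"
    using \<omega>\<phi> by eventually_elim (simp add: moment_def)
  \<comment> \<open>Strong convergence makes the energies converge; lower semicontinuity does not
    have to be invoked.\<close>
  have "(\<lambda>n. B / 2 * (norm_L2 M (A n))\<^sup>2 + m / 2 * (norm_L2 M (v n))\<^sup>2 + K / 2 * (norm_L2 M (r n))\<^sup>2
    - inner_L2 M (v n) f + B * (inner_L2 M (v n) (dDiv \<Omega> G) - inner_L2 M (H n) G)) \<longlonglongrightarrow>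
    B / 2 * (norm_L2 M Y)\<^sup>2 + m / 2 * (norm_L2 M u)\<^sup>2 + K / 2 * (norm_L2 M s)\<^sup>2
    - inner_L2 M u f + B * (inner_L2 M u (dDiv \<Omega> G) - inner_L2 M Z G)"
    by (intro tendsto_intros tendsto_norm_L2 tendsto_inner_L2 lim L2 S RR rL2 f GG)
  then have "(\<lambda>n. convex_energy (v n) (H n) (r n) (A n)) \<longlonglongrightarrow> convex_energy u Z s Y"
    by (simp add: convex_energy_def inner_L2_commute[of M f] inner_L2_commute[of M G] inner_L2_commute[of M "dDiv \<Omega> G"])
  moreover have "(\<lambda>n. I + e n) \<longlonglongrightarrow> I + 0" by (intro tendsto_intros e)
  ultimately have "convex_energy u Z s Y \<le> I + 0" by (rule LIMSEQ_le) (use RR(8) in blast)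
  moreover have "norm_L2 M Y = norm_L2 M (moment u Z \<omega>)"
    by (rule norm_L2_cong_AE[OF L2_spaceD(1)[OF L2(6)] L2_spaceD(1)[OF moment_L2[OF L2(1,3,4)]] Y])
  ultimately show "energy \<Omega> B K m q f G u \<omega> \<le> I"
    unfolding energy_eq[OF u \<omega> L2(4)] by (simp add: convex_energy_def)
qed

end

subsection \<open>Existence of minimisers\<close>

context coupled_problem
begin

text \<open>Convergence is extracted for \<psi> alone. The other components receive a common bound,
  and their convergence comes from the nested convex sets later.\<close>

lemma minimizing_sequence_compact:
  assumes vV: "\<And>n :: nat. v n \<in> V" and \<psi>W: "\<And>n. \<psi> n \<in> W" and E: "\<And>n. energy \<Omega> B K m q f G (v n) (\<psi> n) \<le> E0"
  obtains L \<phi> and r :: "nat \<Rightarrow> nat" where "0 \<le> L" "\<phi> \<in> L2 \<Omega>" "strict_mono r"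
    "(\<lambda>n. norm_L2 M (\<lambda>x. \<psi> (r n) x - \<phi> x)) \<longlonglongrightarrow> 0"
    "\<And>n. norm_L2 M (v n) \<le> L" "\<And>n. norm_L2 M (weak_grad \<Omega> (v n)) \<le> L" "\<And>n. norm_L2 M (weak_hess \<Omega> (v n)) \<le> L"
    "\<And>n. norm_L2 M (\<psi> n) \<le> L" "\<And>n. norm_L2 M (weak_grad \<Omega> (\<psi> n)) \<le> L"
    "\<And>n. norm_L2 M (moment (v n) (weak_hess \<Omega> (v n)) (\<psi> n)) \<le> L"
proof -
  have H2: "is_H2 \<Omega> (v n) (weak_grad \<Omega> (v n)) (weak_hess \<Omega> (v n))" for n
    using vV[of n] H2_is_H2 by (simp add: V_space_def)
  note S = is_H2D[OF H2]
  note P = H1_weak_grad[OF W_D(1)[OF \<psi>W]]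
  let ?A = "\<lambda>n. moment (v n) (weak_hess \<Omega> (v n)) (\<psi> n)"
  obtain C where C: "0 \<le> C" "\<And>v H \<psi> r. v \<in> L2 \<Omega> \<Longrightarrow> H \<in> L2 \<Omega> \<Longrightarrow> \<psi> \<in> L2 \<Omega> \<Longrightarrow>
    B / 4 * (norm_L2 M (moment v H \<psi>))\<^sup>2 + m / 4 * (norm_L2 M v)\<^sup>2 + K / 2 * (norm_L2 M r)\<^sup>2
      \<le> convex_energy v H r (moment v H \<psi>) + C"
    using coercive by metis
  have X: "B / 4 * (norm_L2 M (?A n))\<^sup>2 + m / 4 * (norm_L2 M (v n))\<^sup>2 + K / 2 * (norm_L2 M (weak_grad \<Omega> (\<psi> n)))\<^sup>2 \<le> E0 + C" for n
    using C(2)[OF S(1) S(5) P(1), of n n n "weak_grad \<Omega> (\<psi> n)"] E[of n] unfolding energy_eq[OF H2 P(2) P(1)] by linarith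
  have E0: "0 \<le> E0 + C"
  proof -
    have "0 \<le> B / 4 * (norm_L2 M (?A 0))\<^sup>2 + m / 4 * (norm_L2 M (v 0))\<^sup>2 + K / 2 * (norm_L2 M (weak_grad \<Omega> (\<psi> 0)))\<^sup>2"
      using B m K by simp
    then show ?thesis using X[of 0] by linarith
  qed
  \<comment> \<open>A crude bound from \<open>2 * t \<le> 1 + t\<^sup>2\<close> that avoids square
    roots.\<close>
  have sq: "t \<le> 1 + (E0 + C) / c" if "c > 0" "c * t\<^sup>2 \<le> E0 + C" for c t :: real
  proof -
    have "t\<^sup>2 \<le> (E0 + C) / c" using that by (simp add: field_simps)
    moreover have "2 * t \<le> 1 + t\<^sup>2" using zero_le_power2[of "t - 1"] by (simp add: power2_diff)
    ultimately show ?thesis using divide_nonneg_pos[OF E0 that(1)] by linarith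
  qed
  have pos: "0 \<le> B / 4 * t\<^sup>2" "0 \<le> m / 4 * t\<^sup>2" "0 \<le> K / 2 * t\<^sup>2" for t using B m K by auto
  define L1 where "L1 = (1 + (E0 + C) / (B / 4)) + (1 + (E0 + C) / (m / 4)) + (1 + (E0 + C) / (K / 2))"
  have p: "0 \<le> (E0 + C) / (B / 4)" "0 \<le> (E0 + C) / (m / 4)" "0 \<le> (E0 + C) / (K / 2)"
    using E0 B m K by (auto intro!: divide_nonneg_pos)
  have A: "norm_L2 M (?A n) \<le> L1" and vL: "norm_L2 M (v n) \<le> L1" and rL: "norm_L2 M (weak_grad \<Omega> (\<psi> n)) \<le> L1" for n
  proof -
    have "norm_L2 M (?A n) \<le> 1 + (E0 + C) / (B / 4)"
      by (rule sq) (use B X[of n] pos(2)[of "norm_L2 M (v n)"] pos(3)[of "norm_L2 M (weak_grad \<Omega> (\<psi> n))"] in linarith)+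
    then show "norm_L2 M (?A n) \<le> L1" using p unfolding L1_def by linarith
    have "norm_L2 M (v n) \<le> 1 + (E0 + C) / (m / 4)"
      by (rule sq) (use m X[of n] pos(1)[of "norm_L2 M (?A n)"] pos(3)[of "norm_L2 M (weak_grad \<Omega> (\<psi> n))"] in linarith)+
    then show "norm_L2 M (v n) \<le> L1" using p unfolding L1_def by linarith
    have "norm_L2 M (weak_grad \<Omega> (\<psi> n)) \<le> 1 + (E0 + C) / (K / 2)"
      by (rule sq) (use K X[of n] pos(1)[of "norm_L2 M (?A n)"] pos(2)[of "norm_L2 M (v n)"] in linarith)+
    then show "norm_L2 M (weak_grad \<Omega> (\<psi> n)) \<le> L1" using p unfolding L1_def by linarith
  qed
  have L1: "0 \<le> L1" using p unfolding L1_def by linarith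
  have hL: "norm_L2 M (weak_hess \<Omega> (v n)) \<le> L1 + q\<^sup>2 * L1" for n
  proof -
    note T = L2_space_times_T_mat[OF S(1)[of n] L2_spaceD(1)[OF P(1)[of n]], of "q\<^sup>2"]
    have "weak_hess \<Omega> (v n) = (\<lambda>x. ?A n x - (q\<^sup>2 * v n x) *\<^sub>R T_mat (\<psi> n x))" by (auto simp: moment_def)
    then have "norm_L2 M (weak_hess \<Omega> (v n)) \<le> norm_L2 M (?A n) + norm_L2 M (\<lambda>x. (q\<^sup>2 * v n x) *\<^sub>R T_mat (\<psi> n x))"
      using norm_L2_diff_le[OF moment_L2[OF S(1) S(5) P(1), of n n n] T(1)] by simp
    also have "\<dots> \<le> L1 + q\<^sup>2 * L1"
      using A[of n] T(2) mult_left_mono[OF vL[of n], of "q\<^sup>2"] by simp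
    finally show ?thesis .
  qed
  obtain C2 where C2: "0 \<le> C2" "\<And>v D H. is_H2 \<Omega> v D H \<Longrightarrow> norm_L2 M D \<le> C2 * (norm_L2 M v + norm_L2 M H)"
    using gradient_bound[OF lipschitz] by metis
  have gL: "norm_L2 M (weak_grad \<Omega> (v n)) \<le> C2 * (L1 + (L1 + q\<^sup>2 * L1))" for n
  proof -
    have "C2 * (norm_L2 M (v n) + norm_L2 M (weak_hess \<Omega> (v n))) \<le> C2 * (L1 + (L1 + q\<^sup>2 * L1))"
      by (intro mult_left_mono add_mono vL hL C2(1))
    with C2(2)[OF H2] show ?thesis by (rule order_trans)
  qed
  \<comment> \<open>Subtracting \<eta> gives functions in \<open>H1_0\<close>, to which the Poincare
    inequality and Rellich's theorem apply.\<close>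
  let ?\<zeta> = "\<lambda>n x. \<psi> n x - \<eta> x" and ?D = "\<lambda>n x. weak_grad \<Omega> (\<psi> n) x - weak_grad \<Omega> \<eta> x"
  note Z = W_D(2,3)[OF \<psi>W]
  note E = H1_weak_grad[OF \<eta>]
  have \<zeta>L2: "?\<zeta> n \<in> L2 \<Omega>" for n by (intro L2_space_diff P E)
  have DL: "norm_L2 M (?D n) \<le> L1 + norm_L2 M (weak_grad \<Omega> \<eta>)" for n
    using norm_L2_diff_le[OF P(3) E(3), of n] rL[of n] by linarith
  obtain R where R: "\<Omega> \<subseteq> ball 0 R" "R > 0"
    using bounded_domain bounded_subset_ballD[of \<Omega> 0] by blast
  define Lp where "Lp = 2 * R * (L1 + norm_L2 M (weak_grad \<Omega> \<eta>)) + norm_L2 M \<eta>"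
  have Lp: "0 \<le> Lp" using R L1 by (simp add: Lp_def)
  have \<psi>L: "norm_L2 M (\<psi> n) \<le> Lp" for n
  proof -
    have "norm_L2 M (?\<zeta> n) \<le> 2 * R * norm_L2 M (?D n)" by (rule poincare_H1_0[OF R(1) Z])
    also have "\<dots> \<le> 2 * R * (L1 + norm_L2 M (weak_grad \<Omega> \<eta>))"
      using R by (intro mult_left_mono DL) auto
    finally show ?thesis
      using norm_L2_add_le[OF \<zeta>L2 E(1), of n] unfolding Lp_def by simp
  qed
  show ?thesis
  proof (rule rellich_H1_0[of ?\<zeta> ?D, OF Z DL])
    fix r :: "nat \<Rightarrow> nat"
    assume r: "strict_mono r" "\<forall>e>0. \<exists>N. \<forall>m\<ge>N. \<forall>n\<ge>N. norm_L2 M (\<lambda>x. ?\<zeta> (r m) x - ?\<zeta> (r n) x) < e"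
    then have Cau: "\<exists>N. \<forall>i\<ge>N. \<forall>j\<ge>N. norm_L2 M (\<lambda>x. \<psi> (r i) x - \<psi> (r j) x) < e" if "e > 0" for e
      using that by simp
    \<comment> \<open>The sum of all bounds, so that one constant serves every component.\<close>
    define L where "L = (L1 + q\<^sup>2 * L1) + C2 * (L1 + (L1 + q\<^sup>2 * L1)) + Lp"
    have q1: "0 \<le> q\<^sup>2 * L1" using L1 by simp
    have c1: "0 \<le> C2 * (L1 + (L1 + q\<^sup>2 * L1))" using C2(1) L1 q1 by (intro mult_nonneg_nonneg) auto
    show ?thesis
    proof (rule L2_complete[of M "\<lambda>n. \<psi> (r n)", OF finite_measure_domain P(1) Cau])
      fix \<phi> assume \<phi>: "\<phi> \<in> L2 \<Omega>" "(\<lambda>n. norm_L2 M (\<lambda>x. \<psi> (r n) x - \<phi> x)) \<longlonglongrightarrow> 0"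
      show ?thesis
      proof (rule that[of L \<phi> r])
        show "0 \<le> L" using L1 q1 c1 Lp unfolding L_def by linarith
        show "norm_L2 M (v n) \<le> L" for n using vL[of n] q1 c1 Lp unfolding L_def by linarith
        show "norm_L2 M (weak_grad \<Omega> (v n)) \<le> L" for n using gL[of n] q1 L1 Lp unfolding L_def by linarith
        show "norm_L2 M (weak_hess \<Omega> (v n)) \<le> L" for n using hL[of n] c1 Lp unfolding L_def by linarith
        show "norm_L2 M (\<psi> n) \<le> L" for n using \<psi>L[of n] q1 c1 L1 unfolding L_def by linarith
        show "norm_L2 M (weak_grad \<Omega> (\<psi> n)) \<le> L" for n using rL[of n] q1 c1 Lp unfolding L_def by linarith
        show "norm_L2 M (?A n) \<le> L" for n using A[of n] q1 c1 Lp unfolding L_def by linarith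
      qed (use \<phi> r in auto)
    qed
  qed
qed

text \<open>A true admissible pair enters the relaxed set once \<psi> is close to \<phi>: the
  Lipschitz bound on \<open>T\<close> gives the coupling defect the size
  \<open>4 * q\<^sup>2\<close> times \<open>v\<close> times \<open>\<psi> - \<phi>\<close>, and
  Cauchy-Schwarz bounds its integral.\<close>

lemma relaxed_minimizing_sequence:
  assumes v: "v \<in> V" and \<psi>: "\<psi> \<in> W" and \<phi>: "\<phi> \<in> L2 \<Omega>"
    and E: "energy \<Omega> B K m q f G v \<psi> \<le> I + e" and close: "norm_L2 M (\<lambda>x. \<psi> x - \<phi> x) \<le> e"
    and small: "4 * q\<^sup>2 * L * norm_L2 M (\<lambda>x. \<psi> x - \<phi> x) \<le> e" and L: "norm_L2 M v \<le> L"
  shows "relaxed \<phi> I e v (weak_grad \<Omega> v) (weak_hess \<Omega> v) \<psi> (weak_grad \<Omega> \<psi>) (moment v (weak_hess \<Omega> v) \<psi>)"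
proof -
  have H2: "is_H2 \<Omega> v (weak_grad \<Omega> v) (weak_hess \<Omega> v)"
    using v H2_is_H2 by (simp add: V_space_def)
  note S = is_H2D[OF H2]
  note P = H1_weak_grad[OF W_D(1)[OF \<psi>]]
  let ?A = "moment v (weak_hess \<Omega> v)"
  have d: "(\<lambda>x. \<psi> x - \<phi> x) \<in> L2 \<Omega>" by (rule L2_space_diff[OF P(1) \<phi>])
  have "(LINT x|M. norm (?A \<psi> x - ?A \<phi> x)) \<le> (LINT x|M. 4 * q\<^sup>2 * \<bar>v x * (\<psi> x - \<phi> x)\<bar>)"
  proof (rule integral_mono)
    show "integrable M (\<lambda>x. norm (?A \<psi> x - ?A \<phi> x))"
      by (intro integrable_norm integrable_L2 L2_space_diff moment_L2 S P \<phi>)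
    show "integrable M (\<lambda>x. 4 * q\<^sup>2 * \<bar>v x * (\<psi> x - \<phi> x)\<bar>)"
      by (intro integrable_mult_right integrable_abs integrable_mult_L2 S d)
    fix x
    have "?A \<psi> x - ?A \<phi> x = (q\<^sup>2 * v x) *\<^sub>R (T_mat (\<psi> x) - T_mat (\<phi> x))"
      by (simp add: moment_def scaleR_diff_right)
    then show "norm (?A \<psi> x - ?A \<phi> x) \<le> 4 * q\<^sup>2 * \<bar>v x * (\<psi> x - \<phi> x)\<bar>"
      using mult_left_mono[OF T_mat_lipschitz[of "\<psi> x" "\<phi> x"], of "\<bar>q\<^sup>2 * v x\<bar>"] by (simp add: abs_mult mult_ac)
  qed
  also have "\<dots> = 4 * q\<^sup>2 * (LINT x|M. \<bar>v x * (\<psi> x - \<phi> x)\<bar>)" by (rule integral_mult_right_zero)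
  also have "\<dots> \<le> 4 * q\<^sup>2 * (norm_L2 M v * norm_L2 M (\<lambda>x. \<psi> x - \<phi> x))"
    by (intro mult_left_mono integral_abs_mult_le S d) simp
  also have "\<dots> \<le> 4 * q\<^sup>2 * (L * norm_L2 M (\<lambda>x. \<psi> x - \<phi> x))"
    by (intro mult_left_mono mult_right_mono L) auto
  also have "\<dots> \<le> e" using small by (simp add: mult.assoc)
  finally have coupling: "(LINT x|M. norm (?A \<psi> x - ?A \<phi> x)) \<le> e" .
  show ?thesis
    unfolding relaxed_def
    using H2 V_iff[OF H2] v P W_D[OF \<psi>] moment_L2[OF S(1,5) P(1)] close coupling E
    by (simp add: energy_eq[OF H2 P(2) P(1)])
qed

lemma minimizer_exists:
  obtains u \<phi> where "u \<in> V" "\<phi> \<in> W" "\<And>v \<psi>. v \<in> V \<Longrightarrow> \<psi> \<in> W \<Longrightarrow> energy \<Omega> B K m q f G u \<phi> \<le> energy \<Omega> B K m q f G v \<psi>"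
proof -
  let ?E = "energy \<Omega> B K m q f G"
  define S where "S = (\<lambda>(v, \<psi>). ?E v \<psi>) ` (V \<times> W)"
  \<comment> \<open>Coercivity bounds the energies from below, so this infimum is finite.\<close>
  define I where "I = Inf S"
  obtain C where C: "0 \<le> C" "\<And>v H \<psi> r. v \<in> L2 \<Omega> \<Longrightarrow> H \<in> L2 \<Omega> \<Longrightarrow> \<psi> \<in> L2 \<Omega> \<Longrightarrow>
    B / 4 * (norm_L2 M (moment v H \<psi>))\<^sup>2 + m / 4 * (norm_L2 M v)\<^sup>2 + K / 2 * (norm_L2 M r)\<^sup>2
      \<le> convex_energy v H r (moment v H \<psi>) + C"
    using coercive by metis
  have lower: "- C \<le> ?E v \<psi>" if "v \<in> V" "\<psi> \<in> W" for v \<psi>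
  proof -
    have H2: "is_H2 \<Omega> v (weak_grad \<Omega> v) (weak_hess \<Omega> v)"
      using that(1) H2_is_H2 by (simp add: V_space_def)
    note Sv = is_H2D[OF H2]
    note P = H1_weak_grad[OF W_D(1)[OF that(2)]]
    have "0 \<le> B / 4 * (norm_L2 M (moment v (weak_hess \<Omega> v) \<psi>))\<^sup>2 + m / 4 * (norm_L2 M v)\<^sup>2 + K / 2 * (norm_L2 M (weak_grad \<Omega> \<psi>))\<^sup>2"
      using B m K by simp
    then show ?thesis
      using C(2)[OF Sv(1) Sv(5) P(1), of "weak_grad \<Omega> \<psi>"] unfolding energy_eq[OF H2 P(2) P(1)] by linarith
  qed
  have bdd: "bdd_below S" by (rule bdd_belowI[of _ "- C"]) (use lower in \<open>auto simp: S_def\<close>)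
  have ne: "S \<noteq> {}" using V_W_nonempty by (auto simp: S_def)
  have I_le: "I \<le> ?E v \<psi>" if "v \<in> V" "\<psi> \<in> W" for v \<psi>
    unfolding I_def by (rule cInf_lower[OF _ bdd]) (use that in \<open>auto simp: S_def\<close>)
  have "\<forall>n :: nat. \<exists>p. fst p \<in> V \<and> snd p \<in> W \<and> ?E (fst p) (snd p) < I + 1 / real (Suc n)"
  proof
    fix n :: nat
    have "Inf S < I + 1 / real (Suc n)" by (simp add: I_def)
    then obtain s where "s \<in> S" "s < I + 1 / real (Suc n)" using cInf_lessD[OF ne] by blast
    then show "\<exists>p. fst p \<in> V \<and> snd p \<in> W \<and> ?E (fst p) (snd p) < I + 1 / real (Suc n)"
      by (auto simp: S_def)
  qed
  from choice[OF this] obtain p where p: "\<And>n. fst (p n) \<in> V" "\<And>n. snd (p n) \<in> W"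
    "\<And>n :: nat. ?E (fst (p n)) (snd (p n)) < I + 1 / real (Suc n)" by blast
  define v where "v n = fst (p n)" for n
  define \<psi> where "\<psi> n = snd (p n)" for n
  have vV: "v n \<in> V" and \<psi>W: "\<psi> n \<in> W" and En: "?E (v n) (\<psi> n) < I + 1 / real (Suc n)" for n
    using p by (auto simp: v_def \<psi>_def)
  have E1: "?E (v n) (\<psi> n) \<le> I + 1" for n
  proof -
    have "1 / real (Suc n) \<le> 1" by simp
    then show ?thesis using En[of n] by linarith
  qed
  show ?thesis
  proof (rule minimizing_sequence_compact[of v \<psi> "I + 1", OF vV \<psi>W E1])
    fix L \<phi> and r :: "nat \<Rightarrow> nat"
    assume L: "0 \<le> L" and \<phi>: "\<phi> \<in> L2 \<Omega>" and r: "strict_mono r"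
      and lim: "(\<lambda>n. norm_L2 M (\<lambda>x. \<psi> (r n) x - \<phi> x)) \<longlonglongrightarrow> 0"
      and bounds: "\<And>n. norm_L2 M (v n) \<le> L" "\<And>n. norm_L2 M (weak_grad \<Omega> (v n)) \<le> L" "\<And>n. norm_L2 M (weak_hess \<Omega> (v n)) \<le> L"
        "\<And>n. norm_L2 M (\<psi> n) \<le> L" "\<And>n. norm_L2 M (weak_grad \<Omega> (\<psi> n)) \<le> L"
        "\<And>n. norm_L2 M (moment (v n) (weak_hess \<Omega> (v n)) (\<psi> n)) \<le> L"
    define e where "e n = 1 / real (Suc n)" for n
    have e: "e \<longlonglongrightarrow> 0" unfolding e_def by (rule LIMSEQ_Suc[OF lim_1_over_n])
    have e_mono: "e (Suc n) \<le> e n" for n by (simp add: e_def frac_le)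
    \<comment> \<open>The six fields are packed into one function with values in a product space, so
      that one application of the nested-set lemma makes all of them converge together.\<close>
    define C where "C n = {F. \<exists>v D H \<psi> r A. F = (\<lambda>x. (v x, D x, H x, \<psi> x, r x, A x)) \<and> relaxed \<phi> I (e n) v D H \<psi> r A}" for n
    have comps: "v \<in> L2 \<Omega> \<and> D \<in> L2 \<Omega> \<and> H \<in> L2 \<Omega> \<and> \<psi> \<in> L2 \<Omega> \<and> r \<in> L2 \<Omega> \<and> A \<in> L2 \<Omega>"
      if "relaxed \<phi> I e v D H \<psi> r A" for e v D H \<psi> r A
      using that is_H2D is_weak_gradD(1) by (auto simp: relaxed_def)
    have step: "\<exists>F\<in>C n. norm_L2 M F \<le> 6 * L" for n
    proof -
      \<comment> \<open>With \<open>(4 * q\<^sup>2 * L + 1) * d = e n\<close>, both the distance to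
        \<phi> and the coupling error stay below \<open>e n\<close>.\<close>
      define d where "d = e n / (4 * q\<^sup>2 * L + 1)"
      have den: "4 * q\<^sup>2 * L + 1 \<ge> 1" using L by simp
      have "4 * q\<^sup>2 * L + 1 > 0" using den by linarith
      moreover have "e n > 0" by (simp add: e_def)
      ultimately have d: "d > 0" unfolding d_def by (metis divide_pos_pos)
      have "eventually (\<lambda>k. norm_L2 M (\<lambda>x. \<psi> (r k) x - \<phi> x) < d) sequentially"
        by (rule order_tendstoD(2)[OF lim d])
      then obtain k0 where k0: "\<And>k. k \<ge> k0 \<Longrightarrow> norm_L2 M (\<lambda>x. \<psi> (r k) x - \<phi> x) < d"
        by (auto simp: eventually_sequentially)
      \<comment> \<open>The index has to be large for two reasons: closeness to \<phi> and an energy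
        within \<open>e n\<close> of the infimum.\<close>
      define k where "k = max k0 n"
      let ?v = "v (r k)" and ?\<psi> = "\<psi> (r k)"
      have kd: "norm_L2 M (\<lambda>x. ?\<psi> x - \<phi> x) < d" using k0[of k] by (simp add: k_def)
      have de: "(4 * q\<^sup>2 * L + 1) * d = e n"
        unfolding d_def by (rule nonzero_mult_div_cancel_left[THEN trans[OF times_divide_eq_right]]) (use den in linarith)
      have rel: "relaxed \<phi> I (e n) ?v (weak_grad \<Omega> ?v) (weak_hess \<Omega> ?v) ?\<psi> (weak_grad \<Omega> ?\<psi>) (moment ?v (weak_hess \<Omega> ?v) ?\<psi>)"
      proof (rule relaxed_minimizing_sequence[OF vV \<psi>W \<phi> _ _ _ bounds(1)])
        have "n \<le> r k" using seq_suble[OF r, of k] by (simp add: k_def)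
        then have "1 / real (Suc (r k)) \<le> e n" by (simp add: e_def frac_le)
        then show "?E ?v ?\<psi> \<le> I + e n" using En[of "r k"] by linarith
        have a: "(4 * q\<^sup>2 * L) * norm_L2 M (\<lambda>x. ?\<psi> x - \<phi> x) \<le> (4 * q\<^sup>2 * L) * d"
          using kd L by (intro mult_left_mono) auto
        then show "4 * q\<^sup>2 * L * norm_L2 M (\<lambda>x. ?\<psi> x - \<phi> x) \<le> e n"
          using de d by (simp add: algebra_simps)
        have "0 \<le> (4 * q\<^sup>2 * L) * d" using L d by simp
        then show "norm_L2 M (\<lambda>x. ?\<psi> x - \<phi> x) \<le> e n"
          using de kd by (simp add: algebra_simps)
      qed
      let ?F = "\<lambda>x. (?v x, weak_grad \<Omega> ?v x, weak_hess \<Omega> ?v x, ?\<psi> x, weak_grad \<Omega> ?\<psi> x, moment ?v (weak_hess \<Omega> ?v) ?\<psi> x)"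
      have "?F \<in> C n" using rel unfolding C_def by blast
      moreover have "norm_L2 M ?F \<le> 6 * L"
      proof -
        note c = comps[OF rel]
        have "norm_L2 M ?F \<le> norm_L2 M ?v + (norm_L2 M (weak_grad \<Omega> ?v) + (norm_L2 M (weak_hess \<Omega> ?v) +
           (norm_L2 M ?\<psi> + (norm_L2 M (weak_grad \<Omega> ?\<psi>) + norm_L2 M (moment ?v (weak_hess \<Omega> ?v) ?\<psi>)))))"
          using c by (intro norm_L2_Pair_le[THEN order_trans] add_left_mono L2_space_Pair order_refl) auto
        then show ?thesis using bounds[of "r k"] by linarith
      qed
      ultimately show ?thesis by blast
    qed
    show ?thesis
    proof (rule L2_nested_midpoint_convex[of M C "6 * L", OF finite_measure_domain])
      show "C n \<subseteq> L2_space M" for n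
        using comps unfolding C_def by (auto intro!: L2_space_Pair)
      show "C n \<noteq> {}" for n using step[of n] by blast
      show "C (Suc n) \<subseteq> C n" for n
      proof -
        have "relaxed \<phi> I (e n) v D H \<psi> r A" if "relaxed \<phi> I (e (Suc n)) v D H \<psi> r A" for v D H \<psi> r A
          using that e_mono[of n] unfolding relaxed_def by (auto intro: order_trans)
        then show ?thesis unfolding C_def by blast
      qed
      show "(\<lambda>x. (1/2) *\<^sub>R (F x + F' x)) \<in> C n" if "F \<in> C n" "F' \<in> C n" for n F F'
      proof -
        obtain v D H \<psi> r A where 1: "F = (\<lambda>x. (v x, D x, H x, \<psi> x, r x, A x))" "relaxed \<phi> I (e n) v D H \<psi> r A"
          using \<open>F \<in> C n\<close> unfolding C_def by blast
        obtain v' D' H' \<psi>' r' A' where 2: "F' = (\<lambda>x. (v' x, D' x, H' x, \<psi>' x, r' x, A' x))" "relaxed \<phi> I (e n) v' D' H' \<psi>' r' A'"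
          using \<open>F' \<in> C n\<close> unfolding C_def by blast
        have "(\<lambda>x. (1/2) *\<^sub>R (F x + F' x)) = (\<lambda>x. ((1/2) *\<^sub>R (v x + v' x), (1/2) *\<^sub>R (D x + D' x), (1/2) *\<^sub>R (H x + H' x),
          (1/2) *\<^sub>R (\<psi> x + \<psi>' x), (1/2) *\<^sub>R (r x + r' x), (1/2) *\<^sub>R (A x + A' x)))"
          by (simp add: 1(1) 2(1))
        then show ?thesis
          unfolding C_def mem_Collect_eq
          by (intro exI) (rule conjI[OF _ relaxed_midpoint[OF \<phi> 1(2) 2(2)]])
      qed
      show "\<exists>F\<in>C n. norm_L2 M F \<le> 6 * L" for n by (rule step)
      fix F Y
      assume F: "\<And>n. F n \<in> C n" and Y: "Y \<in> L2_space M" and FY: "(\<lambda>n. norm_L2 M (\<lambda>x. F n x - Y x)) \<longlonglongrightarrow> 0"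
      \<comment> \<open>The sets \<open>C n\<close> contain only packed functions; the six fields of
        each \<open>F n\<close> are recovered by choice.\<close>
      define Q where "Q n c \<longleftrightarrow> F n = (\<lambda>x. (fst c x, fst (snd c) x, fst (snd (snd c)) x, fst (snd (snd (snd c))) x, fst (snd (snd (snd (snd c)))) x, snd (snd (snd (snd (snd c)))) x)) \<and>
        relaxed \<phi> I (e n) (fst c) (fst (snd c)) (fst (snd (snd c))) (fst (snd (snd (snd c)))) (fst (snd (snd (snd (snd c))))) (snd (snd (snd (snd (snd c)))))" for n c
      have "\<forall>n. \<exists>c. Q n c"
      proof
        fix n
        obtain v D H \<psi> r A where "F n = (\<lambda>x. (v x, D x, H x, \<psi> x, r x, A x))" "relaxed \<phi> I (e n) v D H \<psi> r A"
          using F[of n] unfolding C_def by blast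
        then have "Q n (v, D, H, \<psi>, r, A)" unfolding Q_def by simp
        then show "\<exists>c. Q n c" ..
      qed
      from choice[OF this] obtain c where c: "\<forall>n. Q n (c n)" ..
      define a1 where "a1 n = fst (c n)" for n
      define a2 where "a2 n = fst (snd (c n))" for n
      define a3 where "a3 n = fst (snd (snd (c n)))" for n
      define a4 where "a4 n = fst (snd (snd (snd (c n))))" for n
      define a5 where "a5 n = fst (snd (snd (snd (snd (c n)))))" for n
      define a6 where "a6 n = snd (snd (snd (snd (snd (c n)))))" for n
      have Fa: "F n = (\<lambda>x. (a1 n x, a2 n x, a3 n x, a4 n x, a5 n x, a6 n x))" for n
        using c[rule_format, of n] by (simp only: Q_def a1_def a2_def a3_def a4_def a5_def a6_def)
      have rel: "relaxed \<phi> I (e n) (a1 n) (a2 n) (a3 n) (a4 n) (a5 n) (a6 n)" for n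
        using c[rule_format, of n] by (simp only: Q_def a1_def a2_def a3_def a4_def a5_def a6_def)
      have aL: "a1 n \<in> L2 \<Omega>" "a2 n \<in> L2 \<Omega>" "a3 n \<in> L2 \<Omega>" "a4 n \<in> L2 \<Omega>" "a5 n \<in> L2 \<Omega>" "a6 n \<in> L2 \<Omega>" for n
        using comps[OF rel[of n]] by auto
      define y1 where "y1 x = fst (Y x)" for x
      define y2 where "y2 x = fst (snd (Y x))" for x
      define y3 where "y3 x = fst (snd (snd (Y x)))" for x
      define y4 where "y4 x = fst (snd (snd (snd (Y x))))" for x
      define y5 where "y5 x = fst (snd (snd (snd (snd (Y x)))))" for x
      define y6 where "y6 x = snd (snd (snd (snd (snd (Y x)))))" for x
      have yL: "y1 \<in> L2 \<Omega>" "y2 \<in> L2 \<Omega>" "y3 \<in> L2 \<Omega>" "y4 \<in> L2 \<Omega>" "y5 \<in> L2 \<Omega>" "y6 \<in> L2 \<Omega>"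
        unfolding y1_def[abs_def] y2_def[abs_def] y3_def[abs_def] y4_def[abs_def] y5_def[abs_def] y6_def[abs_def]
        by (intro L2_space_fst L2_space_snd Y)+
      have l0: "(\<lambda>n. norm_L2 M (\<lambda>x. (a1 n x, a2 n x, a3 n x, a4 n x, a5 n x, a6 n x) - (y1 x, y2 x, y3 x, y4 x, y5 x, y6 x))) \<longlonglongrightarrow> 0"
        using FY unfolding Fa y1_def y2_def y3_def y4_def y5_def y6_def by simp
      note l1 = tendsto_norm_L2_Pair[OF aL(1) L2_space_Pair[OF aL(2) L2_space_Pair[OF aL(3) L2_space_Pair[OF aL(4) L2_space_Pair[OF aL(5) aL(6)]]]]
        yL(1) L2_space_Pair[OF yL(2) L2_space_Pair[OF yL(3) L2_space_Pair[OF yL(4) L2_space_Pair[OF yL(5) yL(6)]]]] l0]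
      note l2 = tendsto_norm_L2_Pair[OF aL(2) L2_space_Pair[OF aL(3) L2_space_Pair[OF aL(4) L2_space_Pair[OF aL(5) aL(6)]]]
        yL(2) L2_space_Pair[OF yL(3) L2_space_Pair[OF yL(4) L2_space_Pair[OF yL(5) yL(6)]]] l1(2)]
      note l3 = tendsto_norm_L2_Pair[OF aL(3) L2_space_Pair[OF aL(4) L2_space_Pair[OF aL(5) aL(6)]]
        yL(3) L2_space_Pair[OF yL(4) L2_space_Pair[OF yL(5) yL(6)]] l2(2)]
      note l4 = tendsto_norm_L2_Pair[OF aL(4) L2_space_Pair[OF aL(5) aL(6)] yL(4) L2_space_Pair[OF yL(5) yL(6)] l3(2)]
      note l5 = tendsto_norm_L2_Pair[OF aL(5) aL(6) yL(5) yL(6) l4(2)]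
      note R = relaxed_limit[OF \<phi> e rel yL l1(1) l2(1) l3(1) l4(1) l5(1) l5(2)]
      show ?thesis
        \<comment> \<open>The limit has energy at most \<open>I\<close>, and \<open>I\<close> is a
          lower bound for all admissible pairs.\<close>
        by (rule that[OF R(1,2)]) (use R(3) I_le in \<open>blast intro: order_trans\<close>)
    qed
  qed
qed

end

subsection \<open>Euler--Lagrange equations\<close>

text \<open>The approximating test functions vanish outside \<Omega>, in particular on the edges.
  The zero function is therefore a trace, and every boundary integral in the definition is
  0.\<close>

lemma (in bounded_domain) zero_trace_H1_0:
  assumes E: "polygonal_boundary \<Omega> (edges \<beta>)" and v: "v \<in> H1_0 \<Omega>"
  shows "zero_trace_on \<Omega> \<beta> P v"
proof -
  let ?\<mu> = "boundary_measure (edges \<beta>)"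
  obtain \<theta> where \<theta>: "\<And>k. \<theta> k \<in> test_functions \<Omega>" "H1_limit \<Omega> \<theta> v"
    using v by (auto simp: H1_0_def)
  have fin: "finite (edges \<beta>)" and front: "frontier \<Omega> = (\<Union>(a, b)\<in>edges \<beta>. closed_segment a b)"
    using E by (auto simp: polygonal_boundary_def)
  let ?D = "density (count_space (edges \<beta>) \<Otimes>\<^sub>M lebesgue_on {0..1}) (\<lambda>((a, b), t :: real). ennreal (dist a b))"
  let ?f = "\<lambda>((a :: real^2, b :: real^2), t). (1 - t) *\<^sub>R a + t *\<^sub>R b"
  have f: "?f \<in> ?D \<rightarrow>\<^sub>M borel"
  proof -
    have "(\<lambda>p. ?f p) \<in> count_space (edges \<beta>) \<Otimes>\<^sub>M lebesgue_on {0..1} \<rightarrow>\<^sub>M borel"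
    proof (rule measurable_pair_measure_countable1)
      show "countable (edges \<beta>)" using fin by (rule countable_finite)
      show "(\<lambda>t. ?f (e, t)) \<in> lebesgue_on {0..1} \<rightarrow>\<^sub>M borel" for e
      proof -
        have "continuous_on UNIV (\<lambda>t. ?f (e, t))"
          by (cases e) (auto intro!: continuous_intros)
        then show ?thesis
          by (intro measurable_restrict_space1 measurable_completion) (simp add: borel_measurable_continuous_onI)
      qed
    qed
    then show ?thesis by simp
  qed
  have zero: "(LINT x|?\<mu>. (\<theta> k x - 0)\<^sup>2) = 0" for k
  proof -
    have "(LINT x|?\<mu>. (\<theta> k x - 0)\<^sup>2) = (LINT p|?D. (\<theta> k (?f p) - 0)\<^sup>2)"
      unfolding boundary_measure_def
      by (rule integral_distr[OF f]) (use test_functions_measurable(1)[OF \<theta>(1)] in measurable)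
    also have "\<dots> = (LINT p|?D. 0)"
    proof (rule Bochner_Integration.integral_cong[OF refl])
      fix p assume p: "p \<in> space ?D"
      obtain a b t where abt: "p = ((a, b), t)" by (metis prod.exhaust)
      have "(a, b) \<in> edges \<beta>" "0 \<le> t" "t \<le> 1" using p by (auto simp: abt space_pair_measure)
      then have "?f p \<in> frontier \<Omega>" unfolding front abt closed_segment_def by auto
      then have "?f p \<notin> \<Omega>" using open_domain by (auto simp: frontier_def interior_open)
      then show "(\<theta> k (?f p) - 0)\<^sup>2 = 0" using test_functions_eq_0[OF \<theta>(1)] by simp
    qed
    finally show ?thesis by simp
  qed
  have "has_trace \<Omega> \<beta> v (\<lambda>x. 0)"
    unfolding has_trace_def
  proof (intro conjI exI[of _ \<theta>] allI)
    show "v \<in> H1 \<Omega>" by (rule H1_0_D[OF v])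
    show "(\<lambda>x. 0) \<in> L2_space ?\<mu>" by simp
    show "smooth (\<theta> k)" for k by (rule test_functionsD(1)[OF \<theta>(1)])
    show "H1_limit \<Omega> \<theta> v" by (rule \<theta>(2))
    show "(\<lambda>k. LINT x|?\<mu>. (\<theta> k x - 0)\<^sup>2) \<longlonglongrightarrow> 0" unfolding zero by simp
  qed
  then show ?thesis unfolding zero_trace_on_def by (intro exI[of _ "\<lambda>x. 0"]) simp
qed

context coupled_problem
begin

text \<open>The condition on \<open>z\<close> describes the tangent directions of the affine space
  \<open>V\<close>. Test functions and elements of \<open>H2_D\<close> satisfy it, the latter by the
  definition of \<open>H_N\<close>.\<close>

lemma V_add:
  assumes u: "u \<in> V" and z: "z \<in> H2 \<Omega>" "\<And>N. N \<in> H_N \<Omega> \<beta> \<Longrightarrow> tr_dDiv \<Omega> N z = 0"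
  shows "(\<lambda>x. u x + t * z x) \<in> V"
proof -
  have U: "is_H2 \<Omega> u (weak_grad \<Omega> u) (weak_hess \<Omega> u)" using u H2_is_H2 by (simp add: V_space_def)
  note Z = H2_is_H2[OF z(1)]
  have UZ: "is_H2 \<Omega> (\<lambda>x. u x + t * z x) (\<lambda>x. weak_grad \<Omega> u x + t *\<^sub>R weak_grad \<Omega> z x) (\<lambda>x. weak_hess \<Omega> u x + t *\<^sub>R weak_hess \<Omega> z x)"
    using is_H2_lincomb[OF U Z, of 1 t] by simp
  show ?thesis
    unfolding V_iff[OF UZ]
  proof
    fix N assume N: "N \<in> H_N \<Omega> \<beta>"
    then have N': "N \<in> H_dDiv \<Omega>" by (simp add: H_N_def)
    note NL = H_dDivD[OF N']
    have "inner_L2 M z (dDiv \<Omega> N) - inner_L2 M (weak_hess \<Omega> z) N = 0"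
      using z(2)[OF N] tr_eq(2)[OF Z N'] by (simp add: inner_L2_commute[of M z] inner_L2_commute[of M "weak_hess \<Omega> z"])
    moreover have "inner_L2 M u (dDiv \<Omega> N) - inner_L2 M (weak_hess \<Omega> u) N = tr_Ggrad \<Omega> g N"
      using u N unfolding V_iff[OF U] by blast
    moreover have "inner_L2 M (\<lambda>x. u x + t * z x) (dDiv \<Omega> N) - inner_L2 M (\<lambda>x. weak_hess \<Omega> u x + t *\<^sub>R weak_hess \<Omega> z x) N
      = (inner_L2 M u (dDiv \<Omega> N) - inner_L2 M (weak_hess \<Omega> u) N) + t * (inner_L2 M z (dDiv \<Omega> N) - inner_L2 M (weak_hess \<Omega> z) N)"
      using is_H2D[OF U] is_H2D[OF Z] NL
      by (simp add: inner_L2_add L2_space_mult_left L2_space_scaleR inner_L2_mult inner_L2_scaleR right_diff_distrib)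
    ultimately show "inner_L2 M (\<lambda>x. u x + t * z x) (dDiv \<Omega> N) - inner_L2 M (\<lambda>x. weak_hess \<Omega> u x + t *\<^sub>R weak_hess \<Omega> z x) N = tr_Ggrad \<Omega> g N"
      by simp
  qed
qed

section \<open>First variations at a fixed minimiser\<close>

context
  fixes u \<phi>
  assumes u: "u \<in> V" and \<phi>: "\<phi> \<in> W"
    and minimal: "\<And>v \<psi>. v \<in> V \<Longrightarrow> \<psi> \<in> W \<Longrightarrow> energy \<Omega> B K m q f G u \<phi> \<le> energy \<Omega> B K m q f G v \<psi>"
begin

abbreviation "A \<equiv> moment u (weak_hess \<Omega> u) \<phi>"

lemma u_H2: "is_H2 \<Omega> u (weak_grad \<Omega> u) (weak_hess \<Omega> u)"
  using u H2_is_H2 by (simp add: V_space_def)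

lemmas u_L2 = is_H2D[OF u_H2]
lemmas \<phi>_H1 = H1_weak_grad[OF W_D(1)[OF \<phi>]]

lemma A_L2: "A \<in> L2 \<Omega>"
  by (rule moment_L2[OF u_L2(1,5) \<phi>_H1(1)])

text \<open>For fixed \<phi> the moment is linear in \<open>v\<close>, so the energy along
  \<open>u + t z\<close> is exactly quadratic in \<open>t\<close>. Minimality at
  \<open>t = 0\<close> annihilates the linear coefficient.\<close>

lemma euler_lagrange_u:
  assumes z: "z \<in> H2 \<Omega>" "\<And>N. N \<in> H_N \<Omega> \<beta> \<Longrightarrow> tr_dDiv \<Omega> N z = 0"
  shows "B * inner_L2 M A (moment z (weak_hess \<Omega> z) \<phi>) + m * inner_L2 M u z - inner_L2 M f z + B * tr_dDiv \<Omega> G z = 0"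
proof -
  note Z = H2_is_H2[OF z(1)]
  note ZL = is_H2D[OF Z] and GG = H_dDivD[OF G]
  let ?Az = "moment z (weak_hess \<Omega> z) \<phi>"
  have AzL: "?Az \<in> L2 \<Omega>" by (rule moment_L2[OF ZL(1,5) \<phi>_H1(1)])
  define a where "a = B / 2 * (norm_L2 M ?Az)\<^sup>2 + m / 2 * (norm_L2 M z)\<^sup>2"
  define b where "b = B * inner_L2 M A ?Az + m * inner_L2 M u z - inner_L2 M f z + B * tr_dDiv \<Omega> G z"
  have "0 \<le> a * t\<^sup>2 + b * t" for t
  proof -
    let ?v = "\<lambda>x. u x + t * z x" and ?H = "\<lambda>x. weak_hess \<Omega> u x + t *\<^sub>R weak_hess \<Omega> z x"
    have UZ: "is_H2 \<Omega> ?v (\<lambda>x. weak_grad \<Omega> u x + t *\<^sub>R weak_grad \<Omega> z x) ?H"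
      using is_H2_lincomb[OF u_H2 Z, of 1 t] by simp
    have Av: "moment ?v ?H \<phi> = (\<lambda>x. A x + t *\<^sub>R ?Az x)"
      by (auto simp: moment_def fun_eq_iff algebra_simps)
    have "(norm_L2 M (\<lambda>x. A x + t *\<^sub>R ?Az x))\<^sup>2 = (norm_L2 M A)\<^sup>2 + 2 * (t * inner_L2 M A ?Az) + t\<^sup>2 * (norm_L2 M ?Az)\<^sup>2"
      using norm_L2_add_power2[OF A_L2 L2_space_scaleR[OF AzL], of t]
      by (simp add: norm_L2_scaleR inner_L2_scaleR power_mult_distrib)
    moreover have "(norm_L2 M ?v)\<^sup>2 = (norm_L2 M u)\<^sup>2 + 2 * (t * inner_L2 M u z) + t\<^sup>2 * (norm_L2 M z)\<^sup>2"
      using norm_L2_add_power2[OF u_L2(1) L2_space_mult_left[OF ZL(1)], of t]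
      by (simp add: norm_L2_mult inner_L2_mult power_mult_distrib)
    moreover have "inner_L2 M f ?v = inner_L2 M f u + t * inner_L2 M f z"
      "inner_L2 M (dDiv \<Omega> G) ?v = inner_L2 M (dDiv \<Omega> G) u + t * inner_L2 M (dDiv \<Omega> G) z"
      "inner_L2 M G ?H = inner_L2 M G (weak_hess \<Omega> u) + t * inner_L2 M G (weak_hess \<Omega> z)"
      using u_L2 ZL GG f by (simp_all add: inner_L2_add L2_space_mult_left L2_space_scaleR inner_L2_mult inner_L2_scaleR)
    ultimately have "convex_energy ?v ?H (weak_grad \<Omega> \<phi>) (moment ?v ?H \<phi>) = convex_energy u (weak_hess \<Omega> u) (weak_grad \<Omega> \<phi>) A + (a * t\<^sup>2 + b * t)"
      unfolding convex_energy_def Av a_def b_def tr_eq(2)[OF Z G] by (simp add: algebra_simps)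
    moreover have "energy \<Omega> B K m q f G u \<phi> \<le> energy \<Omega> B K m q f G ?v \<phi>"
      by (rule minimal[OF V_add[OF u z] \<phi>])
    ultimately show ?thesis
      unfolding energy_eq[OF u_H2 \<phi>_H1(2,1)] energy_eq[OF UZ \<phi>_H1(2,1)] by simp
  qed
  then have "b = 0" by (rule quadratic_nonneg_imp_linear_coeff_0)
  then show ?thesis by (simp add: b_def)
qed

text \<open>The adjoint of multiplication by \<open>T(\<phi>)\<close>: the zero-order part moves
  from \<open>v\<close> to \<open>N\<close> and becomes the second summand of
  \<open>dDiv_T\<close>.\<close>

lemma inner_moment:
  assumes N: "N \<in> L2 \<Omega>" and v: "v \<in> L2 \<Omega>" and H: "H \<in> L2 \<Omega>"
  shows "inner_L2 M N (moment v H \<phi>) = inner_L2 M N H + inner_L2 M (\<lambda>x. q\<^sup>2 * (T_mat (\<phi> x) \<bullet> N x)) v"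
proof -
  note T = L2_space_times_T_mat(1)[OF v L2_spaceD(1)[OF \<phi>_H1(1)], of "q\<^sup>2"]
  have "inner_L2 M N (moment v H \<phi>) = inner_L2 M N H + inner_L2 M N (\<lambda>x. (q\<^sup>2 * v x) *\<^sub>R T_mat (\<phi> x))"
    unfolding moment_def[abs_def] by (rule inner_L2_add(2)[OF H T N])
  also have "inner_L2 M N (\<lambda>x. (q\<^sup>2 * v x) *\<^sub>R T_mat (\<phi> x)) = inner_L2 M (\<lambda>x. q\<^sup>2 * (T_mat (\<phi> x) \<bullet> N x)) v"
    unfolding inner_L2_def by (intro Bochner_Integration.integral_cong) (auto simp: inner_commute mult_ac)
  finally show ?thesis .
qed

lemma T_inner_L2:
  assumes "N \<in> L2 \<Omega>"
  shows "(\<lambda>x. q\<^sup>2 * (T_mat (\<phi> x) \<bullet> N x)) \<in> L2 \<Omega>"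
  by (intro L2_space_mult_left L2_space_inner_bounded[OF assms T_mat_measurable(1)[OF L2_spaceD(1)[OF \<phi>_H1(1)]], of 1] norm_T_mat_le)

text \<open>For test functions the trace term vanishes, and the variation in \<open>u\<close> says
  that the distributional iterated divergence of \<open>A\<close> is a function in L2. The equation
  then holds almost everywhere.\<close>

lemma A_dDiv:
  "A \<in> H_dDiv \<Omega>" "AE x in M. dDiv_T \<Omega> q \<phi> A x = 1 / B * (f x - m * u x)"
proof -
  \<comment> \<open>The Euler-Lagrange equation solved for the iterated divergence of
    \<open>A\<close>.\<close>
  define w where "w x = 1 / B * (f x - m * u x) - q\<^sup>2 * (T_mat (\<phi> x) \<bullet> A x)" for x
  note TA = T_inner_L2[OF A_L2]
  have fu: "(\<lambda>x. 1 / B * (f x - m * u x)) \<in> L2 \<Omega>"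
    by (intro L2_space_mult_left L2_space_diff f u_L2)
  have w: "w \<in> L2 \<Omega>" unfolding w_def[abs_def] by (rule L2_space_diff[OF fu TA])
  have "is_dDiv \<Omega> A w"
    unfolding is_dDiv_def
  proof (intro conjI ballI w)
    fix \<theta> assume \<theta>: "\<theta> \<in> test_functions \<Omega>"
    note \<theta>H = is_H2_test[OF \<theta>]
    note \<theta>L = is_H2D[OF \<theta>H]
    note h = is_H2_imp_H2[OF \<theta>H]
    have EL: "B * inner_L2 M A (moment \<theta> (weak_hess \<Omega> \<theta>) \<phi>) + m * inner_L2 M u \<theta> - inner_L2 M f \<theta> + B * tr_dDiv \<Omega> G \<theta> = 0"
      by (rule euler_lagrange_u[OF h(1)]) (use tr_dDiv_test[OF \<theta>] in \<open>auto simp: H_N_def\<close>)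
    note whL = is_H2D(5)[OF H2_is_H2[OF h(1)]]
    have "inner_L2 M A (weak_hess \<Omega> \<theta>) = inner_L2 M A (hess \<theta>)"
      using h(2) by (intro inner_L2_cong_AE L2_spaceD(1) A_L2 whL \<theta>L) auto
    then have "B * (inner_L2 M A (hess \<theta>) + inner_L2 M (\<lambda>x. q\<^sup>2 * (T_mat (\<phi> x) \<bullet> A x)) \<theta>) + m * inner_L2 M u \<theta> - inner_L2 M f \<theta> = 0"
      using EL tr_dDiv_test[OF \<theta> G] by (simp add: inner_moment[OF A_L2 \<theta>L(1) whL])
    moreover have "inner_L2 M w \<theta> = 1 / B * (inner_L2 M f \<theta> - m * inner_L2 M u \<theta>) - inner_L2 M (\<lambda>x. q\<^sup>2 * (T_mat (\<phi> x) \<bullet> A x)) \<theta>"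
      unfolding w_def[abs_def]
      by (simp only: inner_L2_diff[OF fu TA \<theta>L(1)] inner_L2_mult(1) inner_L2_diff[OF f L2_space_mult_left[OF u_L2(1)] \<theta>L(1)])
    moreover have "B * (1 / B * x - y) = x - B * y" for x y using B by (simp add: field_simps)
    ultimately have "B * inner_L2 M A (hess \<theta>) = B * inner_L2 M w \<theta>"
      by (simp only: distrib_left)
    then have "inner_L2 M A (hess \<theta>) = inner_L2 M w \<theta>" using B by simp
    then show "ip \<Omega> A (hess \<theta>) = ip \<Omega> w \<theta>" by (simp add: ip_eq_inner_L2)
  qed
  moreover have "AE x in M. transpose (A x) = A x"
    using is_H2_symmetric[OF u_H2]
  proof eventually_elim
    case (elim x)
    have "weak_hess \<Omega> u x $ i $ j = weak_hess \<Omega> u x $ j $ i" for i j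
      using arg_cong[OF elim, of "\<lambda>X. X $ j $ i"] by (simp add: transpose_def)
    moreover have "T_mat s $ i $ j = T_mat s $ j $ i" for s i j
      using arg_cong[OF transpose_T_mat[of s], of "\<lambda>X. X $ j $ i"] by (simp add: transpose_def)
    ultimately show ?case by (simp add: moment_def vec_eq_iff transpose_def)
  qed
  ultimately show A: "A \<in> H_dDiv \<Omega>"
    using A_L2 by (auto simp: H_dDiv_def L2_sym_def)
  show "AE x in M. dDiv_T \<Omega> q \<phi> A x = 1 / B * (f x - m * u x)"
    using dDiv_AE_eq[OF A \<open>is_dDiv \<Omega> A w\<close>] by eventually_elim (simp add: dDiv_T_def w_def)
qed

lemma dDiv_T_L2:
  assumes "N \<in> H_dDiv \<Omega>"
  shows "dDiv_T \<Omega> q \<phi> N \<in> L2 \<Omega>"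
  unfolding dDiv_T_def[abs_def]
  by (intro L2_space_add H_dDivD[OF assms] T_inner_L2)

lemma inner_dDiv_T_A:
  assumes "w \<in> L2 \<Omega>"
  shows "inner_L2 M (dDiv_T \<Omega> q \<phi> A) w = 1 / B * (inner_L2 M f w - m * inner_L2 M u w)"
proof -
  have fu: "(\<lambda>x. 1 / B * (f x - m * u x)) \<in> L2 \<Omega>"
    by (intro L2_space_mult_left L2_space_diff f u_L2)
  have "inner_L2 M (dDiv_T \<Omega> q \<phi> A) w = inner_L2 M (\<lambda>x. 1 / B * (f x - m * u x)) w"
    by (rule inner_L2_cong_AE) (use A_dDiv(2) L2_spaceD(1)[OF dDiv_T_L2[OF A_dDiv(1)]] L2_spaceD(1)[OF fu] L2_spaceD(1)[OF assms] in auto)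
  then show ?thesis
    by (simp only: inner_L2_mult(1) inner_L2_diff[OF f L2_space_mult_left[OF u_L2(1)] assms])
qed

text \<open>The interior equation tested with \<open>z\<close> is subtracted from the variation in
  direction \<open>z\<close>. What remains is the difference of the two trace terms.\<close>

lemma natural_boundary_condition:
  assumes "z \<in> H2_D \<Omega> \<beta>"
  shows "tr_dDiv \<Omega> A z = tr_dDiv \<Omega> G z"
proof -
  have z: "z \<in> H2 \<Omega>" using assms by (simp add: H2_D_def)
  note ZL = is_H2D[OF H2_is_H2[OF z]]
  have "B * inner_L2 M A (moment z (weak_hess \<Omega> z) \<phi>) + m * inner_L2 M u z - inner_L2 M f z + B * tr_dDiv \<Omega> G z = 0"
    by (rule euler_lagrange_u[OF z]) (use assms in \<open>auto simp: H_N_def\<close>)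
  moreover have "inner_L2 M (dDiv \<Omega> A) z + inner_L2 M (\<lambda>x. q\<^sup>2 * (T_mat (\<phi> x) \<bullet> A x)) z = 1 / B * (inner_L2 M f z - m * inner_L2 M u z)"
    using inner_dDiv_T_A[OF ZL(1)] unfolding dDiv_T_def[abs_def]
    by (simp add: inner_L2_add H_dDivD(2)[OF A_dDiv(1)] T_inner_L2[OF A_L2] ZL(1))
  ultimately have "B * (inner_L2 M A (weak_hess \<Omega> z) - inner_L2 M (dDiv \<Omega> A) z + tr_dDiv \<Omega> G z) = 0"
    using B by (simp add: inner_moment[OF A_L2 ZL(1,5)] field_simps)
  then show ?thesis
    using B unfolding tr_eq(2)[OF H2_is_H2[OF z] A_dDiv(1)] by simp
qed

text \<open>Membership of \<open>u\<close> in \<open>V\<close> turns the pairing of \<open>A\<close>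
  with \<open>N\<close> into that of \<open>u\<close> with \<open>dDiv_T N\<close>, minus the datum
  \<open>g\<close>. The equation for \<open>dDiv_T A\<close> then cancels \<open>u\<close>.\<close>

lemma first_equation:
  assumes "N \<in> H_N \<Omega> \<beta>"
  shows "dDiv_form \<Omega> B m q \<phi> A N = B / m * ip \<Omega> f (dDiv_T \<Omega> q \<phi> N) - B * tr_Ggrad \<Omega> g N"
proof -
  have N: "N \<in> H_dDiv \<Omega>" using assms by (simp add: H_N_def)
  note NL = H_dDivD[OF N]
  have "inner_L2 M A N = inner_L2 M N (weak_hess \<Omega> u) + inner_L2 M (\<lambda>x. q\<^sup>2 * (T_mat (\<phi> x) \<bullet> N x)) u"
    using inner_moment[OF NL(1) u_L2(1,5)] by (simp add: inner_L2_commute[of M A])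
  moreover have "inner_L2 M (dDiv_T \<Omega> q \<phi> N) u = inner_L2 M (dDiv \<Omega> N) u + inner_L2 M (\<lambda>x. q\<^sup>2 * (T_mat (\<phi> x) \<bullet> N x)) u"
    unfolding dDiv_T_def[abs_def] by (simp add: inner_L2_add NL T_inner_L2 u_L2)
  moreover have "inner_L2 M u (dDiv \<Omega> N) - inner_L2 M (weak_hess \<Omega> u) N = tr_Ggrad \<Omega> g N"
    using u assms unfolding V_iff[OF u_H2] by blast
  ultimately have "inner_L2 M A N = inner_L2 M (dDiv_T \<Omega> q \<phi> N) u - tr_Ggrad \<Omega> g N"
    by (simp add: inner_L2_commute[of M u] inner_L2_commute[of M "weak_hess \<Omega> u"])
  moreover have "B\<^sup>2 / m * (1 / B * (x - m * y)) = B / m * x - B * y" for x y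
    using B m by (simp add: field_simps power2_eq_square)
  ultimately show ?thesis
    unfolding dDiv_form_def ip_eq_inner_L2 inner_dDiv_T_A[OF dDiv_T_L2[OF N]]
    by (simp add: inner_L2_commute[of M u] right_diff_distrib)
qed

lemma W_add:
  assumes \<zeta>: "\<zeta> \<in> H1_0 \<Omega>"
  shows "(\<lambda>x. \<phi> x + t * \<zeta> x) \<in> W" "is_weak_grad \<Omega> (\<lambda>x. \<phi> x + t * \<zeta> x) (\<lambda>x. weak_grad \<Omega> \<phi> x + t *\<^sub>R weak_grad \<Omega> \<zeta> x)"
    "(\<lambda>x. \<phi> x + t * \<zeta> x) \<in> L2 \<Omega>"
proof -
  note Z = H1_weak_grad[OF H1_0_D[OF \<zeta>]]
  show G: "is_weak_grad \<Omega> (\<lambda>x. \<phi> x + t * \<zeta> x) (\<lambda>x. weak_grad \<Omega> \<phi> x + t *\<^sub>R weak_grad \<Omega> \<zeta> x)"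
    using is_weak_grad_lincomb[OF \<phi>_H1(2) Z(2) \<phi>_H1(1) Z(1), of 1 t] by simp
  show L: "(\<lambda>x. \<phi> x + t * \<zeta> x) \<in> L2 \<Omega>" by (intro L2_space_add L2_space_mult_left \<phi>_H1 Z)
  have "(\<lambda>x. 1 * (\<phi> x - \<eta> x) + t * \<zeta> x) = (\<lambda>x. \<phi> x + t * \<zeta> x - \<eta> x)" by auto
  then show "(\<lambda>x. \<phi> x + t * \<zeta> x) \<in> W"
    using H1_0_lincomb[OF W_D(2)[OF \<phi>] \<zeta>, of 1 t] H1_I[OF L G] by (simp add: W_space_def)
qed

text \<open>The product \<open>u \<zeta>\<close> is square integrable, so that the quadratic remainder is harmless.\<close>

lemma variation_phi_nonneg:
  assumes \<zeta>: "\<zeta> \<in> H1_0 \<Omega>"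
  shows "0 \<le> K * inner_L2 M (weak_grad \<Omega> \<phi>) (weak_grad \<Omega> \<zeta>) + B * q\<^sup>2 * (LINT x|M. (A x \<bullet> T'_mat (\<phi> x)) * u x * \<zeta> x)"
proof -
  note Z = H1_weak_grad[OF H1_0_D[OF \<zeta>]]
  have [measurable]: "\<phi> \<in> borel_measurable M" "\<zeta> \<in> borel_measurable M" "u \<in> borel_measurable M" "A \<in> borel_measurable M"
    using L2_spaceD(1)[OF \<phi>_H1(1)] L2_spaceD(1)[OF Z(1)] L2_spaceD(1)[OF u_L2(1)] L2_spaceD(1)[OF A_L2] by auto
  have u\<zeta>: "(\<lambda>x. u x * \<zeta> x) \<in> L2 \<Omega>" by (rule H1_times_H1_0[OF H1_I[OF u_L2(1,2)] \<zeta>])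
  \<comment> \<open>The change of the moment when \<phi> moves by \<open>t \<zeta>\<close>. It is
    not linear in \<open>t\<close>, but it is bounded by a multiple of \<open>\<bar>t\<bar>\<close>
    times the L2 function \<open>u \<zeta>\<close>.\<close>
  define d where "d t x = (q\<^sup>2 * u x) *\<^sub>R (T_mat (\<phi> x + t * \<zeta> x) - T_mat (\<phi> x))" for t x
  have dm: "d t \<in> borel_measurable M" for t
    unfolding d_def by (intro borel_measurable_scaleR borel_measurable_diff T_mat_measurable(1); measurable)
  have d_le: "norm (d t x) \<le> (4 * q\<^sup>2 * \<bar>t\<bar>) * norm (u x * \<zeta> x)" for t x
    using mult_left_mono[OF T_mat_lipschitz[of "\<phi> x + t * \<zeta> x" "\<phi> x"], of "\<bar>q\<^sup>2 * u x\<bar>"]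
    by (simp add: d_def abs_mult mult_ac)
  have dL2: "d t \<in> L2 \<Omega>" for t by (rule L2_space_bound[OF u\<zeta> dm d_le])
  have dN: "norm_L2 M (d t) \<le> (4 * q\<^sup>2 * \<bar>t\<bar>) * norm_L2 M (\<lambda>x. u x * \<zeta> x)" for t
    by (rule norm_L2_bounded_mult[OF u\<zeta> dm _ d_le]) simp
  define c where "c = B / 2 * (4 * q\<^sup>2 * norm_L2 M (\<lambda>x. u x * \<zeta> x))\<^sup>2 + K / 2 * (norm_L2 M (weak_grad \<Omega> \<zeta>))\<^sup>2"
  let ?k = "inner_L2 M (weak_grad \<Omega> \<phi>) (weak_grad \<Omega> \<zeta>)"
  \<comment> \<open>The squared norms of \<open>d t\<close> and of the gradient increment are of
    order \<open>t\<^sup>2\<close> and are collected in \<open>c\<close>; the terms of first order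
    are kept exactly.\<close>
  have var: "0 \<le> B * inner_L2 M A (d t) + K * (t * ?k) + c * t\<^sup>2" for t
  proof -
    let ?\<psi> = "\<lambda>x. \<phi> x + t * \<zeta> x"
    have Ad: "moment u (weak_hess \<Omega> u) ?\<psi> = (\<lambda>x. A x + d t x)"
      by (auto simp: moment_def d_def fun_eq_iff algebra_simps)
    have "(norm_L2 M (\<lambda>x. A x + d t x))\<^sup>2 = (norm_L2 M A)\<^sup>2 + 2 * inner_L2 M A (d t) + (norm_L2 M (d t))\<^sup>2"
      by (rule norm_L2_add_power2[OF A_L2 dL2])
    moreover have "(norm_L2 M (\<lambda>x. weak_grad \<Omega> \<phi> x + t *\<^sub>R weak_grad \<Omega> \<zeta> x))\<^sup>2
      = (norm_L2 M (weak_grad \<Omega> \<phi>))\<^sup>2 + 2 * (t * ?k) + t\<^sup>2 * (norm_L2 M (weak_grad \<Omega> \<zeta>))\<^sup>2"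
      using norm_L2_add_power2[OF \<phi>_H1(3) L2_space_scaleR[OF Z(3)], of t]
      by (simp add: norm_L2_scaleR inner_L2_scaleR power_mult_distrib)
    moreover have "energy \<Omega> B K m q f G u \<phi> \<le> energy \<Omega> B K m q f G u ?\<psi>"
      by (rule minimal[OF u W_add(1)[OF \<zeta>]])
    ultimately have "0 \<le> B * inner_L2 M A (d t) + B / 2 * (norm_L2 M (d t))\<^sup>2 + K * (t * ?k) + K / 2 * (t\<^sup>2 * (norm_L2 M (weak_grad \<Omega> \<zeta>))\<^sup>2)"
      unfolding energy_eq[OF u_H2 \<phi>_H1(2,1)] energy_eq[OF u_H2 W_add(2,3)[OF \<zeta>]] convex_energy_def Ad
      by (simp add: algebra_simps)
    moreover have "B / 2 * (norm_L2 M (d t))\<^sup>2 \<le> B / 2 * ((4 * q\<^sup>2 * \<bar>t\<bar>) * norm_L2 M (\<lambda>x. u x * \<zeta> x))\<^sup>2"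
      using B by (intro mult_left_mono power_mono dN) auto
    moreover have "B / 2 * ((4 * q\<^sup>2 * \<bar>t\<bar>) * norm_L2 M (\<lambda>x. u x * \<zeta> x))\<^sup>2 + K / 2 * (t\<^sup>2 * (norm_L2 M (weak_grad \<Omega> \<zeta>))\<^sup>2) = c * t\<^sup>2"
      by (simp add: c_def power_mult_distrib algebra_simps)
    ultimately show ?thesis by linarith
  qed
  let ?s = "\<lambda>n. real (Suc n)"
  have quot: "0 \<le> B * inner_L2 M A (\<lambda>x. ?s n *\<^sub>R d (1 / ?s n) x) + K * ?k + c * (1 / ?s n)" for n
  proof -
    have "0 \<le> ?s n * (B * inner_L2 M A (d (1 / ?s n)) + K * (1 / ?s n * ?k) + c * (1 / ?s n)\<^sup>2)"
      using var[of "1 / ?s n"] by (intro mult_nonneg_nonneg) auto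
    also have "\<dots> = B * inner_L2 M A (\<lambda>x. ?s n *\<^sub>R d (1 / ?s n) x) + K * ?k + c * (1 / ?s n)"
      by (simp add: inner_L2_scaleR power2_eq_square field_simps del: of_nat_Suc)
    finally show ?thesis .
  qed
  \<comment> \<open>Pointwise, the difference quotient of \<open>T\<close> tends to its derivative.
    The Lipschitz bound provides the majorant, a multiple of \<open>norm (A x)\<close> times
    \<open>\<bar>u x * \<zeta> x\<bar>\<close>, integrable as a product of L2 functions.\<close>
  have lim: "(\<lambda>n. inner_L2 M A (\<lambda>x. ?s n *\<^sub>R d (1 / ?s n) x)) \<longlonglongrightarrow> (LINT x|M. A x \<bullet> ((q\<^sup>2 * u x * \<zeta> x) *\<^sub>R T'_mat (\<phi> x)))"
    unfolding inner_L2_def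
  proof (rule integral_dominated_convergence)
    have [measurable]: "(\<lambda>x. T'_mat (\<phi> x)) \<in> borel_measurable M" by (rule T_mat_measurable(2)) measurable
    show "(\<lambda>x. A x \<bullet> ((q\<^sup>2 * u x * \<zeta> x) *\<^sub>R T'_mat (\<phi> x))) \<in> borel_measurable M" by measurable
    show "(\<lambda>x. A x \<bullet> (?s n *\<^sub>R d (1 / ?s n) x)) \<in> borel_measurable M" for n
      using dm[of "1 / ?s n"] by measurable
    have nA: "(\<lambda>x. norm (A x)) \<in> L2 \<Omega>" and nu: "(\<lambda>x. \<bar>u x * \<zeta> x\<bar>) \<in> L2 \<Omega>"
      using A_L2 u\<zeta> by (auto simp: L2_space_def)
    show "integrable M (\<lambda>x. 4 * q\<^sup>2 * (norm (A x) * \<bar>u x * \<zeta> x\<bar>))"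
      by (intro integrable_mult_right integrable_mult_L2 nA nu)
    show "AE x in M. (\<lambda>n. A x \<bullet> (?s n *\<^sub>R d (1 / ?s n) x)) \<longlonglongrightarrow> A x \<bullet> ((q\<^sup>2 * u x * \<zeta> x) *\<^sub>R T'_mat (\<phi> x))"
    proof (rule AE_I2)
      fix x
      have "(\<lambda>n. A x \<bullet> ((q\<^sup>2 * u x) *\<^sub>R (?s n *\<^sub>R (T_mat (\<phi> x + 1 / ?s n * \<zeta> x) - T_mat (\<phi> x)))))
        \<longlonglongrightarrow> A x \<bullet> ((q\<^sup>2 * u x) *\<^sub>R (\<zeta> x *\<^sub>R T'_mat (\<phi> x)))"
        by (intro tendsto_inner tendsto_scaleR tendsto_const T_mat_difference_quotient)
      then show "(\<lambda>n. A x \<bullet> (?s n *\<^sub>R d (1 / ?s n) x)) \<longlonglongrightarrow> A x \<bullet> ((q\<^sup>2 * u x * \<zeta> x) *\<^sub>R T'_mat (\<phi> x))"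
        by (simp add: d_def mult_ac)
    qed
    show "AE x in M. norm (A x \<bullet> (?s n *\<^sub>R d (1 / ?s n) x)) \<le> 4 * q\<^sup>2 * (norm (A x) * \<bar>u x * \<zeta> x\<bar>)" for n
    proof (rule AE_I2)
      fix x
      have "norm (?s n *\<^sub>R d (1 / ?s n) x) \<le> ?s n * ((4 * q\<^sup>2 * \<bar>1 / ?s n\<bar>) * norm (u x * \<zeta> x))"
        unfolding norm_scaleR using d_le[of "1 / ?s n" x] by (intro mult_mono) auto
      also have "\<dots> = 4 * q\<^sup>2 * \<bar>u x * \<zeta> x\<bar>" by simp
      finally have "norm (A x) * norm (?s n *\<^sub>R d (1 / ?s n) x) \<le> norm (A x) * (4 * q\<^sup>2 * \<bar>u x * \<zeta> x\<bar>)"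
        by (intro mult_left_mono) auto
      then show "norm (A x \<bullet> (?s n *\<^sub>R d (1 / ?s n) x)) \<le> 4 * q\<^sup>2 * (norm (A x) * \<bar>u x * \<zeta> x\<bar>)"
        using Cauchy_Schwarz_ineq2[of "A x" "?s n *\<^sub>R d (1 / ?s n) x"] by (simp add: mult_ac)
    qed
  qed
  have "(\<lambda>n. B * inner_L2 M A (\<lambda>x. ?s n *\<^sub>R d (1 / ?s n) x) + K * ?k + c * (1 / ?s n)) \<longlonglongrightarrow>
    B * (LINT x|M. A x \<bullet> ((q\<^sup>2 * u x * \<zeta> x) *\<^sub>R T'_mat (\<phi> x))) + K * ?k + c * 0"
    by (intro tendsto_intros lim LIMSEQ_Suc[OF lim_1_over_n])
  then have "0 \<le> B * (LINT x|M. A x \<bullet> ((q\<^sup>2 * u x * \<zeta> x) *\<^sub>R T'_mat (\<phi> x))) + K * ?k + c * 0"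
    by (rule LIMSEQ_le_const) (use quot in blast)
  also have "(LINT x|M. A x \<bullet> ((q\<^sup>2 * u x * \<zeta> x) *\<^sub>R T'_mat (\<phi> x))) = (LINT x|M. q\<^sup>2 * ((A x \<bullet> T'_mat (\<phi> x)) * u x * \<zeta> x))"
    by (intro Bochner_Integration.integral_cong) (auto simp: mult_ac)
  finally show ?thesis by simp
qed

text \<open>The steps \<open>1 / Suc n\<close> are positive, so each direction yields an inequality
  only; \<zeta> and its negative together give equality.\<close>

lemma third_equation:
  assumes \<zeta>: "\<zeta> \<in> H1_0 \<Omega>"
  shows "K * ip \<Omega> (weak_grad \<Omega> \<phi>) (weak_grad \<Omega> \<zeta>) + B * q\<^sup>2 * ip \<Omega> (\<lambda>x. (A x \<bullet> T'_mat (\<phi> x)) * u x) \<zeta> = 0"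
proof -
  note Z = H1_weak_grad[OF H1_0_D[OF \<zeta>]]
  have "(\<lambda>x. 0 * \<zeta> x + (-1) * \<zeta> x) \<in> H1_0 \<Omega>" by (rule H1_0_lincomb[OF \<zeta> \<zeta>])
  then have n: "(\<lambda>x. - \<zeta> x) \<in> H1_0 \<Omega>" by simp
  note ZN = H1_weak_grad[OF H1_0_D[OF n]]
  have "is_weak_grad \<Omega> (\<lambda>x. - \<zeta> x) (\<lambda>x. - weak_grad \<Omega> \<zeta> x)"
    using is_weak_grad_lincomb[OF Z(2) Z(2) Z(1) Z(1), of 0 "-1"] by simp
  then have "AE x in M. weak_grad \<Omega> (\<lambda>x. - \<zeta> x) x = - weak_grad \<Omega> \<zeta> x"
    by (rule weak_grad_AE_eq[OF ZN(1)])
  then have "inner_L2 M (weak_grad \<Omega> \<phi>) (weak_grad \<Omega> (\<lambda>x. - \<zeta> x)) = inner_L2 M (weak_grad \<Omega> \<phi>) (\<lambda>x. - weak_grad \<Omega> \<zeta> x)"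
    by (intro inner_L2_cong_AE L2_spaceD(1) \<phi>_H1 ZN L2_space_uminus Z) auto
  then have "K * inner_L2 M (weak_grad \<Omega> \<phi>) (weak_grad \<Omega> \<zeta>) + B * q\<^sup>2 * (LINT x|M. (A x \<bullet> T'_mat (\<phi> x)) * u x * \<zeta> x) \<le> 0"
    using variation_phi_nonneg[OF n] by (simp add: inner_L2_uminus)
  then show ?thesis
    using variation_phi_nonneg[OF \<zeta>] by (simp add: ip_eq_inner_L2[of "weak_grad \<Omega> \<phi>"]) (simp add: ip_def)
qed

end

end

theorem theorem4:
  fixes \<Omega> :: "(real^2) set" and \<beta> :: boundary_data and q B K m :: real
    and f g \<eta> :: "real^2 \<Rightarrow> real" and G :: "real^2 \<Rightarrow> real^2^2"
  assumes "lipschitz_domain \<Omega>" and "bounded \<Omega>" and "simply_connected \<Omega>"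
    and "boundary_decomposition \<Omega> \<beta>"
    and "q > 0" and "B > 0" and "K > 0" and "m > 0"
    and "f \<in> L2 \<Omega>" and "G \<in> H_dDiv \<Omega>" and "g \<in> H2 \<Omega>" and "\<eta> \<in> H1 \<Omega>"
  shows "\<exists>u \<phi>.
    is_arg_min (\<lambda>(v, \<psi>). energy \<Omega> B K m q f G v \<psi>)
      (\<lambda>(v, \<psi>). v \<in> V_space \<Omega> \<beta> g \<and> \<psi> \<in> W_space \<Omega> \<eta>) (u, \<phi>) \<and>
    (\<exists>M.
      M \<in> H_dDiv \<Omega> \<and> u \<in> L2 \<Omega> \<and> \<phi> \<in> H1 \<Omega> \<and>
      (\<forall>N\<in>H_N \<Omega> \<beta>.
        dDiv_form \<Omega> B m q \<phi> M N = B / m * ip \<Omega> f (dDiv_T \<Omega> q \<phi> N) - B * tr_Ggrad \<Omega> g N) \<and>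
      (\<forall>w\<in>L2 \<Omega>. ip \<Omega> u w + B / m * ip \<Omega> (dDiv_T \<Omega> q \<phi> M) w = 1 / m * ip \<Omega> f w) \<and>
      (\<forall>\<zeta>\<in>H1_0 \<Omega>.
        K * ip \<Omega> (weak_grad \<Omega> \<phi>) (weak_grad \<Omega> \<zeta>) +
        B * q\<^sup>2 * ip \<Omega> (\<lambda>x. (M x \<bullet> T'_mat (\<phi> x)) * u x) \<zeta> = 0) \<and>
      (\<forall>z\<in>H2_D \<Omega> \<beta>. tr_dDiv \<Omega> M z = tr_dDiv \<Omega> G z) \<and>
      zero_trace_on \<Omega> \<beta> (frontier \<Omega>) (\<lambda>x. \<phi> x - \<eta> x) \<and>
      u \<in> H2 \<Omega> \<and>
      (AE x in lebesgue_on \<Omega>. M x = weak_hess \<Omega> u x + (q\<^sup>2 * u x) *\<^sub>R T_mat (\<phi> x)) \<and>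
      (\<forall>N\<in>H_N \<Omega> \<beta>. tr_Ggrad \<Omega> u N = tr_Ggrad \<Omega> g N) \<and>
      (\<forall>z\<in>H2_D \<Omega> \<beta>. tr_dDiv \<Omega> M z = tr_dDiv \<Omega> G z))"
proof -
  have "open \<Omega>" using assms(1) by (simp add: lipschitz_domain_def)
  then interpret coupled_problem \<Omega> \<beta> q B K m f g \<eta> G
    using assms by unfold_locales
  obtain u \<phi> where u: "u \<in> V" and \<phi>: "\<phi> \<in> W"
    and min: "\<And>v \<psi>. v \<in> V \<Longrightarrow> \<psi> \<in> W \<Longrightarrow> energy \<Omega> B K m q f G u \<phi> \<le> energy \<Omega> B K m q f G v \<psi>"
    using minimizer_exists by metis
  note EL = u \<phi> min
  \<comment> \<open>The witness for \<open>M\<close> is the moment of the minimiser.\<close>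
  let ?A = "moment u (weak_hess \<Omega> u) \<phi>"
  have "is_arg_min (\<lambda>(v, \<psi>). energy \<Omega> B K m q f G v \<psi>) (\<lambda>(v, \<psi>). v \<in> V \<and> \<psi> \<in> W) (u, \<phi>)"
    using u \<phi> min by (auto simp: is_arg_min_def not_less)
  moreover have "ip \<Omega> u w + B / m * ip \<Omega> (dDiv_T \<Omega> q \<phi> ?A) w = 1 / m * ip \<Omega> f w" if "w \<in> L2 \<Omega>" for w
    using inner_dDiv_T_A[OF EL that] B m by (simp add: ip_eq_inner_L2 field_simps)
  \<comment> \<open>The condition on \<phi> at the boundary is membership of
    \<open>\<phi> - \<eta>\<close> in \<open>H1_0\<close>, read as a vanishing trace.\<close>
  moreover have "zero_trace_on \<Omega> \<beta> (frontier \<Omega>) (\<lambda>x. \<phi> x - \<eta> x)"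
    by (rule zero_trace_H1_0[OF _ W_D(2)[OF \<phi>]]) (use assms(4) in \<open>simp add: boundary_decomposition_def\<close>)
  moreover have "AE x in M. ?A x = weak_hess \<Omega> u x + (q\<^sup>2 * u x) *\<^sub>R T_mat (\<phi> x)"
    by (simp add: moment_def)
  moreover have "u \<in> H2 \<Omega>" "\<forall>N\<in>H_N \<Omega> \<beta>. tr_Ggrad \<Omega> u N = tr_Ggrad \<Omega> g N"
    using u by (auto simp: V_space_def)
  ultimately show ?thesis
    using A_dDiv(1)[OF EL] u_L2(1)[OF EL] W_D(1)[OF \<phi>] first_equation[OF EL] third_equation[OF EL]
      natural_boundary_condition[OF EL]
    by (intro exI[of _ u] exI[of _ \<phi>] exI[of _ ?A] conjI ballI) simp_all
qed

end
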